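(* Let $1\le p,q\le\infty$ and let $n$ be a natural number. There exist a completely positive and completely isometric map $$H_{p,q}:\ell_p^{n^2}\to S_q^n(S_p^n)$$ and a completely positive and completely contractive map $$Q_{p,q}:S_q^n(S_p^n)\to\ell_p^{n^2}$$ such that $Q_{p,q}\circ H_{p,q}=\mathrm{id}$. Moreover, if $E$ is any operator space, $\ell_p^{n^2}[E]$ is completely isometric to a completely complemented subspace of $S_q^n\big(S_p^n[E]\big)$.
   Context: Operator space conventions. $M_n=B(\ell_2^n)=S_\infty^n$ carries the operator norm and its $C^*$-algebra operator space structure. $S_1^n$ is $M_n$ with the trace norm and the operator space structure of the dual $M_n^*$ via the pairing $\langle A,B\rangle=\mathrm{tr}(AB^t)$. For an operator space $E$: $S_\infty^n[E]=M_n\otimes_{\min}E$, $S_1^n[E]=S_1^n\hat\otimes E$ (operator space projective tensor product), and $S_p^n[E]=(S_\infty^n[E],S_1^n[E])_{1/p}$ by complex interpolation, where interpolation spaces carry the matrix norms $M_k[(E_0,E_1)_\theta]=(M_k[E_0],M_k[E_1])_\theta$; $S_p^n=S_p^n[\mathbb C]$. $\ell_p^N[E]$ is the diagonal subspace of $S_p^N[E]$ and $\ell_p^N=\ell_p^N[\mathbb C]$. We write $S_q^n(X)=S_q^n[X]$. Positivity: as vector spaces $\ell_p^N$ and $S_q^n(S_p^n)$ are identified with the $C^*$-algebras $\ell_\infty^N$ and $M_n\otimes M_n=M_{n^2}$, and "completely positive" refers to these $C^*$-algebras. A map $T:E\to F$ is completely contractive (completely isometric) if $\mathrm{id}_{M_k}\otimes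 T:M_k[E]\to M_k[F]$ is contractive (isometric) for every $k$. A subspace is completely complemented if it is the range of a completely contractive projection. *)

theory Defs
  imports "HOL-Analysis.Analysis" "HOL-Library.Function_Algebras"
begin

section \<open>Operator spaces\<close>

text \<open>
  A complex vector space (on the whole type) together with its matrix norms. An element of
  \<open>M_k[E]\<close> is a function \<open>nat \<Rightarrow> nat \<Rightarrow> 'e\<close>, of which only the entries with indices below \<open>k\<close> matter.
\<close>

record 'e opspace =
  smult :: "complex \<Rightarrow> 'e \<Rightarrow> 'e"
  mnorm :: "nat \<Rightarrow> (nat \<Rightarrow> nat \<Rightarrow> 'e) \<Rightarrow> real"

text \<open>Norm of a matrix as an operator from \<open>\<ell>_2(J)\<close> to \<open>\<ell>_2(I)\<close>, for finite index sets.\<close>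

definition opnorm :: "'i set \<Rightarrow> 'j set \<Rightarrow> ('i \<Rightarrow> 'j \<Rightarrow> complex) \<Rightarrow> real" where
  "opnorm I J A = Sup {L2_set (\<lambda>i. cmod (\<Sum>j\<in>J. A i j * x j)) I | x. L2_set (\<lambda>j. cmod (x j)) J \<le> 1}"

text \<open>
  Abstract operator spaces: matrix norms satisfying Ruan's axioms, with complete underlying
  norm. Completeness makes \<open>S_1^n \<otimes> E\<close> below complete, so that no completion is
  needed in the projective tensor product.
\<close>

locale operator_space = vector_space "smult E" for E :: "'e::ab_group_add opspace" +
  assumes mnorm_cong:
      "\<And>k x y. (\<And>i j. i < k \<Longrightarrow> j < k \<Longrightarrow> x i j = y i j) \<Longrightarrow> mnorm E k x = mnorm E k y"
    and mnorm_nonneg: "\<And>k x. 0 \<le> mnorm E k x"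
    and mnorm_eq_0: "\<And>k x. mnorm E k x = 0 \<longleftrightarrow> (\<forall>i<k. \<forall>j<k. x i j = 0)"
    and mnorm_triangle: "\<And>k x y. mnorm E k (\<lambda>i j. x i j + y i j) \<le> mnorm E k x + mnorm E k y"
    and mnorm_smult: "\<And>k c x. mnorm E k (\<lambda>i j. smult E c (x i j)) = cmod c * mnorm E k x"
    and ruan_sum: "\<And>k l x y.
      mnorm E (k + l) (\<lambda>i j. if i < k \<and> j < k then x i j
                             else if k \<le> i \<and> k \<le> j then y (i - k) (j - k) else 0)
      = max (mnorm E k x) (mnorm E l y)"
    and ruan_mult: "\<And>k l \<alpha> x \<beta>.
      mnorm E l (\<lambda>i j. \<Sum>a<k. \<Sum>b<k. smult E (\<alpha> i a * \<beta> b j) (x a b))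
      \<le> opnorm {..<l} {..<k} \<alpha> * mnorm E k x * opnorm {..<k} {..<l} \<beta>"
    and complete: "\<And>x :: nat \<Rightarrow> 'e.
      (\<forall>e>0. \<exists>N. \<forall>m\<ge>N. \<forall>n\<ge>N. mnorm E 1 (\<lambda>_ _. x m - x n) < e) \<Longrightarrow>
      \<exists>y. (\<lambda>n. mnorm E 1 (\<lambda>_ _. x n - y)) \<longlonglongrightarrow> 0"

definition completely_contractive ::
    "'e::ab_group_add opspace \<Rightarrow> 'f::ab_group_add opspace \<Rightarrow> ('e \<Rightarrow> 'f) \<Rightarrow> bool" where
  "completely_contractive E F T \<longleftrightarrow> Vector_Spaces.linear (smult E) (smult F) T \<and>
     (\<forall>k x. mnorm F k (\<lambda>i j. T (x i j)) \<le> mnorm E k x)"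

definition completely_isometric ::
    "'e::ab_group_add opspace \<Rightarrow> 'f::ab_group_add opspace \<Rightarrow> ('e \<Rightarrow> 'f) \<Rightarrow> bool" where
  "completely_isometric E F T \<longleftrightarrow> Vector_Spaces.linear (smult E) (smult F) T \<and>
     (\<forall>k x. mnorm F k (\<lambda>i j. T (x i j)) = mnorm E k x)"

definition completely_complemented :: "'e::ab_group_add opspace \<Rightarrow> 'e set \<Rightarrow> bool" where
  "completely_complemented E W \<longleftrightarrow>
     (\<exists>P. completely_contractive E E P \<and> P \<circ> P = P \<and> range P = W)"

definition scalars :: "complex opspace" where
  "scalars = \<lparr>smult = (*), mnorm = (\<lambda>k. opnorm {..<k} {..<k})\<rparr>"

text \<open>
  The matrix algebra, in two versions: of size given by a natural number (only entries with
  indices below \<open>m\<close> matter), and of size given by a finite index type. In both,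
  \<open>M_k[M_m]\<close> is normed as the bounded operators on \<open>\<ell>_2^k \<otimes> \<ell>_2^m\<close>.
\<close>

definition matrices_nat :: "nat \<Rightarrow> (nat \<Rightarrow> nat \<Rightarrow> complex) opspace" where
  "matrices_nat m = \<lparr>smult = (\<lambda>c A i j. c * A i j),
     mnorm = (\<lambda>k X. opnorm ({..<k} \<times> {..<m}) ({..<k} \<times> {..<m}) (\<lambda>(i, a) (j, b). X i j a b))\<rparr>"

definition matrices :: "(complex ^ 'n ^ 'n) opspace" where
  "matrices = \<lparr>smult = (\<lambda>c A. \<chi> a b. c * A $ a $ b),
     mnorm = (\<lambda>k X. opnorm ({..<k} \<times> UNIV) ({..<k} \<times> UNIV) (\<lambda>(i, a) (j, b). X i j $ a $ b))\<rparr>"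

text \<open>The trace class: \<open>M_k[S_1^n]\<close> is the space of maps from \<open>M_n\<close> to \<open>M_k\<close> with the cb-norm.\<close>

definition trace_class :: "(complex ^ 'n ^ 'n) opspace" where
  "trace_class = \<lparr>smult = (\<lambda>c A. \<chi> a b. c * A $ a $ b),
     mnorm = (\<lambda>k V. Sup {mnorm (matrices_nat k) m (\<lambda>p q i j. trace (V i j ** transpose (X p q)))
                         | m X. mnorm (matrices :: (complex ^ 'n ^ 'n) opspace) m X \<le> 1})\<rparr>"


section \<open>The spaces \<open>S_p^n[E]\<close> and \<open>\<ell>_p^N[E]\<close>\<close>

text \<open>
  All the spaces \<open>S_p^n[E]\<close> have the underlying vector space \<open>M_n \<otimes> E\<close>, realised as
  the matrices over \<open>E\<close>: the matrix \<open>x\<close> is the tensor that is the sum of the \<open>e_cd \<otimes> x_cd\<close>.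
\<close>

definition entrywise :: "(complex \<Rightarrow> 'e \<Rightarrow> 'e) \<Rightarrow> complex \<Rightarrow> 'e ^ 'n ^ 'n \<Rightarrow> 'e ^ 'n ^ 'n" where
  "entrywise sc c x = (\<chi> a b. sc c (x $ a $ b))"

definition elem_tensor :: "'e opspace \<Rightarrow> complex ^ 'n ^ 'n \<Rightarrow> 'e \<Rightarrow> 'e ^ 'n ^ 'n" where
  "elem_tensor E A x = (\<chi> a b. smult E (A $ a $ b) x)"

definition matrix_unit :: "'n \<Rightarrow> 'n \<Rightarrow> complex ^ 'n ^ 'n" where
  "matrix_unit c d = (\<chi> a b. if a = c \<and> b = d then 1 else 0)"

text \<open>
  Minimal tensor product with \<open>M_n\<close>: the norm of \<open>u\<close> is the supremum of the norms of
  \<open>(f \<otimes> g)(u)\<close> over complete contractions \<open>f\<close>, \<open>g\<close> into matrix algebras.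
\<close>

definition S_inf :: "'e::ab_group_add opspace \<Rightarrow> ('e ^ 'n ^ 'n) opspace" where
  "S_inf E = \<lparr>smult = entrywise (smult E),
     mnorm = (\<lambda>k u. Sup {
       opnorm ({..<k} \<times> {..<m} \<times> {..<r}) ({..<k} \<times> {..<m} \<times> {..<r})
         (\<lambda>(i, a, s) (j, b, t). \<Sum>c\<in>UNIV. \<Sum>d\<in>UNIV. f (matrix_unit c d) a b * g (u i j $ c $ d) s t)
       | m r (f :: complex ^ 'n ^ 'n \<Rightarrow> nat \<Rightarrow> nat \<Rightarrow> complex) (g :: 'e \<Rightarrow> nat \<Rightarrow> nat \<Rightarrow> complex).
         completely_contractive matrices (matrices_nat m) f \<and>
         completely_contractive E (matrices_nat r) g})\<rparr>"

text \<open>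
  Projective tensor product with \<open>S_1^n\<close>: the infimum of the products of the norms of \<open>\<alpha>\<close>, \<open>v\<close>,
  \<open>w\<close>, \<open>\<beta>\<close> over all factorizations \<open>u = \<alpha> (v \<otimes> w) \<beta>\<close>, where \<open>v\<close> is in \<open>M_p[S_1^n]\<close> and
  \<open>w\<close> in \<open>M_q[E]\<close>.
\<close>

definition S_one :: "'e::ab_group_add opspace \<Rightarrow> ('e ^ 'n ^ 'n) opspace" where
  "S_one E = \<lparr>smult = entrywise (smult E),
     mnorm = (\<lambda>k u. Inf {
       opnorm {..<k} ({..<p} \<times> {..<q}) \<alpha> * mnorm trace_class p v * mnorm E q w *
         opnorm ({..<p} \<times> {..<q}) {..<k} \<beta>
       | p q (\<alpha> :: nat \<Rightarrow> nat \<times> nat \<Rightarrow> complex) (v :: nat \<Rightarrow> nat \<Rightarrow> complex ^ 'n ^ 'n) w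
         (\<beta> :: nat \<times> nat \<Rightarrow> nat \<Rightarrow> complex).
         \<forall>i<k. \<forall>j<k. u i j =
           (\<Sum>(a, s)\<in>{..<p} \<times> {..<q}. \<Sum>(b, t)\<in>{..<p} \<times> {..<q}.
              entrywise (smult E) (\<alpha> i (a, s) * \<beta> (b, t) j) (elem_tensor E (v a b) (w s t)))})\<rparr>"

text \<open>
  Complex interpolation (Calderon, Bergh and Loefstrom) of a couple of norms on one vector space,
  which is what is needed here: \<open>S_inf E\<close> and \<open>S_one E\<close> have the same underlying space.
\<close>

definition sum_norm :: "('v::ab_group_add \<Rightarrow> real) \<Rightarrow> ('v \<Rightarrow> real) \<Rightarrow> 'v \<Rightarrow> real" where
  "sum_norm N0 N1 x = Inf {N0 a + N1 b | a b. x = a + b}"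

definition strip :: "complex set" where
  "strip = {z. 0 \<le> Re z \<and> Re z \<le> 1}"

definition calderon ::
    "(complex \<Rightarrow> 'v \<Rightarrow> 'v) \<Rightarrow> ('v::ab_group_add \<Rightarrow> real) \<Rightarrow> ('v \<Rightarrow> real) \<Rightarrow> (complex \<Rightarrow> 'v) \<Rightarrow> bool" where
  "calderon sc N0 N1 f \<longleftrightarrow>
     (\<exists>B. \<forall>z\<in>strip. sum_norm N0 N1 (f z) \<le> B) \<and>
     (\<forall>z\<in>strip. ((\<lambda>w. sum_norm N0 N1 (f w - f z)) \<longlongrightarrow> 0) (at z within strip)) \<and>
     (\<forall>z\<in>interior strip. \<exists>D.
        ((\<lambda>h. sum_norm N0 N1 (sc (1 / h) (f (z + h) - f z) - D)) \<longlongrightarrow> 0) (at 0)) \<and>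
     (\<forall>t. ((\<lambda>s. N0 (f (Complex 0 s) - f (Complex 0 t))) \<longlongrightarrow> 0) (at t)) \<and>
     (\<forall>t. ((\<lambda>s. N1 (f (Complex 1 s) - f (Complex 1 t))) \<longlongrightarrow> 0) (at t)) \<and>
     ((\<lambda>t. N0 (f (Complex 0 t))) \<longlongrightarrow> 0) at_infinity \<and>
     ((\<lambda>t. N1 (f (Complex 1 t))) \<longlongrightarrow> 0) at_infinity"

definition interp_norm ::
    "(complex \<Rightarrow> 'v \<Rightarrow> 'v) \<Rightarrow> real \<Rightarrow> ('v::ab_group_add \<Rightarrow> real) \<Rightarrow> ('v \<Rightarrow> real) \<Rightarrow> 'v \<Rightarrow> real" where
  "interp_norm sc \<theta> N0 N1 x =
     Inf {max (SUP t. N0 (f (Complex 0 t))) (SUP t. N1 (f (Complex 1 t)))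
          | f. calderon sc N0 N1 f \<and> f (of_real \<theta>) = x}"

definition interpolation ::
    "real \<Rightarrow> 'e::ab_group_add opspace \<Rightarrow> 'e opspace \<Rightarrow> 'e opspace" where
  "interpolation \<theta> E0 E1 = \<lparr>smult = smult E0,
     mnorm = (\<lambda>k. interp_norm (\<lambda>c X i j. smult E0 c (X i j)) \<theta> (mnorm E0 k) (mnorm E1 k))\<rparr>"

definition S_p :: "ennreal \<Rightarrow> 'e::ab_group_add opspace \<Rightarrow> ('e ^ 'n ^ 'n) opspace" where
  "S_p p E = (if p = \<infinity> then S_inf E else if p = 1 then S_one E
              else interpolation (enn2real (1 / p)) (S_inf E) (S_one E))"

definition diagonal :: "'e::zero ^ 'm \<Rightarrow> 'e ^ 'm ^ 'm" where
  "diagonal x = (\<chi> a b. if a = b then x $ a else 0)"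

definition l_p :: "ennreal \<Rightarrow> 'e::ab_group_add opspace \<Rightarrow> ('e ^ 'm) opspace" where
  "l_p p E = \<lparr>smult = (\<lambda>c x. \<chi> a. smult E c (x $ a)),
     mnorm = (\<lambda>k X. mnorm (S_p p E :: ('e ^ 'm ^ 'm) opspace) k (\<lambda>i j. diagonal (X i j)))\<rparr>"


section \<open>Complete positivity\<close>

definition positive_matrix :: "'i set \<Rightarrow> ('i \<Rightarrow> 'i \<Rightarrow> complex) \<Rightarrow> bool" where
  "positive_matrix I A \<longleftrightarrow> (\<forall>x. (\<Sum>i\<in>I. \<Sum>j\<in>I. cnj (x i) * A i j * x j) \<in> \<real>\<^sub>\<ge>\<^sub>0)"

text \<open>
  Positivity in \<open>M_k(A)\<close> for a \<open>C\<^sup>*\<close>-algebra \<open>A\<close> of matrices, given by a map sending each element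
  of \<open>A\<close> to its matrix. The algebra \<open>\<ell>_\<infinity>^N\<close> is that of diagonal matrices, and
  \<open>M_n \<otimes> M_n\<close> acts on \<open>\<ell>_2^n \<otimes> \<ell>_2^n\<close>.
\<close>

definition completely_positive ::
    "('e \<Rightarrow> 'i \<Rightarrow> 'i \<Rightarrow> complex) \<Rightarrow> ('f \<Rightarrow> 'j \<Rightarrow> 'j \<Rightarrow> complex) \<Rightarrow> ('e \<Rightarrow> 'f) \<Rightarrow> bool" where
  "completely_positive \<rho> \<sigma> T \<longleftrightarrow>
     (\<forall>k X. positive_matrix ({..<k::nat} \<times> UNIV) (\<lambda>(i, a) (j, b). \<rho> (X i j) a b) \<longrightarrow>
            positive_matrix ({..<k} \<times> UNIV) (\<lambda>(i, a) (j, b). \<sigma> (T (X i j)) a b))"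

definition l_inf_matrix :: "complex ^ 'm \<Rightarrow> 'm \<Rightarrow> 'm \<Rightarrow> complex" where
  "l_inf_matrix x a b = diagonal x $ a $ b"

definition tensor_matrix ::
    "(complex ^ 'n ^ 'n) ^ 'n ^ 'n \<Rightarrow> 'n \<times> 'n \<Rightarrow> 'n \<times> 'n \<Rightarrow> complex" where
  "tensor_matrix U = (\<lambda>(a, c) (b, d). U $ a $ b $ c $ d)"

end

theory Submission
  imports Defs "HOL-Complex_Analysis.Conformal_Mappings"
begin

text \<open>
  Let \<open>\<psi> \<kappa>\<close>, with \<open>\<kappa>\<close> ranging over \<open>n\<^sup>2\<close> indices, be an orthonormal basis of \<open>\<complex>\<^sup>n \<otimes> \<complex>\<^sup>n\<close> consisting of
  maximally entangled vectors: as an \<open>n \<times> n\<close> matrix, each \<open>\<psi> \<kappa>\<close> is \<open>n\<^sup>-\<^sup>1\<^sup>/\<^sup>2\<close> times a unitary. The Weyl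
  matrices provide such a basis (\<open>bell_basis_exists\<close>). Up to powers of \<open>n\<close> the two maps are
  \<open>x \<mapsto> \<Sum>\<kappa>. x \<kappa> |\<psi> \<kappa>\<rangle>\<langle>\<psi> \<kappa>|\<close> and \<open>U \<mapsto> (\<langle>\<psi> \<kappa>|U|\<psi> \<kappa>\<rangle>)\<close> (\<open>bell_embed\<close> and \<open>bell_project\<close>). The second is a
  left inverse of the first by orthonormality, and both are completely positive, as they consist of
  conjugations and of compressions to the diagonal. If the completely bounded norms of these two maps
  are at most \<open>c\<close> and \<open>1/c\<close>, then after division by \<open>c\<close> and multiplication by \<open>c\<close> both are
  complete contractions, hence the first one is completely isometric and the composition in the other
  order is a completely contractive projection. It remains to find these bounds, with
  \<open>c = n powr (1/q - 1/p)\<close>.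

  The norms are estimated by interpolation, first in \<open>p\<close> for a fixed outer space, then in \<open>q\<close>. Take the
  embedding as a map from \<open>\<ell>_p[E]\<close> to \<open>M_n[S_p^n[E]]\<close>. For \<open>p = \<infinity>\<close> it is a conjugation by an isometry,
  of norm \<open>1\<close>. For \<open>p = 1\<close> its norm is at most \<open>1/n\<close>: the dual map consists of conjugations by the matrices
  \<open>\<psi> \<kappa>\<close>, each of which is \<open>n\<^sup>-\<^sup>1\<^sup>/\<^sup>2\<close> times a unitary. Hence the norm is at most \<open>n powr (- 1/p)\<close>, and
  replacing \<open>M_n[F]\<close> by \<open>S_1^n[F]\<close> multiplies it by at most \<open>n\<close> (\<open>S_one_le_inorm\<close>). Interpolation in
  \<open>q\<close> gives \<open>n powr (1/q - 1/p)\<close>. The projection, as a map from \<open>M_n[S_p^n[E]]\<close>, has norm at most \<open>1\<close> for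
  \<open>p = \<infinity>\<close> and at most \<open>n\<close> for \<open>p = 1\<close>. As a map from \<open>S_1^n[S_p^n[E]]\<close> it is determined by its values
  at tensors \<open>v \<otimes> w\<close>, and there the bounds are \<open>1/n\<close> for \<open>p = \<infinity>\<close> and \<open>1\<close> for \<open>p = 1\<close>, the former because
  \<open>\<psi> \<kappa>\<close> is a multiple of a unitary. Interpolation in \<open>q\<close> between \<open>n powr (1/p)\<close> and \<open>n powr (1/p - 1)\<close> gives \<open>n powr (1/p - 1/q)\<close>.

  Three pieces of theory carry these estimates. The minimal tensor product is defined by complete
  contractions into matrix algebras, and Ruan's theorem (\<open>ruan_norming_pos\<close>), which is proved by a
  Hahn--Banach argument, shows that these recover the matrix norms of \<open>E\<close>; consequently \<open>M_k[M_n[E]]\<close> is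
  \<open>M_{k n}[E]\<close> (\<open>mnorm_S_inf\<close>). The projective norm is handled by rewriting factorizations
  \<open>\<alpha> (v \<otimes> w) \<beta>\<close>, after showing that it satisfies Ruan's axioms again (\<open>ruan_seminorm_S_one\<close>). Complex
  interpolation is used through three facts: it is functorial (\<open>interp_map\<close>), its norm is at most
  the geometric mean of the end point norms (\<open>interp_log_convex\<close>), and a seminorm interpolated with
  itself does not decrease (\<open>interp_same_ge\<close>), by the three lines theorem.
\<close>

section \<open>Operator norms of matrices over finite index sets\<close>

lemma L2_set_power2: "(L2_set f I)\<^sup>2 = (\<Sum>i\<in>I. (f i)\<^sup>2)"
  by (simp add: L2_set_def sum_nonneg)

lemma of_real_L2_set_power2: "of_real ((L2_set (\<lambda>i. cmod (y i)) I)\<^sup>2) = (\<Sum>i\<in>I. cnj (y i) * y i)"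
  unfolding L2_set_power2 of_real_sum by (intro sum.cong refl) (metis complex_norm_square mult.commute of_real_power)

lemma L2_set_reindex:
  assumes "bij_betw e I' I"
  shows "L2_set (\<lambda>i. f (e i)) I' = L2_set f I"
  using sum.reindex_bij_betw[OF assms, of "\<lambda>i. (f i)\<^sup>2"] by (simp add: L2_set_def)

lemma L2_set_matrix_bound:
  assumes "finite I" "finite J"
  shows "L2_set (\<lambda>i. cmod (\<Sum>j\<in>J. A i j * x j)) I
    \<le> (\<Sum>i\<in>I. \<Sum>j\<in>J. cmod (A i j)) * L2_set (\<lambda>j. cmod (x j)) J"
proof -
  have "L2_set (\<lambda>i. cmod (\<Sum>j\<in>J. A i j * x j)) I \<le> (\<Sum>i\<in>I. cmod (\<Sum>j\<in>J. A i j * x j))"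
    by (rule L2_set_le_sum) auto
  also have "\<dots> \<le> (\<Sum>i\<in>I. \<Sum>j\<in>J. cmod (A i j) * L2_set (\<lambda>j. cmod (x j)) J)"
  proof (intro sum_mono)
    fix i
    have "cmod (\<Sum>j\<in>J. A i j * x j) \<le> (\<Sum>j\<in>J. cmod (A i j) * cmod (x j))"
      by (metis (mono_tags, lifting) norm_mult sum_norm_le order_refl)
    also have "\<dots> \<le> (\<Sum>j\<in>J. cmod (A i j) * L2_set (\<lambda>j. cmod (x j)) J)"
      using member_le_L2_set[OF assms(2), of _ "\<lambda>j. cmod (x j)"]
      by (intro sum_mono mult_left_mono) auto
    finally show "cmod (\<Sum>j\<in>J. A i j * x j) \<le> (\<Sum>j\<in>J. cmod (A i j) * L2_set (\<lambda>j. cmod (x j)) J)" .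
  qed
  finally show ?thesis by (simp add: sum_distrib_right)
qed

lemma opnorm_bdd:
  assumes "finite I" "finite J"
  shows "bdd_above {L2_set (\<lambda>i. cmod (\<Sum>j\<in>J. A i j * x j)) I | x. L2_set (\<lambda>j. cmod (x j)) J \<le> 1}"
proof -
  have *: "0 \<le> (\<Sum>i\<in>I. \<Sum>j\<in>J. cmod (A i j))" by (simp add: sum_nonneg)
  show ?thesis
    by (rule bdd_aboveI[of _ "\<Sum>i\<in>I. \<Sum>j\<in>J. cmod (A i j)"])
      (use order_trans[OF L2_set_matrix_bound[OF assms] mult_left_mono[OF _ *, of _ 1]] in auto)
qed

lemma opnorm_apply:
  assumes fin: "finite I" "finite J"
  shows "L2_set (\<lambda>i. cmod (\<Sum>j\<in>J. A i j * x j)) I \<le> opnorm I J A * L2_set (\<lambda>j. cmod (x j)) J"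
proof (cases "L2_set (\<lambda>j. cmod (x j)) J = 0")
  case True
  then show ?thesis using L2_set_matrix_bound[OF fin, of A x] by simp
next
  case False
  define r where "r = L2_set (\<lambda>j. cmod (x j)) J"
  have r: "r > 0" using False r_def by (metis L2_set_nonneg less_le)
  define y where "y = (\<lambda>j. x j / of_real r)"
  have y: "L2_set (\<lambda>j. cmod (y j)) J = 1"
  proof -
    have "L2_set (\<lambda>j. cmod (y j)) J = L2_set (\<lambda>j. (1/r) * cmod (x j)) J"
      using r by (simp add: y_def norm_divide)
    also have "\<dots> = 1/r * r" using r by (subst L2_set_right_distrib[symmetric]) (auto simp: r_def)
    finally show ?thesis using r by simp
  qed
  have "L2_set (\<lambda>i. cmod (\<Sum>j\<in>J. A i j * x j)) I = L2_set (\<lambda>i. r * cmod (\<Sum>j\<in>J. A i j * y j)) I"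
    using r by (simp add: y_def sum_divide_distrib[symmetric] norm_divide)
  also have "\<dots> = r * L2_set (\<lambda>i. cmod (\<Sum>j\<in>J. A i j * y j)) I"
    using r by (simp add: L2_set_right_distrib)
  also have "\<dots> \<le> r * opnorm I J A"
    unfolding opnorm_def using r y by (intro mult_left_mono cSup_upper opnorm_bdd fin) auto
  finally show ?thesis by (simp add: r_def mult.commute)
qed

lemma opnorm_le:
  assumes "\<And>x. L2_set (\<lambda>i. cmod (\<Sum>j\<in>J. A i j * x j)) I \<le> C * L2_set (\<lambda>j. cmod (x j)) J" "0 \<le> C"
  shows "opnorm I J A \<le> C"
  unfolding opnorm_def
proof (rule cSup_least)
  show "{L2_set (\<lambda>i. cmod (\<Sum>j\<in>J. A i j * x j)) I | x. L2_set (\<lambda>j. cmod (x j)) J \<le> 1} \<noteq> {}"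
    by (auto intro!: exI[of _ "\<lambda>_. 0"] simp: L2_set_def)
next
  fix y assume "y \<in> {L2_set (\<lambda>i. cmod (\<Sum>j\<in>J. A i j * x j)) I | x. L2_set (\<lambda>j. cmod (x j)) J \<le> 1}"
  then obtain x where "y = L2_set (\<lambda>i. cmod (\<Sum>j\<in>J. A i j * x j)) I" "L2_set (\<lambda>j. cmod (x j)) J \<le> 1"
    by auto
  then show "y \<le> C"
    using assms(1)[of x] mult_left_mono[OF _ assms(2), of "L2_set (\<lambda>j. cmod (x j)) J" 1] by simp
qed

lemma opnorm_nonneg: "finite I \<Longrightarrow> finite J \<Longrightarrow> 0 \<le> opnorm I J A"
  unfolding opnorm_def
  by (intro cSup_upper2[OF _ _ opnorm_bdd, of 0]) (auto intro!: exI[of _ "\<lambda>_. 0"] simp: L2_set_def)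

lemma opnorm_cong:
  assumes "\<And>i j. i \<in> I \<Longrightarrow> j \<in> J \<Longrightarrow> A i j = B i j"
  shows "opnorm I J A = opnorm I J B"
proof -
  have "L2_set (\<lambda>i. cmod (\<Sum>j\<in>J. A i j * x j)) I = L2_set (\<lambda>i. cmod (\<Sum>j\<in>J. B i j * x j)) I" for x
    by (intro L2_set_cong refl arg_cong[of _ _ cmod] sum.cong) (auto simp: assms)
  then show ?thesis by (simp add: opnorm_def)
qed

lemma opnorm_reindex_le:
  assumes e: "bij_betw e I' I" and d: "bij_betw d J' J" and fin: "finite I" "finite J"
  shows "opnorm I' J' (\<lambda>i j. A (e i) (d j)) \<le> opnorm I J A"
proof (rule opnorm_le)
  fix x :: "_ \<Rightarrow> complex"
  define y where "y = (\<lambda>j. x (the_inv_into J' d j))"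
  have yd: "y (d j) = x j" if "j \<in> J'" for j
    using that d by (simp add: y_def bij_betw_def the_inv_into_f_f)
  have "(\<Sum>j\<in>J'. A (e i) (d j) * x j) = (\<Sum>j\<in>J. A (e i) j * y j)" for i
    using sum.reindex_bij_betw[OF d, of "\<lambda>j. A (e i) j * y j"] by (simp add: yd)
  then have "L2_set (\<lambda>i. cmod (\<Sum>j\<in>J'. A (e i) (d j) * x j)) I' = L2_set (\<lambda>i. cmod (\<Sum>j\<in>J. A i j * y j)) I"
    using L2_set_reindex[OF e, of "\<lambda>i. cmod (\<Sum>j\<in>J. A i j * y j)"] by simp
  moreover have "L2_set (\<lambda>j. cmod (x j)) J' = L2_set (\<lambda>j. cmod (y j)) J"
    using L2_set_reindex[OF d, of "\<lambda>j. cmod (y j)"] by (simp add: yd cong: L2_set_cong_simp)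
  ultimately show "L2_set (\<lambda>i. cmod (\<Sum>j\<in>J'. A (e i) (d j) * x j)) I'
      \<le> opnorm I J A * L2_set (\<lambda>j. cmod (x j)) J'"
    using opnorm_apply[OF fin, of A y] by simp
qed (rule opnorm_nonneg[OF fin])

lemma opnorm_reindex:
  assumes e: "bij_betw e I' I" and d: "bij_betw d J' J" and fin: "finite I" "finite J"
  shows "opnorm I' J' (\<lambda>i j. A (e i) (d j)) = opnorm I J A"
proof (rule antisym)
  have e': "bij_betw (the_inv_into I' e) I I'" and d': "bij_betw (the_inv_into J' d) J J'"
    using e d by (auto intro: bij_betw_the_inv_into)
  have fin': "finite I'" "finite J'" using e d fin bij_betw_finite by blast+
  have "opnorm I J A = opnorm I J (\<lambda>i j. A (e (the_inv_into I' e i)) (d (the_inv_into J' d j)))"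
    using e d by (intro opnorm_cong) (simp add: f_the_inv_into_f_bij_betw)
  also have "\<dots> \<le> opnorm I' J' (\<lambda>i j. A (e i) (d j))"
    by (rule opnorm_reindex_le[OF e' d' fin', of "\<lambda>i j. A (e i) (d j)"])
  finally show "opnorm I J A \<le> opnorm I' J' (\<lambda>i j. A (e i) (d j))" .
qed (rule opnorm_reindex_le[OF assms])

lemma opnorm_mult:
  assumes fin: "finite I" "finite J" "finite K"
  shows "opnorm I K (\<lambda>i k. \<Sum>j\<in>J. A i j * B j k) \<le> opnorm I J A * opnorm J K B"
proof (rule opnorm_le)
  fix x :: "_ \<Rightarrow> complex"
  have "(\<Sum>k\<in>K. (\<Sum>j\<in>J. A i j * B j k) * x k) = (\<Sum>j\<in>J. A i j * (\<Sum>k\<in>K. B j k * x k))" for i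
    by (simp add: sum_distrib_left sum_distrib_right mult.assoc) (rule sum.swap)
  then have "L2_set (\<lambda>i. cmod (\<Sum>k\<in>K. (\<Sum>j\<in>J. A i j * B j k) * x k)) I
     \<le> opnorm I J A * L2_set (\<lambda>j. cmod (\<Sum>k\<in>K. B j k * x k)) J"
    by (simp add: opnorm_apply fin)
  also have "\<dots> \<le> opnorm I J A * (opnorm J K B * L2_set (\<lambda>k. cmod (x k)) K)"
    by (intro mult_left_mono opnorm_apply opnorm_nonneg fin)
  finally show "L2_set (\<lambda>i. cmod (\<Sum>k\<in>K. (\<Sum>j\<in>J. A i j * B j k) * x k)) I
     \<le> opnorm I J A * opnorm J K B * L2_set (\<lambda>k. cmod (x k)) K" by (simp add: mult.assoc)
qed (simp add: opnorm_nonneg fin)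

lemma cmod_sum_mult_le:
  "cmod (\<Sum>i\<in>I. y i * x i) \<le> L2_set (\<lambda>i. cmod (y i)) I * L2_set (\<lambda>i. cmod (x i)) I"
proof -
  have "cmod (\<Sum>i\<in>I. y i * x i) \<le> (\<Sum>i\<in>I. \<bar>cmod (y i)\<bar> * \<bar>cmod (x i)\<bar>)"
    by (metis (mono_tags, lifting) norm_mult sum_norm_le order_refl abs_norm_cancel)
  also have "\<dots> \<le> L2_set (\<lambda>i. cmod (y i)) I * L2_set (\<lambda>i. cmod (x i)) I" by (rule L2_set_mult_ineq)
  finally show ?thesis .
qed

lemma opnorm_bilinear:
  assumes fin: "finite I" "finite J"
  shows "cmod (\<Sum>i\<in>I. \<Sum>j\<in>J. cnj (\<eta> i) * A i j * \<xi> j)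
    \<le> opnorm I J A * L2_set (\<lambda>i. cmod (\<eta> i)) I * L2_set (\<lambda>j. cmod (\<xi> j)) J"
proof -
  have "(\<Sum>i\<in>I. \<Sum>j\<in>J. cnj (\<eta> i) * A i j * \<xi> j) = (\<Sum>i\<in>I. cnj (\<eta> i) * (\<Sum>j\<in>J. A i j * \<xi> j))"
    by (simp add: sum_distrib_left mult.assoc)
  then have "cmod (\<Sum>i\<in>I. \<Sum>j\<in>J. cnj (\<eta> i) * A i j * \<xi> j)
    \<le> L2_set (\<lambda>i. cmod (\<eta> i)) I * L2_set (\<lambda>i. cmod (\<Sum>j\<in>J. A i j * \<xi> j)) I"
    using cmod_sum_mult_le[of "\<lambda>i. cnj (\<eta> i)" "\<lambda>i. (\<Sum>j\<in>J. A i j * \<xi> j)" I] by simp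
  also have "\<dots> \<le> L2_set (\<lambda>i. cmod (\<eta> i)) I * (opnorm I J A * L2_set (\<lambda>j. cmod (\<xi> j)) J)"
    by (intro mult_left_mono opnorm_apply fin) auto
  also have "\<dots> = opnorm I J A * L2_set (\<lambda>i. cmod (\<eta> i)) I * L2_set (\<lambda>j. cmod (\<xi> j)) J"
    by simp
  finally show ?thesis .
qed

lemma opnorm_le_bilinear:
  assumes fin: "finite I" "finite J" and C: "0 \<le> C"
    and *: "\<And>\<eta> \<xi>. cmod (\<Sum>i\<in>I. \<Sum>j\<in>J. cnj (\<eta> i) * A i j * \<xi> j)
      \<le> C * L2_set (\<lambda>i. cmod (\<eta> i)) I * L2_set (\<lambda>j. cmod (\<xi> j)) J"
  shows "opnorm I J A \<le> C"
proof (rule opnorm_le[OF _ C])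
  fix x :: "_ \<Rightarrow> complex"
  define y where "y = (\<lambda>i. \<Sum>j\<in>J. A i j * x j)"
  define r where "r = L2_set (\<lambda>i. cmod (y i)) I"
  have "(\<Sum>i\<in>I. \<Sum>j\<in>J. cnj (y i) * A i j * x j) = (\<Sum>i\<in>I. cnj (y i) * y i)"
    by (simp add: sum_distrib_left mult.assoc y_def)
  also have "\<dots> = of_real (r\<^sup>2)"
    by (simp only: r_def of_real_L2_set_power2)
  finally have "cmod (\<Sum>i\<in>I. \<Sum>j\<in>J. cnj (y i) * A i j * x j) = r\<^sup>2" by (simp add: norm_power)
  then have "r * r \<le> r * (C * L2_set (\<lambda>j. cmod (x j)) J)"
    using *[of y x] by (simp add: r_def power2_eq_square mult_ac)
  moreover have "0 \<le> r" "0 \<le> C * L2_set (\<lambda>j. cmod (x j)) J" using C by (auto simp: r_def)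
  ultimately have "r \<le> C * L2_set (\<lambda>j. cmod (x j)) J"
    using mult_le_cancel_left_pos[of r] by (cases "r = 0") auto
  then show "L2_set (\<lambda>i. cmod (\<Sum>j\<in>J. A i j * x j)) I \<le> C * L2_set (\<lambda>j. cmod (x j)) J"
    by (simp add: r_def y_def)
qed

lemma opnorm_adjoint:
  assumes fin: "finite I" "finite J"
  shows "opnorm J I (\<lambda>j i. cnj (A i j)) \<le> opnorm I J A"
proof (rule opnorm_le_bilinear[OF fin(2,1) opnorm_nonneg[OF fin]])
  fix \<eta> \<xi> :: "_ \<Rightarrow> complex"
  have "(\<Sum>j\<in>J. \<Sum>i\<in>I. cnj (\<eta> j) * cnj (A i j) * \<xi> i) = cnj (\<Sum>i\<in>I. \<Sum>j\<in>J. cnj (\<xi> i) * A i j * \<eta> j)"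
    unfolding cnj_sum by (subst sum.swap, intro sum.cong refl) simp
  then have "cmod (\<Sum>j\<in>J. \<Sum>i\<in>I. cnj (\<eta> j) * cnj (A i j) * \<xi> i) = cmod (\<Sum>i\<in>I. \<Sum>j\<in>J. cnj (\<xi> i) * A i j * \<eta> j)"
    by (simp only: complex_mod_cnj)
  also have "\<dots> \<le> opnorm I J A * L2_set (\<lambda>j. cmod (\<xi> j)) I * L2_set (\<lambda>i. cmod (\<eta> i)) J"
    by (rule opnorm_bilinear[OF fin])
  also have "\<dots> = opnorm I J A * L2_set (\<lambda>i. cmod (\<eta> i)) J * L2_set (\<lambda>j. cmod (\<xi> j)) I"
    by simp
  finally show "cmod (\<Sum>j\<in>J. \<Sum>i\<in>I. cnj (\<eta> j) * cnj (A i j) * \<xi> i)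
      \<le> opnorm I J A * L2_set (\<lambda>i. cmod (\<eta> i)) J * L2_set (\<lambda>j. cmod (\<xi> j)) I"
    .
qed

text \<open>The squares of the norms of the blocks of a vector add up, on both sides.\<close>

lemma opnorm_block_diagonal:
  assumes fin: "finite I" "finite J" "finite K" and C: "0 \<le> C"
    and A: "\<And>\<kappa>. \<kappa> \<in> K \<Longrightarrow> opnorm I J (A \<kappa>) \<le> C"
  shows "opnorm (I \<times> K) (J \<times> K) (\<lambda>(i, \<kappa>) (j, \<mu>). if \<kappa> = \<mu> then A \<kappa> i j else 0) \<le> C"
proof (rule opnorm_le[OF _ C])
  fix x :: "_ \<Rightarrow> complex"
  define B where "B = (\<lambda>(i, \<kappa>) (j, \<mu>). if \<kappa> = \<mu> then A \<kappa> i j else 0)"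
  have *: "(\<Sum>b\<in>J \<times> K. B (i, \<kappa>) b * x b) = (\<Sum>j\<in>J. A \<kappa> i j * x (j, \<kappa>))" if "\<kappa> \<in> K" for i \<kappa>
  proof -
    have "(\<Sum>b\<in>J \<times> K. B (i, \<kappa>) b * x b) = (\<Sum>j\<in>J. \<Sum>\<mu>\<in>K. B (i, \<kappa>) (j, \<mu>) * x (j, \<mu>))"
      by (simp add: sum.cartesian_product case_prod_unfold)
    also have "\<dots> = (\<Sum>j\<in>J. \<Sum>\<mu>\<in>K. if \<kappa> = \<mu> then A \<kappa> i j * x (j, \<kappa>) else 0)"
      by (intro sum.cong refl) (auto simp: B_def)
    finally show ?thesis using that fin(3) by simp
  qed
  have "(L2_set (\<lambda>a. cmod (\<Sum>b\<in>J \<times> K. B a b * x b)) (I \<times> K))\<^sup>2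
     = (\<Sum>i\<in>I. \<Sum>\<kappa>\<in>K. (cmod (\<Sum>b\<in>J \<times> K. B (i, \<kappa>) b * x b))\<^sup>2)"
    unfolding L2_set_power2 by (simp add: sum.cartesian_product case_prod_unfold)
  also have "\<dots> = (\<Sum>i\<in>I. \<Sum>\<kappa>\<in>K. (cmod (\<Sum>j\<in>J. A \<kappa> i j * x (j, \<kappa>)))\<^sup>2)"
    by (intro sum.cong refl) (simp only: *)
  also have "\<dots> = (\<Sum>\<kappa>\<in>K. (L2_set (\<lambda>i. cmod (\<Sum>j\<in>J. A \<kappa> i j * x (j, \<kappa>))) I)\<^sup>2)"
    unfolding L2_set_power2 by (rule sum.swap)
  also have "\<dots> \<le> (\<Sum>\<kappa>\<in>K. (C * L2_set (\<lambda>j. cmod (x (j, \<kappa>))) J)\<^sup>2)"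
    by (intro sum_mono power_mono order_trans[OF opnorm_apply[OF fin(1,2)] mult_right_mono] A) auto
  also have "\<dots> = (\<Sum>j\<in>J. \<Sum>\<kappa>\<in>K. C\<^sup>2 * (cmod (x (j, \<kappa>)))\<^sup>2)"
    unfolding power_mult_distrib L2_set_power2 sum_distrib_left by (rule sum.swap)
  also have "\<dots> = (C * L2_set (\<lambda>a. cmod (x a)) (J \<times> K))\<^sup>2"
    unfolding power_mult_distrib L2_set_power2 sum_distrib_left
    by (simp add: sum.cartesian_product case_prod_unfold)
  finally show "L2_set (\<lambda>a. cmod (\<Sum>b\<in>J \<times> K. B a b * x b)) (I \<times> K) \<le> C * L2_set (\<lambda>a. cmod (x a)) (J \<times> K)"
    by (rule power2_le_imp_le) (simp add: C)
qed

text \<open>\<open>A\<^sup>* A = c\<^sup>2\<close>, so that \<open>A\<close> multiplies all norms by \<open>c\<close>.\<close>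

lemma opnorm_scaled_isometry:
  assumes fin: "finite I" "finite J" and c: "0 \<le> c"
    and A: "\<And>j j'. j \<in> J \<Longrightarrow> j' \<in> J \<Longrightarrow> (\<Sum>i\<in>I. cnj (A i j) * A i j') = (if j = j' then of_real (c\<^sup>2) else 0)"
  shows "opnorm I J A \<le> c"
proof (rule opnorm_le[OF _ c])
  fix x :: "_ \<Rightarrow> complex"
  define y where "y = (\<lambda>i. \<Sum>j\<in>J. A i j * x j)"
  have "of_real ((L2_set (\<lambda>i. cmod (y i)) I)\<^sup>2) = (\<Sum>i\<in>I. cnj (y i) * y i)"
    by (rule of_real_L2_set_power2)
  also have "\<dots> = (\<Sum>i\<in>I. \<Sum>j\<in>J. \<Sum>j'\<in>J. cnj (x j) * x j' * (cnj (A i j) * A i j'))"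
    unfolding y_def cnj_sum sum_product by (intro sum.cong refl) simp
  also have "\<dots> = (\<Sum>j\<in>J. \<Sum>j'\<in>J. \<Sum>i\<in>I. cnj (x j) * x j' * (cnj (A i j) * A i j'))"
    by (subst sum.swap, intro sum.cong refl, subst sum.swap, simp)
  also have "\<dots> = (\<Sum>j\<in>J. \<Sum>j'\<in>J. cnj (x j) * x j' * (if j = j' then of_real (c\<^sup>2) else 0))"
    by (simp add: sum_distrib_left[symmetric] A)
  also have "\<dots> = (\<Sum>j\<in>J. cnj (x j) * x j * of_real (c\<^sup>2))"
    using fin by (simp add: if_distrib[of "\<lambda>t. _ * t"] cong: if_cong)
  also have "\<dots> = of_real ((c * L2_set (\<lambda>j. cmod (x j)) J)\<^sup>2)"
    unfolding power_mult_distrib of_real_mult of_real_L2_set_power2 sum_distrib_left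
    by (intro sum.cong refl) simp
  finally have "(L2_set (\<lambda>i. cmod (y i)) I)\<^sup>2 = (c * L2_set (\<lambda>j. cmod (x j)) J)\<^sup>2"
    using of_real_eq_iff by blast
  then show "L2_set (\<lambda>i. cmod (\<Sum>j\<in>J. A i j * x j)) I \<le> c * L2_set (\<lambda>j. cmod (x j)) J"
    using c by (simp add: y_def power2_eq_iff_nonneg)
qed

text \<open>\<open>A\<close> is the adjoint of \<open>c\<close> times an isometry.\<close>

lemma opnorm_scaled_coisometry:
  assumes fin: "finite I" "finite J" and c: "0 \<le> c"
    and A: "\<And>i i'. i \<in> I \<Longrightarrow> i' \<in> I \<Longrightarrow> (\<Sum>j\<in>J. A i j * cnj (A i' j)) = (if i = i' then of_real (c\<^sup>2) else 0)"
  shows "opnorm I J A \<le> c"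
proof -
  have "opnorm J I (\<lambda>j i. cnj (A i j)) \<le> c"
    by (rule opnorm_scaled_isometry[OF fin(2,1) c]) (use A in simp)
  then show ?thesis using opnorm_adjoint[OF fin(2,1), of "\<lambda>j i. cnj (A i j)"] by simp
qed

lemma opnorm_scale:
  assumes "finite I" "finite J"
  shows "opnorm I J (\<lambda>i j. c * A i j) \<le> cmod c * opnorm I J A"
proof (rule opnorm_le)
  fix x :: "_ \<Rightarrow> complex"
  have "(\<Sum>j\<in>J. c * A i j * x j) = c * (\<Sum>j\<in>J. A i j * x j)" for i
    by (simp add: sum_distrib_left mult.assoc)
  then have "L2_set (\<lambda>i. cmod (\<Sum>j\<in>J. c * A i j * x j)) I = L2_set (\<lambda>i. cmod c * cmod (\<Sum>j\<in>J. A i j * x j)) I"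
    by (simp only: norm_mult)
  also have "\<dots> = cmod c * L2_set (\<lambda>i. cmod (\<Sum>j\<in>J. A i j * x j)) I"
    by (rule L2_set_right_distrib[symmetric]) simp
  also have "\<dots> \<le> cmod c * (opnorm I J A * L2_set (\<lambda>j. cmod (x j)) J)"
    by (rule mult_left_mono[OF opnorm_apply[OF assms]]) simp
  also have "\<dots> = cmod c * opnorm I J A * L2_set (\<lambda>j. cmod (x j)) J" by simp
  finally show "L2_set (\<lambda>i. cmod (\<Sum>j\<in>J. c * A i j * x j)) I \<le> \<dots>" .
qed (simp add: opnorm_nonneg assms)

text \<open>Matrices with at most one entry in each row and column, all of them equal to \<open>1\<close>.\<close>

lemma opnorm_partial_injection:
  assumes fin: "finite I" "finite J" and inj: "inj_on f I"
  shows "opnorm I J (\<lambda>i j. if f i = j then 1 else 0) \<le> 1"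
proof (rule opnorm_le)
  fix x :: "_ \<Rightarrow> complex"
  have *: "(\<Sum>j\<in>J. (if f i = j then 1 else 0) * x j) = (if f i \<in> J then x (f i) else 0)" for i
  proof -
    have "(\<Sum>j\<in>J. (if f i = j then 1 else 0) * x j) = (\<Sum>j\<in>J. if f i = j then x j else 0)"
      by (intro sum.cong) auto
    then show ?thesis using fin by simp
  qed
  have "(L2_set (\<lambda>i. cmod (\<Sum>j\<in>J. (if f i = j then 1 else 0) * x j)) I)\<^sup>2
     = (\<Sum>i\<in>I. if f i \<in> J then (cmod (x (f i)))\<^sup>2 else 0)"
    unfolding L2_set_power2 * by (intro sum.cong) auto
  also have "\<dots> = (\<Sum>i\<in>{i\<in>I. f i \<in> J}. (cmod (x (f i)))\<^sup>2)"
    using fin by (simp add: sum.inter_filter)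
  also have "\<dots> = (\<Sum>j\<in>f ` {i\<in>I. f i \<in> J}. (cmod (x j))\<^sup>2)"
    by (subst sum.reindex) (use inj in \<open>auto intro: inj_on_subset\<close>)
  also have "\<dots> \<le> (\<Sum>j\<in>J. (cmod (x j))\<^sup>2)" by (rule sum_mono2) (use fin in auto)
  also have "\<dots> = (L2_set (\<lambda>j. cmod (x j)) J)\<^sup>2" by (simp add: L2_set_power2)
  finally show "L2_set (\<lambda>i. cmod (\<Sum>j\<in>J. (if f i = j then 1 else 0) * x j)) I \<le> 1 * L2_set (\<lambda>j. cmod (x j)) J"
    using power2_le_imp_le by fastforce
qed simp

lemma opnorm_empty: "opnorm {} J A \<le> 0" "opnorm I {} A \<le> 0"
  by (rule opnorm_le; simp add: L2_set_def)+


section \<open>The Hahn--Banach theorem\<close>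

definition sublinear :: "(real \<Rightarrow> 'v \<Rightarrow> 'v) \<Rightarrow> ('v::ab_group_add \<Rightarrow> real) \<Rightarrow> bool" where
  "sublinear sc q \<longleftrightarrow> (\<forall>x y. q (x + y) \<le> q x + q y) \<and> (\<forall>t x. 0 < t \<longrightarrow> q (sc t x) \<le> t * q x)"

lemma sublinearD:
  assumes "sublinear sc q"
  shows "q (x + y) \<le> q x + q y" "0 < t \<Longrightarrow> q (sc t x) \<le> t * q x"
  using assms by (auto simp: sublinear_def)

context
  fixes sc :: "real \<Rightarrow> 'v::ab_group_add \<Rightarrow> 'v"
  assumes vs: "vector_space sc"
begin

lemma sublinear_scale:
  assumes q: "sublinear sc q" and t: "0 \<le> t"
  shows "q (sc t x) = t * q x"
proof -
  interpret vector_space sc by (rule vs)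
  have 0: "q 0 = 0"
    using sublinearD(2)[OF q, of 2 0] sublinearD(2)[OF q, of "1/2" 0] by simp
  show ?thesis
  proof (cases "t = 0")
    case False
    then have t: "t > 0" using t by simp
    have "q x = q (sc (1/t) (sc t x))" using t by simp
    also have "\<dots> \<le> 1/t * q (sc t x)" using t by (intro sublinearD(2)[OF q]) simp
    finally have "t * q x \<le> q (sc t x)" using t by (simp add: field_simps)
    with sublinearD(2)[OF q t] show ?thesis by (meson antisym)
  qed (simp add: 0)
qed

lemma sublinear_zero:
  assumes "sublinear sc q" shows "q 0 = 0"
proof -
  interpret vector_space sc by (rule vs)
  show ?thesis using sublinear_scale[OF assms, of 0 0] by simp
qed

text \<open>
  The infimum is the largest sublinear functional below \<open>q\<close> that is linear along the direction
  \<open>y\<close>; it therefore coincides with \<open>q\<close> when \<open>q\<close> is minimal.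
\<close>

definition directional :: "('v \<Rightarrow> real) \<Rightarrow> 'v \<Rightarrow> 'v \<Rightarrow> real" where
  "directional q y x = (INF t\<in>{0..}. q (x + sc t y) - t * q y)"

lemma directional_lower:
  assumes q: "sublinear sc q" and t: "0 \<le> t"
  shows "- q (- x) \<le> q (x + sc t y) - t * q y"
proof -
  interpret vector_space sc by (rule vs)
  have "t * q y = q (sc t y)" by (rule sublinear_scale[OF q t, symmetric])
  also have "\<dots> = q ((x + sc t y) + (- x))" by simp
  also have "\<dots> \<le> q (x + sc t y) + q (- x)" by (rule sublinearD(1)[OF q])
  finally show ?thesis by simp
qed

lemma directional_le:
  assumes q: "sublinear sc q" and t: "0 \<le> t"
  shows "directional q y x \<le> q (x + sc t y) - t * q y"
  unfolding directional_def
  by (rule cINF_lower) (use directional_lower[OF q] t in \<open>auto intro!: bdd_belowI2[where m = "- q (- x)"]\<close>)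

lemma directional_greatest:
  assumes "\<And>t. 0 \<le> t \<Longrightarrow> a \<le> q (x + sc t y) - t * q y"
  shows "a \<le> directional q y x"
  unfolding directional_def by (rule cINF_greatest) (use assms in auto)

lemma sublinear_directional:
  assumes q: "sublinear sc q"
  shows "sublinear sc (directional q y)"
proof -
  interpret vector_space sc by (rule vs)
  show ?thesis
    unfolding sublinear_def
  proof (intro conjI allI impI)
    fix x x'
    have "directional q y (x + x') \<le> (q (x + sc t y) - t * q y) + (q (x' + sc t' y) - t' * q y)"
      if "0 \<le> t" "0 \<le> t'" for t t'
    proof -
      have "directional q y (x + x') \<le> q (x + x' + sc (t + t') y) - (t + t') * q y"
        using that by (intro directional_le[OF q]) simp
      also have "x + x' + sc (t + t') y = (x + sc t y) + (x' + sc t' y)" by (simp add: scale_left_distrib)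
      also have "q \<dots> \<le> q (x + sc t y) + q (x' + sc t' y)" by (rule sublinearD(1)[OF q])
      finally show ?thesis by (simp add: algebra_simps)
    qed
    note 1 = this
    have 2: "directional q y (x + x') - (q (x' + sc t' y) - t' * q y) \<le> directional q y x" if "0 \<le> t'" for t'
    proof (rule directional_greatest)
      fix t :: real assume "0 \<le> t"
      from 1[OF this that] show "directional q y (x + x') - (q (x' + sc t' y) - t' * q y) \<le> q (x + sc t y) - t * q y"
        by linarith
    qed
    have "directional q y (x + x') - directional q y x \<le> directional q y x'"
    proof (rule directional_greatest)
      fix t :: real assume "0 \<le> t"
      from 2[OF this] show "directional q y (x + x') - directional q y x \<le> q (x' + sc t y) - t * q y"
        by linarith
    qed
    then show "directional q y (x + x') \<le> directional q y x + directional q y x'" by simp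
  next
    fix r x assume r: "(0::real) < r"
    have "directional q y (sc r x) / r \<le> q (x + sc t y) - t * q y" if "0 \<le> t" for t
    proof -
      have "directional q y (sc r x) \<le> q (sc r x + sc (r * t) y) - (r * t) * q y"
        using that r by (intro directional_le[OF q]) simp
      also have "sc r x + sc (r * t) y = sc r (x + sc t y)" by (simp add: scale_right_distrib)
      also have "q \<dots> = r * q (x + sc t y)" using r by (intro sublinear_scale[OF q]) simp
      finally show ?thesis using r by (simp add: field_simps)
    qed
    then have "directional q y (sc r x) / r \<le> directional q y x" by (rule directional_greatest)
    then show "directional q y (sc r x) \<le> r * directional q y x" using r by (simp add: field_simps)
  qed
qed

lemma directional_le_self: "sublinear sc q \<Longrightarrow> directional q y x \<le> q x"
proof -
  interpret vector_space sc by (rule vs)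
  show "sublinear sc q \<Longrightarrow> directional q y x \<le> q x" using directional_le[of q 0 y x] by simp
qed

lemma sublinear_chain_Inf:
  assumes C: "C \<noteq> {}" "\<And>q. q \<in> C \<Longrightarrow> sublinear sc q"
    and p: "\<And>q x. q \<in> C \<Longrightarrow> q x \<le> p x"
    and chain: "\<And>q q'. q \<in> C \<Longrightarrow> q' \<in> C \<Longrightarrow> (\<forall>x. q x \<le> q' x) \<or> (\<forall>x. q' x \<le> q x)"
  shows "sublinear sc (\<lambda>x. INF q\<in>C. q x)" and "q \<in> C \<Longrightarrow> (INF q\<in>C. q x) \<le> q x"
proof -
  interpret vector_space sc by (rule vs)
  have "- p (- x) \<le> q x" if q: "q \<in> C" for q x
    using sublinearD(1)[OF C(2)[OF q], of x "- x"] sublinear_zero[OF C(2)[OF q]] p[OF q, of "- x"]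
    by simp
  then have low: "(INF q\<in>C. q x) \<le> q x" if "q \<in> C" for q x
    using that by (intro cINF_lower bdd_belowI2)
  show "q \<in> C \<Longrightarrow> (INF q\<in>C. q x) \<le> q x" by (rule low)
  show "sublinear sc (\<lambda>x. INF q\<in>C. q x)"
    unfolding sublinear_def
  proof (intro conjI allI impI)
    fix x y
    have *: "(INF q\<in>C. q (x + y)) \<le> q x + q' y" if q: "q \<in> C" "q' \<in> C" for q q'
    proof -
      obtain q'' where q'': "q'' \<in> C" "\<forall>z. q'' z \<le> q z" "\<forall>z. q'' z \<le> q' z"
        using chain[OF q] q by auto
      have "(INF q\<in>C. q (x + y)) \<le> q'' x + q'' y"
          by (rule order_trans[OF low[OF q''(1)] sublinearD(1)[OF C(2)[OF q''(1)]]])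
      then show ?thesis using q''(2)[rule_format, of x] q''(3)[rule_format, of y] by linarith
    qed
    have 1: "(INF q\<in>C. q (x + y)) - q' y \<le> (INF q\<in>C. q x)" if "q' \<in> C" for q'
      by (rule cINF_greatest[OF C(1)]) (use *[OF _ that] in \<open>simp add: diff_le_eq\<close>)
    have "(INF q\<in>C. q (x + y)) - (INF q\<in>C. q x) \<le> (INF q\<in>C. q y)"
      by (rule cINF_greatest[OF C(1)]) (use 1 in \<open>simp add: diff_le_eq add.commute\<close>)
    then show "(INF q\<in>C. q (x + y)) \<le> (INF q\<in>C. q x) + (INF q\<in>C. q y)" by simp
  next
    fix t x assume t: "(0::real) < t"
    have "(INF q\<in>C. q (sc t x)) / t \<le> q x" if q: "q \<in> C" for q
      using low[OF q, of "sc t x"] sublinearD(2)[OF C(2)[OF q] t, of x] t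
      by (simp add: field_simps)
    then have "(INF q\<in>C. q (sc t x)) / t \<le> (INF q\<in>C. q x)"
      using C(1) by (intro cINF_greatest) auto
    then show "(INF q\<in>C. q (sc t x)) \<le> t * (INF q\<in>C. q x)" using t by (simp add: field_simps)
  qed
qed

text \<open>
  By Zorn's lemma: the infimum of a chain is again sublinear, and it is finite because
  \<open>- p (- x)\<close> is a lower bound for the values at \<open>x\<close>.
\<close>

lemma minimal_sublinear_exists:
  assumes p: "sublinear sc p"
  obtains q where "sublinear sc q" "\<And>x. q x \<le> p x"
    "\<And>q'. sublinear sc q' \<Longrightarrow> (\<And>x. q' x \<le> q x) \<Longrightarrow> q' = q"
proof -
  define A where "A = {q. sublinear sc q \<and> (\<forall>x. q x \<le> p x)}"
  define P where "P = (\<lambda>q q' :: 'v \<Rightarrow> real. \<forall>x. q' x \<le> q x)"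
  have "\<exists>m\<in>A. \<forall>a\<in>A. P m a \<longrightarrow> a = m"
  proof (rule predicate_Zorn)
    show "partial_order_on A (relation_of P A)"
    proof (rule partial_order_on_relation_ofI)
      show "P a c" if "P a b" "P b c" for a b c
        using that unfolding P_def by (meson order_trans)
      show "a = b" if "P a b" "P b a" for a b
        using that unfolding P_def by (intro ext antisym) auto
    qed (simp add: P_def)
  next
    fix C assume C: "C \<in> Chains (relation_of P A)"
    show "\<exists>u\<in>A. \<forall>a\<in>C. P a u"
    proof (cases "C = {}")
      case True
      then show ?thesis using p by (auto simp: A_def)
    next
      case False
      have CA: "C \<subseteq> A" using C by (auto simp: Chains_def relation_of_def)
      have ch: "(\<forall>x. q x \<le> q' x) \<or> (\<forall>x. q' x \<le> q x)" if "q \<in> C" "q' \<in> C" for q q'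
        using C that by (auto simp: Chains_def relation_of_def P_def)
      have C1: "sublinear sc q" and C2: "q x \<le> p x" if "q \<in> C" for q x
        using CA that by (auto simp: A_def)
      have sub: "sublinear sc (\<lambda>x. INF q\<in>C. q x)"
        by (rule sublinear_chain_Inf(1)[OF False, where p = p]) (fact C1 C2 ch)+
      have low: "(INF q\<in>C. q x) \<le> q x" if "q \<in> C" for q x
        by (rule sublinear_chain_Inf(2)[OF False, where p = p]) (fact C1 C2 ch that)+
      obtain q where "q \<in> C" using False by blast
      then have "(INF q\<in>C. q x) \<le> p x" for x by (intro order_trans[OF low C2])
      then have "(\<lambda>x. INF q\<in>C. q x) \<in> A" using sub by (simp add: A_def)
      moreover have "\<forall>a\<in>C. P a (\<lambda>x. INF q\<in>C. q x)" using low by (simp add: P_def)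
      ultimately show ?thesis by (intro bexI[where x = "\<lambda>x. INF q\<in>C. q x"])
    qed
  qed
  then obtain m where m: "m \<in> A" "\<And>a. a \<in> A \<Longrightarrow> P m a \<Longrightarrow> a = m" by blast
  show thesis
  proof (rule that)
    show "sublinear sc m" "m x \<le> p x" for x using m(1) by (auto simp: A_def)
    fix q' assume q': "sublinear sc q'" "\<And>x. q' x \<le> m x"
    then have "q' x \<le> p x" for x using m(1) order_trans[of "q' x" "m x" "p x"] by (simp add: A_def)
    then have "q' \<in> A" using q'(1) by (simp add: A_def)
    then show "q' = m" using m(2) q' by (simp add: P_def)
  qed
qed

text \<open>
  A minimal sublinear functional equals each of its directional regularizations, hence is linear.
  Starting the minimization from the regularization in the direction \<open>x0\<close> fixes the value there.
\<close>

theorem hahn_banach: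
  assumes p: "sublinear sc p"
  obtains L where "\<And>x y. L (x + y) = L x + L y" "\<And>t x. L (sc t x) = t * L x"
    "\<And>x. L x \<le> p x" "L x0 = p x0"
proof -
  interpret vector_space sc by (rule vs)
  obtain q where q: "sublinear sc q" "\<And>x. q x \<le> directional p x0 x"
    "\<And>q'. sublinear sc q' \<Longrightarrow> (\<And>x. q' x \<le> q x) \<Longrightarrow> q' = q"
    using minimal_sublinear_exists[OF sublinear_directional[OF p]] by metis
  have qp: "q x \<le> p x" for x by (rule order_trans[OF q(2) directional_le_self[OF p]])
  have q_dir: "directional q y = q" for y
    by (intro q(3) sublinear_directional directional_le_self q(1))
  have add: "q (x + y) = q x + q y" for x y
  proof (rule antisym)
    have "q x \<le> q (x + sc 1 y) - 1 * q y"
      using directional_le[OF q(1), of 1 y x] unfolding q_dir by simp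
    then show "q x + q y \<le> q (x + y)" by simp
  qed (rule sublinearD(1)[OF q(1)])
  have neg: "q (- x) = - q x" for x
    using add[of x "- x"] sublinear_zero[OF q(1)] by simp
  have scale: "q (sc t x) = t * q x" for t x
  proof (cases "0 \<le> t")
    case False
    then have "q (sc t x) = - q (sc (- t) x)" by (simp add: neg[symmetric])
    then show ?thesis using False sublinear_scale[OF q(1), of "- t" x] by simp
  qed (rule sublinear_scale[OF q(1)])
  have "q (- x0) \<le> p (- x0 + sc 1 x0) - 1 * p x0"
    by (rule order_trans[OF q(2) directional_le[OF p]]) simp
  then have "p x0 \<le> q x0" using sublinear_zero[OF p] neg by simp
  then have "q x0 = p x0" by (intro antisym qp)
  then show thesis using that add scale qp by blast
qed

end

section \<open>Matrix seminorms satisfying Ruan's axioms\<close>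

text \<open>
  The interpolation and projective norms below are treated as seminorms. The triangle inequality
  and homogeneity follow from the two axioms of Ruan.
\<close>

lemma sum_Times: "sum f (A \<times> B) = (\<Sum>a\<in>A. \<Sum>b\<in>B. f (a, b))"
  by (simp add: sum.cartesian_product case_prod_unfold)

locale ruan_seminorm = vector_space "smult E" for E :: "'e::ab_group_add opspace" +
  assumes cong: "\<And>k x y. (\<And>i j. i < k \<Longrightarrow> j < k \<Longrightarrow> x i j = y i j) \<Longrightarrow> mnorm E k x = mnorm E k y"
    and nonneg: "\<And>k x. 0 \<le> mnorm E k x"
    and direct_sum: "\<And>k l x y.
      mnorm E (k + l) (\<lambda>i j. if i < k \<and> j < k then x i j
                             else if k \<le> i \<and> k \<le> j then y (i - k) (j - k) else 0)
      \<le> max (mnorm E k x) (mnorm E l y)"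
    and mult: "\<And>k l \<alpha> x \<beta>.
      mnorm E l (\<lambda>i j. \<Sum>a<k. \<Sum>b<k. smult E (\<alpha> i a * \<beta> b j) (x a b))
      \<le> opnorm {..<l} {..<k} \<alpha> * mnorm E k x * opnorm {..<k} {..<l} \<beta>"

lemma (in operator_space) ruan_seminorm: "ruan_seminorm E"
  by unfold_locales (fact mnorm_cong mnorm_nonneg eq_refl[OF ruan_sum] ruan_mult)+

definition enumeration :: "'i set \<Rightarrow> nat \<Rightarrow> 'i" where
  "enumeration I = (SOME e. bij_betw e {..<card I} I)"

text \<open>
  Matrices are indexed by arbitrary finite sets, such as products, so as to avoid arithmetic with
  indices. The choice of the enumeration does not matter, by \<open>inorm_eq\<close> below.
\<close>

definition inorm :: "'e opspace \<Rightarrow> 'i set \<Rightarrow> ('i \<Rightarrow> 'i \<Rightarrow> 'e) \<Rightarrow> real" where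
  "inorm E I x = mnorm E (card I) (\<lambda>i j. x (enumeration I i) (enumeration I j))"

lemma bij_enumeration: "finite I \<Longrightarrow> bij_betw (enumeration I) {..<card I} I"
  unfolding enumeration_def using ex_bij_betw_nat_finite[of I] by (intro someI_ex[of "\<lambda>e. bij_betw e {..<card I} I"]) (simp add: atLeast0LessThan)

lemma enumeration_mem: "finite I \<Longrightarrow> i < card I \<Longrightarrow> enumeration I i \<in> I"
  using bij_enumeration bij_betwE by blast

context ruan_seminorm
begin

text \<open>Permuting rows and columns is multiplication by permutation matrices, of norm at most \<open>1\<close>.\<close>

lemma mnorm_permute_le:
  assumes f: "bij_betw f {..<k} {..<k}"
  shows "mnorm E k (\<lambda>i j. x (f i) (f j)) \<le> mnorm E k x"
proof -
  define P where "P = (\<lambda>i a. if f i = a then (1::complex) else 0)"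
  define R where "R = (\<lambda>a i. if f i = a then (1::complex) else 0)"
  have P: "opnorm {..<k} {..<k} P \<le> 1"
    unfolding P_def using f by (intro opnorm_partial_injection) (auto simp: bij_betw_def)
  have R: "opnorm {..<k} {..<k} R \<le> 1"
    using opnorm_adjoint[of "{..<k}" "{..<k}" P] P by (simp add: R_def P_def if_distrib cong: if_cong)
  have "mnorm E k (\<lambda>i j. x (f i) (f j)) = mnorm E k (\<lambda>i j. \<Sum>a<k. \<Sum>b<k. smult E (P i a * R b j) (x a b))"
  proof (rule cong)
    fix i j assume ij: "i < k" "j < k"
    then have fij: "f i < k" "f j < k" using f by (auto dest: bij_betwE)
    have "(\<Sum>a<k. \<Sum>b<k. smult E (P i a * R b j) (x a b)) = (\<Sum>a<k. \<Sum>b<k. if f i = a then if f j = b then x a b else 0 else 0)"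
      by (intro sum.cong refl) (auto simp: P_def R_def)
    also have "\<dots> = (\<Sum>a<k. if f i = a then (\<Sum>b<k. if f j = b then x a b else 0) else 0)"
      by (intro sum.cong refl) auto
    finally show "x (f i) (f j) = (\<Sum>a<k. \<Sum>b<k. smult E (P i a * R b j) (x a b))"
      using fij by simp
  qed
  also have "\<dots> \<le> opnorm {..<k} {..<k} P * mnorm E k x * opnorm {..<k} {..<k} R" by (rule mult)
  also have "\<dots> \<le> 1 * mnorm E k x * 1"
    using P R nonneg by (intro mult_mono) (auto intro!: opnorm_nonneg mult_nonneg_nonneg)
  finally show ?thesis by simp
qed

lemma mnorm_permute:
  assumes f: "bij_betw f {..<k} {..<k}"
  shows "mnorm E k (\<lambda>i j. x (f i) (f j)) = mnorm E k x"
proof (rule antisym)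
  have g: "bij_betw (the_inv_into {..<k} f) {..<k} {..<k}" using f by (rule bij_betw_the_inv_into)
  have "mnorm E k x = mnorm E k (\<lambda>i j. x (f (the_inv_into {..<k} f i)) (f (the_inv_into {..<k} f j)))"
    using f by (intro cong) (simp add: f_the_inv_into_f_bij_betw)
  also have "\<dots> \<le> mnorm E k (\<lambda>i j. x (f i) (f j))"
    by (rule mnorm_permute_le[OF g, of "\<lambda>i j. x (f i) (f j)"])
  finally show "mnorm E k x \<le> mnorm E k (\<lambda>i j. x (f i) (f j))" .
qed (rule mnorm_permute_le[OF f])

lemma inorm_eq:
  assumes e: "bij_betw e {..<k} I"
  shows "inorm E I x = mnorm E k (\<lambda>i j. x (e i) (e j))"
proof -
  have fin: "finite I" using bij_betw_finite[OF e] by simp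
  have k: "card I = k" using bij_betw_same_card[OF e] by simp
  define f where "f = (\<lambda>i. the_inv_into {..<k} e (enumeration I i))"
  have f: "bij_betw f {..<k} {..<k}"
    unfolding f_def using bij_betw_trans[OF bij_enumeration[OF fin] bij_betw_the_inv_into[OF e]] k
    by (simp add: comp_def)
  have "e (f i) = enumeration I i" if "i < k" for i
    unfolding f_def using e enumeration_mem[OF fin] that k by (intro f_the_inv_into_f_bij_betw) auto
  then have "inorm E I x = mnorm E k (\<lambda>i j. x (e (f i)) (e (f j)))"
    unfolding inorm_def k by (intro cong) simp
  also have "\<dots> = mnorm E k (\<lambda>i j. x (e i) (e j))"
    by (rule mnorm_permute[OF f, of "\<lambda>i j. x (e i) (e j)"])
  finally show ?thesis .
qed

lemma inorm_lessThan: "inorm E {..<k} x = mnorm E k x"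
  using inorm_eq[of id k "{..<k}" x] by simp

lemma inorm_reindex:
  assumes f: "bij_betw f J I" and fin: "finite I"
  shows "inorm E J (\<lambda>i j. x (f i) (f j)) = inorm E I x"
proof -
  have finJ: "finite J" using f fin bij_betw_finite by blast
  have "bij_betw (f \<circ> enumeration J) {..<card J} I"
    by (rule bij_betw_trans[OF bij_enumeration[OF finJ] f])
  then show ?thesis
    using inorm_eq[of "f \<circ> enumeration J" _ I x] inorm_eq[OF bij_enumeration[OF finJ]] by simp
qed

lemma inorm_cong:
  assumes "finite I" "\<And>i j. i \<in> I \<Longrightarrow> j \<in> I \<Longrightarrow> x i j = y i j"
  shows "inorm E I x = inorm E I y"
  unfolding inorm_def using assms enumeration_mem by (intro cong) blast

lemma inorm_nonneg: "0 \<le> inorm E I x"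
  unfolding inorm_def by (rule nonneg)

lemma inorm_mult:
  assumes fin: "finite I" "finite J"
  shows "inorm E I (\<lambda>i j. \<Sum>a\<in>J. \<Sum>b\<in>J. smult E (\<alpha> i a * \<beta> b j) (x a b))
    \<le> opnorm I J \<alpha> * inorm E J x * opnorm J I \<beta>"
proof -
  let ?e = "enumeration I" let ?d = "enumeration J"
  note e = bij_enumeration[OF fin(1)] and d = bij_enumeration[OF fin(2)]
  have "(\<Sum>a\<in>J. \<Sum>b\<in>J. smult E (\<alpha> i a * \<beta> b j) (x a b))
     = (\<Sum>a<card J. \<Sum>b<card J. smult E (\<alpha> i (?d a) * \<beta> (?d b) j) (x (?d a) (?d b)))" for i j
    using sum.reindex_bij_betw[OF d, of "\<lambda>a. \<Sum>b\<in>J. smult E (\<alpha> i a * \<beta> b j) (x a b)"]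
      sum.reindex_bij_betw[OF d, of "\<lambda>b. smult E (\<alpha> i a * \<beta> b j) (x a b)" for a] by simp
  then have "inorm E I (\<lambda>i j. \<Sum>a\<in>J. \<Sum>b\<in>J. smult E (\<alpha> i a * \<beta> b j) (x a b))
    \<le> opnorm {..<card I} {..<card J} (\<lambda>i a. \<alpha> (?e i) (?d a)) * inorm E J x
      * opnorm {..<card J} {..<card I} (\<lambda>b j. \<beta> (?d b) (?e j))"
    unfolding inorm_def by (simp add: mult)
  then show ?thesis using opnorm_reindex[OF e d fin] opnorm_reindex[OF d e fin(2,1)] by simp
qed

lemma inorm_mult_le:
  assumes fin: "finite I" "finite J" and "opnorm I J \<alpha> \<le> a" "opnorm J I \<beta> \<le> b" "inorm E J x \<le> c"
  shows "inorm E I (\<lambda>i j. \<Sum>s\<in>J. \<Sum>t\<in>J. smult E (\<alpha> i s * \<beta> t j) (x s t)) \<le> a * c * b"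
proof -
  have "opnorm I J \<alpha> * inorm E J x * opnorm J I \<beta> \<le> a * c * b"
    using assms opnorm_nonneg[OF fin, of \<alpha>] opnorm_nonneg[OF fin(2,1), of \<beta>] inorm_nonneg[of J x]
    by (intro mult_mono mult_nonneg_nonneg) auto
  then show ?thesis by (rule order_trans[OF inorm_mult[OF fin]])
qed

text \<open>A principal submatrix, possibly with its rows and columns renamed.\<close>

lemma inorm_compress:
  assumes fin: "finite I" "finite J" and f: "inj_on f I" "f ` I \<subseteq> J"
  shows "inorm E I (\<lambda>i j. x (f i) (f j)) \<le> inorm E J x"
proof -
  define P where "P = (\<lambda>i a. if f i = a then (1::complex) else 0)"
  define R where "R = (\<lambda>a i. if f i = a then (1::complex) else 0)"
  have P: "opnorm I J P \<le> 1"
    unfolding P_def by (intro opnorm_partial_injection fin f)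
  have R: "opnorm J I R \<le> 1"
    using opnorm_adjoint[of I J P] P fin by (simp add: R_def P_def if_distrib cong: if_cong)
  have "inorm E I (\<lambda>i j. x (f i) (f j)) = inorm E I (\<lambda>i j. \<Sum>a\<in>J. \<Sum>b\<in>J. smult E (P i a * R b j) (x a b))"
  proof (rule inorm_cong[OF fin(1)])
    fix i j assume ij: "i \<in> I" "j \<in> I"
    then have fij: "f i \<in> J" "f j \<in> J" using f by auto
    have "(\<Sum>a\<in>J. \<Sum>b\<in>J. smult E (P i a * R b j) (x a b)) = (\<Sum>a\<in>J. \<Sum>b\<in>J. if f i = a then if f j = b then x a b else 0 else 0)"
      by (intro sum.cong refl) (auto simp: P_def R_def)
    also have "\<dots> = (\<Sum>a\<in>J. if f i = a then (\<Sum>b\<in>J. if f j = b then x a b else 0) else 0)"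
      by (intro sum.cong refl) auto
    finally show "x (f i) (f j) = (\<Sum>a\<in>J. \<Sum>b\<in>J. smult E (P i a * R b j) (x a b))"
      using fij fin by simp
  qed
  also have "\<dots> \<le> 1 * inorm E J x * 1" by (rule inorm_mult_le[OF fin P R order_refl])
  finally show ?thesis by simp
qed

lemma inorm_empty: "inorm E {} x = 0"
proof -
  have "inorm E {} x \<le> 0 * inorm E {} x * 0"
    using inorm_mult_le[of "{}" "{}" "\<lambda>_ _. 0" 0 "\<lambda>_ _. 0" 0 x] opnorm_empty
    by (subst inorm_cong[of _ _ "\<lambda>i j. \<Sum>s\<in>{}. \<Sum>t\<in>{}. smult E (0 * 0) (x s t)"]) auto
  then show ?thesis using inorm_nonneg[of "{}" x] by simp
qed

lemma inorm_disjoint_union: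
  assumes fin: "finite I" "finite J" and disj: "I \<inter> J = {}"
    and z: "\<And>i j. i \<in> I \<Longrightarrow> j \<in> J \<Longrightarrow> x i j = 0 \<and> x j i = 0"
  shows "inorm E (I \<union> J) x \<le> max (inorm E I x) (inorm E J x)"
proof -
  let ?k = "card I" let ?l = "card J"
  let ?e = "enumeration I" let ?d = "enumeration J"
  note e = bij_enumeration[OF fin(1)] and d = bij_enumeration[OF fin(2)]
  define h where "h = (\<lambda>i. if i < ?k then ?e i else ?d (i - ?k))"
  have h1: "bij_betw h {..<?k} I"
    using e by (subst bij_betw_cong[of _ _ ?e]) (auto simp: h_def)
  have "bij_betw (\<lambda>i. i - ?k) {?k..<?k + ?l} {..<?l}"
    by (rule bij_betw_byWitness[of _ "\<lambda>i. i + ?k"]) auto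
  from bij_betw_trans[OF this d] have h2: "bij_betw h {?k..<?k + ?l} J"
    by (subst bij_betw_cong[of _ _ "?d \<circ> (\<lambda>i. i - ?k)"]) (auto simp: h_def)
  have "{..<?k} \<union> {?k..<?k + ?l} = {..<?k + ?l}" by auto
  then have h: "bij_betw h {..<?k + ?l} (I \<union> J)"
    using bij_betw_combine[OF h1 h2 disj] by simp
  have "inorm E (I \<union> J) x = mnorm E (?k + ?l) (\<lambda>i j. x (h i) (h j))" by (rule inorm_eq[OF h])
  also have "\<dots> = mnorm E (?k + ?l) (\<lambda>i j. if i < ?k \<and> j < ?k then x (?e i) (?e j)
                             else if ?k \<le> i \<and> ?k \<le> j then x (?d (i - ?k)) (?d (j - ?k)) else 0)"
    by (rule cong) (use enumeration_mem[OF fin(1)] enumeration_mem[OF fin(2)] z in \<open>auto simp: h_def\<close>)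
  also have "\<dots> \<le> max (mnorm E ?k (\<lambda>i j. x (?e i) (?e j))) (mnorm E ?l (\<lambda>i j. x (?d i) (?d j)))"
    by (rule direct_sum)
  finally show ?thesis by (simp add: inorm_def)
qed

text \<open>By induction on the set of blocks, each step being an instance of Ruan's axiom on direct sums.\<close>

lemma inorm_block_diagonal:
  assumes fin: "finite I" "finite K" and C: "0 \<le> C"
    and x: "\<And>\<kappa>. \<kappa> \<in> K \<Longrightarrow> inorm E I (x \<kappa>) \<le> C"
  shows "inorm E (I \<times> K) (\<lambda>(i, \<kappa>) (j, \<mu>). if \<kappa> = \<mu> then x \<kappa> i j else 0) \<le> C"
  using fin(2) x
proof (induction K)
  case empty
  show ?case unfolding Sigma_empty2 inorm_empty by (rule C)
next
  case (insert \<kappa> K)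
  let ?x = "\<lambda>(i, \<kappa>) (j, \<mu>). if \<kappa> = \<mu> then x \<kappa> i j else 0"
  have "bij_betw (\<lambda>i. (i, \<kappa>)) I (I \<times> {\<kappa>})" by (auto simp: bij_betw_def inj_on_def)
  from inorm_reindex[OF this, of ?x] have "inorm E (I \<times> {\<kappa>}) ?x = inorm E I (x \<kappa>)"
    using fin(1) by simp
  moreover have "inorm E (I \<times> {\<kappa>} \<union> I \<times> K) ?x \<le> max (inorm E (I \<times> {\<kappa>}) ?x) (inorm E (I \<times> K) ?x)"
    using insert.hyps fin(1) by (intro inorm_disjoint_union) auto
  moreover have "inorm E (I \<times> K) ?x \<le> C" using insert by simp
  moreover have "I \<times> insert \<kappa> K = I \<times> {\<kappa>} \<union> I \<times> K" by auto
  ultimately show ?case using insert.prems[of \<kappa>] by simp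
qed

lemma inorm_smult:
  fixes I :: "'i set"
  assumes fin: "finite I"
  shows "inorm E I (\<lambda>i j. smult E c (x i j)) \<le> cmod c * inorm E I x"
proof -
  define P where "P = (\<lambda>i j :: 'i. if i = j then (1::complex) else 0)"
  have P: "opnorm I I P \<le> 1"
    unfolding P_def using opnorm_partial_injection[OF fin fin, of "\<lambda>x. x"] by simp
  have "inorm E I (\<lambda>i j. smult E c (x i j)) = inorm E I (\<lambda>i j. \<Sum>a\<in>I. \<Sum>b\<in>I. smult E (c * P i a * P b j) (x a b))"
  proof (rule inorm_cong[OF fin])
    fix i j assume ij: "i \<in> I" "j \<in> I"
    have "(\<Sum>a\<in>I. \<Sum>b\<in>I. smult E (c * P i a * P b j) (x a b)) = (\<Sum>a\<in>I. \<Sum>b\<in>I. if i = a then if b = j then smult E c (x a b) else 0 else 0)"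
      by (intro sum.cong refl) (auto simp: P_def)
    also have "\<dots> = (\<Sum>a\<in>I. if i = a then (\<Sum>b\<in>I. if b = j then smult E c (x a b) else 0) else 0)"
      by (intro sum.cong refl) auto
    finally show "smult E c (x i j) = (\<Sum>a\<in>I. \<Sum>b\<in>I. smult E (c * P i a * P b j) (x a b))"
      using ij fin by simp
  qed
  also have "\<dots> \<le> cmod c * inorm E I x * 1"
    using P
    by (intro inorm_mult_le fin) (auto intro!: order_trans[OF opnorm_scale[OF fin fin]] mult_left_le)
  finally show ?thesis by simp
qed

text \<open>
  With \<open>a\<close>, \<open>b\<close> slightly larger than the norms of \<open>x\<close>, \<open>y\<close>, the sum \<open>x + y\<close> is obtained from
  \<open>x / a \<oplus> y / b\<close> by multiplying with the row \<open>(\<surd>a, \<surd>b)\<close> and its transpose, each of norm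
  \<open>\<surd>(a + b)\<close>.
\<close>

lemma inorm_triangle:
  fixes I :: "'i set"
  assumes fin: "finite I"
  shows "inorm E I (\<lambda>i j. x i j + y i j) \<le> inorm E I x + inorm E I y"
proof (rule field_le_epsilon)
  fix e :: real assume e: "0 < e"
  define a where "a = (\<lambda>\<kappa>. (if \<kappa> then inorm E I x else inorm E I y) + e / 2)"
  have a: "0 < a \<kappa>" for \<kappa> using e inorm_nonneg[of I x] inorm_nonneg[of I y] by (simp add: a_def)
  define z where "z = (\<lambda>\<kappa> i j. smult E (of_real (1 / a \<kappa>)) (if \<kappa> then x i j else y i j))"
  define Z where "Z = (\<lambda>(i, \<kappa>) (j, \<mu>). if \<kappa> = \<mu> then z \<kappa> i j else 0)"
  define P where "P = (\<lambda>i :: 'i. \<lambda>(j, \<kappa>). if i = j then complex_of_real (sqrt (a \<kappa>)) else 0)"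
  define R where "R = (\<lambda>(j, \<kappa>) (i :: 'i). if i = j then complex_of_real (sqrt (a \<kappa>)) else 0)"
  let ?J = "I \<times> (UNIV :: bool set)"
  have finJ: "finite ?J" using fin by simp
  have z: "inorm E I (z \<kappa>) \<le> 1" for \<kappa>
  proof -
    have "inorm E I (z \<kappa>) \<le> cmod (of_real (1 / a \<kappa>)) * inorm E I (if \<kappa> then x else y)"
      using inorm_smult[OF fin, of "of_real (1 / a \<kappa>)" "if \<kappa> then x else y"] by (cases \<kappa>) (simp_all add: z_def)
    also have "\<dots> = inorm E I (if \<kappa> then x else y) / a \<kappa>" using a[of \<kappa>] by (simp add: norm_divide)
    also have "\<dots> \<le> 1" using a[of \<kappa>] e by (simp add: a_def)
    finally show ?thesis .
  qed
  have Z: "inorm E ?J Z \<le> 1"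
    unfolding Z_def using z by (intro inorm_block_diagonal fin) auto
  let ?c = "sqrt (a True + a False)"
  have c: "0 \<le> ?c" using add_pos_pos[OF a[of True] a[of False]] by simp
  have P: "opnorm I ?J P \<le> ?c"
  proof (rule opnorm_scaled_coisometry[OF fin finJ c])
    fix i i' assume i: "i \<in> I" "i' \<in> I"
    have "(\<Sum>b\<in>?J. P i b * cnj (P i' b)) = (\<Sum>j\<in>I. \<Sum>\<kappa>\<in>UNIV. P i (j, \<kappa>) * cnj (P i' (j, \<kappa>)))"
      by (simp add: sum.cartesian_product case_prod_unfold)
    also have "\<dots> = (\<Sum>j\<in>I. if j = i then (\<Sum>\<kappa>\<in>UNIV. if i = i' then of_real (a \<kappa>) else 0) else 0)"
      using less_imp_le[OF a] by (intro sum.cong refl) (auto simp: P_def of_real_mult[symmetric] simp del: of_real_mult intro!: sum.cong)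
    also have "\<dots> = (if i = i' then of_real (a True + a False) else 0)"
      using i fin by (simp add: UNIV_bool add.commute)
    also have "a True + a False = ?c\<^sup>2"
      using add_pos_pos[OF a[of True] a[of False]] by simp
    finally show "(\<Sum>b\<in>?J. P i b * cnj (P i' b)) = (if i = i' then of_real (?c\<^sup>2) else 0)" .
  qed
  have "R = (\<lambda>b i. cnj (P i b))" by (auto simp: R_def P_def fun_eq_iff)
  then have R: "opnorm ?J I R \<le> ?c" using opnorm_adjoint[OF fin finJ, of P] P by simp
  have "inorm E I (\<lambda>i j. x i j + y i j) = inorm E I (\<lambda>i j. \<Sum>s\<in>?J. \<Sum>t\<in>?J. smult E (P i s * R t j) (Z s t))"
  proof (rule inorm_cong[OF fin])
    fix i j assume ij: "i \<in> I" "j \<in> I"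
    have "(\<Sum>s\<in>?J. \<Sum>t\<in>?J. smult E (P i s * R t j) (Z s t))
      = (\<Sum>s\<in>I. \<Sum>\<kappa>\<in>UNIV. \<Sum>t\<in>I. \<Sum>\<mu>\<in>UNIV. smult E (P i (s, \<kappa>) * R (t, \<mu>) j) (Z (s, \<kappa>) (t, \<mu>)))"
      by (simp only: sum_Times)
    also have "\<dots> = (\<Sum>s\<in>I. \<Sum>\<kappa>\<in>UNIV. \<Sum>t\<in>I. \<Sum>\<mu>\<in>UNIV. if \<mu> = \<kappa> then if t = j then if s = i then smult E (of_real (a \<kappa>)) (z \<kappa> i j) else 0 else 0 else 0)"
      using less_imp_le[OF a] by (intro sum.cong refl) (auto simp: P_def R_def Z_def of_real_mult[symmetric] simp del: of_real_mult)
    also have "\<dots> = (\<Sum>\<kappa>\<in>UNIV. smult E (of_real (a \<kappa>)) (z \<kappa> i j))"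
      using ij fin by (simp add: UNIV_bool sum.distrib)
    also have "\<dots> = x i j + y i j"
      using a[of True] a[of False] by (simp add: UNIV_bool z_def of_real_mult[symmetric] del: of_real_mult of_real_divide)
    finally show "x i j + y i j = (\<Sum>s\<in>?J. \<Sum>t\<in>?J. smult E (P i s * R t j) (Z s t))" by simp
  qed
  also have "\<dots> \<le> ?c * 1 * ?c" by (rule inorm_mult_le[OF fin finJ P R Z])
  also have "\<dots> = inorm E I x + inorm E I y + e"
    using add_pos_pos[OF a[of True] a[of False]] by (simp add: a_def)
  finally show "inorm E I (\<lambda>i j. x i j + y i j) \<le> inorm E I x + inorm E I y + e" .
qed

lemma mnorm_triangle: "mnorm E k (\<lambda>i j. x i j + y i j) \<le> mnorm E k x + mnorm E k y"
  using inorm_triangle[of "{..<k}" x y] by (simp add: inorm_lessThan)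

lemma mnorm_smult: "mnorm E k (\<lambda>i j. smult E c (x i j)) \<le> cmod c * mnorm E k x"
  using inorm_smult[of "{..<k}" c x] by (simp add: inorm_lessThan)

lemma mnorm_zero: "mnorm E k (\<lambda>i j. 0) = 0"
  using mnorm_smult[of k 0 "\<lambda>i j. 0"] nonneg[of k "\<lambda>i j. 0"] by simp

end


section \<open>Complex functionals dominated by a seminorm\<close>

lemma vector_space_real_part:
  assumes "vector_space sc"
  shows "vector_space (\<lambda>t::real. sc (complex_of_real t))"
proof -
  interpret vector_space sc by fact
  show ?thesis by unfold_locales (simp_all add: scale_right_distrib scale_left_distrib)
qed

lemma complexification:
  fixes L :: "'v::ab_group_add \<Rightarrow> real"
  assumes vs: "vector_space sc"
    and add: "\<And>x y. L (x + y) = L x + L y" and scale: "\<And>t x. L (sc (complex_of_real t) x) = t * L x"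
  defines "\<phi> \<equiv> \<lambda>x. Complex (L x) (- L (sc \<i> x))"
  shows "\<phi> (x + y) = \<phi> x + \<phi> y" "\<phi> (sc c x) = c * \<phi> x"
proof -
  interpret vector_space sc by fact
  show "\<phi> (x + y) = \<phi> x + \<phi> y"
    by (simp add: \<phi>_def add scale_right_distrib complex_eq_iff)
  have L_sc: "L (sc c x) = Re c * L x + Im c * L (sc \<i> x)" for c x
  proof -
    have "sc c x = sc (of_real (Re c)) x + sc (of_real (Im c)) (sc \<i> x)"
      by (simp add: scale_left_distrib[symmetric]) (metis complex_eq mult.commute)
    then show ?thesis by (simp only: add scale)
  qed
  have "L (sc \<i> (sc c x)) = - Im c * L x + Re c * L (sc \<i> x)"
    using L_sc[of "\<i> * c" x] unfolding scale_scale by simp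
  then show "\<phi> (sc c x) = c * \<phi> x"
    by (simp add: \<phi>_def L_sc[of c] complex_eq_iff)
qed

text \<open>
  The complexification of a real functional below \<open>N\<close>; its modulus is bounded by \<open>N\<close> since a
  rotation of the argument makes the value real.
\<close>

lemma complex_hahn_banach:
  fixes sc :: "complex \<Rightarrow> 'v::ab_group_add \<Rightarrow> 'v"
  assumes vs: "vector_space sc"
    and tri: "\<And>x y. N (x + y) \<le> N x + N y" and hom: "\<And>c x. N (sc c x) \<le> cmod c * N x"
  obtains \<phi> where "\<And>x y. \<phi> (x + y) = \<phi> x + \<phi> y" "\<And>c x. \<phi> (sc c x) = c * \<phi> x"
    "\<And>x. cmod (\<phi> x) \<le> N x" "Re (\<phi> x0) = N x0"
proof -
  let ?rs = "\<lambda>t::real. sc (complex_of_real t)"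
  have "sublinear ?rs N"
    unfolding sublinear_def
  proof (intro conjI allI impI)
    fix t :: real and x assume "0 < t"
    then show "N (sc (complex_of_real t) x) \<le> t * N x" using hom[of "complex_of_real t" x] by simp
  qed (rule tri)
  from hahn_banach[OF vector_space_real_part[OF vs] this, of x0]
  obtain L where L: "\<And>x y. L (x + y) = L x + L y" "\<And>t x. L (sc (complex_of_real t) x) = t * L x"
    "\<And>x. L x \<le> N x" "L x0 = N x0" by metis
  define \<phi> where "\<phi> = (\<lambda>x. Complex (L x) (- L (sc \<i> x)))"
  have \<phi>: "\<phi> (x + y) = \<phi> x + \<phi> y" "\<phi> (sc c x) = c * \<phi> x" for x y c
    unfolding \<phi>_def by (rule complexification[OF vs L(1,2)])+
  have bound: "cmod (\<phi> x) \<le> N x" for x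
  proof -
    define c where "c = (if \<phi> x = 0 then 1 else cnj (\<phi> x) / of_real (cmod (\<phi> x)))"
    have c: "cmod c = 1" by (simp add: c_def norm_divide)
    have "c * \<phi> x = of_real (cmod (\<phi> x))"
      using complex_norm_square[of "\<phi> x"] by (simp add: c_def power2_eq_square field_simps)
    then have "cmod (\<phi> x) = Re (\<phi> (sc c x))" by (simp add: \<phi>(2))
    also have "\<dots> = L (sc c x)" by (simp add: \<phi>_def)
    also have "\<dots> \<le> N (sc c x)" by (rule L(3))
    also have "\<dots> \<le> N x" using hom[of c x] c by simp
    finally show ?thesis .
  qed
  have "Re (\<phi> x0) = N x0" by (simp add: \<phi>_def L(4))
  then show thesis by (rule that[OF \<phi> bound])
qed

section \<open>Orthonormal systems for semi-inner products\<close>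

context
  fixes sc :: "complex \<Rightarrow> 'v::ab_group_add \<Rightarrow> 'v" and h :: "'v \<Rightarrow> 'v \<Rightarrow> complex"
  assumes vs: "vector_space sc"
    and h_add: "\<And>x y z. h x (y + z) = h x y + h x z" and h_scale: "\<And>x c y. h x (sc c y) = c * h x y"
    and h_herm: "\<And>x y. h y x = cnj (h x y)" and h_pos: "\<And>x. 0 \<le> Re (h x x)"
begin

lemma semi_inner_zero: "h x 0 = 0" "h 0 x = 0"
  using h_add[of x 0 0] h_herm[of 0 x] by auto

lemma semi_inner_minus: "h x (y - z) = h x y - h x z"
  using h_add[of x "y - z" z] by simp

lemma semi_inner_sum: "h x (\<Sum>t\<in>I. f t) = (\<Sum>t\<in>I. h x (f t))"
  by (induction I rule: infinite_finite_induct) (simp_all add: semi_inner_zero h_add)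

definition orthonormal_or_zero :: "nat \<Rightarrow> (nat \<Rightarrow> 'v) \<Rightarrow> bool" where
  "orthonormal_or_zero k b \<longleftrightarrow>
     (\<forall>s<k. \<forall>t<k. s \<noteq> t \<longrightarrow> h (b s) (b t) = 0) \<and> (\<forall>t<k. h (b t) (b t) = 1 \<or> b t = 0)"

text \<open>The residual \<open>r\<close> is orthogonal to the system, so Pythagoras applies.\<close>

lemma bessel_identity:
  fixes v :: 'v
  assumes b: "orthonormal_or_zero k b"
  defines "r \<equiv> v - (\<Sum>t<k. sc (h (b t) v) (b t))"
  shows "Re (h r r) = Re (h v v) - (\<Sum>t<k. (cmod (h (b t) v))\<^sup>2)" "t < k \<Longrightarrow> h (b t) r = 0"
proof -
  define p where "p = (\<Sum>t<k. sc (h (b t) v) (b t))"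
  have orth: "h (b t) r = 0" if t: "t < k" for t
  proof -
    have "h (b t) p = (\<Sum>s<k. h (b s) v * h (b t) (b s))"
      by (simp add: p_def semi_inner_sum h_scale)
    also have "\<dots> = (\<Sum>s<k. if s = t then h (b t) v else 0)"
      using b t by (intro sum.cong refl) (force simp: orthonormal_or_zero_def semi_inner_zero)
    finally show ?thesis using t by (simp add: r_def p_def[symmetric] semi_inner_minus)
  qed
  then show "t < k \<Longrightarrow> h (b t) r = 0" .
  have "h r p = (\<Sum>t<k. h (b t) v * h r (b t))" by (simp add: p_def semi_inner_sum h_scale)
  also have "\<dots> = 0" using orth h_herm by (intro sum.neutral ballI) (metis complex_cnj_zero lessThan_iff mult_zero_right)
  finally have "h r r = h r v" using semi_inner_minus[of r v p] by (simp add: r_def p_def)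
  also have "\<dots> = cnj (h v r)" by (rule h_herm)
  also have "h v r = h v v - (\<Sum>t<k. h (b t) v * h v (b t))"
    by (simp add: r_def semi_inner_minus semi_inner_sum h_scale)
  also have "(\<Sum>t<k. h (b t) v * h v (b t)) = of_real (\<Sum>t<k. (cmod (h (b t) v))\<^sup>2)"
    unfolding of_real_sum by (intro sum.cong refl) (metis complex_norm_square h_herm of_real_power)
  finally show "Re (h r r) = Re (h v v) - (\<Sum>t<k. (cmod (h (b t) v))\<^sup>2)" by simp
qed

text \<open>
  The Gram--Schmidt process for a possibly degenerate form. Vectors whose residual is null
  contribute the zero vector, so that every \<open>v i\<close> satisfies Parseval's identity.
\<close>

lemma gram_schmidt:
  obtains b where "orthonormal_or_zero k b"
    "\<And>i. i < k \<Longrightarrow> Re (h (v i) (v i)) = (\<Sum>t<k. (cmod (h (b t) (v i)))\<^sup>2)"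
proof -
  interpret vector_space sc by (rule vs)
  have "\<exists>b. orthonormal_or_zero k b \<and> (\<forall>i<k. Re (h (v i) (v i)) = (\<Sum>t<k. (cmod (h (b t) (v i)))\<^sup>2))"
  proof (induction k)
    case 0
    then show ?case by (simp add: orthonormal_or_zero_def)
  next
    case (Suc k)
    then obtain b where b: "orthonormal_or_zero k b"
      "\<And>i. i < k \<Longrightarrow> Re (h (v i) (v i)) = (\<Sum>t<k. (cmod (h (b t) (v i)))\<^sup>2)" by blast
    define r where "r = v k - (\<Sum>t<k. sc (h (b t) (v k)) (b t))"
    define n where "n = Re (h r r)"
    have hr: "h r r = of_real n"
      using h_herm[of r r] by (simp add: n_def complex_eq_iff)
    have n: "0 \<le> n" using h_pos n_def by simp
    define u where "u = (if n = 0 then 0 else sc (1 / of_real (sqrt n)) r)"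
    define b' where "b' = b(k := u)"
    have br: "h (b t) r = 0" if "t < k" for t
      unfolding r_def by (rule bessel_identity(2)[OF b(1) that])
    have bu: "h (b t) u = 0" "h u (b t) = 0" if "t < k" for t
      using br[OF that] h_herm[of u "b t"] by (auto simp: u_def h_scale semi_inner_zero)
    have uu: "h u u = 1 \<or> u = 0"
    proof (cases "n = 0")
      case False
      have "h u r = of_real (sqrt n)"
      proof -
        have "h u r = cnj (h r u)" by (rule h_herm)
        also have "\<dots> = of_real (n / sqrt n)" using False by (simp add: u_def h_scale hr)
        also have "n / sqrt n = sqrt n" using n by (rule real_div_sqrt)
        finally show ?thesis .
      qed
      then have "h u u = 1" using False n by (simp add: u_def h_scale)
      then show ?thesis by simp
    qed (simp add: u_def)
    have b': "orthonormal_or_zero (Suc k) b'"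
      using b(1) bu uu by (auto simp: orthonormal_or_zero_def b'_def less_Suc_eq)
    have same: "(\<Sum>t<k. (cmod (h (b' t) w))\<^sup>2) = (\<Sum>t<k. (cmod (h (b t) w))\<^sup>2)" for w
      by (intro sum.cong) (auto simp: b'_def)
    have bessel: "(\<Sum>t<Suc k. (cmod (h (b' t) w))\<^sup>2) \<le> Re (h w w)" for w
      using bessel_identity(1)[OF b', of w] h_pos[of "w - (\<Sum>t<Suc k. sc (h (b' t) w) (b' t))"] by linarith
    have "Re (h (v i) (v i)) = (\<Sum>t<Suc k. (cmod (h (b' t) (v i)))\<^sup>2)" if i: "i < Suc k" for i
    proof (cases "i = k")
      case False
      then show ?thesis using i b(2)[of i] bessel[of "v i"] same[of "v i"] by simp
    next
      case True
      have "h u (v k) = h u r"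
      proof -
        have vk: "v k = r + (\<Sum>t<k. sc (h (b t) (v k)) (b t))" by (simp add: r_def)
        have "h u (v k) = h u (r + (\<Sum>t<k. sc (h (b t) (v k)) (b t)))" by (rule arg_cong[OF vk])
        also have "\<dots> = h u r + (\<Sum>t<k. h (b t) (v k) * h u (b t))"
          by (simp only: h_add h_scale semi_inner_sum)
        finally have "h u (v k) = h u r + (\<Sum>t<k. h (b t) (v k) * h u (b t))" .
        then show ?thesis by (simp add: bu)
      qed
      moreover have "(cmod (h u r))\<^sup>2 = n"
      proof (cases "n = 0")
        case False
        have "h u r = cnj (h r u)" by (rule h_herm)
        also have "\<dots> = of_real (n / sqrt n)" using False by (simp add: u_def h_scale hr)
        also have "n / sqrt n = sqrt n" using n by (rule real_div_sqrt)
        finally show ?thesis using n by simp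
      qed (simp add: u_def semi_inner_zero)
      moreover have "n = Re (h (v k) (v k)) - (\<Sum>t<k. (cmod (h (b t) (v k)))\<^sup>2)"
        unfolding n_def r_def by (rule bessel_identity(1)[OF b(1)])
      ultimately show ?thesis using True same[of "v k"] by (simp add: b'_def)
    qed
    then show ?case using b' by blast
  qed
  then show thesis using that by blast
qed

lemma orthonormal_or_zero_sum_le:
  assumes b: "orthonormal_or_zero k b"
  shows "Re (h (\<Sum>t<k. sc (\<eta> t) (b t)) (\<Sum>t<k. sc (\<eta> t) (b t))) \<le> (\<Sum>t<k. (cmod (\<eta> t))\<^sup>2)"
proof -
  let ?p = "\<Sum>t<k. sc (\<eta> t) (b t)"
  have bp: "h (b t) ?p = \<eta> t * h (b t) (b t)" if t: "t < k" for t
  proof -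
    have "h (b t) ?p = (\<Sum>s<k. \<eta> s * h (b t) (b s))" by (simp add: semi_inner_sum h_scale)
    also have "\<dots> = (\<Sum>s<k. if s = t then \<eta> t * h (b t) (b t) else 0)"
      using b t by (intro sum.cong refl) (force simp: orthonormal_or_zero_def)
    finally show ?thesis using t by simp
  qed
  have "h ?p ?p = (\<Sum>t<k. \<eta> t * h ?p (b t))" by (subst semi_inner_sum) (simp add: h_scale)
  also have "\<dots> = (\<Sum>t<k. of_real ((cmod (\<eta> t))\<^sup>2) * cnj (h (b t) (b t)))"
  proof (intro sum.cong refl)
    fix t assume "t \<in> {..<k}"
    then have "h ?p (b t) = cnj (\<eta> t * h (b t) (b t))" using bp h_herm[of ?p "b t"] by simp
    then show "\<eta> t * h ?p (b t) = of_real ((cmod (\<eta> t))\<^sup>2) * cnj (h (b t) (b t))"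
      using complex_norm_square[of "\<eta> t"] by simp
  qed
  finally have "Re (h ?p ?p) = (\<Sum>t<k. (cmod (\<eta> t))\<^sup>2 * Re (h (b t) (b t)))" by simp
  also have "\<dots> \<le> (\<Sum>t<k. (cmod (\<eta> t))\<^sup>2)"
    using b by (intro sum_mono) (auto simp: orthonormal_or_zero_def semi_inner_zero)
  finally show ?thesis .
qed

end


section \<open>Ruan's theorem: norming complete contractions into matrix algebras\<close>

lemma sum_lessThan_add:
  fixes f :: "nat \<Rightarrow> 'a::comm_monoid_add"
  shows "sum f {..<m + l} = sum f {..<m} + (\<Sum>a<l. f (m + a))"
  by (induction l) (simp_all add: add.assoc)

lemma vector_space_fun: "vector_space (\<lambda>(c::complex) (x :: 'a \<Rightarrow> complex) i. c * x i)"
  by unfold_locales (auto simp: fun_eq_iff algebra_simps)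

lemma vector_space_fun2: "vector_space (\<lambda>(c::complex) (x :: 'a \<Rightarrow> 'b \<Rightarrow> complex) i j. c * x i j)"
  by unfold_locales (auto simp: fun_eq_iff algebra_simps)

definition rank_one :: "(nat \<Rightarrow> complex) \<Rightarrow> (nat \<Rightarrow> complex) \<Rightarrow> nat \<Rightarrow> nat \<Rightarrow> complex" where
  "rank_one c d = (\<lambda>i j. cnj (c i) * d j)"

definition quad :: "nat \<Rightarrow> (nat \<Rightarrow> nat \<Rightarrow> complex) \<Rightarrow> (nat \<Rightarrow> complex) \<Rightarrow> real" where
  "quad k P c = Re (\<Sum>i<k. \<Sum>j<k. cnj (c i) * P i j * c j)"

lemma quad_add: "quad k (P + Q) c = quad k P c + quad k Q c"
  by (simp add: quad_def sum.distrib algebra_simps)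

lemma quad_minus: "quad k (- P) c = - quad k P c"
  by (simp add: quad_def sum_negf)

lemma quad_scale: "quad k (\<lambda>i j. of_real t * P i j) c = t * quad k P c"
proof -
  have "(\<Sum>i<k. \<Sum>j<k. cnj (c i) * (of_real t * P i j) * c j) = of_real t * (\<Sum>i<k. \<Sum>j<k. cnj (c i) * P i j * c j)"
    unfolding sum_distrib_left by (intro sum.cong refl) simp
  then show ?thesis unfolding quad_def by (simp only: Re_complex_of_real times_complex.sel) simp
qed

lemma quad_zero: "quad k 0 c = 0"
  by (simp add: quad_def)

lemma quad_sum: "quad k (\<Sum>a\<in>I. P a) c = (\<Sum>a\<in>I. quad k (P a) c)"
  by (induction I rule: infinite_finite_induct) (simp_all add: quad_zero[unfolded zero_fun_def] quad_add[unfolded plus_fun_def])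

lemma quad_rank_one: "quad k (rank_one d d) c = (cmod (\<Sum>i<k. d i * c i))\<^sup>2"
proof -
  have "(\<Sum>i<k. \<Sum>j<k. cnj (c i) * rank_one d d i j * c j) = cnj (\<Sum>i<k. d i * c i) * (\<Sum>i<k. d i * c i)"
    unfolding cnj_sum sum_product rank_one_def by (intro sum.cong refl) simp
  also have "\<dots> = of_real ((cmod (\<Sum>i<k. d i * c i))\<^sup>2)"
    by (metis complex_norm_square mult.commute of_real_power)
  finally show ?thesis unfolding quad_def by simp
qed

lemma quad_adjoint: "quad k (\<lambda>i j. cnj (P j i)) c = quad k P c"
proof -
  have "(\<Sum>i<k. \<Sum>j<k. cnj (c i) * cnj (P j i) * c j) = cnj (\<Sum>i<k. \<Sum>j<k. cnj (c i) * P i j * c j)"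
    unfolding cnj_sum by (subst sum.swap, intro sum.cong refl) simp
  then show ?thesis by (simp only: quad_def cnj.sel)
qed

lemma quad_bound: "\<bar>quad k P c\<bar> \<le> (\<Sum>i<k. \<Sum>j<k. cmod (P i j)) * (\<Sum>i<k. (cmod (c i))\<^sup>2)"
proof -
  let ?n = "\<Sum>i<k. (cmod (c i))\<^sup>2"
  have le: "cmod (c i) * cmod (c j) \<le> ?n" if "i < k" "j < k" for i j
  proof -
    have "(cmod (c i))\<^sup>2 \<le> ?n" "(cmod (c j))\<^sup>2 \<le> ?n"
      using that by (auto intro!: member_le_sum)
    moreover have "2 * (cmod (c i) * cmod (c j)) \<le> (cmod (c i))\<^sup>2 + (cmod (c j))\<^sup>2"
      using sum_squares_bound[of "cmod (c i)" "cmod (c j)"] by simp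
    ultimately show ?thesis by simp
  qed
  have "\<bar>quad k P c\<bar> \<le> cmod (\<Sum>i<k. \<Sum>j<k. cnj (c i) * P i j * c j)"
    unfolding quad_def by (rule abs_Re_le_cmod)
  also have "\<dots> \<le> (\<Sum>i<k. \<Sum>j<k. cmod (P i j) * ?n)"
  proof (intro sum_norm_le)
    fix i j assume ij: "i \<in> {..<k}" "j \<in> {..<k}"
    have "cmod (cnj (c i) * P i j * c j) = cmod (P i j) * (cmod (c i) * cmod (c j))"
      by (simp add: norm_mult)
    also have "\<dots> \<le> cmod (P i j) * ?n" using ij by (intro mult_left_mono le) auto
    finally show "cmod (cnj (c i) * P i j * c j) \<le> cmod (P i j) * ?n" .
  qed
  finally show ?thesis by (simp only: sum_distrib_right)
qed

text \<open>
  A positive functional on \<open>M_k\<close> of norm at most \<open>1/2\<close> makes \<open>\<complex>\<^sup>k\<close> a semi-inner product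
  space; a Gram--Schmidt basis of it represents the standard basis up to null vectors. The
  coefficients \<open>\<eta>\<close> form a contractive vector because the squared lengths of the standard basis
  vectors add up to twice the value at the identity.
\<close>

lemma state_basis:
  fixes \<tau> :: "(nat \<Rightarrow> nat \<Rightarrow> complex) \<Rightarrow> real"
  assumes add: "\<And>P Q. \<tau> (P + Q) = \<tau> P + \<tau> Q" and scale: "\<And>t P. \<tau> (\<lambda>i j. of_real t * P i j) = t * \<tau> P"
    and bound: "\<And>P s. (\<And>c. quad k P c \<le> s * (\<Sum>i<k. (cmod (c i))\<^sup>2)) \<Longrightarrow> \<tau> P \<le> s / 2"
  obtains b \<eta> :: "nat \<Rightarrow> nat \<Rightarrow> complex" where
    "\<And>\<zeta>. 2 * \<tau> (rank_one (\<lambda>i. \<Sum>t<k. \<zeta> t * b t i) (\<lambda>i. \<Sum>t<k. \<zeta> t * b t i)) \<le> (\<Sum>t<k. (cmod (\<zeta> t))\<^sup>2)"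
    "\<And>i. i < k \<Longrightarrow> \<tau> (rank_one (\<lambda>j. (if j = i then 1 else 0) - (\<Sum>t<k. \<eta> i t * b t j))
                               (\<lambda>j. (if j = i then 1 else 0) - (\<Sum>t<k. \<eta> i t * b t j))) = 0"
    "(\<Sum>i<k. \<Sum>t<k. (cmod (\<eta> i t))\<^sup>2) \<le> 1"
proof -
  define T where "T = (\<lambda>P. Complex (\<tau> P) (- \<tau> (\<lambda>i j. \<i> * P i j)))"
  define h where "h = (\<lambda>c d. 2 * T (rank_one c d))"
  let ?sc = "\<lambda>(c::complex) (x :: nat \<Rightarrow> complex) i. c * x i"
  have T: "T (P + Q) = T P + T Q" "T (\<lambda>i j. z * P i j) = z * T P" for P Q z
    unfolding T_def by (rule complexification[OF vector_space_fun2, of \<tau>], rule add, rule scale)+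
  have neg: "\<tau> (- P) = - \<tau> P" for P
    using add[of P "- P"] scale[of 0 0] by (simp add: fun_eq_iff zero_fun_def)
  have quad_eq: "\<tau> P = \<tau> Q" if "\<And>c. quad k P c = quad k Q c" for P Q
  proof -
    have q: "quad k (P + - Q) c = 0" "quad k (Q + - P) c = 0" for c
      unfolding quad_add quad_minus that by simp_all
    have "\<tau> (P + - Q) \<le> 0 / 2" by (rule bound) (simp only: q mult_zero_left order_refl)
    moreover have "\<tau> (Q + - P) \<le> 0 / 2" by (rule bound) (simp only: q mult_zero_left order_refl)
    ultimately show ?thesis by (simp only: add neg)
  qed
  have h_add: "h x (y + z) = h x y + h x z" for x y z
  proof -
    have "rank_one x (y + z) = rank_one x y + rank_one x z"
      by (simp add: rank_one_def fun_eq_iff algebra_simps)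
    then show ?thesis by (simp add: h_def T(1))
  qed
  have h_scale: "h x (?sc c y) = c * h x y" for x y c
  proof -
    have "rank_one x (?sc c y) = (\<lambda>i j. c * rank_one x y i j)"
      by (simp add: rank_one_def fun_eq_iff)
    then show ?thesis by (simp add: h_def T(2))
  qed
  have h_herm: "h y x = cnj (h x y)" for x y
  proof -
    have 1: "\<tau> (rank_one y x) = \<tau> (rank_one x y)"
    proof (rule quad_eq)
      fix c
      have "rank_one y x = (\<lambda>i j. cnj (rank_one x y j i))" by (simp add: rank_one_def fun_eq_iff)
      then show "quad k (rank_one y x) c = quad k (rank_one x y) c" by (simp only: quad_adjoint)
    qed
    have "\<tau> (\<lambda>i j. \<i> * rank_one y x i j) = \<tau> (- (\<lambda>i j. \<i> * rank_one x y i j))"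
    proof (rule quad_eq)
      fix c
      have "(\<lambda>i j. \<i> * rank_one y x i j) = (\<lambda>i j. cnj ((- (\<lambda>i j. \<i> * rank_one x y i j)) j i))"
        by (simp add: rank_one_def fun_eq_iff)
      then show "quad k (\<lambda>i j. \<i> * rank_one y x i j) c = quad k (- (\<lambda>i j. \<i> * rank_one x y i j)) c"
        by (simp only: quad_adjoint)
    qed
    then show ?thesis by (simp add: h_def T_def 1 neg complex_eq_iff)
  qed
  have h_Re: "Re (h x y) = 2 * \<tau> (rank_one x y)" for x y by (simp add: h_def T_def)
  have h_pos: "0 \<le> Re (h x x)" for x
  proof -
    have "\<tau> (- rank_one x x) \<le> 0 / 2" by (rule bound) (simp add: quad_minus quad_rank_one)
    then show ?thesis by (simp add: h_Re neg)
  qed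
  note hs = vector_space_fun h_add h_scale h_herm h_pos
  let ?e = "\<lambda>i j. if j = i then (1::complex) else 0"
  obtain b where b: "orthonormal_or_zero h k b"
    "\<And>i. i < k \<Longrightarrow> Re (h (?e i) (?e i)) = (\<Sum>t<k. (cmod (h (b t) (?e i)))\<^sup>2)"
    using gram_schmidt[where sc = ?sc and h = h, OF hs, of k ?e] by blast
  define \<eta> where "\<eta> = (\<lambda>i t. h (b t) (?e i))"
  have sum_apply: "(\<Sum>t<k. ?sc (\<zeta> t) (b t)) = (\<lambda>i. \<Sum>t<k. \<zeta> t * b t i)" for \<zeta>
    by (rule ext) (induction k, simp_all)
  show thesis
  proof (rule that[of b \<eta>])
    show "2 * \<tau> (rank_one (\<lambda>i. \<Sum>t<k. \<zeta> t * b t i) (\<lambda>i. \<Sum>t<k. \<zeta> t * b t i)) \<le> (\<Sum>t<k. (cmod (\<zeta> t))\<^sup>2)" for \<zeta>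
      using orthonormal_or_zero_sum_le[where sc = ?sc and h = h, OF hs b(1), of \<zeta>] by (simp only: sum_apply h_Re)
  next
    fix i assume i: "i < k"
    have "?e i - (\<Sum>t<k. ?sc (h (b t) (?e i)) (b t)) = (\<lambda>j. ?e i j - (\<Sum>t<k. \<eta> i t * b t j))"
      unfolding sum_apply \<eta>_def by (simp add: fun_eq_iff)
    then have "Re (h (\<lambda>j. ?e i j - (\<Sum>t<k. \<eta> i t * b t j)) (\<lambda>j. ?e i j - (\<Sum>t<k. \<eta> i t * b t j))) = 0"
      using bessel_identity(1)[where sc = ?sc and h = h, OF hs b(1), of "?e i"] b(2)[OF i] by simp
    then show "\<tau> (rank_one (\<lambda>j. ?e i j - (\<Sum>t<k. \<eta> i t * b t j)) (\<lambda>j. ?e i j - (\<Sum>t<k. \<eta> i t * b t j))) = 0"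
      by (simp add: h_Re)
  next
    have \<tau>_sum: "\<tau> (\<Sum>i\<in>I. P i) = (\<Sum>i\<in>I. \<tau> (P i))" for I :: "nat set" and P
      using scale[of 0 0] by (induction I rule: infinite_finite_induct) (simp_all add: add zero_fun_def)
    have "(\<Sum>i<k. \<Sum>t<k. (cmod (\<eta> i t))\<^sup>2) = (\<Sum>i<k. 2 * \<tau> (rank_one (?e i) (?e i)))"
      by (intro sum.cong refl) (simp add: \<eta>_def b(2)[symmetric] h_Re)
    also have "\<dots> = 2 * \<tau> (\<Sum>i<k. rank_one (?e i) (?e i))" by (simp add: \<tau>_sum sum_distrib_left)
    also have "\<tau> (\<Sum>i<k. rank_one (?e i) (?e i)) \<le> 1 / 2"
    proof (rule bound)
      fix c
      have "quad k (rank_one (?e i) (?e i)) c = (cmod (c i))\<^sup>2" if "i < k" for i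
      proof -
        have "(\<Sum>j<k. ?e i j * c j) = (\<Sum>j<k. if j = i then c j else 0)" by (intro sum.cong) auto
        then show ?thesis using that by (simp add: quad_rank_one)
      qed
      then show "quad k (\<Sum>i<k. rank_one (?e i) (?e i)) c \<le> 1 * (\<Sum>i<k. (cmod (c i))\<^sup>2)"
        by (simp add: quad_sum)
    qed
    finally show "(\<Sum>i<k. \<Sum>t<k. (cmod (\<eta> i t))\<^sup>2) \<le> 1" by simp
  qed
qed

text \<open>
  The inequality \<open>A\<^sup>* A + P \<le> s\<close> between quadratic forms on \<open>\<complex>\<^sup>k\<close>, in which \<open>P\<close> enters through
  its Hermitian part.
\<close>

definition dominated ::
    "nat \<Rightarrow> nat \<Rightarrow> (nat \<Rightarrow> nat \<Rightarrow> complex) \<Rightarrow> (nat \<Rightarrow> nat \<Rightarrow> complex) \<Rightarrow> real \<Rightarrow> bool" where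
  "dominated k m A P s \<longleftrightarrow>
     (\<forall>c. (\<Sum>a<m. (cmod (\<Sum>i<k. A a i * c i))\<^sup>2) + quad k P c \<le> s * (\<Sum>i<k. (cmod (c i))\<^sup>2))"

lemma dominated_lower:
  assumes "0 < k" "dominated k m A P s"
  shows "Re (P 0 0) \<le> s"
proof -
  let ?c = "\<lambda>i. if i = 0 then (1::complex) else 0"
  have "(\<Sum>i<k. \<Sum>j<k. cnj (?c i) * P i j * ?c j) = (\<Sum>i<k. \<Sum>j<k. if j = 0 then if i = 0 then P 0 0 else 0 else 0)"
    by (intro sum.cong) auto
  also have "\<dots> = P 0 0" using assms(1) by simp
  finally have 1: "quad k P ?c = Re (P 0 0)" by (simp only: quad_def)
  have "(\<Sum>i<k. (cmod (?c i))\<^sup>2) = (\<Sum>i<k. if i = 0 then 1 else 0)" by (intro sum.cong) auto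
  then have 2: "(\<Sum>i<k. (cmod (?c i))\<^sup>2) = 1" using assms(1) by simp
  have 3: "0 \<le> (\<Sum>a<m. (cmod (\<Sum>i<k. A a i * ?c i))\<^sup>2)" by (simp add: sum_nonneg)
  have "(\<Sum>a<m. (cmod (\<Sum>i<k. A a i * ?c i))\<^sup>2) + quad k P ?c \<le> s * (\<Sum>i<k. (cmod (?c i))\<^sup>2)"
    using assms(2) unfolding dominated_def by (rule spec)
  then show ?thesis using 3 unfolding 1 2 by linarith
qed

lemma dominated_sum:
  assumes "dominated k m A P s" "dominated k l B Q t"
  shows "dominated k (m + l) (\<lambda>a. if a < m then A a else B (a - m)) (P + Q) (s + t)"
  unfolding dominated_def
proof
  fix c
  have "(\<Sum>a<m + l. (cmod (\<Sum>i<k. (if a < m then A a else B (a - m)) i * c i))\<^sup>2)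
    = (\<Sum>a<m. (cmod (\<Sum>i<k. A a i * c i))\<^sup>2) + (\<Sum>a<l. (cmod (\<Sum>i<k. B a i * c i))\<^sup>2)"
    unfolding sum_lessThan_add by simp
  then show "(\<Sum>a<m + l. (cmod (\<Sum>i<k. (if a < m then A a else B (a - m)) i * c i))\<^sup>2) + quad k (P + Q) c
      \<le> (s + t) * (\<Sum>i<k. (cmod (c i))\<^sup>2)"
    using assms[unfolded dominated_def, rule_format, of c] by (simp add: quad_add distrib_right)
qed

lemma dominated_scale:
  assumes "dominated k m A P s" "0 < t"
  shows "dominated k m (\<lambda>a i. of_real (sqrt t) * A a i) (\<lambda>i j. of_real t * P i j) (t * s)"
  unfolding dominated_def
proof
  fix c
  have "(cmod (\<Sum>i<k. of_real (sqrt t) * A a i * c i))\<^sup>2 = t * (cmod (\<Sum>i<k. A a i * c i))\<^sup>2" for a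
    unfolding mult.assoc sum_distrib_left[symmetric] norm_mult power_mult_distrib using assms(2) by simp
  then have "(\<Sum>a<m. (cmod (\<Sum>i<k. of_real (sqrt t) * A a i * c i))\<^sup>2) + quad k (\<lambda>i j. of_real t * P i j) c
    = t * ((\<Sum>a<m. (cmod (\<Sum>i<k. A a i * c i))\<^sup>2) + quad k P c)"
    by (simp only: quad_scale sum_distrib_left distrib_left)
  also have "\<dots> \<le> t * (s * (\<Sum>i<k. (cmod (c i))\<^sup>2))"
    using assms by (intro mult_left_mono) (auto simp: dominated_def)
  finally show "(\<Sum>a<m. (cmod (\<Sum>i<k. of_real (sqrt t) * A a i * c i))\<^sup>2) + quad k (\<lambda>i j. of_real t * P i j) c
     \<le> t * s * (\<Sum>i<k. (cmod (c i))\<^sup>2)" by (simp only: mult.assoc)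
qed

lemma dominated_opnorm:
  assumes "dominated k m A 0 s" "0 \<le> s"
  shows "opnorm {..<m} {..<k} A \<le> sqrt s"
proof (rule opnorm_le)
  fix x :: "nat \<Rightarrow> complex"
  have "(L2_set (\<lambda>a. cmod (\<Sum>i<k. A a i * x i)) {..<m})\<^sup>2 \<le> (sqrt s * L2_set (\<lambda>i. cmod (x i)) {..<k})\<^sup>2"
    unfolding power_mult_distrib L2_set_power2
    using assms(1)[unfolded dominated_def, rule_format, of x] assms(2) by (simp add: quad_zero)
  then show "L2_set (\<lambda>a. cmod (\<Sum>i<k. A a i * x i)) {..<m} \<le> sqrt s * L2_set (\<lambda>i. cmod (x i)) {..<k}"
    by (rule power2_le_imp_le) (simp add: assms(2))
qed (simp add: assms(2))

lemma dominated_diagonal: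
  assumes "0 \<le> t"
  shows "dominated k k (\<lambda>a i. if i = a then of_real (sqrt t) else 0) P (t + (\<Sum>i<k. \<Sum>j<k. cmod (P i j)))"
  unfolding dominated_def
proof
  fix c :: "nat \<Rightarrow> complex"
  have "(\<Sum>a<k. (cmod (\<Sum>i<k. (if i = a then of_real (sqrt t) else 0) * c i))\<^sup>2) = (\<Sum>a<k. t * (cmod (c a))\<^sup>2)"
  proof (intro sum.cong refl)
    fix a assume "a \<in> {..<k}"
    moreover have "(\<Sum>i<k. (if i = a then of_real (sqrt t) else 0) * c i) = (\<Sum>i<k. if i = a then of_real (sqrt t) * c i else 0)"
      by (intro sum.cong) auto
    ultimately show "(cmod (\<Sum>i<k. (if i = a then of_real (sqrt t) else 0) * c i))\<^sup>2 = t * (cmod (c a))\<^sup>2"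
      using assms by (simp add: norm_mult power_mult_distrib)
  qed
  then show "(\<Sum>a<k. (cmod (\<Sum>i<k. (if i = a then of_real (sqrt t) else 0) * c i))\<^sup>2) + quad k P c
     \<le> (t + (\<Sum>i<k. \<Sum>j<k. cmod (P i j))) * (\<Sum>i<k. (cmod (c i))\<^sup>2)"
    using quad_bound[of k P c] by (simp add: distrib_right sum_distrib_left[symmetric])
qed

text \<open>By normalizing \<open>\<eta>\<close> and \<open>\<xi>\<close>, the arithmetic mean on the right turns into a geometric mean.\<close>

lemma opnorm_le_quadratic:
  assumes fin: "finite I" "finite J" and C: "0 \<le> C"
    and *: "\<And>\<eta> \<xi>. cmod (\<Sum>i\<in>I. \<Sum>j\<in>J. cnj (\<eta> i) * A i j * \<xi> j)
      \<le> C / 2 * ((\<Sum>i\<in>I. (cmod (\<eta> i))\<^sup>2) + (\<Sum>j\<in>J. (cmod (\<xi> j))\<^sup>2))"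
  shows "opnorm I J A \<le> C"
proof (rule opnorm_le_bilinear[OF fin C])
  fix \<eta> \<xi>
  define a where "a = L2_set (\<lambda>i. cmod (\<eta> i)) I"
  define b where "b = L2_set (\<lambda>j. cmod (\<xi> j)) J"
  have ab: "0 \<le> a" "0 \<le> b" by (auto simp: a_def b_def)
  let ?S = "\<Sum>i\<in>I. \<Sum>j\<in>J. cnj (\<eta> i) * A i j * \<xi> j"
  have "cmod ?S \<le> C * a * b"
  proof (cases "a = 0 \<or> b = 0")
    case True
    then have "(\<forall>i\<in>I. \<eta> i = 0) \<or> (\<forall>j\<in>J. \<xi> j = 0)"
      using fin by (auto simp: a_def b_def L2_set_eq_0_iff)
    then have "?S = 0" by (auto intro!: sum.neutral)
    then show ?thesis using ab C by simp
  next
    case False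
    then have pos: "0 < a" "0 < b" using ab by auto
    let ?\<eta> = "\<lambda>i. \<eta> i / of_real a" let ?\<xi> = "\<lambda>j. \<xi> j / of_real b"
    have "(\<Sum>i\<in>I. (cmod (?\<eta> i))\<^sup>2) = 1"
      using pos L2_set_power2[of "\<lambda>i. cmod (\<eta> i)" I] zero_less_power[OF pos(1), of 2]
      by (simp add: norm_divide power_divide sum_divide_distrib[symmetric] a_def[symmetric])
    moreover have "(\<Sum>j\<in>J. (cmod (?\<xi> j))\<^sup>2) = 1"
      using pos L2_set_power2[of "\<lambda>i. cmod (\<xi> i)" J] zero_less_power[OF pos(2), of 2]
      by (simp add: norm_divide power_divide sum_divide_distrib[symmetric] b_def[symmetric])
    moreover have "?S = of_real (a * b) * (\<Sum>i\<in>I. \<Sum>j\<in>J. cnj (?\<eta> i) * A i j * ?\<xi> j)"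
      unfolding sum_distrib_left using pos by (intro sum.cong refl) simp
    then have "cmod ?S = (a * b) * cmod (\<Sum>i\<in>I. \<Sum>j\<in>J. cnj (?\<eta> i) * A i j * ?\<xi> j)"
      using pos by (simp add: norm_mult)
    ultimately have "cmod ?S \<le> (a * b) * (C / 2 * (1 + 1))"
      using *[of ?\<eta> ?\<xi>] pos by (simp del: times_divide_eq_left times_divide_eq_right)
    then show ?thesis by (simp add: mult_ac)
  qed
  then show "cmod ?S \<le> C * L2_set (\<lambda>i. cmod (\<eta> i)) I * L2_set (\<lambda>j. cmod (\<xi> j)) J"
    by (simp only: a_def b_def)
qed


context ruan_seminorm
begin

text \<open>\<open>x = A\<^sup>* y B\<close> on the indices below \<open>k\<close>.\<close>

definition factorizes ::
    "nat \<Rightarrow> nat \<Rightarrow> (nat \<Rightarrow> nat \<Rightarrow> complex) \<Rightarrow> (nat \<Rightarrow> nat \<Rightarrow> 'e) \<Rightarrow> (nat \<Rightarrow> nat \<Rightarrow> complex) \<Rightarrow>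
      (nat \<Rightarrow> nat \<Rightarrow> 'e) \<Rightarrow> bool" where
  "factorizes k m A y B x \<longleftrightarrow>
     (\<forall>i<k. \<forall>j<k. x i j = (\<Sum>a<m. \<Sum>b<m. smult E (cnj (A a i) * B b j) (y a b)))"

lemma factorizes_sum:
  assumes "factorizes k m A y B x" "factorizes k l A' y' B' x'"
  shows "factorizes k (m + l) (\<lambda>a. if a < m then A a else A' (a - m))
    (\<lambda>i j. if i < m \<and> j < m then y i j else if m \<le> i \<and> m \<le> j then y' (i - m) (j - m) else 0)
    (\<lambda>b. if b < m then B b else B' (b - m)) (x + x')"
  using assms unfolding factorizes_def sum_lessThan_add by simp

lemma factorizes_scale:
  assumes "factorizes k m A y B x" "0 < t"
  shows "factorizes k m (\<lambda>a i. of_real (sqrt t) * A a i) y (\<lambda>b j. of_real (sqrt t) * B b j)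
    (\<lambda>i j. smult E (of_real t) (x i j))"
  unfolding factorizes_def
proof (intro allI impI)
  fix i j assume "i < k" "j < k"
  have eq: "cnj (of_real (sqrt t) * A a i) * (of_real (sqrt t) * B b j) = of_real t * (cnj (A a i) * B b j)" for a b
  proof -
    have "complex_of_real (sqrt t) * of_real (sqrt t) = of_real t"
      using assms(2) by (simp add: of_real_mult[symmetric] del: of_real_mult)
    then show ?thesis by simp
  qed
  show "smult E (of_real t) (x i j)
     = (\<Sum>a<m. \<Sum>b<m. smult E (cnj (of_real (sqrt t) * A a i) * (of_real (sqrt t) * B b j)) (y a b))"
    using assms(1) \<open>i < k\<close> \<open>j < k\<close> unfolding eq factorizes_def
    by (simp add: scale_sum_right)
qed

lemma factorizes_norm_le:
  assumes "factorizes k m A y B x" "mnorm E m y \<le> 1"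
    "opnorm {..<m} {..<k} A \<le> a" "opnorm {..<m} {..<k} B \<le> b" "0 \<le> a" "0 \<le> b"
  shows "mnorm E k x \<le> a * b"
proof -
  have "mnorm E k x = mnorm E k (\<lambda>i j. \<Sum>a<m. \<Sum>b<m. smult E (cnj (A a i) * B b j) (y a b))"
    by (rule cong) (use assms(1) in \<open>simp add: factorizes_def\<close>)
  also have "\<dots> \<le> opnorm {..<k} {..<m} (\<lambda>i a. cnj (A a i)) * mnorm E m y * opnorm {..<m} {..<k} B"
    by (rule mult)
  also have "\<dots> \<le> a * 1 * b"
  proof (intro mult_mono)
    show "opnorm {..<k} {..<m} (\<lambda>i a. cnj (A a i)) \<le> a"
      by (rule order_trans[OF opnorm_adjoint assms(3)]) auto
  qed (use assms nonneg in \<open>auto intro!: opnorm_nonneg\<close>)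
  finally show ?thesis by simp
qed

text \<open>
  A sublinear functional on \<open>M_k(E) \<times> M_k \<times> M_k\<close>. A linear functional below it is non-positive
  at \<open>(A\<^sup>* y B, - A\<^sup>* A, - B\<^sup>* B)\<close> for \<open>y\<close> in the unit ball: its two scalar components are then
  positive and dominate the first one in the way that the construction below requires.
\<close>

definition cost :: "nat \<Rightarrow> (nat \<Rightarrow> nat \<Rightarrow> 'e) \<Rightarrow> (nat \<Rightarrow> nat \<Rightarrow> complex) \<Rightarrow> (nat \<Rightarrow> nat \<Rightarrow> complex) \<Rightarrow> real" where
  "cost k x P Q = Inf {(s + t) / 2 | s t. \<exists>m A y B. factorizes k m A y B x \<and> mnorm E m y \<le> 1
     \<and> dominated k m A P s \<and> dominated k m B Q t}"

lemma cost_le: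
  assumes "0 < k" "factorizes k m A y B x" "mnorm E m y \<le> 1" "dominated k m A P s" "dominated k m B Q t"
  shows "cost k x P Q \<le> (s + t) / 2"
  unfolding cost_def
proof (rule cInf_lower)
  show "bdd_below {(s + t) / 2 | s t. \<exists>m A y B. factorizes k m A y B x \<and> mnorm E m y \<le> 1
     \<and> dominated k m A P s \<and> dominated k m B Q t}"
  proof (rule bdd_belowI)
    fix r assume "r \<in> {(s + t) / 2 | s t. \<exists>m A y B. factorizes k m A y B x \<and> mnorm E m y \<le> 1
     \<and> dominated k m A P s \<and> dominated k m B Q t}"
    then obtain s t m A B where "r = (s + t) / 2" "dominated k m A P s" "dominated k m B Q t" by blast
    then show "(Re (P 0 0) + Re (Q 0 0)) / 2 \<le> r"
      using dominated_lower[OF assms(1), of m A P s] dominated_lower[OF assms(1), of m B Q t] by simp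
  qed
qed (use assms in blast)

lemma cost_greatest:
  assumes "\<And>s t m A y B. factorizes k m A y B x \<Longrightarrow> mnorm E m y \<le> 1 \<Longrightarrow> dominated k m A P s
    \<Longrightarrow> dominated k m B Q t \<Longrightarrow> r \<le> (s + t) / 2"
  shows "r \<le> cost k x P Q"
  unfolding cost_def
proof (rule cInf_greatest)
  define l where "l = mnorm E k x + 1"
  have l: "0 < l" using nonneg[of k x] by (simp add: l_def)
  let ?A = "\<lambda>a i. if i = a then complex_of_real (sqrt l) else 0"
  let ?y = "\<lambda>i j. smult E (of_real (1 / l)) (x i j)"
  have "factorizes k k ?A ?y ?A x"
    unfolding factorizes_def
  proof (intro allI impI)
    fix i j assume ij: "i < k" "j < k"
    have "(\<Sum>a<k. \<Sum>b<k. smult E (cnj (?A a i) * ?A b j) (?y a b))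
      = (\<Sum>a<k. \<Sum>b<k. if b = j then if a = i then x i j else 0 else 0)"
      using l by (intro sum.cong refl) (auto simp: of_real_mult[symmetric] simp del: of_real_mult of_real_divide)
    then show "x i j = (\<Sum>a<k. \<Sum>b<k. smult E (cnj (?A a i) * ?A b j) (?y a b))" using ij by simp
  qed
  moreover have "mnorm E k ?y \<le> 1"
  proof -
    have "mnorm E k ?y \<le> cmod (of_real (1 / l)) * mnorm E k x" by (rule mnorm_smult)
    also have "\<dots> \<le> 1" using l by (simp add: norm_divide) (simp add: l_def)
    finally show ?thesis .
  qed
  ultimately show "{(s + t) / 2 | s t. \<exists>m A y B. factorizes k m A y B x \<and> mnorm E m y \<le> 1
     \<and> dominated k m A P s \<and> dominated k m B Q t} \<noteq> {}"
    using dominated_diagonal[of l k P] dominated_diagonal[of l k Q] l less_imp_le[OF l] by blast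
next
  fix q assume "q \<in> {(s + t) / 2 | s t. \<exists>m A y B. factorizes k m A y B x \<and> mnorm E m y \<le> 1
     \<and> dominated k m A P s \<and> dominated k m B Q t}"
  then show "r \<le> q" using assms by blast
qed

text \<open>
  Two factorizations are combined by stacking: \<open>x + x' = [A; A']\<^sup>* (y \<oplus> y') [B; B']\<close>, and \<open>y \<oplus> y'\<close>
  stays in the unit ball by Ruan's axiom on direct sums. This is where the axiom enters the proof
  of Ruan's theorem.
\<close>

lemma cost_add_le:
  assumes k: "0 < k"
  shows "cost k (x + x') (P + P') (Q + Q') \<le> cost k x P Q + cost k x' P' Q'"
proof -
  have *: "cost k (x + x') (P + P') (Q + Q') \<le> (s + t) / 2 + (s' + t') / 2"
    if "factorizes k m A y B x" "mnorm E m y \<le> 1" "dominated k m A P s" "dominated k m B Q t"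
      "factorizes k m' A' y' B' x'" "mnorm E m' y' \<le> 1" "dominated k m' A' P' s'" "dominated k m' B' Q' t'"
    for m A y B s t m' A' y' B' s' t'
  proof -
    have "cost k (x + x') (P + P') (Q + Q') \<le> ((s + s') + (t + t')) / 2"
    proof (rule cost_le[OF k factorizes_sum[OF that(1,5)] _ dominated_sum[OF that(3,7)] dominated_sum[OF that(4,8)]])
      show "mnorm E (m + m') (\<lambda>i j. if i < m \<and> j < m then y i j
          else if m \<le> i \<and> m \<le> j then y' (i - m) (j - m) else 0) \<le> 1"
        by (rule order_trans[OF direct_sum]) (use that in simp)
    qed
    then show ?thesis by (simp add: field_simps)
  qed
  have 1: "cost k (x + x') (P + P') (Q + Q') - (s' + t') / 2 \<le> cost k x P Q"
    if "factorizes k m' A' y' B' x'" "mnorm E m' y' \<le> 1" "dominated k m' A' P' s'" "dominated k m' B' Q' t'"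
    for m' A' y' B' s' t'
  proof (rule cost_greatest)
    fix s t m A y B
    assume "factorizes k m A y B x" "mnorm E m y \<le> 1" "dominated k m A P s" "dominated k m B Q t"
    from *[OF this that] show "cost k (x + x') (P + P') (Q + Q') - (s' + t') / 2 \<le> (s + t) / 2" by linarith
  qed
  have "cost k (x + x') (P + P') (Q + Q') - cost k x P Q \<le> cost k x' P' Q'"
  proof (rule cost_greatest)
    fix s t m A y B
    assume "factorizes k m A y B x'" "mnorm E m y \<le> 1" "dominated k m A P' s" "dominated k m B Q' t"
    from 1[OF this] show "cost k (x + x') (P + P') (Q + Q') - cost k x P Q \<le> (s + t) / 2" by linarith
  qed
  then show ?thesis by linarith
qed

lemma cost_scale_le:
  assumes k: "0 < k" and r: "0 < r"
  shows "cost k (\<lambda>i j. smult E (of_real r) (x i j)) (\<lambda>i j. of_real r * P i j) (\<lambda>i j. of_real r * Q i j)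
    \<le> r * cost k x P Q" (is "?c \<le> _")
proof -
  have "?c / r \<le> cost k x P Q"
  proof (rule cost_greatest)
    fix s t m A y B
    assume *: "factorizes k m A y B x" "mnorm E m y \<le> 1" "dominated k m A P s" "dominated k m B Q t"
    have "?c \<le> (r * s + r * t) / 2"
      by (rule cost_le[OF k factorizes_scale[OF *(1) r] *(2) dominated_scale[OF *(3) r] dominated_scale[OF *(4) r]])
    then show "?c / r \<le> (s + t) / 2" using r by (simp add: field_simps)
  qed
  then show ?thesis using r by (simp add: field_simps)
qed

text \<open>\<open>A\<^sup>* A \<le> s\<close> and \<open>B\<^sup>* B \<le> t\<close> give \<open>\<parallel>A\<^sup>* y B\<parallel> \<le> \<surd>s \<surd>t \<le> (s + t) / 2\<close>.\<close>

lemma cost_lower: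
  assumes k: "0 < k"
  shows "mnorm E k x \<le> cost k x 0 0"
proof (rule cost_greatest)
  fix s t m A y B
  assume *: "factorizes k m A y B x" "mnorm E m y \<le> 1" "dominated k m A 0 s" "dominated k m B 0 t"
  have s: "0 \<le> s" and t: "0 \<le> t"
    using dominated_lower[OF k *(3)] dominated_lower[OF k *(4)] by simp_all
  have "mnorm E k x \<le> sqrt s * sqrt t"
    using dominated_opnorm[OF *(3) s] dominated_opnorm[OF *(4) t] s t
    by (intro factorizes_norm_le[OF *(1,2)]) auto
  also have "\<dots> \<le> (s + t) / 2"
    using sum_squares_bound[of "sqrt s" "sqrt t"] s t by simp
  finally show "mnorm E k x \<le> (s + t) / 2" .
qed

text \<open>
  The three components of a linear functional that lies below \<open>cost\<close> and attains it at
  \<open>(x0, 0, 0)\<close>. The first is made complex linear by complexification.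
\<close>

lemma ruan_functional:
  assumes k: "0 < k"
  obtains \<phi> \<sigma> \<tau> where
    "\<And>x y. \<phi> (x + y) = \<phi> x + \<phi> y" "\<And>c x. \<phi> (\<lambda>i j. smult E c (x i j)) = c * \<phi> x"
    "\<And>P Q. \<sigma> (P + Q) = \<sigma> P + \<sigma> Q" "\<And>t P. \<sigma> (\<lambda>i j. of_real t * P i j) = t * \<sigma> P"
    "\<And>P s. (\<And>c. quad k P c \<le> s * (\<Sum>i<k. (cmod (c i))\<^sup>2)) \<Longrightarrow> \<sigma> P \<le> s / 2"
    "\<And>P Q. \<tau> (P + Q) = \<tau> P + \<tau> Q" "\<And>t P. \<tau> (\<lambda>i j. of_real t * P i j) = t * \<tau> P"
    "\<And>P s. (\<And>c. quad k P c \<le> s * (\<Sum>i<k. (cmod (c i))\<^sup>2)) \<Longrightarrow> \<tau> P \<le> s / 2"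
    "\<And>m A y B. mnorm E m y \<le> 1 \<Longrightarrow>
       Re (\<phi> (\<lambda>i j. \<Sum>a<m. \<Sum>b<m. smult E (cnj (A a i) * B b j) (y a b)))
         \<le> \<sigma> (\<Sum>a<m. rank_one (A a) (A a)) + \<tau> (\<Sum>b<m. rank_one (B b) (B b))"
    "mnorm E k x0 \<le> Re (\<phi> x0)"
proof -
  define sc where "sc = (\<lambda>(t::real) (x :: nat \<Rightarrow> nat \<Rightarrow> 'e, P :: nat \<Rightarrow> nat \<Rightarrow> complex, Q :: nat \<Rightarrow> nat \<Rightarrow> complex).
    (\<lambda>i j. smult E (of_real t) (x i j), \<lambda>i j. complex_of_real t * P i j, \<lambda>i j. complex_of_real t * Q i j))"
  have vs: "vector_space sc"
    by unfold_locales (auto simp: sc_def fun_eq_iff scale_right_distrib scale_left_distrib algebra_simps)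
  define p where "p = (\<lambda>(x, P, Q). cost k x P Q)"
  have "sublinear sc p"
    unfolding sublinear_def p_def sc_def
    by (auto simp del: plus_fun_apply intro!: cost_add_le cost_scale_le k)
  from hahn_banach[OF vs this, of "(x0, 0, 0)"]
  obtain L where L: "\<And>x y. L (x + y) = L x + L y" "\<And>t x. L (sc t x) = t * L x"
    "\<And>x. L x \<le> p x" "L (x0, 0, 0) = p (x0, 0, 0)" by metis
  define \<sigma> where "\<sigma> = (\<lambda>P. L (0, P, 0))"
  define \<tau> where "\<tau> = (\<lambda>Q. L (0, 0, Q))"
  define \<phi> where "\<phi> = (\<lambda>x. Complex (L (x, 0, 0)) (- L (\<lambda>i j. smult E \<i> (x i j), 0, 0)))"
  have vs2: "vector_space (\<lambda>c (x :: nat \<Rightarrow> nat \<Rightarrow> 'e) i j. smult E c (x i j))"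
    by unfold_locales (auto simp: fun_eq_iff scale_right_distrib scale_left_distrib)
  have 1: "L (x + y, 0, 0) = L (x, 0, 0) + L (y, 0, 0)" for x y
    using L(1)[of "(x, 0, 0)" "(y, 0, 0)"] by (simp del: plus_fun_apply)
  have 2: "L (\<lambda>i j. smult E (complex_of_real t) (x i j), 0, 0) = t * L (x, 0, 0)" for t x
    using L(2)[of t "(x, 0, 0)"] by (simp add: sc_def zero_fun_def)
  have \<phi>: "\<phi> (x + y) = \<phi> x + \<phi> y" "\<phi> (\<lambda>i j. smult E c (x i j)) = c * \<phi> x" for x y c
    unfolding \<phi>_def by (rule complexification[OF vs2, of "\<lambda>x. L (x, 0, 0)"], rule 1, rule 2)+
  have \<sigma>: "\<sigma> (P + Q) = \<sigma> P + \<sigma> Q" "\<sigma> (\<lambda>i j. of_real t * P i j) = t * \<sigma> P" for P Q t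
    using L(1)[of "(0, P, 0)" "(0, Q, 0)"] L(2)[of t "(0, P, 0)"]
    by (simp_all add: \<sigma>_def sc_def zero_fun_def plus_fun_def)
  have \<tau>: "\<tau> (P + Q) = \<tau> P + \<tau> Q" "\<tau> (\<lambda>i j. of_real t * P i j) = t * \<tau> P" for P Q t
    using L(1)[of "(0, 0, P)" "(0, 0, Q)"] L(2)[of t "(0, 0, P)"]
    by (simp_all add: \<tau>_def sc_def zero_fun_def plus_fun_def)
  have null: "factorizes k 0 A y B 0" "mnorm E 0 y \<le> 1" for A y B
    using inorm_empty[of y] by (simp_all add: factorizes_def inorm_lessThan[of 0, symmetric])
  have \<sigma>_bound: "\<sigma> P \<le> s / 2" if "\<And>c. quad k P c \<le> s * (\<Sum>i<k. (cmod (c i))\<^sup>2)" for P s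
  proof -
    have "\<sigma> P \<le> cost k 0 P 0" using L(3)[of "(0, P, 0)"] by (simp add: \<sigma>_def p_def)
    also have "\<dots> \<le> (s + 0) / 2"
      by (rule cost_le[OF k null]) (use that in \<open>simp_all add: dominated_def quad_zero\<close>)
    finally show ?thesis by simp
  qed
  have \<tau>_bound: "\<tau> P \<le> s / 2" if "\<And>c. quad k P c \<le> s * (\<Sum>i<k. (cmod (c i))\<^sup>2)" for P s
  proof -
    have "\<tau> P \<le> cost k 0 0 P" using L(3)[of "(0, 0, P)"] by (simp add: \<tau>_def p_def)
    also have "\<dots> \<le> (0 + s) / 2"
      by (rule cost_le[OF k null]) (use that in \<open>simp_all add: dominated_def quad_zero\<close>)
    finally show ?thesis by simp
  qed
  have main: "Re (\<phi> (\<lambda>i j. \<Sum>a<m. \<Sum>b<m. smult E (cnj (A a i) * B b j) (y a b)))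
         \<le> \<sigma> (\<Sum>a<m. rank_one (A a) (A a)) + \<tau> (\<Sum>b<m. rank_one (B b) (B b))"
    if y: "mnorm E m y \<le> 1" for m A y B
  proof -
    let ?x = "\<lambda>i j. \<Sum>a<m. \<Sum>b<m. smult E (cnj (A a i) * B b j) (y a b)"
    let ?P = "\<Sum>a<m. rank_one (A a) (A a)" let ?Q = "\<Sum>b<m. rank_one (B b) (B b)"
    have dom: "dominated k m A (- (\<Sum>a<m. rank_one (A a) (A a))) 0" for A
      unfolding dominated_def quad_minus quad_sum quad_rank_one by simp
    have "L (?x, - ?P, - ?Q) \<le> cost k ?x (- ?P) (- ?Q)"
      using L(3)[of "(?x, - ?P, - ?Q)"] by (simp add: p_def)
    also have "\<dots> \<le> (0 + 0) / 2"
      by (rule cost_le[OF k _ y dom dom]) (simp add: factorizes_def)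
    finally have le: "L (?x, - ?P, - ?Q) \<le> 0" by simp
    have "(?x, 0, 0) = (?x, - ?P, - ?Q) + ((0, ?P, 0) + (0, 0, ?Q))" by (simp del: plus_fun_apply)
    then have "L (?x, 0, 0) = L (?x, - ?P, - ?Q) + (\<sigma> ?P + \<tau> ?Q)"
      by (simp only: L(1) \<sigma>_def \<tau>_def)
    then show ?thesis using le by (simp add: \<phi>_def)
  qed
  have "Re (\<phi> x0) = cost k x0 0 0" using L(4) by (simp add: \<phi>_def p_def)
  then have last: "mnorm E k x0 \<le> Re (\<phi> x0)" using cost_lower[OF k] by simp
  show thesis
    by (rule that[of \<phi> \<sigma> \<tau>]) (fact \<phi> \<sigma> \<sigma>_bound \<tau> \<tau>_bound main last)+
qed

text \<open>
  For fixed \<open>y\<close> in \<open>E\<close>, the functional \<open>\<phi>\<close> is sesquilinear in the row vectors \<open>A\<close> and \<open>B\<close> and bounded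
  with respect to the semi-inner products given by \<open>\<sigma>\<close> and \<open>\<tau>\<close>. In Gram--Schmidt bases of these it
  is a matrix \<open>g y\<close>. The bound on \<open>\<phi>\<close> holds for factorizations of every size \<open>m\<close>, which makes \<open>g\<close>
  completely contractive; the coefficients of the standard basis form vectors of norm at most \<open>1\<close>
  between which the matrix \<open>g (x i j)\<close> takes the value \<open>\<phi> x\<close>, so its norm is at least that of \<open>x\<close>.
\<close>

lemma ruan_norming_pos:
  fixes x :: "nat \<Rightarrow> nat \<Rightarrow> 'e"
  assumes k: "0 < k"
  obtains g where "completely_contractive E (matrices_nat k) g"
    "mnorm E k x \<le> opnorm ({..<k} \<times> {..<k}) ({..<k} \<times> {..<k}) (\<lambda>(i, s) (j, t). g (x i j) s t)"
proof -
  define x0 where "x0 = (\<lambda>i j. if i < k \<and> j < k then x i j else 0)"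
  obtain \<phi> \<sigma> \<tau> where
    \<phi>: "\<And>x y. \<phi> (x + y) = \<phi> x + \<phi> y" "\<And>c x. \<phi> (\<lambda>i j. smult E c (x i j)) = c * \<phi> x"
    and \<sigma>: "\<And>P Q. \<sigma> (P + Q) = \<sigma> P + \<sigma> Q" "\<And>t P. \<sigma> (\<lambda>i j. of_real t * P i j) = t * \<sigma> P"
      "\<And>P s. (\<And>c. quad k P c \<le> s * (\<Sum>i<k. (cmod (c i))\<^sup>2)) \<Longrightarrow> \<sigma> P \<le> s / 2"
    and \<tau>: "\<And>P Q. \<tau> (P + Q) = \<tau> P + \<tau> Q" "\<And>t P. \<tau> (\<lambda>i j. of_real t * P i j) = t * \<tau> P"
      "\<And>P s. (\<And>c. quad k P c \<le> s * (\<Sum>i<k. (cmod (c i))\<^sup>2)) \<Longrightarrow> \<tau> P \<le> s / 2"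
    and main: "\<And>m A y B. mnorm E m y \<le> 1 \<Longrightarrow>
       Re (\<phi> (\<lambda>i j. \<Sum>a<m. \<Sum>b<m. smult E (cnj (A a i) * B b j) (y a b)))
         \<le> \<sigma> (\<Sum>a<m. rank_one (A a) (A a)) + \<tau> (\<Sum>b<m. rank_one (B b) (B b))"
    and x0: "mnorm E k x0 \<le> Re (\<phi> x0)"
    by (rule ruan_functional[OF k, of x0]) blast
  obtain b \<eta> where b:
    "\<And>\<zeta>. 2 * \<sigma> (rank_one (\<lambda>i. \<Sum>t<k. \<zeta> t * b t i) (\<lambda>i. \<Sum>t<k. \<zeta> t * b t i)) \<le> (\<Sum>t<k. (cmod (\<zeta> t))\<^sup>2)"
    and \<eta>: "\<And>i. i < k \<Longrightarrow> \<sigma> (rank_one (\<lambda>j. (if j = i then 1 else 0) - (\<Sum>t<k. \<eta> i t * b t j))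
                               (\<lambda>j. (if j = i then 1 else 0) - (\<Sum>t<k. \<eta> i t * b t j))) = 0"
      "(\<Sum>i<k. \<Sum>t<k. (cmod (\<eta> i t))\<^sup>2) \<le> 1"
    by (rule state_basis[of \<sigma> k, OF \<sigma>]) blast+
  obtain b' \<eta>' where b':
    "\<And>\<zeta>. 2 * \<tau> (rank_one (\<lambda>i. \<Sum>t<k. \<zeta> t * b' t i) (\<lambda>i. \<Sum>t<k. \<zeta> t * b' t i)) \<le> (\<Sum>t<k. (cmod (\<zeta> t))\<^sup>2)"
    and \<eta>': "\<And>i. i < k \<Longrightarrow> \<tau> (rank_one (\<lambda>j. (if j = i then 1 else 0) - (\<Sum>t<k. \<eta>' i t * b' t j))
                               (\<lambda>j. (if j = i then 1 else 0) - (\<Sum>t<k. \<eta>' i t * b' t j))) = 0"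
      "(\<Sum>i<k. \<Sum>t<k. (cmod (\<eta>' i t))\<^sup>2) \<le> 1"
    by (rule state_basis[of \<tau> k, OF \<tau>]) blast+
  have \<phi>_0: "\<phi> 0 = 0" using \<phi>(1)[of 0 0] by simp
  have \<phi>_diff: "\<phi> (y - z) = \<phi> y - \<phi> z" for y z using \<phi>(1)[of "y - z" z] by simp
  have \<phi>_sum: "\<phi> (\<Sum>a\<in>I. F a) = (\<Sum>a\<in>I. \<phi> (F a))" for I :: "nat set" and F
    by (induction I rule: infinite_finite_induct) (simp_all add: \<phi>_0 \<phi>_0[unfolded zero_fun_def] \<phi>(1) del: plus_fun_apply)
  have sum_apply: "(\<Sum>a\<in>I. F a) i j = (\<Sum>a\<in>I. F a i j)" for I :: "nat set" and F :: "nat \<Rightarrow> nat \<Rightarrow> nat \<Rightarrow> 'e" and i j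
    by (induction I rule: infinite_finite_induct) simp_all
  have \<sigma>_sum: "\<sigma> (\<Sum>i\<in>I. P i) = (\<Sum>i\<in>I. \<sigma> (P i))" for I :: "nat set" and P
    using \<sigma>(2)[of 0 0] by (induction I rule: infinite_finite_induct) (simp_all add: \<sigma>(1) zero_fun_def del: plus_fun_apply)
  have \<tau>_sum: "\<tau> (\<Sum>i\<in>I. P i) = (\<Sum>i\<in>I. \<tau> (P i))" for I :: "nat set" and P
    using \<tau>(2)[of 0 0] by (induction I rule: infinite_finite_induct) (simp_all add: \<tau>(1) zero_fun_def del: plus_fun_apply)
  define \<Psi> where "\<Psi> = (\<lambda>(m::nat) A y B. \<phi> (\<lambda>i j. \<Sum>a<m. \<Sum>b<m. smult E (cnj (A a i) * B b j) (y a b)))"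
  have bound: "cmod (\<Psi> m A y B) \<le> C * ((\<Sum>a<m. \<sigma> (rank_one (A a) (A a))) + (\<Sum>b<m. \<tau> (rank_one (B b) (B b))))"
    if C: "mnorm E m y \<le> C" "0 < C" for m A y B C
  proof -
    define c where "c = (if \<Psi> m A y B = 0 then 1 else cnj (\<Psi> m A y B) / of_real (cmod (\<Psi> m A y B))) / of_real C"
    have c: "cmod c = 1 / C" using C(2) by (simp add: c_def norm_divide)
    have "c * \<Psi> m A y B = of_real (cmod (\<Psi> m A y B) / C)"
      using complex_norm_square[of "\<Psi> m A y B"] by (simp add: c_def power2_eq_square field_simps)
    moreover have "c * \<Psi> m A y B = \<Psi> m A (\<lambda>i j. smult E c (y i j)) B"
      unfolding \<Psi>_def \<phi>(2)[symmetric] by (simp add: scale_sum_right mult.commute)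
    ultimately have "cmod (\<Psi> m A y B) / C = Re (\<Psi> m A (\<lambda>i j. smult E c (y i j)) B)" by simp
    also have "\<dots> \<le> (\<Sum>a<m. \<sigma> (rank_one (A a) (A a))) + (\<Sum>b<m. \<tau> (rank_one (B b) (B b)))"
      unfolding \<Psi>_def \<sigma>_sum[symmetric] \<tau>_sum[symmetric]
    proof (rule main)
      have "mnorm E m (\<lambda>i j. smult E c (y i j)) \<le> 1 / C * mnorm E m y" using mnorm_smult[of m c y] c by simp
      also have "\<dots> \<le> 1" using C by simp
      finally show "mnorm E m (\<lambda>i j. smult E c (y i j)) \<le> 1" .
    qed
    finally show ?thesis using C(2) by (simp add: field_simps)
  qed
  have \<Psi>_diff: "\<Psi> m A y B - \<Psi> m A' y B = \<Psi> m (\<lambda>a i. A a i - A' a i) y B"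
    "\<Psi> m A y B - \<Psi> m A y B' = \<Psi> m A y (\<lambda>a i. B a i - B' a i)" for m A A' y B B'
    unfolding \<Psi>_def \<phi>_diff[symmetric]
    by (simp_all add: fun_diff_def algebra_simps scale_left_diff_distrib sum_subtractf)
  \<comment> \<open>Null vectors may be multiplied by any factor without changing the bound, so they
    contribute nothing to \<open>\<Psi>\<close>.\<close>
  have archimedean: "p = 0" if "\<And>n::real. 0 < n \<Longrightarrow> n * p \<le> K" "0 \<le> p" for p K :: real
  proof (rule ccontr)
    assume "p \<noteq> 0"
    then have p: "0 < p" using that(2) by simp
    have "0 \<le> K" using that(1)[of 1] p by simp
    then show False using that(1)[of "(K + 1) / p"] p by simp
  qed
  have rank_one_scale: "rank_one (\<lambda>i. of_real n * c i) (\<lambda>i. of_real n * c i) = (\<lambda>i j. of_real (n * n) * rank_one c c i j)" for n c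
    by (simp add: rank_one_def fun_eq_iff)
  have null_left: "\<Psi> m D y B = 0" if D: "\<And>a. a < m \<Longrightarrow> \<sigma> (rank_one (D a) (D a)) = 0" for m D y B
  proof -
    define C where "C = mnorm E m y + 1"
    have C: "mnorm E m y \<le> C" "0 < C" using nonneg[of m y] by (auto simp: C_def)
    have "cmod (\<Psi> m D y B) = 0"
    proof (rule archimedean)
      fix n :: real assume n: "0 < n"
      have "\<Psi> m (\<lambda>a i. of_real n * D a i) y B = of_real n * \<Psi> m D y B"
        unfolding \<Psi>_def \<phi>(2)[symmetric] by (simp add: scale_sum_right mult.assoc)
      then have "n * cmod (\<Psi> m D y B) = cmod (\<Psi> m (\<lambda>a i. of_real n * D a i) y B)"
        using n by (simp add: norm_mult)
      also have "\<dots> \<le> C * ((\<Sum>a<m. \<sigma> (rank_one (\<lambda>i. of_real n * D a i) (\<lambda>i. of_real n * D a i))) + (\<Sum>b<m. \<tau> (rank_one (B b) (B b))))"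
        by (rule bound[OF C])
      also have "(\<Sum>a<m. \<sigma> (rank_one (\<lambda>i. of_real n * D a i) (\<lambda>i. of_real n * D a i))) = 0"
        by (intro sum.neutral ballI) (simp only: rank_one_scale \<sigma>(2) D lessThan_iff mult_zero_right)
      finally show "n * cmod (\<Psi> m D y B) \<le> C * (0 + (\<Sum>b<m. \<tau> (rank_one (B b) (B b))))" .
    qed simp
    then show ?thesis by simp
  qed
  have null_right: "\<Psi> m A y D = 0" if D: "\<And>a. a < m \<Longrightarrow> \<tau> (rank_one (D a) (D a)) = 0" for m A y D
  proof -
    define C where "C = mnorm E m y + 1"
    have C: "mnorm E m y \<le> C" "0 < C" using nonneg[of m y] by (auto simp: C_def)
    have "cmod (\<Psi> m A y D) = 0"
    proof (rule archimedean)
      fix n :: real assume n: "0 < n"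
      have "\<Psi> m A y (\<lambda>a i. of_real n * D a i) = of_real n * \<Psi> m A y D"
        unfolding \<Psi>_def \<phi>(2)[symmetric] by (simp add: scale_sum_right mult.left_commute)
      then have "n * cmod (\<Psi> m A y D) = cmod (\<Psi> m A y (\<lambda>a i. of_real n * D a i))"
        using n by (simp add: norm_mult)
      also have "\<dots> \<le> C * ((\<Sum>b<m. \<sigma> (rank_one (A b) (A b))) + (\<Sum>a<m. \<tau> (rank_one (\<lambda>i. of_real n * D a i) (\<lambda>i. of_real n * D a i))))"
        by (rule bound[OF C])
      also have "(\<Sum>a<m. \<tau> (rank_one (\<lambda>i. of_real n * D a i) (\<lambda>i. of_real n * D a i))) = 0"
        by (intro sum.neutral ballI) (simp only: rank_one_scale \<tau>(2) D lessThan_iff mult_zero_right)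
      finally show "n * cmod (\<Psi> m A y D) \<le> C * ((\<Sum>b<m. \<sigma> (rank_one (A b) (A b))) + 0)" .
    qed simp
    then show ?thesis by simp
  qed
  define g where "g = (\<lambda>y s t. \<phi> (\<lambda>i j. smult E (cnj (b s i) * b' t j) y))"
  have g_\<Psi>: "(\<Sum>p\<in>{..<m} \<times> {..<k}. \<Sum>q\<in>{..<m} \<times> {..<k}. cnj (\<zeta> p) * (case p of (i, s) \<Rightarrow> \<lambda>(j, t). g (y i j) s t) q * \<xi> q)
     = \<Psi> m (\<lambda>a i. \<Sum>s<k. \<zeta> (a, s) * b s i) y (\<lambda>a j. \<Sum>t<k. \<xi> (a, t) * b' t j)" for m \<zeta> \<xi> y
  proof -
    have "(\<lambda>i j. \<Sum>a<m. \<Sum>c<m. smult E (cnj (\<Sum>s<k. \<zeta> (a, s) * b s i) * (\<Sum>t<k. \<xi> (c, t) * b' t j)) (y a c))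
      = (\<Sum>a<m. \<Sum>s<k. \<Sum>c<m. \<Sum>t<k. (\<lambda>i j. smult E (cnj (\<zeta> (a, s)) * \<xi> (c, t)) (smult E (cnj (b s i) * b' t j) (y a c))))"
      (is "?l = ?r")
    proof (intro ext)
      fix i j
      have "?l i j = (\<Sum>a<m. \<Sum>c<m. \<Sum>s<k. \<Sum>t<k. smult E (cnj (\<zeta> (a, s)) * \<xi> (c, t)) (smult E (cnj (b s i) * b' t j) (y a c)))"
        unfolding cnj_sum sum_product scale_sum_left by (intro sum.cong refl) (simp add: mult_ac)
      also have "\<dots> = (\<Sum>a<m. \<Sum>s<k. \<Sum>c<m. \<Sum>t<k. smult E (cnj (\<zeta> (a, s)) * \<xi> (c, t)) (smult E (cnj (b s i) * b' t j) (y a c)))"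
        by (rule sum.cong[OF refl], rule sum.swap)
      also have "\<dots> = ?r i j" by (simp only: sum_apply)
      finally show "?l i j = ?r i j" .
    qed
    then have "\<Psi> m (\<lambda>a i. \<Sum>s<k. \<zeta> (a, s) * b s i) y (\<lambda>a j. \<Sum>t<k. \<xi> (a, t) * b' t j)
      = (\<Sum>a<m. \<Sum>s<k. \<Sum>c<m. \<Sum>t<k. cnj (\<zeta> (a, s)) * \<xi> (c, t) * g (y a c) s t)"
      by (simp only: \<Psi>_def \<phi>_sum \<phi>(2) g_def)
    also have "\<dots> = (\<Sum>p\<in>{..<m} \<times> {..<k}. \<Sum>q\<in>{..<m} \<times> {..<k}. cnj (\<zeta> p) * (case p of (i, s) \<Rightarrow> \<lambda>(j, t). g (y i j) s t) q * \<xi> q)"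
      unfolding sum_Times by (intro sum.cong refl) simp
    finally show ?thesis by simp
  qed
  show thesis
  proof (rule that[of g])
    show "completely_contractive E (matrices_nat k) g"
      unfolding completely_contractive_def
    proof (intro conjI allI)
      have vs: "vector_space (smult (matrices_nat k))"
        unfolding matrices_nat_def by (simp add: vector_space_fun2)
      have "g (y + z) = g y + g z" for y z
      proof (intro ext)
        fix s t
        have "(\<lambda>i j. smult E (cnj (b s i) * b' t j) (y + z))
          = (\<lambda>i j. smult E (cnj (b s i) * b' t j) y) + (\<lambda>i j. smult E (cnj (b s i) * b' t j) z)"
          by (simp add: fun_eq_iff scale_right_distrib)
        then show "g (y + z) s t = (g y + g z) s t" by (simp add: g_def \<phi>(1))
      qed
      moreover have "g (smult E c y) = smult (matrices_nat k) c (g y)" for c y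
      proof (intro ext)
        fix s t
        have "(\<lambda>i j. smult E (cnj (b s i) * b' t j) (smult E c y))
          = (\<lambda>i j. smult E c (smult E (cnj (b s i) * b' t j) y))"
          by (simp add: fun_eq_iff mult.commute)
        then show "g (smult E c y) s t = smult (matrices_nat k) c (g y) s t"
          by (simp only: g_def \<phi>(2) matrices_nat_def opspace.simps)
      qed
      ultimately show "Vector_Spaces.linear (smult E) (smult (matrices_nat k)) g"
        using vs vector_space_axioms by (simp add: Vector_Spaces.linear_iff)
    next
      fix m y
      have "opnorm ({..<m} \<times> {..<k}) ({..<m} \<times> {..<k}) (\<lambda>(i, s) (j, t). g (y i j) s t) \<le> C"
        if C: "mnorm E m y \<le> C" "0 < C" for C
      proof (rule opnorm_le_quadratic)
        fix \<zeta> \<xi> :: "nat \<times> nat \<Rightarrow> complex"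
        let ?A = "\<lambda>a i. \<Sum>s<k. \<zeta> (a, s) * b s i" and ?B = "\<lambda>a i. \<Sum>s<k. \<xi> (a, s) * b' s i"
        have "cmod (\<Psi> m ?A y ?B) \<le> C * ((\<Sum>a<m. \<sigma> (rank_one (?A a) (?A a))) + (\<Sum>a<m. \<tau> (rank_one (?B a) (?B a))))"
          by (rule bound[OF C])
        also have "\<dots> \<le> C * ((\<Sum>a<m. (\<Sum>s<k. (cmod (\<zeta> (a, s)))\<^sup>2) / 2) + (\<Sum>a<m. (\<Sum>s<k. (cmod (\<xi> (a, s)))\<^sup>2) / 2))"
        proof (intro mult_left_mono add_mono sum_mono)
          show "\<sigma> (rank_one (?A a) (?A a)) \<le> (\<Sum>s<k. (cmod (\<zeta> (a, s)))\<^sup>2) / 2" for a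
            using b[of "\<lambda>s. \<zeta> (a, s)"] by simp
          show "\<tau> (rank_one (?B a) (?B a)) \<le> (\<Sum>s<k. (cmod (\<xi> (a, s)))\<^sup>2) / 2" for a
            using b'[of "\<lambda>s. \<xi> (a, s)"] by simp
        qed (use C in simp)
        also have "\<dots> = C / 2 * ((\<Sum>p\<in>{..<m} \<times> {..<k}. (cmod (\<zeta> p))\<^sup>2) + (\<Sum>p\<in>{..<m} \<times> {..<k}. (cmod (\<xi> p))\<^sup>2))"
          unfolding sum_Times by (simp add: sum_divide_distrib[symmetric] field_simps)
        finally show "cmod (\<Sum>p\<in>{..<m} \<times> {..<k}. \<Sum>q\<in>{..<m} \<times> {..<k}. cnj (\<zeta> p) * (case p of (i, s) \<Rightarrow> \<lambda>(j, t). g (y i j) s t) q * \<xi> q)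
           \<le> C / 2 * ((\<Sum>p\<in>{..<m} \<times> {..<k}. (cmod (\<zeta> p))\<^sup>2) + (\<Sum>p\<in>{..<m} \<times> {..<k}. (cmod (\<xi> p))\<^sup>2))"
          by (simp only: g_\<Psi>)
      qed (use C in auto)
      note le = this
      have "opnorm ({..<m} \<times> {..<k}) ({..<m} \<times> {..<k}) (\<lambda>(i, s) (j, t). g (y i j) s t) \<le> mnorm E m y"
      proof (rule field_le_epsilon)
        fix e :: real assume "0 < e"
        then show "opnorm ({..<m} \<times> {..<k}) ({..<m} \<times> {..<k}) (\<lambda>(i, s) (j, t). g (y i j) s t) \<le> mnorm E m y + e"
          using nonneg[of m y] by (intro le) auto
      qed
      then show "mnorm (matrices_nat k) m (\<lambda>i j. g (y i j)) \<le> mnorm E m y"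
        by (simp add: matrices_nat_def)
    qed
  next
    let ?e = "\<lambda>a i. if i = a then (1::complex) else 0"
    let ?P = "\<lambda>a i. \<Sum>s<k. \<eta> a s * b s i" and ?Q = "\<lambda>a i. \<Sum>s<k. \<eta>' a s * b' s i"
    let ?O = "opnorm ({..<k} \<times> {..<k}) ({..<k} \<times> {..<k}) (\<lambda>(i, s) (j, t). g (x i j) s t)"
    have L: "L2_set (\<lambda>p. cmod (case_prod \<eta> p)) ({..<k} \<times> {..<k}) \<le> 1"
      "L2_set (\<lambda>p. cmod (case_prod \<eta>' p)) ({..<k} \<times> {..<k}) \<le> 1"
      unfolding L2_set_def sum_Times real_sqrt_le_1_iff using \<eta>(2) \<eta>'(2) by simp_all
    have "x0 = (\<lambda>i j. \<Sum>a<k. \<Sum>c<k. smult E (cnj (?e a i) * ?e c j) (x a c))"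
    proof (intro ext)
      fix i j
      have "(\<Sum>a<k. \<Sum>c<k. smult E (cnj (?e a i) * ?e c j) (x a c)) = (\<Sum>a<k. \<Sum>c<k. if c = j then if a = i then x i j else 0 else 0)"
        by (intro sum.cong refl) auto
      then show "x0 i j = (\<Sum>a<k. \<Sum>c<k. smult E (cnj (?e a i) * ?e c j) (x a c))"
        by (auto simp: x0_def)
    qed
    then have "\<phi> x0 = \<Psi> k ?e x ?e" by (simp only: \<Psi>_def)
    also have "\<dots> = \<Psi> k ?P x ?e"
      using \<Psi>_diff(1)[of k ?e x ?e ?P] null_left[of k "\<lambda>a i. ?e a i - ?P a i" x ?e] \<eta>(1) by simp
    also have "\<dots> = \<Psi> k ?P x ?Q"
      using \<Psi>_diff(2)[of k ?P x ?e ?Q] null_right[of k "\<lambda>a i. ?e a i - ?Q a i" ?P x] \<eta>'(1) by simp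
    also have "\<dots> = (\<Sum>p\<in>{..<k} \<times> {..<k}. \<Sum>q\<in>{..<k} \<times> {..<k}. cnj (case_prod \<eta> p) * (case p of (i, s) \<Rightarrow> \<lambda>(j, t). g (x i j) s t) q * case_prod \<eta>' q)"
      unfolding g_\<Psi> by simp
    finally have "cmod (\<phi> x0) = cmod (\<Sum>p\<in>{..<k} \<times> {..<k}. \<Sum>q\<in>{..<k} \<times> {..<k}. cnj (case_prod \<eta> p) * (case p of (i, s) \<Rightarrow> \<lambda>(j, t). g (x i j) s t) q * case_prod \<eta>' q)"
      by (rule arg_cong)
    also have "\<dots> \<le> ?O * L2_set (\<lambda>p. cmod (case_prod \<eta> p)) ({..<k} \<times> {..<k}) * L2_set (\<lambda>q. cmod (case_prod \<eta>' q)) ({..<k} \<times> {..<k})"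
      by (rule opnorm_bilinear) auto
    also have "\<dots> \<le> ?O * 1 * 1"
      by (intro mult_mono mult_nonneg_nonneg L order_refl L2_set_nonneg opnorm_nonneg) simp_all
    finally have "cmod (\<phi> x0) \<le> ?O" by simp
    moreover have "mnorm E k x = mnorm E k x0" by (rule cong) (simp add: x0_def)
    ultimately show "mnorm E k x \<le> ?O" using x0 complex_Re_le_cmod[of "\<phi> x0"] by linarith
  qed
qed

end


lemma inorm_cc_le:
  assumes fin: "finite I" and g: "completely_contractive E (matrices_nat r) g"
  shows "opnorm (I \<times> {..<r}) (I \<times> {..<r}) (\<lambda>(i, s) (j, t). g (x i j) s t) \<le> inorm E I x"
proof -
  let ?e = "map_prod (enumeration I) (id :: nat \<Rightarrow> nat)"
  have e: "bij_betw ?e ({..<card I} \<times> {..<r}) (I \<times> {..<r})"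
    by (intro bij_betw_map_prod bij_enumeration fin bij_betw_id)
  have "opnorm (I \<times> {..<r}) (I \<times> {..<r}) (\<lambda>(i, s) (j, t). g (x i j) s t)
    = opnorm ({..<card I} \<times> {..<r}) ({..<card I} \<times> {..<r})
        (\<lambda>p q. (\<lambda>(i, s) (j, t). g (x i j) s t) (?e p) (?e q))"
    by (rule opnorm_reindex[OF e e, symmetric]) (use fin in auto)
  also have "\<dots> = mnorm (matrices_nat r) (card I) (\<lambda>i j. g (x (enumeration I i) (enumeration I j)))"
    by (simp add: matrices_nat_def map_prod_def case_prod_unfold)
  also have "\<dots> \<le> inorm E I x"
    using g by (simp add: inorm_def completely_contractive_def)
  finally show ?thesis .
qed

text \<open>
  Matrix norms are determined by complete contractions into matrix algebras, so that estimates
  for an abstract operator space reduce to estimates for operators.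
\<close>

lemma (in ruan_seminorm) inorm_le_cc:
  assumes fin: "finite I" and C: "0 \<le> C"
    and g: "\<And>r g. completely_contractive E (matrices_nat r) g \<Longrightarrow>
      opnorm (I \<times> {..<r}) (I \<times> {..<r}) (\<lambda>(i, s) (j, t). g (x i j) s t) \<le> C"
  shows "inorm E I x \<le> C"
proof (cases "I = {}")
  case True
  show ?thesis unfolding True inorm_empty by (rule C)
next
  case False
  let ?k = "card I"
  have "0 < ?k" using False fin by (simp add: card_gt_0_iff)
  from ruan_norming_pos[OF this, of "\<lambda>i j. x (enumeration I i) (enumeration I j)"]
  obtain g where cc: "completely_contractive E (matrices_nat ?k) g" and
    le: "inorm E I x \<le> opnorm ({..<?k} \<times> {..<?k}) ({..<?k} \<times> {..<?k})
      (\<lambda>(i, s) (j, t). g (x (enumeration I i) (enumeration I j)) s t)"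
    unfolding inorm_def by blast
  let ?e = "map_prod (enumeration I) (id :: nat \<Rightarrow> nat)"
  have e: "bij_betw ?e ({..<card I} \<times> {..<?k}) (I \<times> {..<?k})"
    by (intro bij_betw_map_prod bij_enumeration fin bij_betw_id)
  note le
  also have "opnorm ({..<?k} \<times> {..<?k}) ({..<?k} \<times> {..<?k}) (\<lambda>(i, s) (j, t). g (x (enumeration I i) (enumeration I j)) s t)
    = opnorm ({..<?k} \<times> {..<?k}) ({..<?k} \<times> {..<?k}) (\<lambda>p q. (\<lambda>(i, s) (j, t). g (x i j) s t) (?e p) (?e q))"
    by (simp add: map_prod_def case_prod_unfold)
  also have "\<dots> = opnorm (I \<times> {..<?k}) (I \<times> {..<?k}) (\<lambda>(i, s) (j, t). g (x i j) s t)"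
    by (rule opnorm_reindex[OF e e]) (use fin in auto)
  also have "\<dots> \<le> C" by (rule g[OF cc])
  finally show ?thesis .
qed

lemma inorm_matrices:
  fixes X :: "'i \<Rightarrow> 'i \<Rightarrow> complex ^ 'n ^ 'n"
  assumes fin: "finite I"
  shows "inorm matrices I X = opnorm (I \<times> UNIV) (I \<times> UNIV) (\<lambda>(i, a) (j, b). X i j $ a $ b)"
proof -
  let ?e = "map_prod (enumeration I) (id :: 'n \<Rightarrow> 'n)"
  have e: "bij_betw ?e ({..<card I} \<times> UNIV) (I \<times> UNIV)"
    by (intro bij_betw_map_prod bij_enumeration fin bij_betw_id)
  have "opnorm (I \<times> UNIV) (I \<times> UNIV) (\<lambda>(i, a) (j, b). X i j $ a $ b)
    = opnorm ({..<card I} \<times> UNIV) ({..<card I} \<times> UNIV) (\<lambda>p q. (\<lambda>(i, a) (j, b). X i j $ a $ b) (?e p) (?e q))"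
    by (rule opnorm_reindex[OF e e, symmetric]) (use fin in auto)
  then show ?thesis by (simp add: inorm_def matrices_def map_prod_def case_prod_unfold)
qed

section \<open>Minimal tensor products with matrix algebras\<close>

lemma vector_space_entrywise:
  assumes "vector_space sc"
  shows "vector_space (entrywise sc :: complex \<Rightarrow> 'e::ab_group_add ^ 'n ^ 'n \<Rightarrow> 'e ^ 'n ^ 'n)"
proof -
  interpret vector_space sc by fact
  show ?thesis
    by unfold_locales (simp_all add: entrywise_def vec_eq_iff scale_right_distrib scale_left_distrib)
qed

lemma matrix_unit_expansion:
  "A = (\<Sum>c\<in>UNIV. \<Sum>d\<in>UNIV. smult matrices (A $ c $ d) (matrix_unit c d))"
proof -
  have "(\<Sum>c\<in>UNIV. \<Sum>d\<in>UNIV. smult matrices (A $ c $ d) (matrix_unit c d)) $ a $ b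
    = (\<Sum>c\<in>UNIV. \<Sum>d\<in>UNIV. if b = d then if a = c then A $ c $ d else 0 else 0)" for a b
    unfolding matrices_def matrix_unit_def opspace.simps sum_component by (intro sum.cong refl) auto
  then show ?thesis by (simp add: vec_eq_iff)
qed

lemma linear_matrix_unit_expansion:
  fixes f :: "complex ^ 'n ^ 'n \<Rightarrow> nat \<Rightarrow> nat \<Rightarrow> complex"
  assumes f: "Vector_Spaces.linear (smult matrices) (smult (matrices_nat m)) f"
  shows "f A a b = (\<Sum>c\<in>UNIV. \<Sum>d\<in>UNIV. A $ c $ d * f (matrix_unit c d) a b)"
proof -
  interpret Vector_Spaces.linear "smult matrices" "smult (matrices_nat m)" f by (rule f)
  have s: "(\<Sum>c\<in>I. F c) a b = (\<Sum>c\<in>I. F c a b)" for F :: "'n \<Rightarrow> nat \<Rightarrow> nat \<Rightarrow> complex" and I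
    by (induction I rule: infinite_finite_induct) simp_all
  have "f A = (\<Sum>c\<in>UNIV. \<Sum>d\<in>UNIV. smult (matrices_nat m) (A $ c $ d) (f (matrix_unit c d)))"
    by (subst matrix_unit_expansion) (simp only: sum scale)
  then show ?thesis by (simp only: s) (simp add: matrices_nat_def)
qed

text \<open>
  A complete contraction on \<open>M_n\<close> cannot increase the norm: it is applied to the matrix over
  \<open>M_n\<close> with entries \<open>(g (u i j $ c $ d) s t)_cd\<close>.
\<close>

lemma min_tensor_le:
  fixes u :: "nat \<Rightarrow> nat \<Rightarrow> 'e::ab_group_add ^ 'n ^ 'n"
  assumes f: "completely_contractive matrices (matrices_nat m) f"
    and g: "completely_contractive E (matrices_nat r) g"
  shows "opnorm ({..<k} \<times> {..<m} \<times> {..<r}) ({..<k} \<times> {..<m} \<times> {..<r})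
         (\<lambda>(i, a, s) (j, b, t). \<Sum>c\<in>UNIV. \<Sum>d\<in>UNIV. f (matrix_unit c d) a b * g (u i j $ c $ d) s t)
    \<le> inorm E ({..<k} \<times> UNIV) (\<lambda>(i, c) (j, d). u i j $ c $ d)"
proof -
  define X :: "nat \<times> nat \<Rightarrow> nat \<times> nat \<Rightarrow> complex ^ 'n ^ 'n" where
    "X = (\<lambda>(i, s) (j, t). \<chi> c d. g (u i j $ c $ d) s t)"
  have lin: "Vector_Spaces.linear (smult matrices) (smult (matrices_nat m)) f"
    using f by (simp add: completely_contractive_def)
  let ?h = "\<lambda>(i :: nat, a :: nat, s :: nat). ((i, s), a)"
  have h: "bij_betw ?h ({..<k} \<times> {..<m} \<times> {..<r}) (({..<k} \<times> {..<r}) \<times> {..<m})"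
    by (rule bij_betw_byWitness[where f' = "\<lambda>((i, s), a). (i, a, s)"]) auto
  have "opnorm ({..<k} \<times> {..<m} \<times> {..<r}) ({..<k} \<times> {..<m} \<times> {..<r})
         (\<lambda>(i, a, s) (j, b, t). \<Sum>c\<in>UNIV. \<Sum>d\<in>UNIV. f (matrix_unit c d) a b * g (u i j $ c $ d) s t)
    = opnorm ({..<k} \<times> {..<m} \<times> {..<r}) ({..<k} \<times> {..<m} \<times> {..<r})
        (\<lambda>p q. (\<lambda>(p, a) (q, b). f (X p q) a b) (?h p) (?h q))"
  proof (rule opnorm_cong)
    fix p q :: "nat \<times> nat \<times> nat"
    obtain i a s j b t where pq: "p = (i, a, s)" "q = (j, b, t)" by (metis prod_cases3)
    have "f (X (i, s) (j, t)) a b = (\<Sum>c\<in>UNIV. \<Sum>d\<in>UNIV. X (i, s) (j, t) $ c $ d * f (matrix_unit c d) a b)"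
      by (rule linear_matrix_unit_expansion[OF lin])
    also have "\<dots> = (\<Sum>c\<in>UNIV. \<Sum>d\<in>UNIV. f (matrix_unit c d) a b * g (u i j $ c $ d) s t)"
      by (simp add: X_def mult.commute)
    finally show "(\<lambda>(i, a, s) (j, b, t). \<Sum>c\<in>UNIV. \<Sum>d\<in>UNIV. f (matrix_unit c d) a b * g (u i j $ c $ d) s t) p q
        = (\<lambda>(p, a) (q, b). f (X p q) a b) (?h p) (?h q)" by (simp add: pq)
  qed
  also have "\<dots> = opnorm (({..<k} \<times> {..<r}) \<times> {..<m}) (({..<k} \<times> {..<r}) \<times> {..<m}) (\<lambda>(p, a) (q, b). f (X p q) a b)"
    by (rule opnorm_reindex[OF h h]) auto
  also have "\<dots> \<le> inorm matrices ({..<k} \<times> {..<r}) X" by (rule inorm_cc_le[OF _ f]) auto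
  also have "\<dots> = opnorm (({..<k} \<times> {..<r}) \<times> UNIV) (({..<k} \<times> {..<r}) \<times> UNIV) (\<lambda>(p, c) (q, d). X p q $ c $ d)"
    by (rule inorm_matrices) simp
  also have "\<dots> = opnorm (({..<k} \<times> (UNIV :: 'n set)) \<times> {..<r}) (({..<k} \<times> UNIV) \<times> {..<r})
     (\<lambda>p q. (\<lambda>(p, c) (q, d). X p q $ c $ d) ((\<lambda>((i, c), s). ((i, s), c)) p) ((\<lambda>((i, c), s). ((i, s), c)) q))"
    by (rule opnorm_reindex[symmetric])
      (auto intro!: bij_betw_byWitness[where f' = "\<lambda>((i, s), c). ((i, c), s)"])
  also have "\<dots> = opnorm (({..<k} \<times> (UNIV :: 'n set)) \<times> {..<r}) (({..<k} \<times> UNIV) \<times> {..<r})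
     (\<lambda>(p, s) (q, t). g ((\<lambda>(i, c) (j, d). u i j $ c $ d) p q) s t)"
    by (rule opnorm_cong) (auto simp: X_def)
  also have "\<dots> \<le> inorm E ({..<k} \<times> UNIV) (\<lambda>(i, c) (j, d). u i j $ c $ d)"
    by (rule inorm_cc_le[OF _ g]) simp
  finally show ?thesis .
qed

text \<open>The embedding of \<open>M_n\<close> into matrices indexed by natural numbers.\<close>

definition matrix_embedding :: "complex ^ 'n ^ 'n \<Rightarrow> nat \<Rightarrow> nat \<Rightarrow> complex" where
  "matrix_embedding A = (\<lambda>a b. A $ enumeration UNIV a $ enumeration UNIV b)"

lemma cc_matrix_embedding:
  "completely_contractive (matrices :: (complex ^ 'n ^ 'n) opspace) (matrices_nat CARD('n)) matrix_embedding"
  unfolding completely_contractive_def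
proof (intro conjI allI)
  have "vector_space (smult (matrices :: (complex ^ 'n ^ 'n) opspace))"
    by unfold_locales (simp_all add: matrices_def vec_eq_iff algebra_simps)
  moreover have "vector_space (smult (matrices_nat CARD('n)))"
    unfolding matrices_nat_def by (simp add: vector_space_fun2)
  ultimately show "Vector_Spaces.linear (smult matrices) (smult (matrices_nat CARD('n))) (matrix_embedding :: complex ^ 'n ^ 'n \<Rightarrow> _)"
    by (simp add: Vector_Spaces.linear_iff matrix_embedding_def matrices_def matrices_nat_def fun_eq_iff)
next
  fix k and X :: "nat \<Rightarrow> nat \<Rightarrow> complex ^ 'n ^ 'n"
  let ?e = "map_prod (id :: nat \<Rightarrow> nat) (enumeration (UNIV :: 'n set))"
  have e: "bij_betw ?e ({..<k} \<times> {..<CARD('n)}) ({..<k} \<times> UNIV)"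
    by (intro bij_betw_map_prod bij_enumeration finite bij_betw_id)
  have "opnorm ({..<k} \<times> {..<CARD('n)}) ({..<k} \<times> {..<CARD('n)}) (\<lambda>p q. (\<lambda>(i, a) (j, b). X i j $ a $ b) (?e p) (?e q))
     = opnorm ({..<k} \<times> UNIV) ({..<k} \<times> UNIV) (\<lambda>(i, a) (j, b). X i j $ a $ b)"
    by (rule opnorm_reindex[OF e e]) auto
  then show "mnorm (matrices_nat CARD('n)) k (\<lambda>i j. matrix_embedding (X i j)) \<le> mnorm matrices k X"
    by (simp add: matrices_nat_def matrices_def matrix_embedding_def map_prod_def case_prod_unfold)
qed

context ruan_seminorm
begin

text \<open>
  The supremum that defines the minimal tensor norm is attained by the embedding of \<open>M_n\<close> and a
  complete contraction on \<open>E\<close> that norms the amplified matrix.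
\<close>

theorem mnorm_S_inf:
  fixes u :: "nat \<Rightarrow> nat \<Rightarrow> 'e ^ 'n ^ 'n"
  shows "mnorm (S_inf E) k u = inorm E ({..<k} \<times> UNIV) (\<lambda>(i, c) (j, d). u i j $ c $ d)"
proof -
  let ?S = "{opnorm ({..<k} \<times> {..<m} \<times> {..<r}) ({..<k} \<times> {..<m} \<times> {..<r})
         (\<lambda>(i, a, s) (j, b, t). \<Sum>c\<in>UNIV. \<Sum>d\<in>UNIV. f (matrix_unit c d) a b * g (u i j $ c $ d) s t)
       | m r (f :: complex ^ 'n ^ 'n \<Rightarrow> nat \<Rightarrow> nat \<Rightarrow> complex) (g :: 'e \<Rightarrow> nat \<Rightarrow> nat \<Rightarrow> complex).
         completely_contractive matrices (matrices_nat m) f \<and>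
         completely_contractive E (matrices_nat r) g}"
  let ?N = "inorm E ({..<k} \<times> UNIV) (\<lambda>(i, c) (j, d). u i j $ c $ d)"
  have up: "x \<le> ?N" if "x \<in> ?S" for x
    using that by (auto intro!: min_tensor_le)
  then have bdd: "bdd_above ?S" by (rule bdd_aboveI)
  have mem: "opnorm (({..<k} \<times> UNIV) \<times> {..<r}) (({..<k} \<times> UNIV) \<times> {..<r})
      (\<lambda>(p, s) (q, t). g ((\<lambda>(i, c) (j, d). u i j $ c $ d) p q) s t) \<in> ?S"
    if g: "completely_contractive E (matrices_nat r) g" for r g
  proof -
    let ?n = "CARD('n)" let ?d = "enumeration (UNIV :: 'n set)"
    let ?e = "\<lambda>(i :: nat, a :: nat, s :: nat). ((i, ?d a), s)"
    have d: "bij_betw ?d {..<?n} UNIV" by (rule bij_enumeration) simp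
    have e: "bij_betw ?e ({..<k} \<times> {..<?n} \<times> {..<r}) (({..<k} \<times> UNIV) \<times> {..<r})"
    proof (rule bij_betw_byWitness[where f' = "\<lambda>((i, c), s). (i, the_inv_into {..<?n} ?d c, s)"])
      show "\<forall>p\<in>{..<k} \<times> {..<?n} \<times> {..<r}. (\<lambda>((i, c), s). (i, the_inv_into {..<?n} ?d c, s)) (?e p) = p"
        using d by (auto simp: bij_betw_def the_inv_into_f_f)
      show "\<forall>p\<in>({..<k} \<times> UNIV) \<times> {..<r}. ?e ((\<lambda>((i, c), s). (i, the_inv_into {..<?n} ?d c, s)) p) = p"
        using d by (auto simp: f_the_inv_into_f_bij_betw)
      show "(\<lambda>((i, c), s). (i, the_inv_into {..<?n} ?d c, s)) ` (({..<k} \<times> UNIV) \<times> {..<r}) \<subseteq> {..<k} \<times> {..<?n} \<times> {..<r}"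
        using bij_betwE[OF bij_betw_the_inv_into[OF d]] by auto
    qed auto
    have "opnorm (({..<k} \<times> UNIV) \<times> {..<r}) (({..<k} \<times> UNIV) \<times> {..<r})
        (\<lambda>(p, s) (q, t). g ((\<lambda>(i, c) (j, d). u i j $ c $ d) p q) s t)
      = opnorm ({..<k} \<times> {..<?n} \<times> {..<r}) ({..<k} \<times> {..<?n} \<times> {..<r})
        (\<lambda>p q. (\<lambda>(p, s) (q, t). g ((\<lambda>(i, c) (j, d). u i j $ c $ d) p q) s t) (?e p) (?e q))"
      by (rule opnorm_reindex[OF e e, symmetric]) auto
    also have "\<dots> = opnorm ({..<k} \<times> {..<?n} \<times> {..<r}) ({..<k} \<times> {..<?n} \<times> {..<r})
         (\<lambda>(i, a, s) (j, b, t). \<Sum>c\<in>UNIV. \<Sum>d\<in>UNIV. matrix_embedding (matrix_unit c d) a b * g (u i j $ c $ d) s t)"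
    proof (rule opnorm_cong)
      fix p q assume "p \<in> {..<k} \<times> {..<?n} \<times> {..<r}" "q \<in> {..<k} \<times> {..<?n} \<times> {..<r}"
      obtain i a s j b t where pq: "p = (i, a, s)" "q = (j, b, t)" by (metis prod_cases3)
      have "(\<Sum>c\<in>UNIV. \<Sum>d\<in>UNIV. matrix_embedding (matrix_unit c d) a b * g (u i j $ c $ d) s t)
        = (\<Sum>c\<in>UNIV. \<Sum>d\<in>UNIV. if ?d b = d then if ?d a = c then g (u i j $ c $ d) s t else 0 else 0)"
        by (intro sum.cong refl) (auto simp: matrix_embedding_def matrix_unit_def)
      also have "\<dots> = g (u i j $ ?d a $ ?d b) s t" by simp
      finally show "(\<lambda>(p, s) (q, t). g ((\<lambda>(i, c) (j, d). u i j $ c $ d) p q) s t) (?e p) (?e q)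
        = (\<lambda>(i, a, s) (j, b, t). \<Sum>c\<in>UNIV. \<Sum>d\<in>UNIV. matrix_embedding (matrix_unit c d) a b * g (u i j $ c $ d) s t) p q"
        by (simp add: pq)
    qed
    finally show ?thesis using cc_matrix_embedding g by blast
  qed
  have "vector_space (smult (matrices_nat 0))"
    unfolding matrices_nat_def by (simp add: vector_space_fun2)
  moreover have "opnorm {} {} A = 0" for A :: "nat \<times> nat \<Rightarrow> nat \<times> nat \<Rightarrow> complex"
    using opnorm_empty(1)[of "{}" A] opnorm_nonneg[of "{}" "{}" A] by simp
  ultimately have zero: "completely_contractive E (matrices_nat 0) (\<lambda>_ _ _. 0)"
    using nonneg vector_space_axioms
    by (simp add: completely_contractive_def Vector_Spaces.linear_iff matrices_nat_def fun_eq_iff)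
  have "mnorm (S_inf E) k u = Sup ?S" by (simp add: S_inf_def)
  also have "\<dots> = ?N"
  proof (rule antisym)
    have "?S \<noteq> {}"
    proof
      assume "?S = {}"
      from equals0D[OF this] mem[OF zero] show False by (rule notE)
    qed
    then show "Sup ?S \<le> ?N" by (rule cSup_least) (rule up)
    show "?N \<le> Sup ?S"
    proof (rule inorm_le_cc)
      show "0 \<le> Sup ?S"
        by (rule order_trans[OF opnorm_nonneg cSup_upper[OF mem[OF zero] bdd]]) auto
      show "opnorm (({..<k} \<times> UNIV) \<times> {..<r}) (({..<k} \<times> UNIV) \<times> {..<r})
        (\<lambda>(p, s) (q, t). g ((\<lambda>(i, c) (j, d). u i j $ c $ d) p q) s t) \<le> Sup ?S"
        if "completely_contractive E (matrices_nat r) g" for r g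
        by (rule cSup_upper[OF mem[OF that] bdd])
    qed simp
  qed
  finally show ?thesis .
qed

lemma inorm_S_inf:
  fixes u :: "'i \<Rightarrow> 'i \<Rightarrow> 'e ^ 'n ^ 'n"
  assumes fin: "finite I"
  shows "inorm (S_inf E) I u = inorm E (I \<times> UNIV) (\<lambda>(i, c) (j, d). u i j $ c $ d)"
proof -
  let ?e = "map_prod (enumeration I) (id :: 'n \<Rightarrow> 'n)"
  have e: "bij_betw ?e ({..<card I} \<times> UNIV) (I \<times> UNIV)"
    by (intro bij_betw_map_prod bij_enumeration fin bij_betw_id)
  show ?thesis
    using inorm_reindex[OF e, of "\<lambda>(i, c) (j, d). u i j $ c $ d"] fin
    by (simp add: inorm_def[of "S_inf E"] mnorm_S_inf map_prod_def case_prod_unfold)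
qed

lemma inorm_mult_amplified:
  fixes I :: "'i set" and J :: "'j set" and K :: "'k set"
  assumes fin: "finite I" "finite J" "finite K"
  shows "inorm E (I \<times> K) (\<lambda>(i, c) (j, d). \<Sum>a\<in>J. \<Sum>b\<in>J. smult E (\<alpha> i a * \<beta> b j) (x (a, c) (b, d)))
    \<le> opnorm I J \<alpha> * inorm E (J \<times> K) x * opnorm J I \<beta>"
proof -
  define P where "P = (\<lambda>(i :: 'i, c :: 'k) (a :: 'j, c'). if c = c' then \<alpha> i a else 0)"
  define R where "R = (\<lambda>(b :: 'j, d' :: 'k) (j :: 'i, d). if d' = d then \<beta> b j else 0)"
  have P: "opnorm (I \<times> K) (J \<times> K) P \<le> opnorm I J \<alpha>"
    unfolding P_def by (intro opnorm_block_diagonal opnorm_nonneg fin) auto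
  have R: "opnorm (J \<times> K) (I \<times> K) R \<le> opnorm J I \<beta>"
    unfolding R_def by (intro opnorm_block_diagonal opnorm_nonneg fin) auto
  have "inorm E (I \<times> K) (\<lambda>(i, c) (j, d). \<Sum>a\<in>J. \<Sum>b\<in>J. smult E (\<alpha> i a * \<beta> b j) (x (a, c) (b, d)))
    = inorm E (I \<times> K) (\<lambda>p q. \<Sum>s\<in>J \<times> K. \<Sum>t\<in>J \<times> K. smult E (P p s * R t q) (x s t))"
  proof (rule inorm_cong)
    fix p q assume "p \<in> I \<times> K" "q \<in> I \<times> K"
    then obtain i c j d where pq: "p = (i, c)" "q = (j, d)" and cd: "c \<in> K" "d \<in> K" by auto
    have "(\<Sum>s\<in>J \<times> K. \<Sum>t\<in>J \<times> K. smult E (P p s * R t q) (x s t))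
      = (\<Sum>a\<in>J. \<Sum>c'\<in>K. \<Sum>b\<in>J. \<Sum>d'\<in>K. if d' = d then if c' = c then smult E (\<alpha> i a * \<beta> b j) (x (a, c) (b, d)) else 0 else 0)"
      unfolding sum_Times pq by (intro sum.cong refl) (auto simp: P_def R_def)
    also have "\<dots> = (\<Sum>a\<in>J. \<Sum>c'\<in>K. if c' = c then \<Sum>b\<in>J. smult E (\<alpha> i a * \<beta> b j) (x (a, c) (b, d)) else 0)"
      using cd fin by (intro sum.cong refl) simp
    finally show "(\<lambda>(i, c) (j, d). \<Sum>a\<in>J. \<Sum>b\<in>J. smult E (\<alpha> i a * \<beta> b j) (x (a, c) (b, d))) p q
      = (\<Sum>s\<in>J \<times> K. \<Sum>t\<in>J \<times> K. smult E (P p s * R t q) (x s t))"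
      using cd fin by (simp add: pq)
  qed (use fin in auto)
  also have "\<dots> \<le> opnorm I J \<alpha> * inorm E (J \<times> K) x * opnorm J I \<beta>"
    by (rule inorm_mult_le) (use fin P R in auto)
  finally show ?thesis .
qed

theorem ruan_seminorm_S_inf: "ruan_seminorm (S_inf E :: ('e ^ 'n ^ 'n) opspace)"
proof -
  interpret S: vector_space "smult (S_inf E :: ('e ^ 'n ^ 'n) opspace)"
    unfolding S_inf_def opspace.simps by (rule vector_space_entrywise[OF vector_space_axioms])
  show ?thesis
  proof unfold_locales
    fix k and x y :: "nat \<Rightarrow> nat \<Rightarrow> 'e ^ 'n ^ 'n"
    assume "\<And>i j. i < k \<Longrightarrow> j < k \<Longrightarrow> x i j = y i j"
    then show "mnorm (S_inf E) k x = mnorm (S_inf E) k y"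
      unfolding mnorm_S_inf by (intro inorm_cong) auto
  next
    show "0 \<le> mnorm (S_inf E) k x" for k and x :: "nat \<Rightarrow> nat \<Rightarrow> 'e ^ 'n ^ 'n"
      unfolding mnorm_S_inf by (rule inorm_nonneg)
  next
    fix k l and x y :: "nat \<Rightarrow> nat \<Rightarrow> 'e ^ 'n ^ 'n"
    let ?z = "\<lambda>i j. if i < k \<and> j < k then x i j else if k \<le> i \<and> k \<le> j then y (i - k) (j - k) else 0"
    let ?Z = "\<lambda>(i, c) (j, d). ?z i j $ c $ d"
    have "{..<k + l} \<times> UNIV = {..<k} \<times> (UNIV :: 'n set) \<union> {k..<k + l} \<times> UNIV" by auto
    moreover have "inorm E ({..<k} \<times> UNIV \<union> {k..<k + l} \<times> UNIV) ?Z
        \<le> max (inorm E ({..<k} \<times> UNIV) ?Z) (inorm E ({k..<k + l} \<times> UNIV) ?Z)"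
      by (rule inorm_disjoint_union) auto
    moreover have "inorm E ({..<k} \<times> UNIV) ?Z = mnorm (S_inf E) k x"
      unfolding mnorm_S_inf by (rule inorm_cong) auto
    moreover have "inorm E ({k..<k + l} \<times> UNIV) ?Z = mnorm (S_inf E) l y"
    proof -
      have "bij_betw (\<lambda>(i, c). (i + k, c)) ({..<l} \<times> (UNIV :: 'n set)) ({k..<k + l} \<times> UNIV)"
        by (rule bij_betw_byWitness[where f' = "\<lambda>(i, c). (i - k, c)"]) auto
      from inorm_reindex[OF this, of ?Z] show ?thesis
        unfolding mnorm_S_inf by (simp add: case_prod_unfold)
    qed
    ultimately show "mnorm (S_inf E) (k + l) ?z \<le> max (mnorm (S_inf E) k x) (mnorm (S_inf E) l y)"
      unfolding mnorm_S_inf[of "k + l"] by simp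
  next
    fix k l \<alpha> \<beta> and x :: "nat \<Rightarrow> nat \<Rightarrow> 'e ^ 'n ^ 'n"
    show "mnorm (S_inf E) l (\<lambda>i j. \<Sum>a<k. \<Sum>b<k. smult (S_inf E) (\<alpha> i a * \<beta> b j) (x a b))
      \<le> opnorm {..<l} {..<k} \<alpha> * mnorm (S_inf E) k x * opnorm {..<k} {..<l} \<beta>"
      using inorm_mult_amplified[of "{..<l}" "{..<k}" "UNIV :: 'n set" \<alpha> \<beta> "\<lambda>(i, c) (j, d). x i j $ c $ d"]
      unfolding mnorm_S_inf by (simp add: S_inf_def entrywise_def case_prod_unfold)
  qed
qed

end


section \<open>Scalar matrices\<close>

lemma opnorm_add:
  assumes fin: "finite I" "finite J"
  shows "opnorm I J (\<lambda>i j. A i j + B i j) \<le> opnorm I J A + opnorm I J B"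
proof (rule opnorm_le)
  fix x :: "_ \<Rightarrow> complex"
  have "L2_set (\<lambda>i. cmod (\<Sum>j\<in>J. (A i j + B i j) * x j)) I
     \<le> L2_set (\<lambda>i. cmod (\<Sum>j\<in>J. A i j * x j) + cmod (\<Sum>j\<in>J. B i j * x j)) I"
    by (rule L2_set_mono) (simp_all add: distrib_right sum.distrib norm_triangle_ineq)
  also have "\<dots> \<le> L2_set (\<lambda>i. cmod (\<Sum>j\<in>J. A i j * x j)) I + L2_set (\<lambda>i. cmod (\<Sum>j\<in>J. B i j * x j)) I"
    by (rule L2_set_triangle_ineq)
  also have "\<dots> \<le> opnorm I J A * L2_set (\<lambda>j. cmod (x j)) J + opnorm I J B * L2_set (\<lambda>j. cmod (x j)) J"
    by (intro add_mono opnorm_apply fin)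
  finally show "L2_set (\<lambda>i. cmod (\<Sum>j\<in>J. (A i j + B i j) * x j)) I
     \<le> (opnorm I J A + opnorm I J B) * L2_set (\<lambda>j. cmod (x j)) J" by (simp only: distrib_right)
qed (simp add: opnorm_nonneg fin)

lemma opnorm_sum:
  assumes fin: "finite I" "finite J"
  shows "opnorm I J (\<lambda>i j. \<Sum>\<kappa>\<in>K. A \<kappa> i j) \<le> (\<Sum>\<kappa>\<in>K. opnorm I J (A \<kappa>))"
proof (induction K rule: infinite_finite_induct)
  case (insert \<kappa> K)
  then show ?case using opnorm_add[OF fin, of "A \<kappa>" "\<lambda>i j. \<Sum>\<kappa>\<in>K. A \<kappa> i j"] by simp
qed (auto intro!: opnorm_le simp: L2_set_def)

lemma opnorm_mult_le:
  assumes fin: "finite I" "finite J" "finite K" and "opnorm I J A \<le> a" "opnorm J K B \<le> b"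
  shows "opnorm I K (\<lambda>i k. \<Sum>j\<in>J. A i j * B j k) \<le> a * b"
proof -
  have "opnorm I J A * opnorm J K B \<le> a * b"
    using assms opnorm_nonneg[OF fin(1,2), of A] opnorm_nonneg[OF fin(2,3), of B]
    by (intro mult_mono) auto
  then show ?thesis by (rule order_trans[OF opnorm_mult[OF fin]])
qed

lemma opnorm_compress:
  assumes fin: "finite I" "finite J" "finite I'" "finite J'"
    and f: "inj_on f I" "f ` I \<subseteq> I'" and g: "inj_on g J" "g ` J \<subseteq> J'"
  shows "opnorm I J (\<lambda>i j. A (f i) (g j)) \<le> opnorm I' J' A"
proof -
  define P where "P = (\<lambda>i i'. if f i = i' then (1::complex) else 0)"
  define R where "R = (\<lambda>j j'. if g j = j' then (1::complex) else 0)"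
  have P: "opnorm I I' P \<le> 1" unfolding P_def by (intro opnorm_partial_injection fin f)
  have R: "opnorm J' J (\<lambda>j' j. cnj (R j j')) \<le> 1"
    by (rule order_trans[OF opnorm_adjoint])
      (use fin g in \<open>auto simp: R_def intro: opnorm_partial_injection\<close>)
  have "opnorm I J (\<lambda>i j. A (f i) (g j)) = opnorm I J (\<lambda>i j. \<Sum>j'\<in>J'. (\<Sum>i'\<in>I'. P i i' * A i' j') * cnj (R j j'))"
  proof (rule opnorm_cong)
    fix i j assume ij: "i \<in> I" "j \<in> J"
    have "(\<Sum>j'\<in>J'. (\<Sum>i'\<in>I'. P i i' * A i' j') * cnj (R j j')) = (\<Sum>j'\<in>J'. if g j = j' then (\<Sum>i'\<in>I'. if f i = i' then A i' j' else 0) else 0)"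
      by (rule sum.cong) (auto simp: P_def R_def if_distrib[of "\<lambda>t. t * _"] cong: if_cong)
    then show "A (f i) (g j) = (\<Sum>j'\<in>J'. (\<Sum>i'\<in>I'. P i i' * A i' j') * cnj (R j j'))"
      using ij f g fin by (simp add: image_subset_iff)
  qed
  also have "\<dots> \<le> (1 * opnorm I' J' A) * 1"
    by (intro opnorm_mult_le fin P R order_refl)
  finally show ?thesis by simp
qed

lemma opnorm_tensor:
  fixes I :: "'i set" and J :: "'j set" and P :: "'p set" and Q :: "'q set"
  assumes fin: "finite I" "finite J" "finite P" "finite Q"
  shows "opnorm (I \<times> P) (J \<times> Q) (\<lambda>(i, p) (j, q). A i j * B p q) \<le> opnorm I J A * opnorm P Q B"
proof -
  define A' where "A' = (\<lambda>(i :: 'i, p :: 'p) (j :: 'j, p'). if p = p' then A i j else 0)"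
  define B' where "B' = (\<lambda>(p :: 'p, j :: 'j) (q :: 'q, j'). if j = j' then B p q else 0)"
  have A': "opnorm (I \<times> P) (J \<times> P) A' \<le> opnorm I J A"
    unfolding A'_def by (intro opnorm_block_diagonal opnorm_nonneg fin) auto
  have B': "opnorm (P \<times> J) (Q \<times> J) B' \<le> opnorm P Q B"
    unfolding B'_def by (intro opnorm_block_diagonal opnorm_nonneg fin) auto
  have "opnorm (J \<times> P) (J \<times> Q) (\<lambda>x y. B' (prod.swap x) (prod.swap y)) = opnorm (P \<times> J) (Q \<times> J) B'"
    by (rule opnorm_reindex) (use fin in \<open>auto intro!: bij_betw_byWitness[where f' = prod.swap]\<close>)
  then have B'': "opnorm (J \<times> P) (J \<times> Q) (\<lambda>x y. B' (prod.swap x) (prod.swap y)) \<le> opnorm P Q B"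
    using B' by simp
  have "opnorm (I \<times> P) (J \<times> Q) (\<lambda>(i, p) (j, q). A i j * B p q)
    = opnorm (I \<times> P) (J \<times> Q) (\<lambda>x y. \<Sum>z\<in>J \<times> P. A' x z * B' (prod.swap z) (prod.swap y))"
  proof (rule opnorm_cong)
    fix x y assume "x \<in> I \<times> P" "y \<in> J \<times> Q"
    then obtain i p j q where xy: "x = (i, p)" "y = (j, q)" and mem: "p \<in> P" "j \<in> J" by auto
    have "(\<Sum>z\<in>J \<times> P. A' x z * B' (prod.swap z) (prod.swap y))
      = (\<Sum>j'\<in>J. \<Sum>p'\<in>P. if p = p' then if j' = j then A i j * B p q else 0 else 0)"
      unfolding sum_Times xy by (intro sum.cong refl) (auto simp: A'_def B'_def)
    then show "(\<lambda>(i, p) (j, q). A i j * B p q) x y = (\<Sum>z\<in>J \<times> P. A' x z * B' (prod.swap z) (prod.swap y))"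
      using mem fin by (simp add: xy)
  qed
  also have "\<dots> \<le> opnorm I J A * opnorm P Q B"
    by (rule opnorm_mult_le) (use fin A' B'' in auto)
  finally show ?thesis .
qed

text \<open>The two blocks send orthogonal subspaces to orthogonal subspaces.\<close>

lemma opnorm_two_blocks:
  assumes fin: "finite I" "finite J" and C: "0 \<le> C"
    and sub: "I1 \<subseteq> I" "I2 \<subseteq> I" "J1 \<subseteq> J" "J2 \<subseteq> J" and disj: "I1 \<inter> I2 = {}" "J1 \<inter> J2 = {}"
    and zero: "\<And>i j. i \<in> I \<Longrightarrow> j \<in> J \<Longrightarrow> \<not> (i \<in> I1 \<and> j \<in> J1) \<Longrightarrow> \<not> (i \<in> I2 \<and> j \<in> J2) \<Longrightarrow> A i j = 0"
    and A: "opnorm I1 J1 A \<le> C" "opnorm I2 J2 A \<le> C"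
  shows "opnorm I J A \<le> C"
proof (rule opnorm_le[OF _ C])
  fix x :: "_ \<Rightarrow> complex"
  have fin': "finite I1" "finite I2" "finite J1" "finite J2"
    using fin sub finite_subset by blast+
  define y where "y = (\<lambda>i. \<Sum>j\<in>J. A i j * x j)"
  have z1: "A i j = 0" if "i \<in> I1" "j \<in> J - J1" for i j
    using zero[of i j] sub disj that by blast
  have z2: "A i j = 0" if "i \<in> I2" "j \<in> J - J2" for i j
    using zero[of i j] sub disj that by blast
  have y1: "y i = (\<Sum>j\<in>J1. A i j * x j)" if "i \<in> I1" for i
    unfolding y_def by (rule sum.mono_neutral_right) (use fin sub z1[OF that] in auto)
  have y2: "y i = (\<Sum>j\<in>J2. A i j * x j)" if "i \<in> I2" for i
    unfolding y_def by (rule sum.mono_neutral_right) (use fin sub z2[OF that] in auto)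
  have y0: "y i = 0" if "i \<in> I" "i \<notin> I1" "i \<notin> I2" for i
    unfolding y_def using zero that by (intro sum.neutral) auto
  have "(L2_set (\<lambda>i. cmod (y i)) I)\<^sup>2 = (\<Sum>i\<in>I1 \<union> I2. (cmod (y i))\<^sup>2)"
    unfolding L2_set_power2 by (rule sum.mono_neutral_right) (use fin sub y0 in auto)
  also have "\<dots> = (\<Sum>i\<in>I1. (cmod (y i))\<^sup>2) + (\<Sum>i\<in>I2. (cmod (y i))\<^sup>2)"
    by (rule sum.union_disjoint) (use fin' disj in auto)
  also have "\<dots> = (L2_set (\<lambda>i. cmod (\<Sum>j\<in>J1. A i j * x j)) I1)\<^sup>2 + (L2_set (\<lambda>i. cmod (\<Sum>j\<in>J2. A i j * x j)) I2)\<^sup>2"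
    unfolding L2_set_power2 using y1 y2 by simp
  also have "\<dots> \<le> (C * L2_set (\<lambda>j. cmod (x j)) J1)\<^sup>2 + (C * L2_set (\<lambda>j. cmod (x j)) J2)\<^sup>2"
    by (intro add_mono power_mono order_trans[OF opnorm_apply mult_right_mono] A fin') auto
  also have "\<dots> = C\<^sup>2 * ((\<Sum>j\<in>J1. (cmod (x j))\<^sup>2) + (\<Sum>j\<in>J2. (cmod (x j))\<^sup>2))"
    unfolding power_mult_distrib L2_set_power2 by (simp only: distrib_left)
  also have "(\<Sum>j\<in>J1. (cmod (x j))\<^sup>2) + (\<Sum>j\<in>J2. (cmod (x j))\<^sup>2) = (\<Sum>j\<in>J1 \<union> J2. (cmod (x j))\<^sup>2)"
    by (rule sum.union_disjoint[symmetric]) (use fin' disj in auto)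
  also have "\<dots> \<le> (\<Sum>j\<in>J. (cmod (x j))\<^sup>2)" by (rule sum_mono2) (use fin sub in auto)
  finally have "(L2_set (\<lambda>i. cmod (y i)) I)\<^sup>2 \<le> (C * L2_set (\<lambda>j. cmod (x j)) J)\<^sup>2"
    unfolding power_mult_distrib L2_set_power2 by (simp add: mult_left_mono)
  then show "L2_set (\<lambda>i. cmod (\<Sum>j\<in>J. A i j * x j)) I \<le> C * L2_set (\<lambda>j. cmod (x j)) J"
    unfolding y_def by (rule power2_le_imp_le) (simp add: C)
qed

theorem ruan_seminorm_scalars: "ruan_seminorm scalars"
proof -
  interpret vector_space "smult scalars"
    by unfold_locales (simp_all add: scalars_def algebra_simps)
  show ?thesis
  proof unfold_locales
    show "mnorm scalars k x = mnorm scalars k y" if "\<And>i j. i < k \<Longrightarrow> j < k \<Longrightarrow> x i j = y i j" for k x y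
      unfolding scalars_def opspace.simps using that by (intro opnorm_cong) auto
    show "0 \<le> mnorm scalars k x" for k x
      unfolding scalars_def opspace.simps by (rule opnorm_nonneg) auto
  next
    fix k l and x y :: "nat \<Rightarrow> nat \<Rightarrow> complex"
    let ?A = "\<lambda>i j. if i < k \<and> j < k then x i j else if k \<le> i \<and> k \<le> j then y (i - k) (j - k) else 0"
    have 1: "opnorm {..<k} {..<k} ?A = mnorm scalars k x"
      unfolding scalars_def opspace.simps by (rule opnorm_cong) auto
    have b: "bij_betw (\<lambda>i. i + k) {..<l} {k..<k + l}"
      by (rule bij_betw_byWitness[where f' = "\<lambda>i. i - k"]) auto
    have "opnorm {k..<k + l} {k..<k + l} ?A = opnorm {..<l} {..<l} (\<lambda>i j. ?A (i + k) (j + k))"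
      by (rule opnorm_reindex[OF b b, symmetric]) auto
    also have "\<dots> = mnorm scalars l y" unfolding scalars_def opspace.simps by (rule opnorm_cong) auto
    finally have 2: "opnorm {k..<k + l} {k..<k + l} ?A = mnorm scalars l y" .
    have "0 \<le> mnorm scalars k x" unfolding scalars_def opspace.simps by (rule opnorm_nonneg) auto
    then have 0: "0 \<le> max (mnorm scalars k x) (mnorm scalars l y)" by simp
    have "opnorm {..<k + l} {..<k + l} ?A \<le> max (mnorm scalars k x) (mnorm scalars l y)"
    proof (rule opnorm_two_blocks[OF _ _ 0, of _ _ "{..<k}" "{k..<k + l}" "{..<k}" "{k..<k + l}"])
      show "opnorm {..<k} {..<k} ?A \<le> max (mnorm scalars k x) (mnorm scalars l y)"
        unfolding 1 by (rule max.cobounded1)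
      show "opnorm {k..<k + l} {k..<k + l} ?A \<le> max (mnorm scalars k x) (mnorm scalars l y)"
        unfolding 2 by (rule max.cobounded2)
    qed auto
    then show "mnorm scalars (k + l) ?A \<le> max (mnorm scalars k x) (mnorm scalars l y)"
      by (simp add: scalars_def)
  next
    fix k l and \<alpha> \<beta> x :: "nat \<Rightarrow> nat \<Rightarrow> complex"
    have "(\<Sum>a<k. \<Sum>b<k. \<alpha> i a * \<beta> b j * x a b) = (\<Sum>b<k. (\<Sum>a<k. \<alpha> i a * x a b) * \<beta> b j)" for i j
      unfolding sum_distrib_right by (subst sum.swap, intro sum.cong refl) simp
    then show "mnorm scalars l (\<lambda>i j. \<Sum>a<k. \<Sum>b<k. smult scalars (\<alpha> i a * \<beta> b j) (x a b))
      \<le> opnorm {..<l} {..<k} \<alpha> * mnorm scalars k x * opnorm {..<k} {..<l} \<beta>"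
      unfolding scalars_def opspace.simps by (simp only:) (intro opnorm_mult_le order_refl, auto)
  qed
qed

section \<open>The trace class\<close>

text \<open>
  A matrix over \<open>S_1^n\<close> acts on a matrix over \<open>M_n\<close> entrywise through the trace pairing. Its norm is
  the norm of this action; the next lemmas say so for arbitrary finite index sets.
\<close>

definition pairing ::
    "('p \<Rightarrow> 'p \<Rightarrow> complex ^ 'n ^ 'n) \<Rightarrow> ('i \<Rightarrow> 'i \<Rightarrow> complex ^ 'n ^ 'n) \<Rightarrow> 'i \<times> 'p \<Rightarrow> 'i \<times> 'p \<Rightarrow> complex" where
  "pairing V X = (\<lambda>(p, i) (q, j). \<Sum>a\<in>UNIV. \<Sum>b\<in>UNIV. V i j $ a $ b * X p q $ a $ b)"

definition matrix_norm :: "'i set \<Rightarrow> ('i \<Rightarrow> 'i \<Rightarrow> complex ^ 'n ^ 'n) \<Rightarrow> real" where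
  "matrix_norm I X = opnorm (I \<times> UNIV) (I \<times> UNIV) (\<lambda>(i, a) (j, b). X i j $ a $ b)"

lemma matrix_norm_nonneg: "finite I \<Longrightarrow> 0 \<le> matrix_norm I X"
  unfolding matrix_norm_def by (rule opnorm_nonneg) auto

lemma trace_mult_transpose:
  "trace (A ** transpose B) = (\<Sum>a\<in>UNIV. \<Sum>b\<in>UNIV. A $ a $ b * B $ a $ b)" for A B :: "complex ^ 'n ^ 'n"
  by (simp add: trace_def matrix_matrix_mult_def transpose_def)

lemma mnorm_trace_class:
  "mnorm trace_class k V = Sup {opnorm ({..<m} \<times> {..<k}) ({..<m} \<times> {..<k}) (pairing V X) | m X. matrix_norm {..<m::nat} X \<le> 1}"
  by (simp add: trace_class_def matrices_nat_def matrices_def matrix_norm_def trace_mult_transpose pairing_def)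

text \<open>
  The crude bound by the sum over the \<open>n\<^sup>2\<close> matrix entries only serves to make the supremum that
  defines the norm of the trace class finite.
\<close>

lemma pairing_bounded:
  fixes V :: "'p \<Rightarrow> 'p \<Rightarrow> complex ^ 'n ^ 'n"
  assumes fin: "finite I" "finite P"
  shows "opnorm (I \<times> P) (I \<times> P) (pairing V X)
    \<le> (\<Sum>a\<in>UNIV. \<Sum>b\<in>UNIV. opnorm P P (\<lambda>i j. V i j $ a $ b)) * matrix_norm I X"
proof -
  have "opnorm (I \<times> P) (I \<times> P) (pairing V X)
    = opnorm (I \<times> P) (I \<times> P) (\<lambda>x y. \<Sum>a\<in>UNIV. \<Sum>b\<in>UNIV. (\<lambda>(p, i) (q, j). X p q $ a $ b * V i j $ a $ b) x y)"
    by (rule opnorm_cong) (auto simp: pairing_def mult.commute)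
  also have "\<dots> \<le> (\<Sum>a\<in>UNIV. opnorm (I \<times> P) (I \<times> P) (\<lambda>x y. \<Sum>b\<in>UNIV. (\<lambda>(p, i) (q, j). X p q $ a $ b * V i j $ a $ b) x y))"
    by (rule opnorm_sum) (use fin in auto)
  also have "\<dots> \<le> (\<Sum>a\<in>UNIV. \<Sum>b\<in>UNIV. opnorm (I \<times> P) (I \<times> P) (\<lambda>(p, i) (q, j). X p q $ a $ b * V i j $ a $ b))"
    by (intro sum_mono opnorm_sum) (use fin in auto)
  also have "\<dots> \<le> (\<Sum>a\<in>UNIV. \<Sum>b\<in>UNIV. opnorm P P (\<lambda>i j. V i j $ a $ b) * matrix_norm I X)"
  proof (intro sum_mono)
    fix a b :: 'n
    have "opnorm I I (\<lambda>p q. (\<lambda>(i, a) (j, b). X i j $ a $ b) (p, a) (q, b)) \<le> matrix_norm I X"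
      unfolding matrix_norm_def by (rule opnorm_compress) (use fin in \<open>auto simp: inj_on_def\<close>)
    then have X: "opnorm I I (\<lambda>p q. X p q $ a $ b) \<le> matrix_norm I X" by simp
    have "opnorm (I \<times> P) (I \<times> P) (\<lambda>(p, i) (q, j). X p q $ a $ b * V i j $ a $ b)
      \<le> opnorm I I (\<lambda>p q. X p q $ a $ b) * opnorm P P (\<lambda>i j. V i j $ a $ b)"
      by (rule opnorm_tensor) (use fin in auto)
    also have "\<dots> \<le> matrix_norm I X * opnorm P P (\<lambda>i j. V i j $ a $ b)"
      by (rule mult_right_mono[OF X]) (rule opnorm_nonneg[OF fin(2,2)])
    finally show "opnorm (I \<times> P) (I \<times> P) (\<lambda>(p, i) (q, j). X p q $ a $ b * V i j $ a $ b)
      \<le> opnorm P P (\<lambda>i j. V i j $ a $ b) * matrix_norm I X" by (simp only: mult.commute)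
  qed
  finally show ?thesis by (simp only: sum_distrib_right)
qed

lemma trace_class_bdd:
  fixes k :: nat
  shows "bdd_above {opnorm ({..<m} \<times> {..<k}) ({..<m} \<times> {..<k}) (pairing V X) | m X. matrix_norm {..<m::nat} X \<le> 1}"
proof (rule bdd_aboveI)
  let ?C = "\<Sum>a\<in>UNIV. \<Sum>b\<in>UNIV. opnorm {..<k} {..<k} (\<lambda>i j. V i j $ a $ b)"
  fix x assume "x \<in> {opnorm ({..<m} \<times> {..<k}) ({..<m} \<times> {..<k}) (pairing V X) | m X. matrix_norm {..<m::nat} X \<le> 1}"
  then obtain m X where x: "x = opnorm ({..<m} \<times> {..<k}) ({..<m} \<times> {..<k}) (pairing V X)" "matrix_norm {..<m::nat} X \<le> 1"
    by blast
  have "x \<le> ?C * matrix_norm {..<m} X" unfolding x(1) by (rule pairing_bounded) auto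
  also have "\<dots> \<le> ?C * 1" by (rule mult_left_mono[OF x(2)]) (simp add: sum_nonneg opnorm_nonneg)
  finally show "x \<le> ?C" by simp
qed

text \<open>Infima are used through this lemma: a bound is proved for every number above the infimum.\<close>

lemma le_mult_of_greater:
  fixes L t x :: real
  assumes "\<And>r. x < r \<Longrightarrow> L \<le> t * r" "0 \<le> t"
  shows "L \<le> t * x"
proof (rule field_le_epsilon)
  fix e :: real assume e: "0 < e"
  have "L \<le> t * (x + e / (t + 1))" using e assms(2) by (intro assms(1)) simp
  also have "t * (e / (t + 1)) \<le> e" using e assms(2) by (simp add: field_simps)
  then have "t * (x + e / (t + 1)) \<le> t * x + e" by (simp add: distrib_left)
  finally show "L \<le> t * x + e" .
qed

lemma matrix_norm_empty: "matrix_norm {..<0::nat} X \<le> 1"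
  unfolding matrix_norm_def by (rule order_trans[OF opnorm_le[of _ _ _ 0]]) (auto simp: L2_set_def)

lemma trace_class_nonneg: "0 \<le> mnorm trace_class k V"
proof -
  have "opnorm ({..<0} \<times> {..<k}) ({..<0} \<times> {..<k}) (pairing V (\<lambda>_ _ :: nat. 0))
      \<in> {opnorm ({..<m} \<times> {..<k}) ({..<m} \<times> {..<k}) (pairing V X) | m X. matrix_norm {..<m::nat} X \<le> 1}"
    using matrix_norm_empty by blast
  from cSup_upper[OF this trace_class_bdd] show ?thesis
    unfolding mnorm_trace_class by (rule order_trans[OF opnorm_nonneg, rotated 2]) auto
qed

lemma trace_class_apply_nat:
  fixes m k :: nat
  shows "opnorm ({..<m} \<times> {..<k}) ({..<m} \<times> {..<k}) (pairing V X) \<le> mnorm trace_class k V * matrix_norm {..<m} X"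
proof (rule le_mult_of_greater[OF _ trace_class_nonneg])
  fix r assume r: "matrix_norm {..<m} X < r"
  then have r0: "0 < r" using matrix_norm_nonneg[of "{..<m}" X] by simp
  let ?Y = "\<lambda>i j. \<chi> a b. of_real (1 / r) * X i j $ a $ b"
  have "matrix_norm {..<m} ?Y \<le> cmod (of_real (1 / r)) * matrix_norm {..<m} X"
  proof -
    have "matrix_norm {..<m} ?Y = opnorm ({..<m} \<times> UNIV) ({..<m} \<times> UNIV) (\<lambda>x y. of_real (1 / r) * (\<lambda>(i, a) (j, b). X i j $ a $ b) x y)"
      unfolding matrix_norm_def by (rule opnorm_cong) auto
    then show ?thesis unfolding matrix_norm_def by (simp only:) (rule opnorm_scale, auto)
  qed
  also have "\<dots> \<le> 1" using r r0 by (simp add: norm_divide)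
  finally have Y: "matrix_norm {..<m} ?Y \<le> 1" .
  have "opnorm ({..<m} \<times> {..<k}) ({..<m} \<times> {..<k}) (pairing V X)
    = opnorm ({..<m} \<times> {..<k}) ({..<m} \<times> {..<k}) (\<lambda>x y. of_real r * pairing V ?Y x y)"
    by (rule opnorm_cong) (use r0 in \<open>auto simp: pairing_def sum_distrib_left\<close>)
  also have "\<dots> \<le> cmod (of_real r) * opnorm ({..<m} \<times> {..<k}) ({..<m} \<times> {..<k}) (pairing V ?Y)"
    by (rule opnorm_scale) auto
  also have "\<dots> \<le> r * mnorm trace_class k V"
  proof -
    have "opnorm ({..<m} \<times> {..<k}) ({..<m} \<times> {..<k}) (pairing V ?Y) \<le> mnorm trace_class k V"
      unfolding mnorm_trace_class by (rule cSup_upper[OF _ trace_class_bdd]) (use Y in blast)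
    then show ?thesis using r0 by simp
  qed
  finally show "opnorm ({..<m} \<times> {..<k}) ({..<m} \<times> {..<k}) (pairing V X) \<le> mnorm trace_class k V * r"
    by (simp only: mult.commute)
qed

lemma matrix_norm_reindex:
  fixes X :: "'i \<Rightarrow> 'i \<Rightarrow> complex ^ 'n ^ 'n"
  assumes e: "bij_betw e I' I" and fin: "finite I"
  shows "matrix_norm I' (\<lambda>i j. X (e i) (e j)) = matrix_norm I X"
proof -
  have e': "bij_betw (map_prod e (id :: 'n \<Rightarrow> 'n)) (I' \<times> UNIV) (I \<times> UNIV)"
    by (intro bij_betw_map_prod e bij_betw_id)
  show ?thesis
    using opnorm_reindex[OF e' e', of "\<lambda>(i, a) (j, b). X i j $ a $ b"] fin
    by (simp add: matrix_norm_def map_prod_def case_prod_unfold)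
qed

lemma trace_class_apply:
  assumes fin: "finite I" "finite P"
  shows "opnorm (I \<times> P) (I \<times> P) (pairing V X) \<le> inorm trace_class P V * matrix_norm I X"
proof -
  let ?e = "map_prod (enumeration I) (enumeration P)"
  have e: "bij_betw ?e ({..<card I} \<times> {..<card P}) (I \<times> P)"
    by (intro bij_betw_map_prod bij_enumeration fin)
  have "opnorm (I \<times> P) (I \<times> P) (pairing V X)
    = opnorm ({..<card I} \<times> {..<card P}) ({..<card I} \<times> {..<card P}) (\<lambda>x y. pairing V X (?e x) (?e y))"
    by (rule opnorm_reindex[OF e e, symmetric]) (use fin in auto)
  also have "(\<lambda>x y. pairing V X (?e x) (?e y))
    = pairing (\<lambda>i j. V (enumeration P i) (enumeration P j)) (\<lambda>i j. X (enumeration I i) (enumeration I j))"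
    by (simp add: pairing_def map_prod_def case_prod_unfold)
  also have "opnorm ({..<card I} \<times> {..<card P}) ({..<card I} \<times> {..<card P}) \<dots>
    \<le> inorm trace_class P V * matrix_norm I X"
    unfolding inorm_def matrix_norm_reindex[OF bij_enumeration[OF fin(1)] fin(1), of X, symmetric]
    by (rule trace_class_apply_nat)
  finally show ?thesis .
qed

lemma trace_class_le:
  fixes V :: "'p \<Rightarrow> 'p \<Rightarrow> complex ^ 'n ^ 'n"
  assumes fin: "finite P" and C: "0 \<le> C"
    and *: "\<And>m X. opnorm ({..<m::nat} \<times> P) ({..<m} \<times> P) (pairing V X) \<le> C * matrix_norm {..<m} X"
  shows "inorm trace_class P V \<le> C"
  unfolding inorm_def mnorm_trace_class
proof (rule cSup_least)
  have "matrix_norm {..<0::nat} (\<lambda>_ _. 0 :: complex ^ 'n ^ 'n) \<le> 1" by (rule matrix_norm_empty)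
  then show "{opnorm ({..<m} \<times> {..<card P}) ({..<m} \<times> {..<card P})
      (pairing (\<lambda>i j. V (enumeration P i) (enumeration P j)) X) |m X. matrix_norm {..<m::nat} X \<le> 1} \<noteq> {}"
    by blast
next
  fix x assume "x \<in> {opnorm ({..<m} \<times> {..<card P}) ({..<m} \<times> {..<card P})
      (pairing (\<lambda>i j. V (enumeration P i) (enumeration P j)) X) |m X. matrix_norm {..<m::nat} X \<le> 1}"
  then obtain m X where x: "x = opnorm ({..<m} \<times> {..<card P}) ({..<m} \<times> {..<card P})
      (pairing (\<lambda>i j. V (enumeration P i) (enumeration P j)) X)" and X: "matrix_norm {..<m::nat} X \<le> 1" by blast
  let ?e = "map_prod (id :: nat \<Rightarrow> nat) (enumeration P)"
  have e: "bij_betw ?e ({..<m} \<times> {..<card P}) ({..<m} \<times> P)"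
    by (intro bij_betw_map_prod bij_enumeration fin bij_betw_id)
  have "x = opnorm ({..<m} \<times> {..<card P}) ({..<m} \<times> {..<card P}) (\<lambda>x y. pairing V X (?e x) (?e y))"
    unfolding x by (simp add: pairing_def map_prod_def case_prod_unfold)
  also have "\<dots> = opnorm ({..<m} \<times> P) ({..<m} \<times> P) (pairing V X)"
    by (rule opnorm_reindex[OF e e]) (use fin in auto)
  also have "\<dots> \<le> C * matrix_norm {..<m} X" by (rule *)
  also have "\<dots> \<le> C * 1" by (rule mult_left_mono[OF X C])
  finally show "x \<le> C" by simp
qed

lemma inorm_trace_class_nonneg: "0 \<le> inorm trace_class P V"
  unfolding inorm_def by (rule trace_class_nonneg)


section \<open>Projective tensor products with the trace class\<close>

lemma sum_swap4:
  "(\<Sum>a\<in>A. \<Sum>b\<in>B. \<Sum>y\<in>Y. \<Sum>z\<in>Z. G a b y z) = (\<Sum>y\<in>Y. \<Sum>z\<in>Z. \<Sum>a\<in>A. \<Sum>b\<in>B. G a b y z)"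
proof -
  have "(\<Sum>a\<in>A. \<Sum>b\<in>B. \<Sum>y\<in>Y. \<Sum>z\<in>Z. G a b y z) = (\<Sum>a\<in>A. \<Sum>y\<in>Y. \<Sum>z\<in>Z. \<Sum>b\<in>B. G a b y z)"
    by (rule sum.cong[OF refl], rule trans[OF sum.swap], rule sum.cong[OF refl], rule sum.swap)
  also have "\<dots> = (\<Sum>y\<in>Y. \<Sum>z\<in>Z. \<Sum>a\<in>A. \<Sum>b\<in>B. G a b y z)"
    by (rule trans[OF sum.swap], rule sum.cong[OF refl], rule sum.swap)
  finally show ?thesis .
qed

text \<open>The factorization \<open>u = \<alpha> (v \<otimes> w) \<beta>\<close>, entry by entry and over arbitrary index sets.\<close>

definition tensor_factorization ::
    "'e::ab_group_add opspace \<Rightarrow> 'i set \<Rightarrow> 'p set \<Rightarrow> 'q set \<Rightarrow> ('i \<Rightarrow> 'p \<times> 'q \<Rightarrow> complex) \<Rightarrow>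
      ('p \<Rightarrow> 'p \<Rightarrow> complex ^ 'n ^ 'n) \<Rightarrow> ('q \<Rightarrow> 'q \<Rightarrow> 'e) \<Rightarrow> ('p \<times> 'q \<Rightarrow> 'i \<Rightarrow> complex) \<Rightarrow>
      ('i \<Rightarrow> 'i \<Rightarrow> 'e ^ 'n ^ 'n) \<Rightarrow> bool" where
  "tensor_factorization E I P Q \<alpha> v w \<beta> u \<longleftrightarrow> (\<forall>i\<in>I. \<forall>j\<in>I. \<forall>c d. u i j $ c $ d =
     (\<Sum>y\<in>P \<times> Q. \<Sum>z\<in>P \<times> Q. smult E (\<alpha> i y * \<beta> z j * v (fst y) (fst z) $ c $ d) (w (snd y) (snd z))))"

lemma tensor_factorization_reindex:
  assumes e: "bij_betw e I' I" and f: "bij_betw f P' P" and g: "bij_betw g Q' Q"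
    and t: "tensor_factorization E I P Q \<alpha> v w \<beta> u"
  shows "tensor_factorization E I' P' Q' (\<lambda>i y. \<alpha> (e i) (map_prod f g y)) (\<lambda>a b. v (f a) (f b))
    (\<lambda>s t. w (g s) (g t)) (\<lambda>z j. \<beta> (map_prod f g z) (e j)) (\<lambda>i j. u (e i) (e j))"
  unfolding tensor_factorization_def
proof (intro ballI allI)
  fix i j c d assume ij: "i \<in> I'" "j \<in> I'"
  have fg: "bij_betw (map_prod f g) (P' \<times> Q') (P \<times> Q)" by (intro bij_betw_map_prod f g)
  have "e i \<in> I" "e j \<in> I" using ij e by (auto dest: bij_betwE)
  then have "u (e i) (e j) $ c $ d = (\<Sum>y\<in>P \<times> Q. \<Sum>z\<in>P \<times> Q.
      smult E (\<alpha> (e i) y * \<beta> z (e j) * v (fst y) (fst z) $ c $ d) (w (snd y) (snd z)))"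
    using t unfolding tensor_factorization_def by simp
  also have "\<dots> = (\<Sum>y\<in>P' \<times> Q'. \<Sum>z\<in>P' \<times> Q'. smult E (\<alpha> (e i) (map_prod f g y) * \<beta> (map_prod f g z) (e j)
      * v (fst (map_prod f g y)) (fst (map_prod f g z)) $ c $ d) (w (snd (map_prod f g y)) (snd (map_prod f g z))))"
    by (subst sum.reindex_bij_betw[OF fg, symmetric], rule sum.cong[OF refl], rule sum.reindex_bij_betw[OF fg, symmetric])
  finally show "u (e i) (e j) $ c $ d = (\<Sum>y\<in>P' \<times> Q'. \<Sum>z\<in>P' \<times> Q'.
      smult E (\<alpha> (e i) (map_prod f g y) * \<beta> (map_prod f g z) (e j) * v (f (fst y)) (f (fst z)) $ c $ d)
        (w (g (snd y)) (g (snd z))))" by simp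
qed

lemma mult_less_enlarge:
  fixes x y c :: real
  assumes "0 \<le> x" "0 \<le> y" "x * y < c"
  obtains x' y' where "x < x'" "y < y'" "x' * y' < c"
proof -
  define d where "d = min 1 ((c - x * y) / (2 * (x + y + 1)))"
  have d: "0 < d" "d \<le> 1" using assms by (auto simp: d_def)
  have "d * (x + y + 1) \<le> (c - x * y) / (2 * (x + y + 1)) * (x + y + 1)"
    using assms by (intro mult_right_mono) (auto simp: d_def)
  also have "\<dots> = (c - x * y) / 2" using assms by (simp add: field_simps)
  finally have "d * (x + y + 1) < c - x * y" using assms(3) by simp
  moreover have "d * d \<le> d * 1" using d by (intro mult_left_mono) auto
  ultimately have "(x + d) * (y + d) < c" by (simp add: algebra_simps)
  then show thesis using that[of "x + d" "y + d"] d by simp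
qed

lemma inorm_trace_class_lessThan:
  fixes v :: "nat \<Rightarrow> nat \<Rightarrow> complex ^ 'n ^ 'n"
  shows "inorm trace_class {..<p} v = mnorm trace_class p v"
proof (rule antisym)
  show "inorm trace_class {..<p} v \<le> mnorm trace_class p v"
    by (rule trace_class_le) (auto intro: trace_class_nonneg trace_class_apply_nat)
  show "mnorm trace_class p v \<le> inorm trace_class {..<p} v"
    unfolding mnorm_trace_class
  proof (rule cSup_least)
    show "{opnorm ({..<m} \<times> {..<p}) ({..<m} \<times> {..<p}) (pairing v X) |m X. matrix_norm {..<m::nat} X \<le> 1} \<noteq> {}"
      using matrix_norm_empty by blast
    fix x assume "x \<in> {opnorm ({..<m} \<times> {..<p}) ({..<m} \<times> {..<p}) (pairing v X) |m X. matrix_norm {..<m::nat} X \<le> 1}"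
    then obtain m X where x: "x = opnorm ({..<m} \<times> {..<p}) ({..<m} \<times> {..<p}) (pairing v X)"
      and X: "matrix_norm {..<m::nat} X \<le> 1" by blast
    have "x \<le> inorm trace_class {..<p} v * matrix_norm {..<m} X"
      unfolding x by (rule trace_class_apply) auto
    also have "\<dots> \<le> inorm trace_class {..<p} v * 1" by (rule mult_left_mono[OF X inorm_trace_class_nonneg])
    finally show "x \<le> inorm trace_class {..<p} v" by simp
  qed
qed

context ruan_seminorm
begin

lemma mnorm_S_one:
  fixes u :: "nat \<Rightarrow> nat \<Rightarrow> 'e ^ 'n ^ 'n"
  shows "mnorm (S_one E) k u = Inf {opnorm {..<k} ({..<p} \<times> {..<q}) \<alpha> * mnorm trace_class p v * mnorm E q w *
         opnorm ({..<p} \<times> {..<q}) {..<k} \<beta>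
       | p q \<alpha> (v :: nat \<Rightarrow> nat \<Rightarrow> complex ^ 'n ^ 'n) w \<beta>.
         tensor_factorization E {..<k} {..<p} {..<q} \<alpha> v w \<beta> u}"
proof -
  have "(\<forall>i<k. \<forall>j<k. u i j =
           (\<Sum>(a, s)\<in>{..<p} \<times> {..<q}. \<Sum>(b, t)\<in>{..<p} \<times> {..<q}.
              entrywise (smult E) (\<alpha> i (a, s) * \<beta> (b, t) j) (elem_tensor E (v a b) (w s t))))
     \<longleftrightarrow> tensor_factorization E {..<k} {..<p} {..<q} \<alpha> v w \<beta> u"
    for p q :: nat and \<alpha> and v :: "nat \<Rightarrow> nat \<Rightarrow> complex ^ 'n ^ 'n" and w \<beta>
    by (simp add: tensor_factorization_def vec_eq_iff case_prod_unfold entrywise_def elem_tensor_def Ball_def)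
  then show ?thesis by (simp add: S_one_def)
qed

lemma factorization_value_nonneg:
  fixes v :: "nat \<Rightarrow> nat \<Rightarrow> complex ^ 'n ^ 'n" and p q k :: nat
  shows "0 \<le> opnorm {..<k} ({..<p} \<times> {..<q}) \<alpha> * mnorm trace_class p v * mnorm E q w * opnorm ({..<p} \<times> {..<q}) {..<k} \<beta>"
  by (intro mult_nonneg_nonneg opnorm_nonneg trace_class_nonneg nonneg) auto

lemma S_one_le_nat:
  fixes u :: "nat \<Rightarrow> nat \<Rightarrow> 'e ^ 'n ^ 'n"
  assumes "tensor_factorization E {..<k} {..<p} {..<q} \<alpha> v w \<beta> u"
  shows "mnorm (S_one E) k u \<le> opnorm {..<k} ({..<p} \<times> {..<q}) \<alpha> * mnorm trace_class p v * mnorm E q w *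
    opnorm ({..<p} \<times> {..<q}) {..<k} \<beta>"
  unfolding mnorm_S_one
proof (rule cInf_lower)
  show "bdd_below {opnorm {..<k} ({..<p} \<times> {..<q}) \<alpha> * mnorm trace_class p v * mnorm E q w *
         opnorm ({..<p} \<times> {..<q}) {..<k} \<beta>
       | p q \<alpha> (v :: nat \<Rightarrow> nat \<Rightarrow> complex ^ 'n ^ 'n) w \<beta>.
         tensor_factorization E {..<k} {..<p} {..<q} \<alpha> v w \<beta> u}"
    by (rule bdd_belowI[of _ 0]) (auto intro: factorization_value_nonneg)
qed (use assms in blast)

text \<open>In the definition of the norm, \<open>v\<close> and \<open>w\<close> may be indexed by arbitrary finite sets.\<close>

lemma S_one_le:
  fixes u :: "'i \<Rightarrow> 'i \<Rightarrow> 'e ^ 'n ^ 'n" and P :: "'p set" and Q :: "'q set"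
  assumes fin: "finite I" "finite P" "finite Q" and t: "tensor_factorization E I P Q \<alpha> v w \<beta> u"
  shows "inorm (S_one E) I u \<le> opnorm I (P \<times> Q) \<alpha> * inorm trace_class P v * inorm E Q w * opnorm (P \<times> Q) I \<beta>"
proof -
  let ?e = "enumeration I" let ?f = "enumeration P" let ?g = "enumeration Q"
  note e = bij_enumeration[OF fin(1)] and f = bij_enumeration[OF fin(2)] and g = bij_enumeration[OF fin(3)]
  have fg: "bij_betw (map_prod ?f ?g) ({..<card P} \<times> {..<card Q}) (P \<times> Q)" by (intro bij_betw_map_prod f g)
  have finPQ: "finite (P \<times> Q)" using fin by simp
  note t' = tensor_factorization_reindex[OF e f g t]
  have "inorm (S_one E) I u \<le> opnorm {..<card I} ({..<card P} \<times> {..<card Q}) (\<lambda>i y. \<alpha> (?e i) (map_prod ?f ?g y))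
      * mnorm trace_class (card P) (\<lambda>a b. v (?f a) (?f b)) * mnorm E (card Q) (\<lambda>s t. w (?g s) (?g t))
      * opnorm ({..<card P} \<times> {..<card Q}) {..<card I} (\<lambda>z j. \<beta> (map_prod ?f ?g z) (?e j))"
    unfolding inorm_def[of "S_one E"] by (rule S_one_le_nat[OF t'])
  then show ?thesis
    unfolding opnorm_reindex[OF e fg fin(1) finPQ] opnorm_reindex[OF fg e finPQ fin(1)] inorm_def .
qed

text \<open>
  The factorization with \<open>w = u\<close> and \<open>v\<close> the matrix of matrix units, which represents the
  identity of \<open>M_n\<close>, picks out the diagonal of \<open>\<complex>\<^sup>n \<otimes> \<complex>\<^sup>n\<close> by a row and a column of norm \<open>\<surd>n\<close>.
\<close>

lemma S_one_factorization_units: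
  fixes u :: "'i \<Rightarrow> 'i \<Rightarrow> 'e ^ 'n ^ 'n"
  assumes fin: "finite I"
  defines "\<alpha> \<equiv> \<lambda>(i :: 'i) (y :: 'n \<times> 'i \<times> 'n). if fst (snd y) = i \<and> fst y = snd (snd y) then 1 else (0 :: complex)"
  shows "tensor_factorization E I UNIV (I \<times> UNIV) \<alpha> matrix_unit (\<lambda>(i, c) (j, d). u i j $ c $ d) (\<lambda>z j. \<alpha> j z) u"
    "opnorm I (UNIV \<times> I \<times> UNIV) \<alpha> \<le> sqrt CARD('n)"
    "opnorm (UNIV \<times> I \<times> UNIV) I (\<lambda>z j. \<alpha> j z) \<le> sqrt CARD('n)"
    "inorm trace_class UNIV (matrix_unit :: 'n \<Rightarrow> _) \<le> 1"
proof -
  let ?D = "UNIV \<times> I \<times> UNIV :: ('n \<times> 'i \<times> 'n) set"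
  have delta: "(\<Sum>y\<in>?D. \<Sum>z\<in>?D. smult E (\<alpha> i y * \<alpha> j z * matrix_unit (fst y) (fst z) $ c $ d) (F (snd y) (snd z)))
     = F (i, c) (j, d)" if "i \<in> I" "j \<in> I" for i j c d F
  proof -
    have "(\<Sum>y\<in>?D. \<Sum>z\<in>?D. smult E (\<alpha> i y * \<alpha> j z * matrix_unit (fst y) (fst z) $ c $ d) (F (snd y) (snd z)))
      = (\<Sum>y\<in>?D. \<Sum>z\<in>?D. if z = (d, j, d) then if y = (c, i, c) then F (i, c) (j, d) else 0 else 0)"
      by (intro sum.cong refl) (auto simp: \<alpha>_def matrix_unit_def)
    then show ?thesis using that fin by simp
  qed
  show "tensor_factorization E I UNIV (I \<times> UNIV) \<alpha> matrix_unit (\<lambda>(i, c) (j, d). u i j $ c $ d) (\<lambda>z j. \<alpha> j z) u"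
    unfolding tensor_factorization_def using delta by simp
  show 1: "opnorm I ?D \<alpha> \<le> sqrt CARD('n)"
  proof (rule opnorm_scaled_coisometry)
    fix i i' assume i: "i \<in> I" "i' \<in> I"
    have "(\<Sum>y\<in>?D. \<alpha> i y * cnj (\<alpha> i' y)) = (\<Sum>a\<in>(UNIV :: 'n set). \<Sum>j\<in>I. \<Sum>s\<in>UNIV. if s = a then if j = i then if i = i' then 1 else 0 else 0 else 0)"
      unfolding sum_Times by (intro sum.cong refl) (auto simp: \<alpha>_def)
    then show "(\<Sum>y\<in>?D. \<alpha> i y * cnj (\<alpha> i' y)) = (if i = i' then of_real ((sqrt CARD('n))\<^sup>2) else 0)"
      using i fin by simp
  qed (use fin in auto)
  have "(\<lambda>z j. cnj (\<alpha> j z)) = (\<lambda>z j. \<alpha> j z)" by (auto simp: \<alpha>_def fun_eq_iff)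
  then show "opnorm ?D I (\<lambda>z j. \<alpha> j z) \<le> sqrt CARD('n)"
    using order_trans[OF opnorm_adjoint 1] fin by fastforce
  show "inorm trace_class UNIV (matrix_unit :: 'n \<Rightarrow> _) \<le> 1"
  proof (rule trace_class_le)
    fix m and X :: "nat \<Rightarrow> nat \<Rightarrow> complex ^ 'n ^ 'n"
    have "(\<Sum>c\<in>UNIV. \<Sum>d\<in>UNIV. matrix_unit a b $ c $ d * X p q $ c $ d) = X p q $ a $ b" for a b p q
    proof -
      have "(\<Sum>c\<in>UNIV. \<Sum>d\<in>UNIV. matrix_unit a b $ c $ d * X p q $ c $ d)
        = (\<Sum>c\<in>UNIV. \<Sum>d\<in>UNIV. if d = b then if c = a then X p q $ a $ b else 0 else 0)"
        by (intro sum.cong refl) (auto simp: matrix_unit_def)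
      then show ?thesis by simp
    qed
    then show "opnorm ({..<m} \<times> UNIV) ({..<m} \<times> UNIV) (pairing matrix_unit X) \<le> 1 * matrix_norm {..<m} X"
      by (simp add: pairing_def matrix_norm_def)
  qed auto
qed

lemma S_one_le_inorm:
  fixes u :: "'i \<Rightarrow> 'i \<Rightarrow> 'e ^ 'n ^ 'n"
  assumes fin: "finite I"
  shows "inorm (S_one E) I u \<le> CARD('n) * inorm E (I \<times> UNIV) (\<lambda>(i, c) (j, d). u i j $ c $ d)"
proof -
  let ?\<alpha> = "\<lambda>(i :: 'i) (y :: 'n \<times> 'i \<times> 'n). if fst (snd y) = i \<and> fst y = snd (snd y) then 1 else (0 :: complex)"
  let ?N = "inorm E (I \<times> UNIV) (\<lambda>(i, c) (j, d). u i j $ c $ d)"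
  note f = S_one_factorization_units(2-4)[OF fin]
  have "inorm (S_one E) I u \<le> opnorm I (UNIV \<times> I \<times> UNIV) ?\<alpha> * inorm trace_class UNIV (matrix_unit :: 'n \<Rightarrow> _) * ?N
      * opnorm (UNIV \<times> I \<times> UNIV) I (\<lambda>z j. ?\<alpha> j z)"
    by (rule S_one_le[OF fin _ _ S_one_factorization_units(1)[OF fin]]) (use fin in auto)
  also have "\<dots> \<le> sqrt CARD('n) * 1 * ?N * sqrt CARD('n)"
    by (intro mult_mono mult_nonneg_nonneg f order_refl opnorm_nonneg inorm_nonneg inorm_trace_class_nonneg) (use fin in auto)
  also have "\<dots> = CARD('n) * ?N" by simp
  finally show ?thesis .
qed

lemma S_one_less_nat:
  fixes u :: "nat \<Rightarrow> nat \<Rightarrow> 'e ^ 'n ^ 'n"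
  assumes less: "mnorm (S_one E) k u < c"
  obtains p q \<alpha> w \<beta> and v :: "nat \<Rightarrow> nat \<Rightarrow> complex ^ 'n ^ 'n" where
    "tensor_factorization E {..<k} {..<p} {..<q} \<alpha> v w \<beta> u"
    "opnorm {..<k} ({..<p} \<times> {..<q}) \<alpha> * mnorm trace_class p v * mnorm E q w * opnorm ({..<p} \<times> {..<q}) {..<k} \<beta> < c"
proof -
  let ?S = "{opnorm {..<k} ({..<p} \<times> {..<q}) \<alpha> * mnorm trace_class p v * mnorm E q w *
         opnorm ({..<p} \<times> {..<q}) {..<k} \<beta>
       | p q \<alpha> (v :: nat \<Rightarrow> nat \<Rightarrow> complex ^ 'n ^ 'n) w \<beta>.
         tensor_factorization E {..<k} {..<p} {..<q} \<alpha> v w \<beta> u}"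
  have fin: "finite {..<k}" "finite ({..<k} \<times> (UNIV :: 'n set))" by auto
  have ne: "?S \<noteq> {}"
    using tensor_factorization_reindex[OF bij_betw_id bij_enumeration[OF finite] bij_enumeration[OF fin(2)]
        S_one_factorization_units(1)[OF fin(1), of u]] by fastforce
  have "Inf ?S < c" using less by (simp only: mnorm_S_one)
  from cInf_lessD[OF ne this] obtain y where y: "y \<in> ?S" "y < c" by (elim bexE)
  from y(1) obtain p q \<alpha> w \<beta> and v :: "nat \<Rightarrow> nat \<Rightarrow> complex ^ 'n ^ 'n" where
    eq: "y = opnorm {..<k} ({..<p} \<times> {..<q}) \<alpha> * mnorm trace_class p v * mnorm E q w * opnorm ({..<p} \<times> {..<q}) {..<k} \<beta>"
    and t: "tensor_factorization E {..<k} {..<p} {..<q} \<alpha> v w \<beta> u"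
    by (elim CollectE exE conjE)
  show thesis by (rule that[OF t]) (use y(2) eq in simp)
qed

lemma S_one_less:
  fixes u :: "'i \<Rightarrow> 'i \<Rightarrow> 'e ^ 'n ^ 'n"
  assumes fin: "finite I" and less: "inorm (S_one E) I u < c"
  obtains p q :: nat and \<alpha> w \<beta> and v :: "nat \<Rightarrow> nat \<Rightarrow> complex ^ 'n ^ 'n" where
    "tensor_factorization E I {..<p} {..<q} \<alpha> v w \<beta> u"
    "opnorm I ({..<p} \<times> {..<q}) \<alpha> * inorm trace_class {..<p} v * mnorm E q w * opnorm ({..<p} \<times> {..<q}) I \<beta> < c"
proof -
  let ?e = "enumeration I"
  define d where "d = the_inv_into {..<card I} ?e"
  have e: "bij_betw ?e {..<card I} I" by (rule bij_enumeration[OF fin])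
  have d: "bij_betw d I {..<card I}" unfolding d_def by (rule bij_betw_the_inv_into[OF e])
  have ed: "?e (d i) = i" if "i \<in> I" for i
    unfolding d_def using e that by (simp add: f_the_inv_into_f_bij_betw)
  from S_one_less_nat[OF less[unfolded inorm_def]]
  obtain p q \<alpha> w \<beta> and v :: "nat \<Rightarrow> nat \<Rightarrow> complex ^ 'n ^ 'n" where
    t: "tensor_factorization E {..<card I} {..<p} {..<q} \<alpha> v w \<beta> (\<lambda>i j. u (?e i) (?e j))" and
    less': "opnorm {..<card I} ({..<p} \<times> {..<q}) \<alpha> * mnorm trace_class p v * mnorm E q w * opnorm ({..<p} \<times> {..<q}) {..<card I} \<beta> < c" .
  have t': "tensor_factorization E I {..<p} {..<q} (\<lambda>i. \<alpha> (d i)) v w (\<lambda>z j. \<beta> z (d j)) u"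
    using tensor_factorization_reindex[OF d bij_betw_id bij_betw_id t] ed
    by (simp add: tensor_factorization_def map_prod_def)
  have "opnorm I ({..<p} \<times> {..<q}) (\<lambda>i. \<alpha> (d i)) = opnorm {..<card I} ({..<p} \<times> {..<q}) \<alpha>"
    using opnorm_reindex[OF d bij_betw_id, of "{..<p} \<times> {..<q}" \<alpha>] by simp
  moreover have "opnorm ({..<p} \<times> {..<q}) I (\<lambda>z j. \<beta> z (d j)) = opnorm ({..<p} \<times> {..<q}) {..<card I} \<beta>"
    using opnorm_reindex[OF bij_betw_id d, of "{..<p} \<times> {..<q}" \<beta>] by simp
  ultimately show thesis using that[OF t'] less' by (simp add: inorm_trace_class_lessThan)
qed

lemma tensor_factorization_scale:
  assumes t: "tensor_factorization E I P Q \<alpha> v w \<beta> u" and c: "a * b * r * s = (1 :: complex)"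
  shows "tensor_factorization E I P Q (\<lambda>i y. a * \<alpha> i y) (\<lambda>i j. \<chi> c d. r * v i j $ c $ d)
    (\<lambda>i j. smult E s (w i j)) (\<lambda>z j. b * \<beta> z j) u"
proof -
  have eq: "a * \<alpha> i y * (b * \<beta> z j) * (r * v i' j' $ c $ d) * s = \<alpha> i y * \<beta> z j * v i' j' $ c $ d" for i y z j i' j' c d
  proof -
    have eq: "a * \<alpha> i y * (b * \<beta> z j) * (r * v i' j' $ c $ d) * s = (a * b * r * s) * (\<alpha> i y * \<beta> z j * v i' j' $ c $ d)"
      by (simp only: mult_ac)
    then show ?thesis using c by simp
  qed
  show ?thesis using t unfolding tensor_factorization_def by (simp only: scale_scale eq vec_lambda_beta)
qed

lemma inorm_trace_class_scale:
  fixes v :: "'p \<Rightarrow> 'p \<Rightarrow> complex ^ 'n ^ 'n"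
  assumes fin: "finite P"
  shows "inorm trace_class P (\<lambda>i j. \<chi> c d. r * v i j $ c $ d) \<le> cmod r * inorm trace_class P v"
proof (rule trace_class_le[OF fin])
  fix m and X :: "nat \<Rightarrow> nat \<Rightarrow> complex ^ 'n ^ 'n"
  have "pairing (\<lambda>i j. \<chi> c d. r * v i j $ c $ d) X = (\<lambda>x y. r * pairing v X x y)"
    by (simp add: pairing_def fun_eq_iff sum_distrib_left mult.assoc)
  then have "opnorm ({..<m} \<times> P) ({..<m} \<times> P) (pairing (\<lambda>i j. \<chi> c d. r * v i j $ c $ d) X)
     \<le> cmod r * opnorm ({..<m} \<times> P) ({..<m} \<times> P) (pairing v X)"
    using fin by (simp add: opnorm_scale)
  also have "\<dots> \<le> cmod r * (inorm trace_class P v * matrix_norm {..<m} X)"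
    by (intro mult_left_mono trace_class_apply) (use fin in auto)
  finally show "opnorm ({..<m} \<times> P) ({..<m} \<times> P) (pairing (\<lambda>i j. \<chi> c d. r * v i j $ c $ d) X)
     \<le> cmod r * inorm trace_class P v * matrix_norm {..<m} X" by (simp only: mult.assoc)
qed (simp add: inorm_trace_class_nonneg)

text \<open>The four factors may be rescaled at will, provided that their product stays the same.\<close>

lemma S_one_normalized:
  fixes u :: "'i \<Rightarrow> 'i \<Rightarrow> 'e ^ 'n ^ 'n"
  assumes fin: "finite I" and less: "inorm (S_one E) I u < c"
  obtains p q :: nat and \<alpha> w \<beta> and v :: "nat \<Rightarrow> nat \<Rightarrow> complex ^ 'n ^ 'n" where
    "tensor_factorization E I {..<p} {..<q} \<alpha> v w \<beta> u"
    "opnorm I ({..<p} \<times> {..<q}) \<alpha> \<le> sqrt c" "inorm trace_class {..<p} v \<le> 1" "inorm E {..<q} w \<le> 1"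
    "opnorm ({..<p} \<times> {..<q}) I \<beta> \<le> sqrt c"
proof -
  obtain p q :: nat and \<alpha> w \<beta> and v :: "nat \<Rightarrow> nat \<Rightarrow> complex ^ 'n ^ 'n" where
    t: "tensor_factorization E I {..<p} {..<q} \<alpha> v w \<beta> u" and
    lt: "opnorm I ({..<p} \<times> {..<q}) \<alpha> * inorm trace_class {..<p} v * mnorm E q w * opnorm ({..<p} \<times> {..<q}) I \<beta> < c"
    by (rule S_one_less[OF fin less])
  let ?A = "opnorm I ({..<p} \<times> {..<q}) \<alpha>" and ?V = "inorm trace_class {..<p} v"
    and ?W = "mnorm E q w" and ?B = "opnorm ({..<p} \<times> {..<q}) I \<beta>"
  have nn: "0 \<le> ?A" "0 \<le> ?V" "0 \<le> ?W" "0 \<le> ?B"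
    using fin by (auto intro!: opnorm_nonneg inorm_trace_class_nonneg nonneg)
  obtain x B where 1: "?A * ?V * ?W < x" "?B < B" "x * B < c"
    using mult_less_enlarge[of "?A * ?V * ?W" ?B c] lt nn by (auto intro: mult_nonneg_nonneg)
  obtain y W where 2: "?A * ?V < y" "?W < W" "y * W < x"
    using mult_less_enlarge[of "?A * ?V" ?W x] 1(1) nn by (auto intro: mult_nonneg_nonneg)
  obtain A V where 3: "?A < A" "?V < V" "A * V < y"
    using mult_less_enlarge[of ?A ?V y] 2(1) nn by auto
  have pos: "0 < A" "0 < V" "0 < W" "0 < B" using nn 1(2) 2(2) 3 by linarith+
  have "A * V * W * B < c"
  proof -
    have "A * V * W < y * W" by (rule mult_strict_right_mono[OF 3(3) pos(3)])
    then have "A * V * W < x" using 2(3) by linarith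
    then have "A * V * W * B < x * B" using pos(4) by (rule mult_strict_right_mono)
    then show ?thesis using 1(3) by linarith
  qed
  moreover have "0 < A * V * W * B" using pos by simp
  ultimately have c: "0 < c" by linarith
  let ?a = "sqrt c / A" let ?b = "A * V * W / sqrt c"
  have "?a * ?b * (1 / V) * (1 / W) = 1" using pos c by simp
  then have "complex_of_real ?a * of_real ?b * of_real (1 / V) * of_real (1 / W) = 1"
    by (simp only: of_real_mult[symmetric] of_real_1)
  note t' = tensor_factorization_scale[OF t this]
  show thesis
  proof (rule that[OF t'])
    have "opnorm I ({..<p} \<times> {..<q}) (\<lambda>i y. of_real ?a * \<alpha> i y) \<le> cmod (of_real ?a) * ?A"
      using fin by (intro opnorm_scale) auto
    also have "\<dots> \<le> ?a * A" using pos c 3 nn by (simp only: norm_of_real) (intro mult_mono, auto)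
    also have "\<dots> = sqrt c" using pos by simp
    finally show "opnorm I ({..<p} \<times> {..<q}) (\<lambda>i y. of_real ?a * \<alpha> i y) \<le> sqrt c" .
    have "opnorm ({..<p} \<times> {..<q}) I (\<lambda>z j. of_real ?b * \<beta> z j) \<le> cmod (of_real ?b) * ?B"
      using fin by (intro opnorm_scale) auto
    also have "\<dots> \<le> ?b * B" using pos c 1 nn by (simp only: norm_of_real) (intro mult_mono, auto)
    also have "\<dots> \<le> c / sqrt c" using \<open>A * V * W * B < c\<close> c by (simp add: divide_right_mono)
    also have "\<dots> = sqrt c" using c by (simp add: real_div_sqrt)
    finally show "opnorm ({..<p} \<times> {..<q}) I (\<lambda>z j. of_real ?b * \<beta> z j) \<le> sqrt c" .
    have "inorm trace_class {..<p} (\<lambda>i j. \<chi> c d. of_real (1 / V) * v i j $ c $ d) \<le> cmod (of_real (1 / V)) * ?V"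
      by (rule inorm_trace_class_scale) simp
    also have "\<dots> \<le> 1" using pos 3 by (simp add: norm_divide)
    finally show "inorm trace_class {..<p} (\<lambda>i j. \<chi> c d. of_real (1 / V) * v i j $ c $ d) \<le> 1" .
    have "inorm E {..<q} (\<lambda>i j. smult E (of_real (1 / W)) (w i j)) \<le> cmod (of_real (1 / W)) * ?W"
      unfolding inorm_lessThan by (rule mnorm_smult)
    also have "\<dots> \<le> 1" using pos 2 by (simp add: norm_divide)
    finally show "inorm E {..<q} (\<lambda>i j. smult E (of_real (1 / W)) (w i j)) \<le> 1" .
  qed
qed

lemma inorm_S_one_lessThan:
  fixes u :: "nat \<Rightarrow> nat \<Rightarrow> 'e ^ 'n ^ 'n"
  shows "inorm (S_one E) {..<k} u = mnorm (S_one E) k u"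
proof (rule antisym; rule dense_ge)
  fix c assume "mnorm (S_one E) k u < c"
  then obtain p q \<alpha> w \<beta> and v :: "nat \<Rightarrow> nat \<Rightarrow> complex ^ 'n ^ 'n" where
    t: "tensor_factorization E {..<k} {..<p} {..<q} \<alpha> v w \<beta> u" and
    lt: "opnorm {..<k} ({..<p} \<times> {..<q}) \<alpha> * mnorm trace_class p v * mnorm E q w * opnorm ({..<p} \<times> {..<q}) {..<k} \<beta> < c"
    by (rule S_one_less_nat)
  from S_one_le[OF _ _ _ t] lt show "inorm (S_one E) {..<k} u \<le> c"
    by (simp add: inorm_trace_class_lessThan inorm_lessThan)
next
  fix c assume c: "inorm (S_one E) {..<k} u < c"
  obtain p q :: nat and \<alpha> w \<beta> and v :: "nat \<Rightarrow> nat \<Rightarrow> complex ^ 'n ^ 'n" where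
    t: "tensor_factorization E {..<k} {..<p} {..<q} \<alpha> v w \<beta> u" and
    lt: "opnorm {..<k} ({..<p} \<times> {..<q}) \<alpha> * inorm trace_class {..<p} v * mnorm E q w * opnorm ({..<p} \<times> {..<q}) {..<k} \<beta> < c"
    by (rule S_one_less[OF _ c]) simp
  from S_one_le_nat[OF t] lt show "mnorm (S_one E) k u \<le> c"
    by (simp add: inorm_trace_class_lessThan)
qed

text \<open>
  For the direct sum, both factorizations are placed in disjoint parts of the index sets; the
  blocks of \<open>(v \<oplus> v') \<otimes> (w \<oplus> w')\<close> that mix the two are annihilated by \<open>\<alpha>\<close> and \<open>\<beta>\<close>.
\<close>

lemma S_one_direct_sum:
  fixes x y :: "nat \<Rightarrow> nat \<Rightarrow> 'e ^ 'n ^ 'n" and k l :: nat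
  defines "z \<equiv> \<lambda>i j. if i < k \<and> j < k then x i j else if k \<le> i \<and> k \<le> j then y (i - k) (j - k) else 0"
  shows "mnorm (S_one E) (k + l) z \<le> max (mnorm (S_one E) k x) (mnorm (S_one E) l y)"
proof (rule dense_ge)
  fix c assume "max (mnorm (S_one E) k x) (mnorm (S_one E) l y) < c"
  then have cx: "inorm (S_one E) {..<k} x < c" and cy: "inorm (S_one E) {..<l} y < c"
    by (simp_all add: inorm_S_one_lessThan)
  obtain p q :: nat and \<alpha> w \<beta> and v :: "nat \<Rightarrow> nat \<Rightarrow> complex ^ 'n ^ 'n" where
    t: "tensor_factorization E {..<k} {..<p} {..<q} \<alpha> v w \<beta> x" and
    n: "opnorm {..<k} ({..<p} \<times> {..<q}) \<alpha> \<le> sqrt c" "inorm trace_class {..<p} v \<le> 1" "inorm E {..<q} w \<le> 1"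
      "opnorm ({..<p} \<times> {..<q}) {..<k} \<beta> \<le> sqrt c"
    by (rule S_one_normalized[OF _ cx]) simp
  obtain p' q' :: nat and \<alpha>' w' \<beta>' and v' :: "nat \<Rightarrow> nat \<Rightarrow> complex ^ 'n ^ 'n" where
    t': "tensor_factorization E {..<l} {..<p'} {..<q'} \<alpha>' v' w' \<beta>' y" and
    n': "opnorm {..<l} ({..<p'} \<times> {..<q'}) \<alpha>' \<le> sqrt c" "inorm trace_class {..<p'} v' \<le> 1" "inorm E {..<q'} w' \<le> 1"
      "opnorm ({..<p'} \<times> {..<q'}) {..<l} \<beta>' \<le> sqrt c"
    by (rule S_one_normalized[OF _ cy]) simp
  let ?P = "{..<p} <+> {..<p'}" and ?Q = "{..<q} <+> {..<q'}" and ?I = "{..<k + l}"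
  define A where "A = (\<lambda>i (s, t). case (s, t) of (Inl a, Inl b) \<Rightarrow> if i < k then \<alpha> i (a, b) else 0
    | (Inr a, Inr b) \<Rightarrow> if k \<le> i then \<alpha>' (i - k) (a, b) else 0 | _ \<Rightarrow> 0)"
  define B where "B = (\<lambda>(s, t) i. case (s, t) of (Inl a, Inl b) \<Rightarrow> if i < k then \<beta> (a, b) i else 0
    | (Inr a, Inr b) \<Rightarrow> if k \<le> i then \<beta>' (a, b) (i - k) else 0 | _ \<Rightarrow> 0)"
  define V where "V = (\<lambda>s t. case (s, t) of (Inl a, Inl b) \<Rightarrow> v a b | (Inr a, Inr b) \<Rightarrow> v' a b | _ \<Rightarrow> 0)"
  define W where "W = (\<lambda>s t. case (s, t) of (Inl a, Inl b) \<Rightarrow> w a b | (Inr a, Inr b) \<Rightarrow> w' a b | _ \<Rightarrow> 0)"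
  have c: "0 \<le> sqrt c" by (rule order_trans[OF opnorm_nonneg n(1)]) auto
  let ?J = "map_prod Inl Inl ` ({..<p} \<times> {..<q}) :: ((nat + nat) \<times> (nat + nat)) set"
  let ?J' = "map_prod Inr Inr ` ({..<p'} \<times> {..<q'}) :: ((nat + nat) \<times> (nat + nat)) set"
  have J: "bij_betw (map_prod Inl Inl) ({..<p} \<times> {..<q}) ?J" "bij_betw (map_prod Inr Inr) ({..<p'} \<times> {..<q'}) ?J'"
    by (auto simp: bij_betw_def inj_on_def)
  have K: "bij_betw (\<lambda>i. i + k) {..<l} {k..<k + l}"
    by (rule bij_betw_byWitness[where f' = "\<lambda>i. i - k"]) auto
  have tf: "tensor_factorization E ?I ?P ?Q A V W B z"
    unfolding tensor_factorization_def
  proof (intro ballI allI)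
    fix i j c d assume ij: "i \<in> ?I" "j \<in> ?I"
    have x: "x i j $ c $ d = (\<Sum>a<p. \<Sum>s<q. \<Sum>b<p. \<Sum>t<q. smult E (\<alpha> i (a, s) * \<beta> (b, t) j * v a b $ c $ d) (w s t))"
      if "i < k" "j < k"
      using t that unfolding tensor_factorization_def sum_Times fst_conv snd_conv by simp
    have y: "y (i - k) (j - k) $ c $ d = (\<Sum>a<p'. \<Sum>s<q'. \<Sum>b<p'. \<Sum>t<q'. smult E (\<alpha>' (i - k) (a, s) * \<beta>' (b, t) (j - k) * v' a b $ c $ d) (w' s t))"
      if "k \<le> i" "k \<le> j"
      using t' that ij unfolding tensor_factorization_def sum_Times fst_conv snd_conv by simp
    show "z i j $ c $ d = (\<Sum>y\<in>?P \<times> ?Q. \<Sum>z\<in>?P \<times> ?Q. smult E (A i y * B z j * V (fst y) (fst z) $ c $ d) (W (snd y) (snd z)))"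
      unfolding sum_Times
      by (cases "i < k"; cases "j < k"; simp add: sum.Plus A_def B_def V_def W_def z_def x y)
  qed
  have finPQ: "finite (?P \<times> ?Q)" by auto
  have A: "opnorm ?I (?P \<times> ?Q) A \<le> sqrt c"
  proof (rule opnorm_two_blocks[OF _ finPQ c, of _ "{..<k}" "{k..<k + l}" ?J ?J'])
    have "opnorm {..<k} ?J A = opnorm {..<k} ({..<p} \<times> {..<q}) (\<lambda>i y. A (id i) (map_prod Inl Inl y))"
      by (rule opnorm_reindex[OF bij_betw_id J(1), symmetric]) auto
    also have "\<dots> = opnorm {..<k} ({..<p} \<times> {..<q}) \<alpha>" by (rule opnorm_cong) (auto simp: A_def)
    finally show "opnorm {..<k} ?J A \<le> sqrt c" using n by simp
    have "opnorm {k..<k + l} ?J' A = opnorm {..<l} ({..<p'} \<times> {..<q'}) (\<lambda>i y. A (i + k) (map_prod Inr Inr y))"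
      by (rule opnorm_reindex[OF K J(2), symmetric]) auto
    also have "\<dots> = opnorm {..<l} ({..<p'} \<times> {..<q'}) \<alpha>'" by (rule opnorm_cong) (auto simp: A_def)
    finally show "opnorm {k..<k + l} ?J' A \<le> sqrt c" using n' by simp
  qed (auto simp: A_def)
  have B: "opnorm (?P \<times> ?Q) ?I B \<le> sqrt c"
  proof (rule opnorm_two_blocks[OF finPQ _ c, of _ ?J ?J' "{..<k}" "{k..<k + l}"])
    have "opnorm ?J {..<k} B = opnorm ({..<p} \<times> {..<q}) {..<k} (\<lambda>y i. B (map_prod Inl Inl y) (id i))"
      by (rule opnorm_reindex[OF J(1) bij_betw_id, symmetric]) auto
    also have "\<dots> = opnorm ({..<p} \<times> {..<q}) {..<k} \<beta>" by (rule opnorm_cong) (auto simp: B_def)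
    finally show "opnorm ?J {..<k} B \<le> sqrt c" using n by simp
    have "opnorm ?J' {k..<k + l} B = opnorm ({..<p'} \<times> {..<q'}) {..<l} (\<lambda>y i. B (map_prod Inr Inr y) (i + k))"
      by (rule opnorm_reindex[OF J(2) K, symmetric]) auto
    also have "\<dots> = opnorm ({..<p'} \<times> {..<q'}) {..<l} \<beta>'" by (rule opnorm_cong) (auto simp: B_def)
    finally show "opnorm ?J' {k..<k + l} B \<le> sqrt c" using n' by simp
  qed (auto simp: B_def)
  have V: "inorm trace_class ?P V \<le> 1"
  proof (rule trace_class_le)
    fix m and X :: "nat \<Rightarrow> nat \<Rightarrow> complex ^ 'n ^ 'n"
    have X: "0 \<le> 1 * matrix_norm {..<m} X" by (simp add: matrix_norm_nonneg)
    let ?L = "{..<m} \<times> Inl ` {..<p} :: (nat \<times> (nat + nat)) set"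
    let ?R = "{..<m} \<times> Inr ` {..<p'} :: (nat \<times> (nat + nat)) set"
    have LR: "bij_betw (map_prod id Inl) ({..<m} \<times> {..<p}) ?L" "bij_betw (map_prod id Inr) ({..<m} \<times> {..<p'}) ?R"
      by (intro bij_betw_map_prod bij_betw_id; simp add: bij_betw_def)+
    show "opnorm ({..<m} \<times> ?P) ({..<m} \<times> ?P) (pairing V X) \<le> 1 * matrix_norm {..<m} X"
    proof (rule opnorm_two_blocks[OF _ _ X, of _ _ ?L ?R ?L ?R])
      have "opnorm ?L ?L (pairing V X) = opnorm ({..<m} \<times> {..<p}) ({..<m} \<times> {..<p}) (\<lambda>i j. pairing V X (map_prod id Inl i) (map_prod id Inl j))"
        by (rule opnorm_reindex[OF LR(1) LR(1), symmetric]) auto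
      also have "\<dots> = opnorm ({..<m} \<times> {..<p}) ({..<m} \<times> {..<p}) (pairing v X)"
        by (rule opnorm_cong) (auto simp: pairing_def V_def)
      also have "\<dots> \<le> inorm trace_class {..<p} v * matrix_norm {..<m} X" by (rule trace_class_apply) auto
      also have "\<dots> \<le> 1 * matrix_norm {..<m} X" by (rule mult_right_mono[OF n(2) matrix_norm_nonneg]) auto
      finally show "opnorm ?L ?L (pairing V X) \<le> 1 * matrix_norm {..<m} X" .
      have "opnorm ?R ?R (pairing V X) = opnorm ({..<m} \<times> {..<p'}) ({..<m} \<times> {..<p'}) (\<lambda>i j. pairing V X (map_prod id Inr i) (map_prod id Inr j))"
        by (rule opnorm_reindex[OF LR(2) LR(2), symmetric]) auto
      also have "\<dots> = opnorm ({..<m} \<times> {..<p'}) ({..<m} \<times> {..<p'}) (pairing v' X)"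
        by (rule opnorm_cong) (auto simp: pairing_def V_def)
      also have "\<dots> \<le> inorm trace_class {..<p'} v' * matrix_norm {..<m} X" by (rule trace_class_apply) auto
      also have "\<dots> \<le> 1 * matrix_norm {..<m} X" by (rule mult_right_mono[OF n'(2) matrix_norm_nonneg]) auto
      finally show "opnorm ?R ?R (pairing V X) \<le> 1 * matrix_norm {..<m} X" .
    qed (auto simp: pairing_def V_def)
  qed auto
  have W: "inorm E ?Q W \<le> 1"
  proof -
    have LR: "bij_betw Inl {..<q} (Inl ` {..<q} :: (nat + nat) set)" "bij_betw Inr {..<q'} (Inr ` {..<q'} :: (nat + nat) set)"
      by (auto simp: bij_betw_def)
    have "inorm E ?Q W \<le> max (inorm E (Inl ` {..<q}) W) (inorm E (Inr ` {..<q'}) W)"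
      unfolding Plus_def by (rule inorm_disjoint_union) (auto simp: W_def)
    moreover have "inorm E (Inl ` {..<q}) W = inorm E {..<q} w"
      using inorm_reindex[OF LR(1), of W] by (simp add: W_def)
    moreover have "inorm E (Inr ` {..<q'}) W = inorm E {..<q'} w'"
      using inorm_reindex[OF LR(2), of W] by (simp add: W_def)
    ultimately show ?thesis using n(3) n'(3) by simp
  qed
  have "mnorm (S_one E) (k + l) z \<le> opnorm ?I (?P \<times> ?Q) A * inorm trace_class ?P V * inorm E ?Q W * opnorm (?P \<times> ?Q) ?I B"
    unfolding inorm_S_one_lessThan[symmetric] by (rule S_one_le[OF _ _ _ tf]) auto
  also have "\<dots> \<le> sqrt c * 1 * 1 * sqrt c"
    by (intro mult_mono mult_nonneg_nonneg A B V W c opnorm_nonneg inorm_trace_class_nonneg inorm_nonneg finPQ) auto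
  also have "\<dots> = c" using c by simp
  finally show "mnorm (S_one E) (k + l) z \<le> c" .
qed

text \<open>Multiplication by scalar matrices is absorbed into \<open>\<alpha>\<close> and \<open>\<beta>\<close>.\<close>

lemma tensor_factorization_mult:
  fixes u :: "'j \<Rightarrow> 'j \<Rightarrow> 'e ^ 'n ^ 'n"
  assumes "tensor_factorization E J P Q \<alpha> v w \<beta> u"
  shows "tensor_factorization E I P Q (\<lambda>i y. \<Sum>a\<in>J. \<gamma> i a * \<alpha> a y) v w (\<lambda>z j. \<Sum>b\<in>J. \<beta> z b * \<delta> b j)
    (\<lambda>i j. \<Sum>a\<in>J. \<Sum>b\<in>J. entrywise (smult E) (\<gamma> i a * \<delta> b j) (u a b))"
  unfolding tensor_factorization_def
proof (intro ballI allI)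
  fix i j c d
  let ?F = "\<lambda>a b y z. smult E (\<gamma> i a * \<alpha> a y * (\<beta> z b * \<delta> b j) * v (fst y) (fst z) $ c $ d) (w (snd y) (snd z))"
  have "(\<Sum>a\<in>J. \<Sum>b\<in>J. entrywise (smult E) (\<gamma> i a * \<delta> b j) (u a b)) $ c $ d
    = (\<Sum>a\<in>J. \<Sum>b\<in>J. smult E (\<gamma> i a * \<delta> b j) (u a b $ c $ d))"
    by (simp add: entrywise_def)
  also have "\<dots> = (\<Sum>a\<in>J. \<Sum>b\<in>J. \<Sum>y\<in>P \<times> Q. \<Sum>z\<in>P \<times> Q. ?F a b y z)"
  proof (rule sum.cong[OF refl], rule sum.cong[OF refl])
    fix a b assume ab: "a \<in> J" "b \<in> J"
    have "u a b $ c $ d = (\<Sum>y\<in>P \<times> Q. \<Sum>z\<in>P \<times> Q. smult E (\<alpha> a y * \<beta> z b * v (fst y) (fst z) $ c $ d) (w (snd y) (snd z)))"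
      using assms ab unfolding tensor_factorization_def by simp
    moreover have "\<gamma> i a * \<delta> b j * (\<alpha> a y * \<beta> z b * r) = \<gamma> i a * \<alpha> a y * (\<beta> z b * \<delta> b j) * r" for y z r by simp
    ultimately show "smult E (\<gamma> i a * \<delta> b j) (u a b $ c $ d) = (\<Sum>y\<in>P \<times> Q. \<Sum>z\<in>P \<times> Q. ?F a b y z)"
      by (simp only: scale_sum_right scale_scale)
  qed
  also have "\<dots> = (\<Sum>y\<in>P \<times> Q. \<Sum>z\<in>P \<times> Q. \<Sum>a\<in>J. \<Sum>b\<in>J. ?F a b y z)" by (rule sum_swap4)
  also have "\<dots> = (\<Sum>y\<in>P \<times> Q. \<Sum>z\<in>P \<times> Q. smult E ((\<Sum>a\<in>J. \<gamma> i a * \<alpha> a y) * (\<Sum>b\<in>J. \<beta> z b * \<delta> b j) * v (fst y) (fst z) $ c $ d) (w (snd y) (snd z)))"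
    unfolding sum_product unfolding sum_distrib_right scale_sum_left ..
  finally show "(\<Sum>a\<in>J. \<Sum>b\<in>J. entrywise (smult E) (\<gamma> i a * \<delta> b j) (u a b)) $ c $ d = \<dots>" .
qed

theorem ruan_seminorm_S_one: "ruan_seminorm (S_one E :: ('e ^ 'n ^ 'n) opspace)"
proof -
  interpret S: vector_space "smult (S_one E :: ('e ^ 'n ^ 'n) opspace)"
    unfolding S_one_def opspace.simps by (rule vector_space_entrywise[OF vector_space_axioms])
  show ?thesis
  proof unfold_locales
    fix k and x y :: "nat \<Rightarrow> nat \<Rightarrow> 'e ^ 'n ^ 'n"
    assume "\<And>i j. i < k \<Longrightarrow> j < k \<Longrightarrow> x i j = y i j"
    then have "tensor_factorization E {..<k} {..<p} {..<q} \<alpha> v w \<beta> x = tensor_factorization E {..<k} {..<p} {..<q} \<alpha> v w \<beta> y"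
      for p q :: nat and \<alpha> v w \<beta> by (simp add: tensor_factorization_def)
    then show "mnorm (S_one E) k x = mnorm (S_one E) k y" unfolding mnorm_S_one by simp
  next
    fix k and x :: "nat \<Rightarrow> nat \<Rightarrow> 'e ^ 'n ^ 'n"
    show "0 \<le> mnorm (S_one E) k x"
    proof (rule ccontr)
      assume "\<not> 0 \<le> mnorm (S_one E) k x"
      then have "mnorm (S_one E) k x < 0" by simp
      then obtain p q \<alpha> w \<beta> and v :: "nat \<Rightarrow> nat \<Rightarrow> complex ^ 'n ^ 'n" where
        "opnorm {..<k} ({..<p} \<times> {..<q}) \<alpha> * mnorm trace_class p v * mnorm E q w * opnorm ({..<p} \<times> {..<q}) {..<k} \<beta> < 0"
        by (rule S_one_less_nat)
      then show False using factorization_value_nonneg[of k p q \<alpha> v w \<beta>] by linarith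
    qed
  next
    fix k l and x y :: "nat \<Rightarrow> nat \<Rightarrow> 'e ^ 'n ^ 'n"
    show "mnorm (S_one E) (k + l) (\<lambda>i j. if i < k \<and> j < k then x i j else if k \<le> i \<and> k \<le> j then y (i - k) (j - k) else 0)
      \<le> max (mnorm (S_one E) k x) (mnorm (S_one E) l y)" by (rule S_one_direct_sum)
  next
    fix k l and \<gamma> \<delta> :: "nat \<Rightarrow> nat \<Rightarrow> complex" and x :: "nat \<Rightarrow> nat \<Rightarrow> 'e ^ 'n ^ 'n"
    let ?x = "\<lambda>i j. \<Sum>a<k. \<Sum>b<k. smult (S_one E) (\<gamma> i a * \<delta> b j) (x a b)"
    let ?g = "opnorm {..<l} {..<k} \<gamma>" and ?d = "opnorm {..<k} {..<l} \<delta>"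
    have "mnorm (S_one E) l ?x \<le> ?g * ?d * r" if r: "mnorm (S_one E) k x < r" for r
    proof -
      obtain p q \<alpha> w \<beta> and v :: "nat \<Rightarrow> nat \<Rightarrow> complex ^ 'n ^ 'n" where
        t: "tensor_factorization E {..<k} {..<p} {..<q} \<alpha> v w \<beta> x" and
        lt: "opnorm {..<k} ({..<p} \<times> {..<q}) \<alpha> * mnorm trace_class p v * mnorm E q w * opnorm ({..<p} \<times> {..<q}) {..<k} \<beta> < r"
        by (rule S_one_less_nat[OF r])
      let ?a = "opnorm {..<k} ({..<p} \<times> {..<q}) \<alpha>" and ?b = "opnorm ({..<p} \<times> {..<q}) {..<k} \<beta>"
      have x: "?x = (\<lambda>i j. \<Sum>a<k. \<Sum>b<k. entrywise (smult E) (\<gamma> i a * \<delta> b j) (x a b))"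
        by (simp add: S_one_def)
      have "mnorm (S_one E) l ?x \<le> opnorm {..<l} ({..<p} \<times> {..<q}) (\<lambda>i y. \<Sum>a<k. \<gamma> i a * \<alpha> a y)
        * mnorm trace_class p v * mnorm E q w * opnorm ({..<p} \<times> {..<q}) {..<l} (\<lambda>z j. \<Sum>b<k. \<beta> z b * \<delta> b j)"
        unfolding x by (rule S_one_le_nat[OF tensor_factorization_mult[OF t]])
      also have "\<dots> \<le> (?g * ?a) * mnorm trace_class p v * mnorm E q w * (?b * ?d)"
        by (intro mult_mono mult_nonneg_nonneg opnorm_mult opnorm_nonneg trace_class_nonneg nonneg order_refl) auto
      also have "\<dots> = ?g * ?d * (?a * mnorm trace_class p v * mnorm E q w * ?b)" by simp
      also have "\<dots> \<le> ?g * ?d * r"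
        using lt by (intro mult_left_mono mult_nonneg_nonneg opnorm_nonneg) auto
      finally show ?thesis .
    qed
    then have "mnorm (S_one E) l ?x \<le> ?g * ?d * mnorm (S_one E) k x"
      by (rule le_mult_of_greater) (auto intro!: mult_nonneg_nonneg opnorm_nonneg)
    then show "mnorm (S_one E) l ?x \<le> ?g * mnorm (S_one E) k x * ?d" by (simp add: mult_ac)
  qed
qed

end


section \<open>The three lines theorem\<close>

lemma cmod_exp_square: "cmod (exp (of_real e * z\<^sup>2)) = exp (e * ((Re z)\<^sup>2 - (Im z)\<^sup>2))"
  by (simp add: power2_eq_square)

text \<open>
  The factor \<open>exp (e z\<^sup>2)\<close> makes the function small at the ends of a long rectangle, where the
  maximum modulus principle applies; then \<open>e\<close> tends to \<open>0\<close>.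
\<close>

lemma three_lines_rectangle:
  assumes cont: "continuous_on strip g" and hol: "g holomorphic_on interior strip"
    and K: "\<And>z. z \<in> strip \<Longrightarrow> cmod (g z) \<le> K" and a: "0 < a"
    and edge: "\<And>z. Re z = 0 \<or> Re z = 1 \<Longrightarrow> cmod (g z) \<le> a" and z: "z \<in> strip" and e: "0 < e"
  shows "cmod (g z) * exp (e * ((Re z)\<^sup>2 - (Im z)\<^sup>2)) \<le> a * exp e"
proof -
  obtain R0 where R0: "\<And>R. R0 \<le> R \<Longrightarrow> K * exp (- e * R\<^sup>2) \<le> a"
  proof -
    have "((\<lambda>R. K * exp (- e * R\<^sup>2)) \<longlongrightarrow> 0) at_top" using e by real_asymp
    then have "eventually (\<lambda>R. K * exp (- e * R\<^sup>2) < a) at_top" using a by (rule order_tendstoD)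
    then show thesis using that unfolding eventually_at_top_linorder by (meson less_imp_le)
  qed
  define R where "R = max (max R0 1) \<bar>Im z\<bar>"
  have R: "R0 \<le> R" "0 < R" "\<bar>Im z\<bar> \<le> R" by (auto simp: R_def)
  define S where "S = cbox (Complex 0 (- R)) (Complex 1 R)"
  have S_strip: "S \<subseteq> strip" by (auto simp: S_def strip_def in_cbox_complex_iff)
  have intS: "interior S \<subseteq> interior strip" using S_strip by (rule interior_mono)
  have "cmod (g z * exp (of_real e * z\<^sup>2)) \<le> a * exp e"
  proof (rule maximum_modulus_frontier[where f = "\<lambda>z. g z * exp (of_real e * z\<^sup>2)" and S = S])
    show "(\<lambda>z. g z * exp (of_real e * z\<^sup>2)) holomorphic_on interior S"
      by (intro holomorphic_intros holomorphic_on_subset[OF hol intS])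
    have "closure S = S" by (simp add: S_def)
    then show "continuous_on (closure S) (\<lambda>z. g z * exp (of_real e * z\<^sup>2))"
      by (auto intro!: continuous_intros continuous_on_subset[OF cont S_strip])
    show "bounded S" by (simp add: S_def)
    show "z \<in> S" using z R by (auto simp: S_def strip_def in_cbox_complex_iff)
    fix w assume "w \<in> frontier S"
    then have w: "w \<in> S" "w \<notin> box (Complex 0 (- R)) (Complex 1 R)"
      by (auto simp: S_def frontier_cbox)
    have wb: "0 \<le> Re w" "Re w \<le> 1" using w(1) by (auto simp: S_def in_cbox_complex_iff)
    then have sq: "(Re w)\<^sup>2 \<le> 1" by (simp add: power_le_one)
    have n: "cmod (g w * exp (of_real e * w\<^sup>2)) = cmod (g w) * exp (e * ((Re w)\<^sup>2 - (Im w)\<^sup>2))"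
      by (simp only: norm_mult cmod_exp_square)
    consider "Re w = 0 \<or> Re w = 1" | "\<bar>Im w\<bar> = R"
      using w by (auto simp: S_def in_cbox_complex_iff in_box_complex_iff)
    then show "cmod (g w * exp (of_real e * w\<^sup>2)) \<le> a * exp e"
    proof cases
      case 1
      have "e * ((Re w)\<^sup>2 - (Im w)\<^sup>2) \<le> e * 1" using sq e by (intro mult_left_mono) (auto intro: order_trans[OF _ sq])
      then show ?thesis unfolding n using edge[OF 1] a by (intro mult_mono) auto
    next
      case 2
      have im: "(Im w)\<^sup>2 = R\<^sup>2" using 2 power2_abs[of "Im w"] by simp
      have "e * ((Re w)\<^sup>2 - (Im w)\<^sup>2) \<le> e * (1 - R\<^sup>2)" unfolding im using sq e by (intro mult_left_mono) auto
      then have "exp (e * ((Re w)\<^sup>2 - (Im w)\<^sup>2)) \<le> exp (- e * R\<^sup>2) * exp e"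
        by (simp add: exp_add[symmetric] algebra_simps)
      moreover have "cmod (g w) \<le> K" using K S_strip w(1) by blast
      ultimately have "cmod (g w) * exp (e * ((Re w)\<^sup>2 - (Im w)\<^sup>2)) \<le> K * (exp (- e * R\<^sup>2) * exp e)"
        using order_trans[OF norm_ge_zero \<open>cmod (g w) \<le> K\<close>] by (intro mult_mono) auto
      also have "\<dots> = K * exp (- e * R\<^sup>2) * exp e" by simp
      also have "\<dots> \<le> a * exp e" by (rule mult_right_mono[OF R0[OF R(1)]]) simp
      finally show ?thesis unfolding n .
    qed
  qed
  then show ?thesis by (simp only: norm_mult cmod_exp_square)
qed

text \<open>
  The rectangle estimate with \<open>e\<close> so small that the additional factors cost less than the
  distance of \<open>r\<close> from \<open>a\<close>.
\<close>

theorem three_lines: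
  assumes cont: "continuous_on strip g" and hol: "g holomorphic_on interior strip"
    and K: "\<And>z. z \<in> strip \<Longrightarrow> cmod (g z) \<le> K"
    and edge: "\<And>z. Re z = 0 \<or> Re z = 1 \<Longrightarrow> cmod (g z) \<le> a" and z: "z \<in> strip"
  shows "cmod (g z) \<le> a"
proof (rule dense_ge)
  fix r assume r: "a < r"
  have "0 \<le> a" using edge[of 0] norm_ge_zero[of "g 0"] by (simp only: zero_complex.sel) linarith
  define b where "b = (a + r) / 2"
  have b: "0 < b" "a \<le> b" "b < r" using r \<open>0 \<le> a\<close> by (auto simp: b_def)
  define e where "e = ln (r / b) / (2 + (Im z)\<^sup>2)"
  have l: "0 < ln (r / b)" using b by simp
  have pos: "0 < 2 + (Im z)\<^sup>2" by (simp add: add_pos_nonneg)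
  have e: "0 < e" unfolding e_def using l pos by simp
  have "cmod (g z) * exp (e * ((Re z)\<^sup>2 - (Im z)\<^sup>2)) \<le> b * exp e"
    by (rule three_lines_rectangle[OF cont hol K b(1) order_trans[OF edge b(2)] z e])
  then have "cmod (g z) \<le> b * exp e / exp (e * ((Re z)\<^sup>2 - (Im z)\<^sup>2))" by (simp add: pos_le_divide_eq)
  also have "\<dots> = b * exp (e - e * ((Re z)\<^sup>2 - (Im z)\<^sup>2))" by (simp add: exp_diff)
  also have "\<dots> \<le> b * exp (ln (r / b))"
  proof -
    have "e - e * ((Re z)\<^sup>2 - (Im z)\<^sup>2) = e * (1 - (Re z)\<^sup>2 + (Im z)\<^sup>2)" by (simp add: algebra_simps)
    also have "\<dots> \<le> e * (2 + (Im z)\<^sup>2)"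
      using e zero_le_power2[of "Re z"] by (intro mult_left_mono) (linarith, simp)
    also have "\<dots> = ln (r / b)" using pos by (simp add: e_def)
    finally show ?thesis using b by (intro mult_left_mono iffD2[OF exp_le_cancel_iff]) simp_all
  qed
  also have "\<dots> = r" using b by simp
  finally show "cmod (g z) \<le> r" .
qed

section \<open>Complex interpolation of seminorms\<close>

definition seminorm :: "(complex \<Rightarrow> 'v \<Rightarrow> 'v) \<Rightarrow> ('v::ab_group_add \<Rightarrow> real) \<Rightarrow> bool" where
  "seminorm sc N \<longleftrightarrow> (\<forall>x y. N (x + y) \<le> N x + N y) \<and> (\<forall>c x. N (sc c x) \<le> cmod c * N x)"

lemma seminormD:
  assumes "seminorm sc N"
  shows "N (x + y) \<le> N x + N y" "N (sc c x) \<le> cmod c * N x"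
  using assms by (auto simp: seminorm_def)

lemma tendsto_zero_bound:
  fixes f g :: "'a \<Rightarrow> real"
  assumes "(g \<longlongrightarrow> 0) F" "eventually (\<lambda>x. 0 \<le> f x \<and> f x \<le> C * g x) F"
  shows "(f \<longlongrightarrow> 0) F"
proof (rule Lim_null_comparison)
  show "eventually (\<lambda>x. norm (f x) \<le> C * g x) F" using assms(2) by (rule eventually_mono) auto
  show "((\<lambda>x. C * g x) \<longlongrightarrow> 0) F" using assms(1) by (rule tendsto_mult_right_zero)
qed

text \<open>
  Multiplication by \<open>exp (d (z\<^sup>2 - \<theta>\<^sup>2) + c (z - \<theta>))\<close> fixes the value at \<open>\<theta>\<close>; for \<open>d > 0\<close> it
  produces decay, and \<open>c\<close> balances the bounds on the two edges.
\<close>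

definition weight :: "real \<Rightarrow> real \<Rightarrow> real \<Rightarrow> complex \<Rightarrow> complex" where
  "weight \<theta> d c z = exp (of_real d * (z\<^sup>2 - of_real (\<theta>\<^sup>2)) + of_real c * (z - of_real \<theta>))"

lemma weight_theta: "weight \<theta> d c (of_real \<theta>) = 1"
  by (simp add: weight_def)

lemma weight_deriv: "(weight \<theta> d c has_field_derivative (of_real d * (2 * z) + of_real c) * weight \<theta> d c z) (at z)"
  unfolding weight_def by (auto intro!: derivative_eq_intros)

lemma cmod_weight: "cmod (weight \<theta> d c z) = exp (d * ((Re z)\<^sup>2 - (Im z)\<^sup>2 - \<theta>\<^sup>2) + c * (Re z - \<theta>))"
  by (simp add: weight_def power2_eq_square)

lemma cmod_weight_strip:
  assumes "0 \<le> d" "0 \<le> \<theta>" "\<theta> \<le> 1" "z \<in> strip"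
  shows "cmod (weight \<theta> d c z) \<le> exp (d + \<bar>c\<bar>)"
proof -
  have z: "0 \<le> Re z" "Re z \<le> 1" using assms(4) by (auto simp: strip_def)
  have "(Re z)\<^sup>2 \<le> 1" using z by (simp add: power_le_one)
  then have "d * ((Re z)\<^sup>2 - (Im z)\<^sup>2 - \<theta>\<^sup>2) \<le> d * 1"
    using assms(1) zero_le_power2[of "Im z"] zero_le_power2[of \<theta>] by (intro mult_left_mono) linarith+
  moreover have "c * (Re z - \<theta>) \<le> \<bar>c\<bar>"
  proof -
    have "c * (Re z - \<theta>) \<le> \<bar>c\<bar> * \<bar>Re z - \<theta>\<bar>" using abs_ge_self[of "c * (Re z - \<theta>)"] by (simp only: abs_mult)
    also have "\<dots> \<le> \<bar>c\<bar> * 1" using z assms by (intro mult_left_mono) auto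
    finally show ?thesis by simp
  qed
  ultimately show ?thesis unfolding cmod_weight by simp
qed

text \<open>With \<open>c = ln (A / B)\<close> the two edge bounds become equal.\<close>

lemma balance:
  fixes A B :: real
  assumes "0 < A" "0 < B"
  shows "exp (ln (A / B) * (0 - \<theta>)) * A = A powr (1 - \<theta>) * B powr \<theta>"
    "exp (ln (A / B) * (1 - \<theta>)) * B = A powr (1 - \<theta>) * B powr \<theta>"
proof -
  have p: "A powr (1 - \<theta>) * B powr \<theta> = exp ((1 - \<theta>) * ln A + \<theta> * ln B)"
    using assms by (simp add: powr_def exp_add)
  have "exp (ln (A / B) * (0 - \<theta>)) * A = exp (ln (A / B) * (0 - \<theta>) + ln A)"
    by (simp only: exp_add exp_ln assms)
  also have "\<dots> = exp ((1 - \<theta>) * ln A + \<theta> * ln B)"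
    by (rule arg_cong[of _ _ exp]) (use assms in \<open>simp add: ln_div algebra_simps\<close>)
  finally show "exp (ln (A / B) * (0 - \<theta>)) * A = A powr (1 - \<theta>) * B powr \<theta>" unfolding p .
  have "exp (ln (A / B) * (1 - \<theta>)) * B = exp (ln (A / B) * (1 - \<theta>) + ln B)"
    by (simp only: exp_add exp_ln assms)
  also have "\<dots> = exp ((1 - \<theta>) * ln A + \<theta> * ln B)"
    by (rule arg_cong[of _ _ exp]) (use assms in \<open>simp add: ln_div algebra_simps\<close>)
  finally show "exp (ln (A / B) * (1 - \<theta>)) * B = A powr (1 - \<theta>) * B powr \<theta>" unfolding p .
qed

lemma calderonD:
  assumes "calderon sc N0 N1 f"
  shows "\<exists>B. \<forall>z\<in>strip. sum_norm N0 N1 (f z) \<le> B"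
    "z \<in> strip \<Longrightarrow> ((\<lambda>w. sum_norm N0 N1 (f w - f z)) \<longlongrightarrow> 0) (at z within strip)"
    "z \<in> interior strip \<Longrightarrow> \<exists>D. ((\<lambda>h. sum_norm N0 N1 (sc (1 / h) (f (z + h) - f z) - D)) \<longlongrightarrow> 0) (at 0)"
    "((\<lambda>s. N0 (f (Complex 0 s) - f (Complex 0 t))) \<longlongrightarrow> 0) (at t)"
    "((\<lambda>s. N1 (f (Complex 1 s) - f (Complex 1 t))) \<longlongrightarrow> 0) (at t)"
    "((\<lambda>t. N0 (f (Complex 0 t))) \<longlongrightarrow> 0) at_infinity"
    "((\<lambda>t. N1 (f (Complex 1 t))) \<longlongrightarrow> 0) at_infinity"
  using assms by (simp_all add: calderon_def)

locale couple = vector_space sc for sc :: "complex \<Rightarrow> 'v::ab_group_add \<Rightarrow> 'v" +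
  fixes N0 N1 :: "'v \<Rightarrow> real"
  assumes N0: "seminorm sc N0" and N1: "seminorm sc N1"
begin

lemma seminorm_zero:
  assumes "seminorm sc N"
  shows "N 0 = 0"
  using seminormD(1)[OF assms, of 0 0] seminormD(2)[OF assms, of 0 0] by simp

lemma seminorm_minus:
  assumes "seminorm sc N"
  shows "N (- x) = N x"
proof -
  have "N (- x) \<le> N x" for x using seminormD(2)[OF assms, of "-1" x] by simp
  from this[of x] this[of "- x"] show ?thesis by simp
qed

lemma seminorm_nonneg:
  assumes "seminorm sc N"
  shows "0 \<le> N x"
  using seminormD(1)[OF assms, of x "- x"] seminorm_zero[OF assms] seminorm_minus[OF assms, of x] by simp

lemma seminorm_diff_le:
  assumes "seminorm sc N"
  shows "\<bar>N x - N y\<bar> \<le> N (x - y)"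
  using seminormD(1)[OF assms, of "x - y" y] seminormD(1)[OF assms, of "y - x" x] seminorm_minus[OF assms, of "x - y"] by simp

abbreviation "S \<equiv> sum_norm N0 N1"

lemma sum_norm_le: "S (a + b) \<le> N0 a + N1 b"
  unfolding sum_norm_def
proof (rule cInf_lower)
  show "bdd_below {N0 a' + N1 b' | a' b'. a + b = a' + b'}"
    by (rule bdd_belowI[of _ 0]) (auto intro!: add_nonneg_nonneg seminorm_nonneg[OF N0] seminorm_nonneg[OF N1])
qed blast

lemma sum_norm_greatest:
  assumes "\<And>a b. x = a + b \<Longrightarrow> r \<le> N0 a + N1 b"
  shows "r \<le> S x"
  unfolding sum_norm_def
proof (rule cInf_greatest)
  have "x = x + 0" by simp
  then show "{N0 a + N1 b | a b. x = a + b} \<noteq> {}" by blast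
qed (use assms in blast)

lemma sum_norm_seminorm: "seminorm sc S"
  unfolding seminorm_def
proof (intro conjI allI)
  fix x y
  have 1: "S (x + y) - (N0 a' + N1 b') \<le> S x" if y: "y = a' + b'" for a' b'
  proof (rule sum_norm_greatest)
    fix a b assume x: "x = a + b"
    have "S ((a + a') + (b + b')) \<le> N0 (a + a') + N1 (b + b')" by (rule sum_norm_le)
    also have "\<dots> \<le> (N0 a + N0 a') + (N1 b + N1 b')" by (intro add_mono seminormD[OF N0] seminormD[OF N1])
    finally show "S (x + y) - (N0 a' + N1 b') \<le> N0 a + N1 b" by (simp add: x y add_ac)
  qed
  have "S (x + y) - S x \<le> S y"
  proof (rule sum_norm_greatest)
    fix a b assume "y = a + b"
    from 1[OF this] show "S (x + y) - S x \<le> N0 a + N1 b" by simp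
  qed
  then show "S (x + y) \<le> S x + S y" by simp
next
  fix c x
  show "S (sc c x) \<le> cmod c * S x"
  proof (cases "c = 0")
    case True
    then show ?thesis using sum_norm_le[of 0 0] seminorm_zero[OF N0] seminorm_zero[OF N1] by simp
  next
    case False
    have "S (sc c x) / cmod c \<le> S x"
    proof (rule sum_norm_greatest)
      fix a b assume "x = a + b"
      then have "S (sc c x) \<le> N0 (sc c a) + N1 (sc c b)"
        using sum_norm_le[of "sc c a" "sc c b"] by (simp add: scale_right_distrib)
      also have "\<dots> \<le> cmod c * N0 a + cmod c * N1 b" by (intro add_mono seminormD[OF N0] seminormD[OF N1])
      finally show "S (sc c x) / cmod c \<le> N0 a + N1 b" using False by (simp add: field_simps)
    qed
    then show ?thesis using False by (simp add: field_simps)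
  qed
qed

lemma sum_norm_nonneg: "0 \<le> S x" by (rule seminorm_nonneg[OF sum_norm_seminorm])

text \<open>
  The conditions on Calderon's functions, without the decay along the two edges. Constant functions
  satisfy them; multiplication by a weight then supplies the decay.
\<close>

definition precalderon :: "(complex \<Rightarrow> 'v) \<Rightarrow> bool" where
  "precalderon f \<longleftrightarrow>
     (\<exists>B. \<forall>z\<in>strip. S (f z) \<le> B) \<and>
     (\<forall>z\<in>strip. ((\<lambda>w. S (f w - f z)) \<longlongrightarrow> 0) (at z within strip)) \<and>
     (\<forall>z\<in>interior strip. \<exists>D. ((\<lambda>h. S (sc (1 / h) (f (z + h) - f z) - D)) \<longlongrightarrow> 0) (at 0)) \<and>
     (\<forall>t. ((\<lambda>s. N0 (f (Complex 0 s) - f (Complex 0 t))) \<longlongrightarrow> 0) (at t)) \<and>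
     (\<forall>t. ((\<lambda>s. N1 (f (Complex 1 s) - f (Complex 1 t))) \<longlongrightarrow> 0) (at t))"

lemma calderon_iff:
  "calderon sc N0 N1 f \<longleftrightarrow> precalderon f \<and>
     ((\<lambda>t. N0 (f (Complex 0 t))) \<longlongrightarrow> 0) at_infinity \<and> ((\<lambda>t. N1 (f (Complex 1 t))) \<longlongrightarrow> 0) at_infinity"
  by (auto simp: calderon_def precalderon_def)

lemma precalderon_const: "precalderon (\<lambda>z. x)"
proof -
  have "\<exists>D. ((\<lambda>h::complex. S (0 - D)) \<longlongrightarrow> 0) (at 0)"
    by (rule exI[of _ 0]) (simp add: seminorm_zero[OF sum_norm_seminorm])
  then show ?thesis
    unfolding precalderon_def
    by (auto simp: seminorm_zero[OF N0] seminorm_zero[OF N1] seminorm_zero[OF sum_norm_seminorm])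
qed

lemma seminorm_product_tendsto:
  assumes N: "seminorm sc N" and m: "(m \<longlongrightarrow> m0) F" and f: "((\<lambda>w. N (f w - y)) \<longlongrightarrow> 0) F"
  shows "((\<lambda>w. N (sc (m w) (f w) - sc m0 y)) \<longlongrightarrow> 0) F"
proof (rule tendsto_zero_bound[where C = 1])
  have "((\<lambda>w. cmod (m w) * N (f w - y) + cmod (m w - m0) * N y) \<longlongrightarrow> cmod m0 * 0 + cmod (m0 - m0) * N y) F"
    by (intro tendsto_intros m f)
  then show "((\<lambda>w. cmod (m w) * N (f w - y) + cmod (m w - m0) * N y) \<longlongrightarrow> 0) F" by simp
  have "N (sc (m w) (f w) - sc m0 y) \<le> cmod (m w) * N (f w - y) + cmod (m w - m0) * N y" for w
  proof -
    have "sc (m w) (f w) - sc m0 y = sc (m w) (f w - y) + sc (m w - m0) y"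
      by (simp add: scale_right_diff_distrib scale_left_diff_distrib)
    then have "N (sc (m w) (f w) - sc m0 y) \<le> N (sc (m w) (f w - y)) + N (sc (m w - m0) y)"
      by (simp only: seminormD(1)[OF N])
    also have "\<dots> \<le> cmod (m w) * N (f w - y) + cmod (m w - m0) * N y" by (intro add_mono seminormD[OF N])
    finally show ?thesis .
  qed
  then show "eventually (\<lambda>w. 0 \<le> N (sc (m w) (f w) - sc m0 y) \<and>
      N (sc (m w) (f w) - sc m0 y) \<le> 1 * (cmod (m w) * N (f w - y) + cmod (m w - m0) * N y)) F"
    using seminorm_nonneg[OF N] by simp
qed

text \<open>
  The product rule, and the estimate \<open>m w f w - m z f z = m w (f w - f z) + (m w - m z) f z\<close> for
  each of the seminorms.
\<close>

lemma precalderon_mult: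
  assumes f: "precalderon f" and m: "\<And>z. (m has_field_derivative m' z) (at z)"
    and K: "\<And>z. z \<in> strip \<Longrightarrow> cmod (m z) \<le> K"
  shows "precalderon (\<lambda>z. sc (m z) (f z))"
  unfolding precalderon_def
proof (intro conjI ballI allI)
  obtain B where B: "\<And>z. z \<in> strip \<Longrightarrow> S (f z) \<le> B" using f by (auto simp: precalderon_def)
  have "S (sc (m z) (f z)) \<le> K * B" if z: "z \<in> strip" for z
  proof -
    have "S (sc (m z) (f z)) \<le> cmod (m z) * S (f z)" by (rule seminormD[OF sum_norm_seminorm])
    also have "\<dots> \<le> K * B" using K[OF z] B[OF z] sum_norm_nonneg order_trans[OF norm_ge_zero K[OF z]] by (intro mult_mono) auto
    finally show ?thesis .
  qed
  then show "\<exists>B. \<forall>z\<in>strip. S (sc (m z) (f z)) \<le> B" by blast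
next
  have m_lim: "(m \<longlongrightarrow> m z) (at z within T)" for z T
    using DERIV_isCont[OF m] by (simp add: isCont_def tendsto_within_subset[where S = UNIV and T = T])
  {
    fix z assume "z \<in> strip"
    then have "((\<lambda>w. S (f w - f z)) \<longlongrightarrow> 0) (at z within strip)" using f by (simp add: precalderon_def)
    then show "((\<lambda>w. S (sc (m w) (f w) - sc (m z) (f z))) \<longlongrightarrow> 0) (at z within strip)"
      by (rule seminorm_product_tendsto[OF sum_norm_seminorm m_lim])
  next
    fix t
    have "((\<lambda>s. m (Complex c s)) \<longlongrightarrow> m (Complex c t)) (at t)" for c
      by (rule isCont_tendsto_compose[OF DERIV_isCont[OF m]]) (intro tendsto_intros)
    note m_edge = this
    have e0: "((\<lambda>s. N0 (f (Complex 0 s) - f (Complex 0 t))) \<longlongrightarrow> 0) (at t)"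
      and e1: "((\<lambda>s. N1 (f (Complex 1 s) - f (Complex 1 t))) \<longlongrightarrow> 0) (at t)"
      using f by (simp_all add: precalderon_def)
    show "((\<lambda>s. N0 (sc (m (Complex 0 s)) (f (Complex 0 s)) - sc (m (Complex 0 t)) (f (Complex 0 t)))) \<longlongrightarrow> 0) (at t)"
      by (rule seminorm_product_tendsto[OF N0 m_edge e0])
    show "((\<lambda>s. N1 (sc (m (Complex 1 s)) (f (Complex 1 s)) - sc (m (Complex 1 t)) (f (Complex 1 t)))) \<longlongrightarrow> 0) (at t)"
      by (rule seminorm_product_tendsto[OF N1 m_edge e1])
  next
    fix z assume "z \<in> interior strip"
    then obtain D where D: "((\<lambda>h. S (sc (1 / h) (f (z + h) - f z) - D)) \<longlongrightarrow> 0) (at 0)"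
      using f by (auto simp: precalderon_def)
    have m1: "((\<lambda>h. m (z + h)) \<longlongrightarrow> m z) (at 0)"
    proof (rule isCont_tendsto_compose[OF DERIV_isCont[OF m]])
      have "((\<lambda>h. z + h) \<longlongrightarrow> z + 0) (at 0)" by (intro tendsto_intros)
      then show "((\<lambda>h. z + h) \<longlongrightarrow> z) (at 0)" by simp
    qed
    have 1: "((\<lambda>h. S (sc (m (z + h)) (sc (1 / h) (f (z + h) - f z)) - sc (m z) D)) \<longlongrightarrow> 0) (at 0)"
      by (rule seminorm_product_tendsto[OF sum_norm_seminorm m1 D])
    have 2: "((\<lambda>h. cmod ((m (z + h) - m z) / h - m' z)) \<longlongrightarrow> 0) (at 0)"
      using m[of z] unfolding DERIV_def by (simp add: LIM_zero tendsto_norm_zero)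
    have "((\<lambda>h. S (sc (1 / h) (sc (m (z + h)) (f (z + h)) - sc (m z) (f z)) - (sc (m z) D + sc (m' z) (f z)))) \<longlongrightarrow> 0) (at 0)"
    proof (rule tendsto_zero_bound[where C = 1])
      show "((\<lambda>h. S (sc (m (z + h)) (sc (1 / h) (f (z + h) - f z)) - sc (m z) D)
          + cmod ((m (z + h) - m z) / h - m' z) * S (f z)) \<longlongrightarrow> 0) (at 0)"
        using tendsto_add[OF 1 tendsto_mult_left_zero[OF 2, of "S (f z)"]] by simp
      have "S (sc (1 / h) (sc (m (z + h)) (f (z + h)) - sc (m z) (f z)) - (sc (m z) D + sc (m' z) (f z)))
          \<le> S (sc (m (z + h)) (sc (1 / h) (f (z + h) - f z)) - sc (m z) D)
            + cmod ((m (z + h) - m z) / h - m' z) * S (f z)" for h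
      proof -
        have "sc (1 / h) (sc (m (z + h)) (f (z + h)) - sc (m z) (f z)) - (sc (m z) D + sc (m' z) (f z))
          = (sc (m (z + h)) (sc (1 / h) (f (z + h) - f z)) - sc (m z) D) + sc ((m (z + h) - m z) / h - m' z) (f z)"
          by (simp add: scale_right_diff_distrib scale_left_diff_distrib diff_divide_distrib)
        then show ?thesis
          by (simp only:) (rule order_trans[OF seminormD(1)[OF sum_norm_seminorm] add_left_mono[OF seminormD(2)[OF sum_norm_seminorm]]])
      qed
      then show "eventually (\<lambda>h. 0 \<le> S (sc (1 / h) (sc (m (z + h)) (f (z + h)) - sc (m z) (f z)) - (sc (m z) D + sc (m' z) (f z))) \<and>
         S (sc (1 / h) (sc (m (z + h)) (f (z + h)) - sc (m z) (f z)) - (sc (m z) D + sc (m' z) (f z)))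
          \<le> 1 * (S (sc (m (z + h)) (sc (1 / h) (f (z + h) - f z)) - sc (m z) D)
            + cmod ((m (z + h) - m z) / h - m' z) * S (f z))) (at 0)"
        using sum_norm_nonneg by simp
    qed
    then show "\<exists>D. ((\<lambda>h. S (sc (1 / h) (sc (m (z + h)) (f (z + h)) - sc (m z) (f z)) - D)) \<longlongrightarrow> 0) (at 0)" by blast
  }
qed

lemma calderon_add:
  assumes "calderon sc N0 N1 f" "calderon sc N0 N1 g"
  shows "calderon sc N0 N1 (\<lambda>z. f z + g z)"
proof -
  have lim: "((\<lambda>w. N (u w + v w)) \<longlongrightarrow> 0) F"
    if N: "seminorm sc N" and "((\<lambda>w. N (u w)) \<longlongrightarrow> 0) F" "((\<lambda>w. N (v w)) \<longlongrightarrow> 0) F"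
    for N F and u v :: "'x \<Rightarrow> 'v"
  proof (rule tendsto_zero_bound[where C = 1])
    show "((\<lambda>w. N (u w) + N (v w)) \<longlongrightarrow> 0) F" using tendsto_add[OF that(2,3)] by simp
    show "eventually (\<lambda>w. 0 \<le> N (u w + v w) \<and> N (u w + v w) \<le> 1 * (N (u w) + N (v w))) F"
      using seminorm_nonneg[OF N] seminormD(1)[OF N] by simp
  qed
  have diff: "(a + b) - (c + d) = (a - c) + (b - d)" for a b c d :: 'v by simp
  show ?thesis
    unfolding calderon_def
  proof (intro conjI ballI allI)
    obtain B B' where B: "\<And>z. z \<in> strip \<Longrightarrow> S (f z) \<le> B" "\<And>z. z \<in> strip \<Longrightarrow> S (g z) \<le> B'"
      using calderonD(1)[OF assms(1)] calderonD(1)[OF assms(2)] by blast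
    have "\<forall>z\<in>strip. S (f z + g z) \<le> B + B'"
      by (intro ballI order_trans[OF seminormD(1)[OF sum_norm_seminorm] add_mono] B)
    then show "\<exists>B. \<forall>z\<in>strip. S (f z + g z) \<le> B" ..
  next
    fix z assume "z \<in> strip"
    then show "((\<lambda>w. S (f w + g w - (f z + g z))) \<longlongrightarrow> 0) (at z within strip)"
      unfolding diff by (intro lim[OF sum_norm_seminorm] calderonD(2)[OF assms(1)] calderonD(2)[OF assms(2)])
  next
    fix z assume z: "z \<in> interior strip"
    obtain D where D: "((\<lambda>h. S (sc (1 / h) (f (z + h) - f z) - D)) \<longlongrightarrow> 0) (at 0)"
      using calderonD(3)[OF assms(1) z] by blast
    obtain D' where D': "((\<lambda>h. S (sc (1 / h) (g (z + h) - g z) - D')) \<longlongrightarrow> 0) (at 0)"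
      using calderonD(3)[OF assms(2) z] by blast
    have "sc (1 / h) (f (z + h) + g (z + h) - (f z + g z)) - (D + D')
       = (sc (1 / h) (f (z + h) - f z) - D) + (sc (1 / h) (g (z + h) - g z) - D')" for h
      unfolding diff scale_right_distrib by simp
    then have "((\<lambda>h. S (sc (1 / h) (f (z + h) + g (z + h) - (f z + g z)) - (D + D'))) \<longlongrightarrow> 0) (at 0)"
      by (simp only:) (rule lim[OF sum_norm_seminorm D D'])
    then show "\<exists>D. ((\<lambda>h. S (sc (1 / h) (f (z + h) + g (z + h) - (f z + g z)) - D)) \<longlongrightarrow> 0) (at 0)" ..
  next
    fix t
    show "((\<lambda>s. N0 (f (Complex 0 s) + g (Complex 0 s) - (f (Complex 0 t) + g (Complex 0 t)))) \<longlongrightarrow> 0) (at t)"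
      unfolding diff by (intro lim[OF N0] calderonD(4)[OF assms(1)] calderonD(4)[OF assms(2)])
    show "((\<lambda>s. N1 (f (Complex 1 s) + g (Complex 1 s) - (f (Complex 1 t) + g (Complex 1 t)))) \<longlongrightarrow> 0) (at t)"
      unfolding diff by (intro lim[OF N1] calderonD(5)[OF assms(1)] calderonD(5)[OF assms(2)])
  next
    show "((\<lambda>t. N0 (f (Complex 0 t) + g (Complex 0 t))) \<longlongrightarrow> 0) at_infinity"
      by (intro lim[OF N0] calderonD(6)[OF assms(1)] calderonD(6)[OF assms(2)])
    show "((\<lambda>t. N1 (f (Complex 1 t) + g (Complex 1 t))) \<longlongrightarrow> 0) at_infinity"
      by (intro lim[OF N1] calderonD(7)[OF assms(1)] calderonD(7)[OF assms(2)])
  qed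
qed

text \<open>
  Continuous on every compact interval and small outside one. Without boundedness the supremum in
  the interpolation norm would be an arbitrary number.
\<close>

lemma edge_bounded:
  fixes h :: "real \<Rightarrow> 'v"
  assumes N: "seminorm sc N" and cont: "\<And>t. ((\<lambda>s. N (h s - h t)) \<longlongrightarrow> 0) (at t)"
    and lim: "((\<lambda>t. N (h t)) \<longlongrightarrow> 0) at_infinity"
  shows "bdd_above (range (\<lambda>t. N (h t)))"
proof -
  have "isCont (\<lambda>t. N (h t)) t" for t
  proof -
    have "((\<lambda>s. N (h s) - N (h t)) \<longlongrightarrow> 0) (at t)"
      by (rule Lim_null_comparison[OF _ cont]) (simp add: seminorm_diff_le[OF N])
    then show ?thesis by (simp add: isCont_def LIM_zero_iff)
  qed
  then have c: "continuous_on T (\<lambda>t. N (h t))" for T by (simp add: continuous_at_imp_continuous_on)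
  have "eventually (\<lambda>t. N (h t) < 1) at_infinity" using lim by (rule order_tendstoD) simp
  then obtain b where b: "\<And>t. b \<le> \<bar>t\<bar> \<Longrightarrow> N (h t) < 1" by (auto simp: eventually_at_infinity)
  have "compact ((\<lambda>t. N (h t)) ` {-b..b})" by (rule compact_continuous_image[OF c]) simp
  from bounded_imp_bdd_above[OF compact_imp_bounded[OF this]]
  obtain K where K: "\<And>t. t \<in> {-b..b} \<Longrightarrow> N (h t) \<le> K"
    unfolding bdd_above_def by blast
  have "N (h t) \<le> max K 1" for t
  proof (cases "b \<le> \<bar>t\<bar>")
    case True
    then show ?thesis using b[of t] by simp
  next
    case False
    then have "t \<in> {-b..b}" by auto
    from K[OF this] show ?thesis by simp
  qed
  then show ?thesis by (intro bdd_aboveI2)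
qed

lemma calderon_edges:
  assumes "calderon sc N0 N1 f"
  shows "bdd_above (range (\<lambda>t. N0 (f (Complex 0 t))))" "bdd_above (range (\<lambda>t. N1 (f (Complex 1 t))))"
  by (intro edge_bounded N0 N1 calderonD[OF assms])+

lemma interp_le:
  assumes f: "calderon sc N0 N1 f" "f (of_real \<theta>) = x"
    and a: "\<And>t. N0 (f (Complex 0 t)) \<le> a" "\<And>t. N1 (f (Complex 1 t)) \<le> a"
  shows "interp_norm sc \<theta> N0 N1 x \<le> a"
proof -
  have "interp_norm sc \<theta> N0 N1 x \<le> max (SUP t. N0 (f (Complex 0 t))) (SUP t. N1 (f (Complex 1 t)))"
    unfolding interp_norm_def
  proof (rule cInf_lower)
    show "bdd_below {max (SUP t. N0 (f (Complex 0 t))) (SUP t. N1 (f (Complex 1 t)))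
          | f. calderon sc N0 N1 f \<and> f (of_real \<theta>) = x}"
    proof (rule bdd_belowI[of _ 0])
      fix y assume "y \<in> {max (SUP t. N0 (f (Complex 0 t))) (SUP t. N1 (f (Complex 1 t)))
          | f. calderon sc N0 N1 f \<and> f (of_real \<theta>) = x}"
      then obtain g where y: "y = max (SUP t. N0 (g (Complex 0 t))) (SUP t. N1 (g (Complex 1 t)))"
        and g: "calderon sc N0 N1 g" by blast
      have "0 \<le> N0 (g (Complex 0 0))" by (rule seminorm_nonneg[OF N0])
      also have "\<dots> \<le> (SUP t. N0 (g (Complex 0 t)))" by (rule cSUP_upper[OF UNIV_I calderon_edges(1)[OF g]])
      finally show "0 \<le> y" by (simp add: y)
    qed
  qed (use f in blast)
  also have "\<dots> \<le> a" using a by (intro max.boundedI cSUP_least) auto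
  finally show ?thesis .
qed

lemma calderon_weight:
  assumes f: "calderon sc N0 N1 f" and \<theta>: "0 \<le> \<theta>" "\<theta> \<le> 1"
  shows "calderon sc N0 N1 (\<lambda>z. sc (weight \<theta> 0 c z) (f z))"
  unfolding calderon_iff
proof (intro conjI)
  show "precalderon (\<lambda>z. sc (weight \<theta> 0 c z) (f z))"
    using f cmod_weight_strip[of 0 \<theta> _ c] \<theta> by (intro precalderon_mult[OF _ weight_deriv]) (auto simp: calderon_iff)
  have edge: "((\<lambda>t. N (sc (weight \<theta> 0 c (Complex r t)) (f (Complex r t)))) \<longlongrightarrow> 0) at_infinity"
    if N: "seminorm sc N" and lim: "((\<lambda>t. N (f (Complex r t))) \<longlongrightarrow> 0) at_infinity" for N r
  proof (rule tendsto_zero_bound[OF lim])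
    have "N (sc (weight \<theta> 0 c (Complex r t)) (f (Complex r t))) \<le> exp (c * (r - \<theta>)) * N (f (Complex r t))" for t
      using seminormD(2)[OF N, of "weight \<theta> 0 c (Complex r t)" "f (Complex r t)"] by (simp add: cmod_weight)
    then show "eventually (\<lambda>t. 0 \<le> N (sc (weight \<theta> 0 c (Complex r t)) (f (Complex r t))) \<and>
       N (sc (weight \<theta> 0 c (Complex r t)) (f (Complex r t))) \<le> exp (c * (r - \<theta>)) * N (f (Complex r t))) at_infinity"
      using seminorm_nonneg[OF N] by simp
  qed
  show "((\<lambda>t. N0 (sc (weight \<theta> 0 c (Complex 0 t)) (f (Complex 0 t)))) \<longlongrightarrow> 0) at_infinity"
    "((\<lambda>t. N1 (sc (weight \<theta> 0 c (Complex 1 t)) (f (Complex 1 t)))) \<longlongrightarrow> 0) at_infinity"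
    using f by (auto simp: calderon_iff intro!: edge N0 N1)
qed

lemma calderon_weight_const:
  assumes \<theta>: "0 \<le> \<theta>" "\<theta> \<le> 1" and d: "0 < d"
  shows "calderon sc N0 N1 (\<lambda>z. sc (weight \<theta> d c z) x)"
  unfolding calderon_iff
proof (intro conjI)
  show "precalderon (\<lambda>z. sc (weight \<theta> d c z) x)"
    using cmod_weight_strip[of d \<theta> _ c] \<theta> d by (intro precalderon_mult[OF precalderon_const weight_deriv]) auto
  have edge: "((\<lambda>t. N (sc (weight \<theta> d c (Complex r t)) x)) \<longlongrightarrow> 0) at_infinity" if N: "seminorm sc N" for N r
  proof (rule tendsto_zero_bound[where C = "N x"])
    have "((\<lambda>t. exp (d * (r\<^sup>2 - t\<^sup>2 - \<theta>\<^sup>2) + c * (r - \<theta>))) \<longlongrightarrow> 0) at_top"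
      "((\<lambda>t. exp (d * (r\<^sup>2 - t\<^sup>2 - \<theta>\<^sup>2) + c * (r - \<theta>))) \<longlongrightarrow> 0) at_bot"
      using d by real_asymp+
    then show "((\<lambda>t. exp (d * (r\<^sup>2 - t\<^sup>2 - \<theta>\<^sup>2) + c * (r - \<theta>))) \<longlongrightarrow> 0) at_infinity"
      by (simp add: at_infinity_eq_at_top_bot filterlim_sup)
    have "N (sc (weight \<theta> d c (Complex r t)) x) \<le> N x * exp (d * (r\<^sup>2 - t\<^sup>2 - \<theta>\<^sup>2) + c * (r - \<theta>))" for t
      using seminormD(2)[OF N, of "weight \<theta> d c (Complex r t)" x] by (simp add: cmod_weight mult.commute)
    then show "eventually (\<lambda>t. 0 \<le> N (sc (weight \<theta> d c (Complex r t)) x) \<and>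
       N (sc (weight \<theta> d c (Complex r t)) x) \<le> N x * exp (d * (r\<^sup>2 - t\<^sup>2 - \<theta>\<^sup>2) + c * (r - \<theta>))) at_infinity"
      using seminorm_nonneg[OF N] by simp
  qed
  show "((\<lambda>t. N0 (sc (weight \<theta> d c (Complex 0 t)) x)) \<longlongrightarrow> 0) at_infinity"
    "((\<lambda>t. N1 (sc (weight \<theta> d c (Complex 1 t)) x)) \<longlongrightarrow> 0) at_infinity" by (intro edge N0 N1)+
qed

lemma interp_less:
  assumes "interp_norm sc \<theta> N0 N1 x < r" "0 \<le> \<theta>" "\<theta> \<le> 1"
  obtains f where "calderon sc N0 N1 f" "f (of_real \<theta>) = x"
    "\<And>t. N0 (f (Complex 0 t)) < r" "\<And>t. N1 (f (Complex 1 t)) < r"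
proof -
  let ?S = "{max (SUP t. N0 (f (Complex 0 t))) (SUP t. N1 (f (Complex 1 t)))
          | f. calderon sc N0 N1 f \<and> f (of_real \<theta>) = x}"
  have "calderon sc N0 N1 (\<lambda>z. sc (weight \<theta> 1 0 z) x)" using assms by (intro calderon_weight_const) auto
  moreover have "sc (weight \<theta> 1 0 (of_real \<theta>)) x = x" by (simp only: weight_theta scale_one)
  ultimately have ne: "?S \<noteq> {}" by blast
  have "Inf ?S < r" using assms(1) by (simp only: interp_norm_def)
  from cInf_lessD[OF ne this] obtain y where y: "y \<in> ?S" "y < r" by (elim bexE)
  from y(1) obtain f where f: "y = max (SUP t. N0 (f (Complex 0 t))) (SUP t. N1 (f (Complex 1 t)))"
    "calderon sc N0 N1 f" "f (of_real \<theta>) = x" by (elim CollectE exE conjE)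
  show thesis
  proof (rule that[OF f(2,3)])
    fix t
    have "N0 (f (Complex 0 t)) \<le> (SUP t. N0 (f (Complex 0 t)))"
      by (rule cSUP_upper[OF UNIV_I calderon_edges(1)[OF f(2)]])
    then show "N0 (f (Complex 0 t)) < r" using y(2) f(1) by simp
    have "N1 (f (Complex 1 t)) \<le> (SUP t. N1 (f (Complex 1 t)))"
      by (rule cSUP_upper[OF UNIV_I calderon_edges(2)[OF f(2)]])
    then show "N1 (f (Complex 1 t)) < r" using y(2) f(1) by simp
  qed
qed

lemma interp_nonneg:
  assumes "0 \<le> \<theta>" "\<theta> \<le> 1"
  shows "0 \<le> interp_norm sc \<theta> N0 N1 x"
proof (rule ccontr)
  assume "\<not> 0 \<le> interp_norm sc \<theta> N0 N1 x"
  then have "interp_norm sc \<theta> N0 N1 x < 0" by simp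
  then obtain f where "calderon sc N0 N1 f" "f (of_real \<theta>) = x"
    and f: "\<And>t. N0 (f (Complex 0 t)) < 0" "\<And>t. N1 (f (Complex 1 t)) < 0" by (rule interp_less[OF _ assms]) blast
  show False using f(1)[of 0] seminorm_nonneg[OF N0, of "f (Complex 0 0)"] by linarith
qed

lemma interp_triangle:
  assumes \<theta>: "0 \<le> \<theta>" "\<theta> \<le> 1"
  shows "interp_norm sc \<theta> N0 N1 (x + y) \<le> interp_norm sc \<theta> N0 N1 x + interp_norm sc \<theta> N0 N1 y"
proof (rule field_le_epsilon)
  fix e :: real assume e: "0 < e"
  let ?a = "interp_norm sc \<theta> N0 N1 x + e / 2" and ?b = "interp_norm sc \<theta> N0 N1 y + e / 2"
  have lt: "interp_norm sc \<theta> N0 N1 x < ?a" "interp_norm sc \<theta> N0 N1 y < ?b" using e by simp_all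
  from lt(1) obtain f where f: "calderon sc N0 N1 f" "f (of_real \<theta>) = x"
    "\<And>t. N0 (f (Complex 0 t)) < ?a" "\<And>t. N1 (f (Complex 1 t)) < ?a"
    by (rule interp_less[OF _ \<theta>]) blast
  from lt(2) obtain g where g: "calderon sc N0 N1 g" "g (of_real \<theta>) = y"
    "\<And>t. N0 (g (Complex 0 t)) < ?b" "\<And>t. N1 (g (Complex 1 t)) < ?b"
    by (rule interp_less[OF _ \<theta>]) blast
  have "interp_norm sc \<theta> N0 N1 (x + y) \<le> ?a + ?b"
  proof (rule interp_le[OF calderon_add[OF f(1) g(1)]])
    show "N0 (f (Complex 0 t) + g (Complex 0 t)) \<le> ?a + ?b" for t
      by (rule order_trans[OF seminormD(1)[OF N0] add_mono]) (use f(3) g(3) in \<open>auto intro: less_imp_le\<close>)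
    show "N1 (f (Complex 1 t) + g (Complex 1 t)) \<le> ?a + ?b" for t
      by (rule order_trans[OF seminormD(1)[OF N1] add_mono]) (use f(4) g(4) in \<open>auto intro: less_imp_le\<close>)
  qed (simp add: f(2) g(2))
  then show "interp_norm sc \<theta> N0 N1 (x + y) \<le> interp_norm sc \<theta> N0 N1 x + interp_norm sc \<theta> N0 N1 y + e" by simp
qed

text \<open>
  The test function is the constant \<open>x\<close>, multiplied by a weight that balances the edges and has a
  small quadratic part for decay.
\<close>

theorem interp_log_convex:
  assumes \<theta>: "0 \<le> \<theta>" "\<theta> \<le> 1" and AB: "0 < A" "0 < B" and x: "N0 x \<le> A" "N1 x \<le> B"
  shows "interp_norm sc \<theta> N0 N1 x \<le> A powr (1 - \<theta>) * B powr \<theta>"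
proof (rule dense_ge)
  let ?K = "A powr (1 - \<theta>) * B powr \<theta>"
  fix r assume r: "?K < r"
  have K: "0 < ?K" using AB by simp
  define d where "d = ln (r / ?K)"
  have d: "0 < d" "exp d * ?K = r" using r K less_trans[OF K r] by (auto simp: d_def)
  let ?w = "weight \<theta> d (ln (A / B))"
  show "interp_norm sc \<theta> N0 N1 x \<le> r"
  proof (rule interp_le[OF calderon_weight_const[OF \<theta> d(1), of "ln (A / B)" x]])
    show "sc (?w (of_real \<theta>)) x = x" by (simp only: weight_theta scale_one)
    fix t
    have w: "cmod (?w (Complex s t)) \<le> exp d * exp (ln (A / B) * (s - \<theta>))" if "s = 0 \<or> s = 1" for s
    proof -
      have "s\<^sup>2 \<le> 1" using that by auto
      then have h: "s\<^sup>2 - t\<^sup>2 - \<theta>\<^sup>2 \<le> 1" using zero_le_power2[of t] zero_le_power2[of \<theta>] by linarith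
      have "d * (s\<^sup>2 - t\<^sup>2 - \<theta>\<^sup>2) \<le> d * 1" using d(1) h by (intro mult_left_mono) simp_all
      then show ?thesis unfolding cmod_weight by (simp add: exp_add[symmetric])
    qed
    have "N0 (sc (?w (Complex 0 t)) x) \<le> cmod (?w (Complex 0 t)) * N0 x" by (rule seminormD[OF N0])
    also have "\<dots> \<le> (exp d * exp (ln (A / B) * (0 - \<theta>))) * A"
      by (intro mult_mono w x seminorm_nonneg[OF N0]) auto
    also have "\<dots> = r" using balance(1)[OF AB, of \<theta>] d(2) by (simp only: mult.assoc)
    finally show "N0 (sc (?w (Complex 0 t)) x) \<le> r" .
    have "N1 (sc (?w (Complex 1 t)) x) \<le> cmod (?w (Complex 1 t)) * N1 x" by (rule seminormD[OF N1])
    also have "\<dots> \<le> (exp d * exp (ln (A / B) * (1 - \<theta>))) * B"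
      by (intro mult_mono w x seminorm_nonneg[OF N1]) auto
    also have "\<dots> = r" using balance(2)[OF AB, of \<theta>] d(2) by (simp only: mult.assoc)
    finally show "N1 (sc (?w (Complex 1 t)) x) \<le> r" .
  qed
qed

end

text \<open>A linear map that is bounded by \<open>A\<close> at one end point and by \<open>B\<close> at the other.\<close>

locale couple_map = dom: couple sc N0 N1 + cod: couple sc' M0 M1
  for sc :: "complex \<Rightarrow> 'v::ab_group_add \<Rightarrow> 'v" and N0 N1
    and sc' :: "complex \<Rightarrow> 'w::ab_group_add \<Rightarrow> 'w" and M0 M1 +
  fixes T :: "'v \<Rightarrow> 'w" and A B :: real
  assumes T_add: "\<And>x y. T (x + y) = T x + T y" and T_scale: "\<And>c x. T (sc c x) = sc' c (T x)"
    and A: "0 < A" "\<And>x. M0 (T x) \<le> A * N0 x" and B: "0 < B" "\<And>x. M1 (T x) \<le> B * N1 x"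
begin

lemma T_diff: "T (x - y) = T x - T y"
  using T_add[of "x - y" y] by (simp add: algebra_simps)

lemma sum_norm_T: "sum_norm M0 M1 (T x) \<le> max A B * sum_norm N0 N1 x"
proof -
  have pos: "0 < max A B" using A by simp
  have "sum_norm M0 M1 (T x) / max A B \<le> sum_norm N0 N1 x"
  proof (rule dom.sum_norm_greatest)
    fix a b assume "x = a + b"
    then have "sum_norm M0 M1 (T x) \<le> M0 (T a) + M1 (T b)" by (simp add: T_add cod.sum_norm_le)
    also have "\<dots> \<le> A * N0 a + B * N1 b" by (intro add_mono A B)
    also have "\<dots> \<le> max A B * N0 a + max A B * N1 b"
      by (intro add_mono mult_right_mono dom.seminorm_nonneg[OF dom.N0] dom.seminorm_nonneg[OF dom.N1]) auto
    finally show "sum_norm M0 M1 (T x) / max A B \<le> N0 a + N1 b"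
      unfolding pos_divide_le_eq[OF pos] by (simp only: distrib_right mult.commute[of "max A B"])
  qed
  then show ?thesis using pos by (simp only: pos_divide_le_eq mult.commute)
qed

lemma calderon_T:
  assumes f: "calderon sc N0 N1 f"
  shows "calderon sc' M0 M1 (\<lambda>z. T (f z))"
proof -
  let ?C = "max A B"
  have lim: "((\<lambda>w. sum_norm M0 M1 (T (u w))) \<longlongrightarrow> 0) F" if "((\<lambda>w. sum_norm N0 N1 (u w)) \<longlongrightarrow> 0) F"
    for u :: "'x \<Rightarrow> 'v" and F
    by (rule tendsto_zero_bound[OF that, of _ ?C]) (simp add: sum_norm_T cod.sum_norm_nonneg)
  have lim0: "((\<lambda>w. M0 (T (u w))) \<longlongrightarrow> 0) F" if "((\<lambda>w. N0 (u w)) \<longlongrightarrow> 0) F" for u :: "'x \<Rightarrow> 'v" and F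
    by (rule tendsto_zero_bound[OF that, of _ A]) (simp add: A cod.seminorm_nonneg[OF cod.N0])
  have lim1: "((\<lambda>w. M1 (T (u w))) \<longlongrightarrow> 0) F" if "((\<lambda>w. N1 (u w)) \<longlongrightarrow> 0) F" for u :: "'x \<Rightarrow> 'v" and F
    by (rule tendsto_zero_bound[OF that, of _ B]) (simp add: B cod.seminorm_nonneg[OF cod.N1])
  show ?thesis
    unfolding calderon_def T_diff[symmetric] T_scale[symmetric]
  proof (intro conjI ballI allI)
    obtain K where K: "\<And>z. z \<in> strip \<Longrightarrow> sum_norm N0 N1 (f z) \<le> K" using calderonD(1)[OF f] by blast
    have "sum_norm M0 M1 (T (f z)) \<le> ?C * K" if "z \<in> strip" for z
      by (rule order_trans[OF sum_norm_T mult_left_mono[OF K[OF that]]]) (use A in simp)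
    then show "\<exists>K. \<forall>z\<in>strip. sum_norm M0 M1 (T (f z)) \<le> K" by blast
  next
    fix z assume "z \<in> strip"
    then show "((\<lambda>w. sum_norm M0 M1 (T (f w - f z))) \<longlongrightarrow> 0) (at z within strip)"
      by (intro lim calderonD(2)[OF f])
  next
    fix z assume "z \<in> interior strip"
    then obtain D where D: "((\<lambda>h. sum_norm N0 N1 (sc (1 / h) (f (z + h) - f z) - D)) \<longlongrightarrow> 0) (at 0)"
      using calderonD(3)[OF f] by blast
    from lim[OF D] show "\<exists>D. ((\<lambda>h. sum_norm M0 M1 (T (sc (1 / h) (f (z + h) - f z)) - D)) \<longlongrightarrow> 0) (at 0)"
      unfolding T_diff by blast
  next
    show "((\<lambda>s. M0 (T (f (Complex 0 s) - f (Complex 0 t)))) \<longlongrightarrow> 0) (at t)" for t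
      by (intro lim0 calderonD(4)[OF f])
    show "((\<lambda>s. M1 (T (f (Complex 1 s) - f (Complex 1 t)))) \<longlongrightarrow> 0) (at t)" for t
      by (intro lim1 calderonD(5)[OF f])
    show "((\<lambda>t. M0 (T (f (Complex 0 t)))) \<longlongrightarrow> 0) at_infinity" by (intro lim0 calderonD(6)[OF f])
    show "((\<lambda>t. M1 (T (f (Complex 1 t)))) \<longlongrightarrow> 0) at_infinity" by (intro lim1 calderonD(7)[OF f])
  qed
qed

text \<open>
  \<open>T\<close> maps test functions to test functions; a weight then balances the edge bounds \<open>A r\<close> and
  \<open>B r\<close>.
\<close>

theorem interp_map:
  assumes \<theta>: "0 \<le> \<theta>" "\<theta> \<le> 1"
  shows "interp_norm sc' \<theta> M0 M1 (T x) \<le> A powr (1 - \<theta>) * B powr \<theta> * interp_norm sc \<theta> N0 N1 x"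
proof (rule le_mult_of_greater)
  fix r assume "interp_norm sc \<theta> N0 N1 x < r"
  then obtain f where f: "calderon sc N0 N1 f" "f (of_real \<theta>) = x"
    "\<And>t. N0 (f (Complex 0 t)) < r" "\<And>t. N1 (f (Complex 1 t)) < r" by (rule dom.interp_less[OF _ \<theta>]) blast
  let ?K = "A powr (1 - \<theta>) * B powr \<theta>"
  show "interp_norm sc' \<theta> M0 M1 (T x) \<le> ?K * r"
  proof (rule cod.interp_le[OF cod.calderon_weight[OF calderon_T[OF f(1)] \<theta>, of "ln (A / B)"]])
    show "sc' (weight \<theta> 0 (ln (A / B)) (of_real \<theta>)) (T (f (of_real \<theta>))) = T x"
      by (simp only: weight_theta cod.scale_one f(2))
    fix t
    have "M0 (sc' (weight \<theta> 0 (ln (A / B)) (Complex 0 t)) (T (f (Complex 0 t)))) \<le> exp (ln (A / B) * (0 - \<theta>)) * M0 (T (f (Complex 0 t)))"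
      by (rule order_trans[OF seminormD(2)[OF cod.N0]]) (simp add: cmod_weight)
    also have "\<dots> \<le> exp (ln (A / B) * (0 - \<theta>)) * (A * r)"
      by (intro mult_left_mono order_trans[OF A(2)] less_imp_le[OF f(3)]) (use A in auto)
    also have "\<dots> = ?K * r" using balance(1)[OF A(1) B(1), of \<theta>] by (simp only: mult.assoc[symmetric])
    finally show "M0 (sc' (weight \<theta> 0 (ln (A / B)) (Complex 0 t)) (T (f (Complex 0 t)))) \<le> ?K * r" .
    have "M1 (sc' (weight \<theta> 0 (ln (A / B)) (Complex 1 t)) (T (f (Complex 1 t)))) \<le> exp (ln (A / B) * (1 - \<theta>)) * M1 (T (f (Complex 1 t)))"
      by (rule order_trans[OF seminormD(2)[OF cod.N1]]) (simp add: cmod_weight)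
    also have "\<dots> \<le> exp (ln (A / B) * (1 - \<theta>)) * (B * r)"
      by (intro mult_left_mono order_trans[OF B(2)] less_imp_le[OF f(4)]) (use B in auto)
    also have "\<dots> = ?K * r" using balance(2)[OF A(1) B(1), of \<theta>] by (simp only: mult.assoc[symmetric])
    finally show "M1 (sc' (weight \<theta> 0 (ln (A / B)) (Complex 1 t)) (T (f (Complex 1 t)))) \<le> ?K * r" .
  qed
qed (use A B in simp)

end

text \<open>
  For equal end points nothing is lost: a norming functional reduces this to the three lines
  theorem for scalar functions.
\<close>

theorem interp_same_ge:
  fixes sc :: "complex \<Rightarrow> 'v::ab_group_add \<Rightarrow> 'v"
  assumes vs: "vector_space sc" and N: "seminorm sc N" and \<theta>: "0 \<le> \<theta>" "\<theta> \<le> 1"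
  shows "N x \<le> interp_norm sc \<theta> N N x"
proof (rule dense_ge)
  interpret couple sc N N by (intro couple.intro vs couple_axioms.intro N)
  fix r assume "interp_norm sc \<theta> N N x < r"
  then obtain f where f: "calderon sc N N f" "f (of_real \<theta>) = x"
    "\<And>t. N (f (Complex 0 t)) < r" "\<And>t. N (f (Complex 1 t)) < r" by (rule interp_less[OF _ \<theta>]) blast
  obtain \<phi> where \<phi>: "\<And>x y. \<phi> (x + y) = \<phi> x + \<phi> y" "\<And>c x. \<phi> (sc c x) = c * \<phi> x"
    "\<And>x. cmod (\<phi> x) \<le> N x" "Re (\<phi> x) = N x"
    by (rule complex_hahn_banach[OF vs seminormD(1)[OF N] seminormD(2)[OF N], of x]) auto
  have \<phi>_diff: "\<phi> (a - b) = \<phi> a - \<phi> b" for a b using \<phi>(1)[of "a - b" b] by (simp add: algebra_simps)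
  have bound: "cmod (\<phi> y) \<le> sum_norm N N y" for y
  proof (rule sum_norm_greatest)
    fix a b assume "y = a + b"
    then have "cmod (\<phi> y) \<le> cmod (\<phi> a) + cmod (\<phi> b)" by (simp add: \<phi>(1) norm_triangle_ineq)
    also have "\<dots> \<le> N a + N b" by (intro add_mono \<phi>(3))
    finally show "cmod (\<phi> y) \<le> N a + N b" .
  qed
  have lim: "((\<lambda>w. \<phi> (u w)) \<longlongrightarrow> 0) F" if "((\<lambda>w. sum_norm N N (u w)) \<longlongrightarrow> 0) F" for u :: "complex \<Rightarrow> 'v" and F
    by (rule Lim_null_comparison[OF _ that]) (simp add: bound)
  let ?g = "\<lambda>z. \<phi> (f z)"
  obtain K where K: "\<And>z. z \<in> strip \<Longrightarrow> sum_norm N N (f z) \<le> K" using calderonD(1)[OF f(1)] by blast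
  have cont: "continuous_on strip ?g"
    unfolding continuous_on_def
  proof
    fix z assume "z \<in> strip"
    then have "((\<lambda>w. sum_norm N N (f w - f z)) \<longlongrightarrow> 0) (at z within strip)"
      by (rule calderonD(2)[OF f(1)])
    from lim[OF this] show "(?g \<longlongrightarrow> ?g z) (at z within strip)" by (simp add: \<phi>_diff LIM_zero_iff)
  qed
  have hol: "?g holomorphic_on interior strip"
  proof (rule holomorphic_onI)
    fix z assume z: "z \<in> interior strip"
    then obtain D where "((\<lambda>h. sum_norm N N (sc (1 / h) (f (z + h) - f z) - D)) \<longlongrightarrow> 0) (at 0)"
      using calderonD(3)[OF f(1)] by blast
    from lim[OF this] have "((\<lambda>h. (?g (z + h) - ?g z) / h) \<longlongrightarrow> \<phi> D) (at 0)"
      by (simp add: \<phi>_diff \<phi>(2) LIM_zero_iff)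
    then have "(?g has_field_derivative \<phi> D) (at z)" by (simp add: DERIV_def)
    then show "?g field_differentiable at z within interior strip"
      by (auto simp: field_differentiable_def intro: has_field_derivative_at_within)
  qed
  have "cmod (?g (of_real \<theta>)) \<le> r"
  proof (rule three_lines[OF cont hol order_trans[OF bound K]])
    show "of_real \<theta> \<in> strip" using \<theta> by (simp add: strip_def)
    fix z assume "Re z = 0 \<or> Re z = 1"
    then have "z = Complex 0 (Im z) \<or> z = Complex 1 (Im z)" by (auto simp: complex_eq_iff)
    then have "N (f z) < r" using f(3)[of "Im z"] f(4)[of "Im z"] by metis
    then show "cmod (?g z) \<le> r" using \<phi>(3)[of "f z"] by simp
  qed
  then show "N x \<le> r" using \<phi>(4) complex_Re_le_cmod[of "\<phi> x"] f(2) by simp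
qed

lemma couple_same_smult:
  assumes "ruan_seminorm E0" "ruan_seminorm E1" "smult E1 = smult E0"
  shows "couple (\<lambda>c X i j. smult E0 c (X i j)) (mnorm E0 k) (mnorm E1 k)"
proof -
  interpret E0: ruan_seminorm E0 by fact
  interpret E1: ruan_seminorm E1 by fact
  have "seminorm (\<lambda>c X i j. smult E0 c (X i j)) (mnorm E0 k)"
    unfolding seminorm_def plus_fun_def using E0.mnorm_triangle E0.mnorm_smult by simp
  moreover have "seminorm (\<lambda>c X i j. smult E0 c (X i j)) (mnorm E1 k)"
    unfolding seminorm_def plus_fun_def using E1.mnorm_triangle E1.mnorm_smult by (simp add: assms(3))
  ultimately show ?thesis
    by unfold_locales (auto simp: fun_eq_iff E0.scale_right_distrib E0.scale_left_distrib)
qed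

lemma powr_same: "0 < r \<Longrightarrow> r powr (1 - \<theta>) * r powr \<theta> = (r :: real)"
  by (simp add: powr_add[symmetric])

text \<open>
  Multiplication by scalar matrices is a map of couples. For direct sums, test functions for \<open>x\<close>
  and \<open>y\<close> are combined pointwise into one for \<open>x \<oplus> y\<close>, and the end point estimates apply on each
  edge.
\<close>

theorem ruan_seminorm_interpolation:
  fixes E0 :: "'e::ab_group_add opspace"
  assumes R0: "ruan_seminorm E0" and R1: "ruan_seminorm E1" and sm: "smult E1 = smult E0"
    and \<theta>: "0 \<le> \<theta>" "\<theta> \<le> 1"
  shows "ruan_seminorm (interpolation \<theta> E0 E1)"
proof -
  interpret E0: ruan_seminorm E0 by fact
  interpret E1: ruan_seminorm E1 by fact
  let ?sc = "\<lambda>c (X :: nat \<Rightarrow> nat \<Rightarrow> 'e) i j. smult E0 c (X i j)"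
  let ?N = "\<lambda>k. interp_norm ?sc \<theta> (mnorm E0 k) (mnorm E1 k)"
  note cp = couple_same_smult[OF R0 R1 sm]
  interpret V: vector_space "smult (interpolation \<theta> E0 E1)"
    unfolding interpolation_def opspace.simps by (rule E0.vector_space_axioms)
  have m: "mnorm (interpolation \<theta> E0 E1) k = ?N k" for k by (simp add: interpolation_def)
  have cong: "?N k x \<le> ?N k y" if eq: "\<And>i j. i < k \<Longrightarrow> j < k \<Longrightarrow> x i j = y i j" for k x y
  proof -
    interpret c: couple ?sc "mnorm E0 k" "mnorm E1 k" by (rule cp)
    \<comment> \<open>Matrices that agree below \<open>k\<close> differ by an element that is null at both end points.\<close>
    have "mnorm E0 k (x - y) = 0" "mnorm E1 k (x - y) = 0"
      using E0.cong[of k "x - y" "\<lambda>i j. 0"] E1.cong[of k "x - y" "\<lambda>i j. 0"]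
      by (simp_all add: eq E0.mnorm_zero E1.mnorm_zero)
    then have le: "?N k (x - y) \<le> e" if "0 < e" for e
      using c.interp_log_convex[OF \<theta>, of e e "x - y"] that by (simp add: powr_same)
    have "?N k (x - y) \<le> 0" by (rule dense_ge) (rule le)
    then show ?thesis using c.interp_triangle[OF \<theta>, of "x - y" y] by simp
  qed
  show ?thesis
  proof (unfold_locales, unfold m)
    show "?N k x = ?N k y" if "\<And>i j. i < k \<Longrightarrow> j < k \<Longrightarrow> x i j = y i j" for k x y
      using cong[of k x y] cong[of k y x] that by (simp add: antisym)
  next
    show "0 \<le> ?N k x" for k x
    proof -
      interpret c: couple ?sc "mnorm E0 k" "mnorm E1 k" by (rule cp)
      show ?thesis by (rule c.interp_nonneg[OF \<theta>])
    qed
  next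
    fix k l and x y :: "nat \<Rightarrow> nat \<Rightarrow> 'e"
    interpret ck: couple ?sc "mnorm E0 k" "mnorm E1 k" by (rule cp)
    interpret cl: couple ?sc "mnorm E0 l" "mnorm E1 l" by (rule cp)
    interpret c: couple ?sc "mnorm E0 (k + l)" "mnorm E1 (k + l)" by (rule cp)
    define J where "J = (\<lambda>(x :: nat \<Rightarrow> nat \<Rightarrow> 'e) y i j. if i < k \<and> j < k then x i j
      else if k \<le> i \<and> k \<le> j then y (i - k) (j - k) else 0)"
    have J0: "mnorm E0 (k + l) (J x y) \<le> max (mnorm E0 k x) (mnorm E0 l y)" for x y
      unfolding J_def by (rule E0.direct_sum)
    have J1: "mnorm E1 (k + l) (J x y) \<le> max (mnorm E1 k x) (mnorm E1 l y)" for x y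
      unfolding J_def by (rule E1.direct_sum)
    have J_split: "J x y = J x 0 + J 0 y" for x y by (auto simp: J_def fun_eq_iff)
    have z: "mnorm E0 k 0 = 0" "mnorm E1 k 0 = 0" for k
      using E0.mnorm_zero[of k] E1.mnorm_zero[of k] by (simp_all add: zero_fun_def)
    interpret Tx: couple_map ?sc "mnorm E0 k" "mnorm E1 k" ?sc "mnorm E0 (k + l)" "mnorm E1 (k + l)" "\<lambda>x. J x 0" 1 1
    proof unfold_locales
      show "mnorm E0 (k + l) (J x 0) \<le> 1 * mnorm E0 k x" for x using J0[of x 0] E0.nonneg[of k x] by (simp add: z)
      show "mnorm E1 (k + l) (J x 0) \<le> 1 * mnorm E1 k x" for x using J1[of x 0] E1.nonneg[of k x] by (simp add: z)
    qed (auto simp: J_def fun_eq_iff)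
    interpret Ty: couple_map ?sc "mnorm E0 l" "mnorm E1 l" ?sc "mnorm E0 (k + l)" "mnorm E1 (k + l)" "\<lambda>y. J 0 y" 1 1
    proof unfold_locales
      show "mnorm E0 (k + l) (J 0 x) \<le> 1 * mnorm E0 l x" for x using J0[of 0 x] E0.nonneg[of l x] by (simp add: z)
      show "mnorm E1 (k + l) (J 0 x) \<le> 1 * mnorm E1 l x" for x using J1[of 0 x] E1.nonneg[of l x] by (simp add: z)
    qed (auto simp: J_def fun_eq_iff)
    have "?N (k + l) (J x y) \<le> max (?N k x) (?N l y)"
    proof (rule dense_ge)
      fix r assume "max (?N k x) (?N l y) < r"
      then have lt: "?N k x < r" "?N l y < r" by simp_all
      from lt(1) obtain f where f: "calderon ?sc (mnorm E0 k) (mnorm E1 k) f" "f (of_real \<theta>) = x"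
        "\<And>t. mnorm E0 k (f (Complex 0 t)) < r" "\<And>t. mnorm E1 k (f (Complex 1 t)) < r"
        by (rule ck.interp_less[OF _ \<theta>]) blast
      from lt(2) obtain g where g: "calderon ?sc (mnorm E0 l) (mnorm E1 l) g" "g (of_real \<theta>) = y"
        "\<And>t. mnorm E0 l (g (Complex 0 t)) < r" "\<And>t. mnorm E1 l (g (Complex 1 t)) < r"
        by (rule cl.interp_less[OF _ \<theta>]) blast
      have "calderon ?sc (mnorm E0 (k + l)) (mnorm E1 (k + l)) (\<lambda>z. J (f z) (g z))"
        unfolding J_split[of "f _" "g _"] by (rule c.calderon_add[OF Tx.calderon_T[OF f(1)] Ty.calderon_T[OF g(1)]])
      then show "?N (k + l) (J x y) \<le> r"
      proof (rule c.interp_le)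
        show "mnorm E0 (k + l) (J (f (Complex 0 t)) (g (Complex 0 t))) \<le> r" for t
          by (rule order_trans[OF J0]) (use f(3)[of t] g(3)[of t] in simp)
        show "mnorm E1 (k + l) (J (f (Complex 1 t)) (g (Complex 1 t))) \<le> r" for t
          by (rule order_trans[OF J1]) (use f(4)[of t] g(4)[of t] in simp)
      qed (simp add: f(2) g(2))
    qed
    then show "?N (k + l) (\<lambda>i j. if i < k \<and> j < k then x i j else if k \<le> i \<and> k \<le> j then y (i - k) (j - k) else 0)
      \<le> max (?N k x) (?N l y)" by (simp only: J_def)
  next
    fix k l and \<alpha> \<beta> :: "nat \<Rightarrow> nat \<Rightarrow> complex" and x :: "nat \<Rightarrow> nat \<Rightarrow> 'e"
    let ?ab = "opnorm {..<l} {..<k} \<alpha> * opnorm {..<k} {..<l} \<beta>"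
    define T where "T = (\<lambda>(x :: nat \<Rightarrow> nat \<Rightarrow> 'e) i j. \<Sum>a<k. \<Sum>b<k. smult E0 (\<alpha> i a * \<beta> b j) (x a b))"
    interpret ck: couple ?sc "mnorm E0 k" "mnorm E1 k" by (rule cp)
    interpret cl: couple ?sc "mnorm E0 l" "mnorm E1 l" by (rule cp)
    have "0 \<le> ?ab" by (intro mult_nonneg_nonneg opnorm_nonneg) auto
    have "?N l (T x) \<le> ?N k x * r" if r: "?ab < r" for r
    proof -
      have r0: "0 < r" using r \<open>0 \<le> ?ab\<close> by linarith
      interpret couple_map ?sc "mnorm E0 k" "mnorm E1 k" ?sc "mnorm E0 l" "mnorm E1 l" T r r
      proof unfold_locales
        fix x :: "nat \<Rightarrow> nat \<Rightarrow> 'e"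
        have "mnorm E0 l (T x) \<le> ?ab * mnorm E0 k x" using E0.mult[where l = l and k = k and \<alpha> = \<alpha> and \<beta> = \<beta> and x = x] by (simp add: T_def mult_ac)
        also have "\<dots> \<le> r * mnorm E0 k x" using r by (intro mult_right_mono E0.nonneg) simp
        finally show "mnorm E0 l (T x) \<le> r * mnorm E0 k x" .
        have "mnorm E1 l (T x) \<le> ?ab * mnorm E1 k x" using E1.mult[where l = l and k = k and \<alpha> = \<alpha> and \<beta> = \<beta> and x = x] by (simp add: T_def sm mult_ac)
        also have "\<dots> \<le> r * mnorm E1 k x" using r by (intro mult_right_mono E1.nonneg) simp
        finally show "mnorm E1 l (T x) \<le> r * mnorm E1 k x" .
      qed (auto simp: T_def fun_eq_iff r0 E0.scale_right_distrib sum.distrib E0.scale_sum_right mult.commute)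
      show ?thesis using interp_map[OF \<theta>, of x] unfolding powr_same[OF r0] by (simp only: mult.commute)
    qed
    then have "?N l (T x) \<le> ?N k x * ?ab" by (rule le_mult_of_greater[OF _ ck.interp_nonneg[OF \<theta>]])
    then show "?N l (\<lambda>i j. \<Sum>a<k. \<Sum>b<k. smult (interpolation \<theta> E0 E1) (\<alpha> i a * \<beta> b j) (x a b))
      \<le> opnorm {..<l} {..<k} \<alpha> * ?N k x * opnorm {..<k} {..<l} \<beta>"
      by (simp add: T_def interpolation_def mult_ac)
  qed
qed


section \<open>Bases of maximally entangled vectors\<close>

text \<open>
  Orthonormal vectors of \<open>\<complex>\<^sup>n \<otimes> \<complex>\<^sup>n\<close> that are, as \<open>n \<times> n\<close> matrices, multiples of unitaries.
\<close>

locale bell_basis =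
  fixes \<psi> :: "'m::finite \<Rightarrow> 'n::finite \<times> 'n \<Rightarrow> complex"
  assumes orthonormal: "\<And>\<kappa> \<mu>. (\<Sum>s\<in>UNIV. cnj (\<psi> \<kappa> s) * \<psi> \<mu> s) = (if \<kappa> = \<mu> then 1 else 0)"
    and right_unitary: "\<And>\<kappa> a b. (\<Sum>c\<in>UNIV. \<psi> \<kappa> (a, c) * cnj (\<psi> \<kappa> (b, c))) = (if a = b then 1 / of_nat CARD('n) else 0)"
    and left_unitary: "\<And>\<kappa> c d. (\<Sum>a\<in>UNIV. cnj (\<psi> \<kappa> (a, c)) * \<psi> \<kappa> (a, d)) = (if c = d then 1 / of_nat CARD('n) else 0)"

lemma bell_basis_cnj:
  assumes "bell_basis \<psi>"
  shows "bell_basis (\<lambda>\<kappa> s. cnj (\<psi> \<kappa> s))"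
proof -
  interpret bell_basis \<psi> by fact
  show ?thesis
  proof
    show "(\<Sum>s\<in>UNIV. cnj (cnj (\<psi> \<kappa> s)) * cnj (\<psi> \<mu> s)) = (if \<kappa> = \<mu> then 1 else 0)" for \<kappa> \<mu>
      using orthonormal[of \<mu> \<kappa>] by (auto simp: mult.commute)
    show "(\<Sum>c\<in>UNIV. cnj (\<psi> \<kappa> (a, c)) * cnj (cnj (\<psi> \<kappa> (b, c)))) = (if a = b then 1 / of_nat CARD('b) else 0)" for \<kappa> a b
      using right_unitary[of \<kappa> b a] by (auto simp: mult.commute)
    show "(\<Sum>a\<in>UNIV. cnj (cnj (\<psi> \<kappa> (a, c))) * cnj (\<psi> \<kappa> (a, d))) = (if c = d then 1 / of_nat CARD('b) else 0)" for \<kappa> c d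
      using left_unitary[of \<kappa> d c] by (auto simp: mult.commute)
  qed
qed

lemma sum_cis_roots:
  assumes N: "0 < N" and d: "\<bar>d\<bar> < int N" "d \<noteq> 0"
  shows "(\<Sum>j<N. cis (2 * pi * real_of_int d * real j / real N)) = 0"
proof -
  let ?z = "cis (2 * pi * real_of_int d / real N)"
  have z: "cis (2 * pi * real_of_int d * real j / real N) = ?z ^ j" for j
    by (subst Complex.DeMoivre) (simp add: mult_ac)
  have "?z \<noteq> 1"
  proof
    assume "?z = 1"
    then have "cos (2 * pi * real_of_int d / real N) = 1" by (simp add: complex_eq_iff)
    then obtain k :: int where "2 * pi * real_of_int d / real N = of_int k * 2 * pi"
      by (auto simp: cos_one_2pi_int)
    then have "real_of_int d = real_of_int (k * int N)" using N by (simp add: field_simps)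
    then have "d = k * int N" by (simp only: of_int_eq_iff)
    moreover have "k \<noteq> 0" using calculation d by auto
    ultimately have "int N \<le> \<bar>d\<bar>" using N by (simp add: abs_mult)
    then show False using d by simp
  qed
  moreover have "?z ^ N = 1"
    using N by (simp add: Complex.DeMoivre)
  ultimately show ?thesis unfolding z by (simp add: geometric_sum)
qed

text \<open>
  The vectors of the Weyl matrices, that is, of products of powers of a cyclic shift and of a
  diagonal matrix of roots of unity.
\<close>

lemma bell_basis_exists:
  assumes card: "CARD('m::finite) = CARD('n::finite) ^ 2"
  obtains \<psi> :: "'m::finite \<Rightarrow> 'n::finite \<times> 'n \<Rightarrow> complex" where "bell_basis \<psi>"
proof -
  let ?N = "CARD('n)"
  have N: "0 < ?N" by simp
  obtain e :: "'n \<Rightarrow> nat" where e: "bij_betw e UNIV {..<?N}"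
    using finite_same_card_bij[of "UNIV :: 'n set" "{..<?N}"] by auto
  have "card (UNIV :: 'm set) = card (UNIV :: ('n \<times> 'n) set)" by (simp add: card power2_eq_square)
  then obtain h :: "'m \<Rightarrow> 'n \<times> 'n" where h: "bij h"
    using finite_same_card_bij[of "UNIV :: 'm set" "UNIV :: ('n \<times> 'n) set"] by auto
  have e_inj: "e a = e b \<longleftrightarrow> a = b" for a b using e by (auto simp: bij_betw_def inj_on_def)
  have e_less: "e a < ?N" for a using bij_betwE[OF e] by auto
  define shift where "shift = (\<lambda>r a. the_inv_into UNIV e ((e a + e r) mod ?N))"
  have e_shift: "e (shift r a) = (e a + e r) mod ?N" for r a
    unfolding shift_def using e N by (intro f_the_inv_into_f_bij_betw[OF e]) simp
  have mod_inj: "x = y" if "(x + r) mod ?N = (y + r) mod ?N" "x < ?N" "y < ?N" for x y r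
  proof -
    have "((x + r) mod ?N + (?N * r - r)) mod ?N = ((y + r) mod ?N + (?N * r - r)) mod ?N" using that(1) by simp
    then have "(x + r + (?N * r - r)) mod ?N = (y + r + (?N * r - r)) mod ?N" by (simp only: mod_add_left_eq)
    moreover have "z + r + (?N * r - r) = z + ?N * r" for z using N by (cases ?N) simp_all
    ultimately show ?thesis using that(2,3) by simp
  qed
  have shift_inj: "shift r a = shift r b \<longleftrightarrow> a = b" for r a b
    using mod_inj[of "e a" "e r" "e b"] e_less e_inj by (metis e_shift)
  have shift_inj': "shift r a = shift r' a \<longleftrightarrow> r = r'" for r r' a
    using mod_inj[of "e r" "e a" "e r'"] e_less e_inj by (metis e_shift add.commute)
  have shift_bij: "bij (shift r)" for r
  proof -
    have "inj (shift r)" using shift_inj by (simp add: inj_on_def)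
    then show ?thesis by (simp add: bij_def finite_UNIV_inj_surj)
  qed
  define \<omega> where "\<omega> = (\<lambda>\<kappa> a. cis (2 * pi * real (e (snd (h \<kappa>))) * real (e a) / real ?N) / of_real (sqrt ?N))"
  define \<psi> where "\<psi> = (\<lambda>\<kappa> (a, c). if c = shift (fst (h \<kappa>)) a then \<omega> \<kappa> a else 0)"
  have \<omega>: "cnj (\<omega> \<kappa> a) * \<omega> \<mu> a
      = cis (2 * pi * real_of_int (int (e (snd (h \<mu>))) - int (e (snd (h \<kappa>)))) * real (e a) / real ?N) / of_nat ?N" for \<kappa> \<mu> a
  proof -
    have "complex_of_real (sqrt ?N) * of_real (sqrt ?N) = of_nat ?N"
      by (simp add: of_real_mult[symmetric] del: of_real_mult)
    then show ?thesis
      by (simp add: \<omega>_def cis_cnj cis_mult diff_divide_distrib[symmetric] algebra_simps)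
  qed
  have \<omega>1: "cnj (\<omega> \<kappa> a) * \<omega> \<kappa> a = 1 / of_nat ?N" for \<kappa> a by (simp add: \<omega>)
  show thesis
  proof (rule that, rule bell_basis.intro)
    fix \<kappa> \<mu>
    have "(\<Sum>s\<in>UNIV. cnj (\<psi> \<kappa> s) * \<psi> \<mu> s) = (\<Sum>a\<in>UNIV. \<Sum>c\<in>UNIV. cnj (\<psi> \<kappa> (a, c)) * \<psi> \<mu> (a, c))"
      by (simp add: UNIV_Times_UNIV[symmetric] sum_Times del: UNIV_Times_UNIV)
    also have "\<dots> = (\<Sum>a\<in>UNIV. \<Sum>c\<in>UNIV. if c = shift (fst (h \<kappa>)) a then if fst (h \<kappa>) = fst (h \<mu>) then cnj (\<omega> \<kappa> a) * \<omega> \<mu> a else 0 else 0)"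
      by (intro sum.cong refl) (auto simp: \<psi>_def shift_inj')
    also have "\<dots> = (\<Sum>a\<in>UNIV. if fst (h \<kappa>) = fst (h \<mu>) then cnj (\<omega> \<kappa> a) * \<omega> \<mu> a else 0)" by simp
    also have "\<dots> = (if \<kappa> = \<mu> then 1 else 0)"
    proof (cases "fst (h \<kappa>) = fst (h \<mu>)")
      case True
      show ?thesis
      proof (cases "snd (h \<kappa>) = snd (h \<mu>)")
        case eq: True
        then have "h \<kappa> = h \<mu>" using True by (simp add: prod_eq_iff)
        then have "\<kappa> = \<mu>" using h by (simp add: bij_def inj_eq)
        then show ?thesis by (simp add: \<omega>1)
      next
        case ne: False
        then have "\<kappa> \<noteq> \<mu>" by auto
        let ?d = "int (e (snd (h \<mu>))) - int (e (snd (h \<kappa>)))"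
        have "\<bar>?d\<bar> < int ?N" "?d \<noteq> 0"
          using e_less[of "snd (h \<mu>)"] e_less[of "snd (h \<kappa>)"] e_inj[of "snd (h \<mu>)" "snd (h \<kappa>)"] ne by auto
        from sum_cis_roots[OF N this]
        have "(\<Sum>a\<in>UNIV. cis (2 * pi * real_of_int ?d * real (e a) / real ?N)) = 0"
          using sum.reindex_bij_betw[OF e, of "\<lambda>j. cis (2 * pi * real_of_int ?d * real j / real ?N)"] by simp
        then show ?thesis using True \<open>\<kappa> \<noteq> \<mu>\<close> by (simp add: \<omega> sum_divide_distrib[symmetric])
      qed
    qed auto
    finally show "(\<Sum>s\<in>UNIV. cnj (\<psi> \<kappa> s) * \<psi> \<mu> s) = (if \<kappa> = \<mu> then 1 else 0)" .
  next
    fix \<kappa> and a b :: 'n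
    have "(\<Sum>c\<in>UNIV. \<psi> \<kappa> (a, c) * cnj (\<psi> \<kappa> (b, c)))
      = (\<Sum>c\<in>UNIV. if c = shift (fst (h \<kappa>)) a then if a = b then cnj (\<omega> \<kappa> a) * \<omega> \<kappa> a else 0 else 0)"
      by (intro sum.cong refl) (auto simp: \<psi>_def shift_inj)
    then show "(\<Sum>c\<in>UNIV. \<psi> \<kappa> (a, c) * cnj (\<psi> \<kappa> (b, c))) = (if a = b then 1 / of_nat ?N else 0)"
      by (simp add: \<omega>1)
  next
    fix \<kappa> and c d :: 'n
    let ?s = "shift (fst (h \<kappa>))"
    obtain a where a: "c = ?s a" using shift_bij[of "fst (h \<kappa>)"] by (auto simp: bij_def surj_def)
    have "(\<Sum>a'\<in>UNIV. cnj (\<psi> \<kappa> (a', c)) * \<psi> \<kappa> (a', d))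
      = (\<Sum>a'\<in>UNIV. if a' = a then if c = d then cnj (\<omega> \<kappa> a) * \<omega> \<kappa> a else 0 else 0)"
      by (intro sum.cong refl) (auto simp: \<psi>_def a shift_inj)
    then show "(\<Sum>a\<in>UNIV. cnj (\<psi> \<kappa> (a, c)) * \<psi> \<kappa> (a, d)) = (if c = d then 1 / of_nat ?N else 0)"
      by (simp add: \<omega>1)
  qed
qed

lemma (in ruan_seminorm) inorm_mult_amplified_right:
  fixes I :: "'i set" and J :: "'j set" and K :: "'k set"
  assumes fin: "finite I" "finite J" "finite K"
    and n: "opnorm I J \<alpha> \<le> a" "opnorm J I \<beta> \<le> b"
  shows "inorm E (K \<times> I) (\<lambda>(c, i) (d, j). \<Sum>s\<in>J. \<Sum>t\<in>J. smult E (\<alpha> i s * \<beta> t j) (x (c, s) (d, t)))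
    \<le> a * inorm E (K \<times> J) x * b"
proof -
  have sw: "bij_betw prod.swap (K \<times> I) (I \<times> K)" "bij_betw prod.swap (J \<times> K) (K \<times> J)"
    by (auto intro!: bij_betw_byWitness[where f' = prod.swap])
  let ?y = "\<lambda>p q. x (prod.swap p) (prod.swap q)"
  have "inorm E (K \<times> I) (\<lambda>(c, i) (d, j). \<Sum>s\<in>J. \<Sum>t\<in>J. smult E (\<alpha> i s * \<beta> t j) (x (c, s) (d, t)))
    = inorm E (I \<times> K) (\<lambda>(i, c) (j, d). \<Sum>s\<in>J. \<Sum>t\<in>J. smult E (\<alpha> i s * \<beta> t j) (?y (s, c) (t, d)))"
    using inorm_reindex[OF sw(1), of "\<lambda>(i, c) (j, d). \<Sum>s\<in>J. \<Sum>t\<in>J. smult E (\<alpha> i s * \<beta> t j) (?y (s, c) (t, d))"] fin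
    by (simp add: case_prod_unfold)
  also have "\<dots> \<le> opnorm I J \<alpha> * inorm E (J \<times> K) ?y * opnorm J I \<beta>" by (rule inorm_mult_amplified[OF fin])
  also have "inorm E (J \<times> K) ?y = inorm E (K \<times> J) x" by (rule inorm_reindex[OF sw(2)]) (use fin in auto)
  also have "opnorm I J \<alpha> * inorm E (K \<times> J) x * opnorm J I \<beta> \<le> a * inorm E (K \<times> J) x * b"
    using order_trans[OF opnorm_nonneg n(1)] fin n
    by (intro mult_mono mult_nonneg_nonneg inorm_nonneg opnorm_nonneg) auto
  finally show ?thesis .
qed

lemma inorm_scalars:
  assumes fin: "finite I"
  shows "inorm scalars I x = opnorm I I x"
proof -
  have "inorm scalars I x = opnorm {..<card I} {..<card I} (\<lambda>i j. x (enumeration I i) (enumeration I j))"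
    by (simp add: inorm_def scalars_def)
  then show ?thesis using opnorm_reindex[OF bij_enumeration[OF fin] bij_enumeration[OF fin] fin fin] by simp
qed

lemma matrix_norm_scalars: "finite I \<Longrightarrow> matrix_norm I X = inorm scalars (I \<times> UNIV) (\<lambda>(i, a) (j, b). X i j $ a $ b)"
  unfolding matrix_norm_def by (rule inorm_scalars[symmetric]) simp

lemma smult_scalars: "smult scalars = (*)"
  by (simp add: scalars_def)

context bell_basis
begin

lemma opnorm_bell: "opnorm UNIV UNIV (\<lambda>s \<kappa>. \<psi> \<kappa> s) \<le> 1" "opnorm UNIV UNIV (\<lambda>\<kappa> s. cnj (\<psi> \<kappa> s)) \<le> 1"
proof -
  show 1: "opnorm UNIV UNIV (\<lambda>s \<kappa>. \<psi> \<kappa> s) \<le> 1"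
    by (rule opnorm_scaled_isometry) (auto simp: orthonormal)
  show "opnorm UNIV UNIV (\<lambda>\<kappa> s. cnj (\<psi> \<kappa> s)) \<le> 1"
    by (rule order_trans[OF opnorm_adjoint 1]) auto
qed

lemma opnorm_bell_matrix: "opnorm UNIV UNIV (\<lambda>a c. \<psi> \<kappa> (a, c)) \<le> 1 / sqrt CARD('n)"
  "opnorm UNIV UNIV (\<lambda>c a. cnj (\<psi> \<kappa> (a, c))) \<le> 1 / sqrt CARD('n)"
proof -
  show 1: "opnorm UNIV UNIV (\<lambda>a c. \<psi> \<kappa> (a, c)) \<le> 1 / sqrt CARD('n)"
    by (rule opnorm_scaled_isometry) (auto simp: left_unitary power_divide)
  show "opnorm UNIV UNIV (\<lambda>c a. cnj (\<psi> \<kappa> (a, c))) \<le> 1 / sqrt CARD('n)"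
    by (rule order_trans[OF opnorm_adjoint 1]) auto
qed

end

text \<open>Each diagonal block is a compression.\<close>

lemma (in ruan_seminorm) inorm_pinch:
  assumes fin: "finite I" "finite K"
  shows "inorm E (I \<times> K) (\<lambda>(i, \<kappa>) (j, \<mu>). if \<kappa> = \<mu> then y (i, \<kappa>) (j, \<kappa>) else 0) \<le> inorm E (I \<times> K) y"
proof (rule inorm_block_diagonal[OF fin inorm_nonneg])
  fix \<kappa> assume "\<kappa> \<in> K"
  then show "inorm E I (\<lambda>i j. y (i, \<kappa>) (j, \<kappa>)) \<le> inorm E (I \<times> K) y"
    using inorm_compress[of I "I \<times> K" "\<lambda>i. (i, \<kappa>)" y] fin by (auto simp: inj_on_def)
qed

text \<open>Pinching to the diagonal, followed by the isometry that sends the standard basis to \<open>\<psi>\<close>.\<close>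

lemma (in ruan_seminorm) inorm_bell_expand:
  fixes \<psi> :: "'m::finite \<Rightarrow> 'n::finite \<times> 'n \<Rightarrow> complex" and I :: "'i set"
  assumes "bell_basis \<psi>" and fin: "finite I"
  shows "inorm E ((I \<times> UNIV) \<times> UNIV)
      (\<lambda>((i, a), c) ((j, b), d). \<Sum>\<kappa>\<in>UNIV. smult E (\<psi> \<kappa> (a, c) * cnj (\<psi> \<kappa> (b, d))) (y (i, \<kappa>) (j, \<kappa>)))
    \<le> inorm E (I \<times> UNIV) y"
proof -
  interpret bell_basis \<psi> by fact
  let ?y = "\<lambda>(i, \<kappa>) (j, \<mu>). if \<kappa> = \<mu> then y (i, \<kappa>) (j, \<kappa>) else 0"
  let ?x = "\<lambda>(i, s) (j, t). \<Sum>\<kappa>\<in>UNIV. smult E (\<psi> \<kappa> s * cnj (\<psi> \<kappa> t)) (y (i, \<kappa>) (j, \<kappa>))"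
  let ?f = "\<lambda>((i :: 'i, a :: 'n), c :: 'n). (i, (a, c))"
  have f: "bij_betw ?f ((I \<times> UNIV) \<times> UNIV) (I \<times> UNIV)"
    by (rule bij_betw_byWitness[where f' = "\<lambda>(i, (a, c)). ((i, a), c)"]) auto
  have "inorm E ((I \<times> UNIV) \<times> UNIV)
      (\<lambda>((i, a), c) ((j, b), d). \<Sum>\<kappa>\<in>UNIV. smult E (\<psi> \<kappa> (a, c) * cnj (\<psi> \<kappa> (b, d))) (y (i, \<kappa>) (j, \<kappa>)))
    = inorm E (I \<times> UNIV) ?x"
    using inorm_reindex[OF f, of ?x] fin by (simp add: case_prod_unfold)
  also have "\<dots> = inorm E (I \<times> UNIV) (\<lambda>(i, s) (j, t). \<Sum>\<kappa>\<in>UNIV. \<Sum>\<mu>\<in>UNIV. smult E (\<psi> \<kappa> s * cnj (\<psi> \<mu> t)) (?y (i, \<kappa>) (j, \<mu>)))"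
  proof -
    have "(\<Sum>\<mu>\<in>UNIV. smult E (\<psi> \<kappa> s * cnj (\<psi> \<mu> t)) (?y (i, \<kappa>) (j, \<mu>))) = smult E (\<psi> \<kappa> s * cnj (\<psi> \<kappa> t)) (y (i, \<kappa>) (j, \<kappa>))" for \<kappa> s t i j
    proof -
      have "(\<Sum>\<mu>\<in>UNIV. smult E (\<psi> \<kappa> s * cnj (\<psi> \<mu> t)) (?y (i, \<kappa>) (j, \<mu>)))
        = (\<Sum>\<mu>\<in>UNIV. if \<kappa> = \<mu> then smult E (\<psi> \<kappa> s * cnj (\<psi> \<kappa> t)) (y (i, \<kappa>) (j, \<kappa>)) else 0)"
        by (intro sum.cong) auto
      then show ?thesis by simp
    qed
    then show ?thesis by simp
  qed
  also have "\<dots> \<le> 1 * inorm E (I \<times> UNIV) ?y * 1"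
    by (rule inorm_mult_amplified_right[OF _ _ fin opnorm_bell]) auto
  also have "\<dots> \<le> inorm E (I \<times> UNIV) y" using inorm_pinch[OF fin, of UNIV y] by simp
  finally show ?thesis .
qed

text \<open>Conjugation by the adjoint of that isometry, followed by pinching to the diagonal.\<close>

lemma (in ruan_seminorm) inorm_bell_compress:
  fixes \<psi> :: "'m::finite \<Rightarrow> 'n::finite \<times> 'n \<Rightarrow> complex" and I :: "'i set"
  assumes "bell_basis \<psi>" and fin: "finite I"
  shows "inorm E (I \<times> UNIV) (\<lambda>(i, \<kappa>) (j, \<mu>). if \<kappa> = \<mu> then
      \<Sum>s\<in>UNIV. \<Sum>t\<in>UNIV. smult E (cnj (\<psi> \<kappa> s) * \<psi> \<kappa> t) (y ((i, fst s), snd s) ((j, fst t), snd t)) else 0)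
    \<le> inorm E ((I \<times> UNIV) \<times> UNIV) y"
proof -
  interpret bell_basis \<psi> by fact
  let ?f = "\<lambda>p :: 'i \<times> 'n \<times> 'n. ((fst p, fst (snd p)), snd (snd p))"
  let ?y = "\<lambda>p q. y (?f p) (?f q)"
  have f: "bij_betw ?f (I \<times> UNIV) ((I \<times> UNIV) \<times> UNIV)"
    by (rule bij_betw_byWitness[where f' = "\<lambda>((i, a), c). (i, (a, c))"]) auto
  let ?z = "\<lambda>(i, \<kappa>) (j, \<mu>). \<Sum>s\<in>UNIV. \<Sum>t\<in>UNIV. smult E (cnj (\<psi> \<kappa> s) * \<psi> \<mu> t) (?y (i, s) (j, t))"
  have "inorm E (I \<times> UNIV) (\<lambda>(i, \<kappa>) (j, \<mu>). if \<kappa> = \<mu> then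
      \<Sum>s\<in>UNIV. \<Sum>t\<in>UNIV. smult E (cnj (\<psi> \<kappa> s) * \<psi> \<kappa> t) (y ((i, fst s), snd s) ((j, fst t), snd t)) else 0)
    = inorm E (I \<times> UNIV) (\<lambda>(i, \<kappa>) (j, \<mu>). if \<kappa> = \<mu> then ?z (i, \<kappa>) (j, \<kappa>) else 0)"
    by (rule inorm_cong) (use fin in auto)
  also have "\<dots> \<le> inorm E (I \<times> UNIV) ?z" by (rule inorm_pinch) (use fin in auto)
  also have "\<dots> \<le> 1 * inorm E (I \<times> UNIV) ?y * 1"
    by (rule inorm_mult_amplified_right[OF _ _ fin opnorm_bell(2,1)]) auto
  also have "inorm E (I \<times> UNIV) ?y = inorm E ((I \<times> UNIV) \<times> UNIV) y" by (rule inorm_reindex[OF f]) (use fin in auto)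
  finally show ?thesis by simp
qed

text \<open>Conjugation by \<open>n\<^sup>-\<^sup>1\<^sup>/\<^sup>2\<close> times a unitary, namely the matrix \<open>\<psi> \<kappa>\<close>.\<close>

lemma (in ruan_seminorm) inorm_bell_conjugate:
  fixes \<psi> :: "'m::finite \<Rightarrow> 'n::finite \<times> 'n \<Rightarrow> complex" and I :: "'i set"
  assumes "bell_basis \<psi>" and fin: "finite I"
  shows "inorm E (I \<times> UNIV) (\<lambda>(i, a) (j, b). \<Sum>c\<in>UNIV. \<Sum>d\<in>UNIV. smult E (\<psi> \<kappa> (a, c) * cnj (\<psi> \<kappa> (b, d))) (y (i, c) (j, d)))
    \<le> 1 / CARD('n) * inorm E (I \<times> UNIV) y"
proof -
  interpret bell_basis \<psi> by fact
  have "inorm E (I \<times> UNIV) (\<lambda>(i, a) (j, b). \<Sum>c\<in>UNIV. \<Sum>d\<in>UNIV. smult E (\<psi> \<kappa> (a, c) * cnj (\<psi> \<kappa> (b, d))) (y (i, c) (j, d)))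
    \<le> 1 / sqrt CARD('n) * inorm E (I \<times> UNIV) y * (1 / sqrt CARD('n))"
    by (rule inorm_mult_amplified_right[OF _ _ fin opnorm_bell_matrix]) auto
  then show ?thesis by (simp add: field_simps)
qed

section \<open>Estimates at the end points\<close>

lemma sum_UNIV_pair: "(\<Sum>s\<in>UNIV. F s) = (\<Sum>a\<in>UNIV. \<Sum>c\<in>UNIV. F (a, c))" for F :: "'a::finite \<times> 'b::finite \<Rightarrow> 'c::comm_monoid_add"
  by (simp add: UNIV_Times_UNIV[symmetric] sum_Times del: UNIV_Times_UNIV)

text \<open>The row operator is \<open>\<alpha> \<otimes> 1\<close> followed by a multiple of a coisometry of norm \<open>\<surd>(card K)\<close>.\<close>

lemma opnorm_column_to_row:
  fixes I :: "'i set" and K :: "'k set" and J :: "'j set"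
  assumes fin: "finite I" "finite J" "finite K"
  shows "opnorm I (J \<times> K) (\<lambda>i (y, a). \<alpha> (i, a) y) \<le> sqrt (card K) * opnorm (I \<times> K) J \<alpha>"
proof -
  define R where "R = (\<lambda>(i :: 'i) (x :: ('i \<times> 'k) \<times> 'k). if fst (fst x) = i \<and> snd (fst x) = snd x then (1::complex) else 0)"
  define A where "A = (\<lambda>(x :: 'i \<times> 'k, \<kappa> :: 'k) (y :: 'j, \<mu>). if \<kappa> = \<mu> then \<alpha> x y else 0)"
  let ?X = "(I \<times> K) \<times> K"
  have A: "opnorm ?X (J \<times> K) A \<le> opnorm (I \<times> K) J \<alpha>"
    unfolding A_def by (intro opnorm_block_diagonal opnorm_nonneg) (use fin in auto)
  have R: "opnorm I ?X R \<le> sqrt (card K)"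
  proof (rule opnorm_scaled_coisometry)
    fix i i' assume i: "i \<in> I" "i' \<in> I"
    have "(\<Sum>x\<in>?X. R i x * cnj (R i' x)) = (\<Sum>j\<in>I. \<Sum>a\<in>K. \<Sum>b\<in>K. if b = a then if j = i then if i = i' then 1 else 0 else 0 else 0)"
      unfolding sum_Times by (intro sum.cong refl) (auto simp: R_def)
    also have "\<dots> = (\<Sum>j\<in>I. if j = i then of_nat (card K) * (if i = i' then 1 else 0) else 0)"
      using fin by (intro sum.cong refl) auto
    finally show "(\<Sum>x\<in>?X. R i x * cnj (R i' x)) = (if i = i' then of_real ((sqrt (card K))\<^sup>2) else 0)"
      using i fin by simp
  qed (use fin in auto)
  have "opnorm I (J \<times> K) (\<lambda>i (y, a). \<alpha> (i, a) y) = opnorm I (J \<times> K) (\<lambda>i z. \<Sum>x\<in>?X. R i x * A x z)"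
  proof (rule opnorm_cong)
    fix i z assume i: "i \<in> I" and "z \<in> J \<times> K"
    then obtain y a where z: "z = (y, a)" "a \<in> K" by auto
    have "(\<Sum>x\<in>?X. R i x * A x z) = (\<Sum>j\<in>I. \<Sum>b\<in>K. \<Sum>c\<in>K. if c = a then if b = a then if j = i then \<alpha> (i, a) y else 0 else 0 else 0)"
      unfolding sum_Times by (intro sum.cong refl) (auto simp: R_def A_def z)
    then show "(\<lambda>(y, a). \<alpha> (i, a) y) z = (\<Sum>x\<in>?X. R i x * A x z)" using i z fin by simp
  qed
  also have "\<dots> \<le> sqrt (card K) * opnorm (I \<times> K) J \<alpha>"
    by (rule opnorm_mult_le[OF _ _ _ R A]) (use fin in auto)
  finally show ?thesis .
qed

text \<open>As completely bounded maps on matrix algebras, \<open>v\<close> and \<open>V\<close> are applied one after the other.\<close>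

lemma trace_class_slice:
  fixes v :: "'p \<Rightarrow> 'p \<Rightarrow> complex ^ 'n ^ 'n" and V :: "'q \<times> 'n \<Rightarrow> 'q \<times> 'n \<Rightarrow> complex ^ 'm ^ 'm"
  assumes fin: "finite P" "finite Q"
  shows "inorm trace_class (Q \<times> P) (\<lambda>(s, p) (t, q). \<chi> \<kappa> \<mu>. \<Sum>a\<in>UNIV. \<Sum>b\<in>UNIV. v p q $ a $ b * V (s, a) (t, b) $ \<kappa> $ \<mu>)
    \<le> inorm trace_class P v * inorm trace_class (Q \<times> UNIV) V"
proof (rule trace_class_le)
  fix m :: nat and Y :: "nat \<Rightarrow> nat \<Rightarrow> complex ^ 'm ^ 'm"
  let ?I = "{..<m}"
  let ?V = "\<lambda>(s, p) (t, q). \<chi> \<kappa> \<mu>. \<Sum>a\<in>UNIV. \<Sum>b\<in>UNIV. v p q $ a $ b * V (s, a) (t, b) $ \<kappa> $ \<mu>"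
  define U :: "nat \<times> 'q \<Rightarrow> nat \<times> 'q \<Rightarrow> complex ^ 'n ^ 'n" where
    "U = (\<lambda>(x, s) (y, t). \<chi> a b. pairing V Y (x, (s, a)) (y, (t, b)))"
  let ?f = "\<lambda>(x :: nat, (s :: 'q, p :: 'p)). ((x, s), p)" and ?g = "\<lambda>((x :: nat, s :: 'q), a :: 'n). (x, (s, a))"
  have f: "bij_betw ?f (?I \<times> Q \<times> P) ((?I \<times> Q) \<times> P)"
    by (rule bij_betw_byWitness[where f' = "\<lambda>((x, s), p). (x, (s, p))"]) auto
  have g: "bij_betw ?g ((?I \<times> Q) \<times> UNIV) (?I \<times> Q \<times> UNIV)"
    by (rule bij_betw_byWitness[where f' = "\<lambda>(x, (s, p)). ((x, s), p)"]) auto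
  have entry: "pairing ?V Y (x, (s, p)) (y, (t, q)) = pairing v U ((x, s), p) ((y, t), q)" for x y s t p q
  proof -
    have "pairing ?V Y (x, (s, p)) (y, (t, q))
      = (\<Sum>\<kappa>\<in>UNIV. \<Sum>\<mu>\<in>UNIV. \<Sum>a\<in>UNIV. \<Sum>b\<in>UNIV. v p q $ a $ b * (V (s, a) (t, b) $ \<kappa> $ \<mu> * Y x y $ \<kappa> $ \<mu>))"
      by (simp add: pairing_def sum_distrib_right mult.assoc)
    also have "\<dots> = (\<Sum>a\<in>UNIV. \<Sum>b\<in>UNIV. \<Sum>\<kappa>\<in>UNIV. \<Sum>\<mu>\<in>UNIV. v p q $ a $ b * (V (s, a) (t, b) $ \<kappa> $ \<mu> * Y x y $ \<kappa> $ \<mu>))"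
      by (rule sum_swap4)
    also have "\<dots> = pairing v U ((x, s), p) ((y, t), q)"
      by (simp add: pairing_def U_def sum_distrib_left)
    finally show ?thesis .
  qed
  have "opnorm (?I \<times> Q \<times> P) (?I \<times> Q \<times> P) (pairing ?V Y)
    = opnorm (?I \<times> Q \<times> P) (?I \<times> Q \<times> P) (\<lambda>x y. pairing v U (?f x) (?f y))"
    by (rule opnorm_cong) (auto simp only: entry prod.case split: prod.split)
  also have "\<dots> = opnorm ((?I \<times> Q) \<times> P) ((?I \<times> Q) \<times> P) (pairing v U)"
    by (rule opnorm_reindex[OF f f]) (use fin in auto)
  also have "\<dots> \<le> inorm trace_class P v * matrix_norm (?I \<times> Q) U" by (rule trace_class_apply) (use fin in auto)
  also have "matrix_norm (?I \<times> Q) U = opnorm ((?I \<times> Q) \<times> UNIV) ((?I \<times> Q) \<times> UNIV) (\<lambda>x y. pairing V Y (?g x) (?g y))"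
    unfolding matrix_norm_def by (rule opnorm_cong) (auto simp: U_def)
  also have "\<dots> = opnorm (?I \<times> Q \<times> UNIV) (?I \<times> Q \<times> UNIV) (pairing V Y)"
    by (rule opnorm_reindex[OF g g]) (use fin in auto)
  also have "inorm trace_class P v * \<dots> \<le> inorm trace_class P v * (inorm trace_class (Q \<times> UNIV) V * matrix_norm ?I Y)"
    by (intro mult_left_mono trace_class_apply inorm_trace_class_nonneg) (use fin in auto)
  finally show "opnorm (?I \<times> Q \<times> P) (?I \<times> Q \<times> P) (pairing ?V Y)
    \<le> inorm trace_class P v * inorm trace_class (Q \<times> UNIV) V * matrix_norm ?I Y" by (simp only: mult.assoc)
qed (use fin in \<open>auto intro!: mult_nonneg_nonneg inorm_trace_class_nonneg\<close>)

context bell_basis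
begin

lemma bell: "bell_basis \<psi>" by (rule bell_basis_axioms)

text \<open>
  Under the trace pairing, \<open>twist\<close> is adjoint to the compression to the diagonal in the basis \<open>\<psi>\<close>,
  and \<open>untwist\<close> to the expansion of a diagonal in that basis.
\<close>

definition twist :: "('i \<Rightarrow> 'i \<Rightarrow> complex ^ 'm ^ 'm) \<Rightarrow> 'i \<times> 'n \<Rightarrow> 'i \<times> 'n \<Rightarrow> complex ^ 'n ^ 'n" where
  "twist Y = (\<lambda>(x, a) (y, b). \<chi> c d. \<Sum>\<kappa>\<in>UNIV. cnj (\<psi> \<kappa> (a, c)) * \<psi> \<kappa> (b, d) * Y x y $ \<kappa> $ \<kappa>)"

definition untwist :: "('i \<Rightarrow> 'i \<Rightarrow> complex ^ 'n ^ 'n) \<Rightarrow> 'i \<times> 'n \<Rightarrow> 'i \<times> 'n \<Rightarrow> complex ^ 'm ^ 'm" where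
  "untwist X = (\<lambda>(x, a) (y, b). \<chi> \<kappa> \<mu>. if \<kappa> = \<mu> then
     \<Sum>c\<in>UNIV. \<Sum>d\<in>UNIV. \<psi> \<kappa> (a, c) * cnj (\<psi> \<kappa> (b, d)) * X x y $ c $ d else 0)"

lemma matrix_norm_twist:
  assumes fin: "finite I"
  shows "matrix_norm (I \<times> UNIV) (twist Y) \<le> matrix_norm I Y"
  using ruan_seminorm.inorm_bell_expand[OF ruan_seminorm_scalars bell_basis_cnj[OF bell] fin, of "\<lambda>(x, \<kappa>) (y, \<mu>). Y x y $ \<kappa> $ \<mu>"] fin
  by (simp add: matrix_norm_scalars twist_def smult_scalars case_prod_unfold)

text \<open>The block of \<open>\<kappa>\<close> is conjugation by \<open>\<psi> \<kappa>\<close>, which is \<open>n\<^sup>-\<^sup>1\<^sup>/\<^sup>2\<close> times a unitary.\<close>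

lemma matrix_norm_untwist:
  assumes fin: "finite I"
  shows "matrix_norm (I \<times> UNIV) (untwist X) \<le> 1 / CARD('n) * matrix_norm I X"
proof -
  interpret scalars: ruan_seminorm scalars by (rule ruan_seminorm_scalars)
  let ?x = "\<lambda>\<kappa> (x, a) (y, b). \<Sum>c\<in>UNIV. \<Sum>d\<in>UNIV. \<psi> \<kappa> (a, c) * cnj (\<psi> \<kappa> (b, d)) * X x y $ c $ d"
  have "matrix_norm (I \<times> UNIV) (untwist X) = inorm scalars ((I \<times> UNIV) \<times> UNIV) (\<lambda>(p, \<kappa>) (q, \<mu>). untwist X p q $ \<kappa> $ \<mu>)"
    by (rule matrix_norm_scalars) (use fin in auto)
  also have "\<dots> = inorm scalars ((I \<times> UNIV) \<times> UNIV) (\<lambda>(p, \<kappa>) (q, \<mu>). if \<kappa> = \<mu> then ?x \<kappa> p q else 0)"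
    by (rule scalars.inorm_cong) (use fin in \<open>auto simp: untwist_def\<close>)
  also have "\<dots> \<le> 1 / CARD('n) * matrix_norm I X"
  proof (rule scalars.inorm_block_diagonal)
    show "inorm scalars (I \<times> UNIV) (?x \<kappa>) \<le> 1 / CARD('n) * matrix_norm I X" for \<kappa>
      using scalars.inorm_bell_conjugate[OF bell fin, of \<kappa> "\<lambda>(x, c) (y, d). X x y $ c $ d"] fin
      by (simp add: matrix_norm_scalars smult_scalars case_prod_unfold)
  qed (use fin matrix_norm_nonneg[OF fin, of X] in auto)
  finally show ?thesis .
qed

text \<open>
  By duality from \<open>untwist\<close>, which has norm \<open>1/n\<close>. This is the gain that makes up for the passage
  from the operator norm to the trace norm.
\<close>

lemma trace_class_expand:
  assumes fin: "finite P"
  shows "inorm trace_class (P \<times> UNIV) (\<lambda>(p, a) (q, b). \<chi> c d. \<Sum>\<kappa>\<in>UNIV. \<psi> \<kappa> (a, c) * cnj (\<psi> \<kappa> (b, d)) * v p q $ \<kappa> $ \<kappa>)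
    \<le> 1 / CARD('n) * inorm trace_class P v" (is "inorm trace_class _ ?V \<le> _")
proof (rule trace_class_le)
  fix m :: nat and X :: "nat \<Rightarrow> nat \<Rightarrow> complex ^ 'n ^ 'n"
  let ?I = "{..<m}"
  let ?f = "\<lambda>(x :: nat, (p, a :: 'n)). ((x, a), p)"
  have f: "bij_betw ?f (?I \<times> P \<times> UNIV) ((?I \<times> UNIV) \<times> P)"
    by (rule bij_betw_byWitness[where f' = "\<lambda>((x, a), p). (x, (p, a))"]) auto
  have entry: "pairing ?V X (x, (p, a)) (y, (q, b)) = pairing v (untwist X) ((x, a), p) ((y, b), q)" for x y p q a b
  proof -
    let ?F = "\<lambda>c d \<kappa>. v p q $ \<kappa> $ \<kappa> * (\<psi> \<kappa> (a, c) * cnj (\<psi> \<kappa> (b, d)) * X x y $ c $ d)"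
    have "pairing ?V X (x, (p, a)) (y, (q, b)) = (\<Sum>c\<in>UNIV. \<Sum>d\<in>UNIV. \<Sum>\<kappa>\<in>UNIV. ?F c d \<kappa>)"
      by (simp add: pairing_def sum_distrib_right) (simp add: mult_ac)
    also have "\<dots> = (\<Sum>c\<in>UNIV. \<Sum>\<kappa>\<in>UNIV. \<Sum>d\<in>UNIV. ?F c d \<kappa>)" by (rule sum.cong[OF refl], rule sum.swap)
    also have "\<dots> = (\<Sum>\<kappa>\<in>UNIV. \<Sum>c\<in>UNIV. \<Sum>d\<in>UNIV. ?F c d \<kappa>)" by (rule sum.swap)
    also have "\<dots> = (\<Sum>\<kappa>\<in>UNIV. \<Sum>\<mu>\<in>UNIV. if \<kappa> = \<mu> then \<Sum>c\<in>UNIV. \<Sum>d\<in>UNIV. ?F c d \<kappa> else 0)" by simp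
    also have "\<dots> = pairing v (untwist X) ((x, a), p) ((y, b), q)"
      unfolding pairing_def untwist_def prod.case by (intro sum.cong refl) (simp add: sum_distrib_left)
    finally show ?thesis .
  qed
  have "opnorm (?I \<times> P \<times> UNIV) (?I \<times> P \<times> UNIV) (pairing ?V X)
    = opnorm (?I \<times> P \<times> UNIV) (?I \<times> P \<times> UNIV) (\<lambda>x y. pairing v (untwist X) (?f x) (?f y))"
    by (rule opnorm_cong) (auto simp only: entry prod.case split: prod.split)
  also have "\<dots> = opnorm ((?I \<times> UNIV) \<times> P) ((?I \<times> UNIV) \<times> P) (pairing v (untwist X))"
    by (rule opnorm_reindex[OF f f]) (use fin in auto)
  also have "\<dots> \<le> inorm trace_class P v * matrix_norm (?I \<times> UNIV) (untwist X)"
    by (rule trace_class_apply) (use fin in auto)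
  also have "\<dots> \<le> inorm trace_class P v * (1 / CARD('n) * matrix_norm ?I X)"
    by (intro mult_left_mono matrix_norm_untwist inorm_trace_class_nonneg) auto
  finally show "opnorm (?I \<times> P \<times> UNIV) (?I \<times> P \<times> UNIV) (pairing ?V X)
    \<le> 1 / CARD('n) * inorm trace_class P v * matrix_norm ?I X" by (simp add: mult_ac)
qed (use fin in \<open>simp_all add: inorm_trace_class_nonneg\<close>)

text \<open>By duality from \<open>twist\<close>, which is contractive.\<close>

lemma trace_class_compress:
  assumes fin: "finite P"
  shows "inorm trace_class (P \<times> UNIV) (\<lambda>(p, a) (q, b). \<chi> \<kappa> \<mu>. if \<kappa> = \<mu> then
      \<Sum>c\<in>UNIV. \<Sum>d\<in>UNIV. cnj (\<psi> \<kappa> (a, c)) * \<psi> \<kappa> (b, d) * v p q $ c $ d else 0)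
    \<le> inorm trace_class P v" (is "inorm trace_class _ ?V \<le> _")
proof (rule trace_class_le)
  fix m :: nat and Y :: "nat \<Rightarrow> nat \<Rightarrow> complex ^ 'm ^ 'm"
  let ?I = "{..<m}"
  let ?f = "\<lambda>(x :: nat, (p, a :: 'n)). ((x, a), p)"
  have f: "bij_betw ?f (?I \<times> P \<times> UNIV) ((?I \<times> UNIV) \<times> P)"
    by (rule bij_betw_byWitness[where f' = "\<lambda>((x, a), p). (x, (p, a))"]) auto
  have entry: "pairing ?V Y (x, (p, a)) (y, (q, b)) = pairing v (twist Y) ((x, a), p) ((y, b), q)" for x y p q a b
  proof -
    let ?F = "\<lambda>c d \<kappa>. v p q $ c $ d * (cnj (\<psi> \<kappa> (a, c)) * \<psi> \<kappa> (b, d) * Y x y $ \<kappa> $ \<kappa>)"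
    have "pairing ?V Y (x, (p, a)) (y, (q, b)) = (\<Sum>\<kappa>\<in>UNIV. \<Sum>\<mu>\<in>UNIV. if \<kappa> = \<mu> then \<Sum>c\<in>UNIV. \<Sum>d\<in>UNIV. ?F c d \<kappa> else 0)"
      unfolding pairing_def prod.case by (intro sum.cong refl) (simp add: sum_distrib_right; simp add: mult_ac)
    also have "\<dots> = (\<Sum>\<kappa>\<in>UNIV. \<Sum>c\<in>UNIV. \<Sum>d\<in>UNIV. ?F c d \<kappa>)" by simp
    also have "\<dots> = (\<Sum>c\<in>UNIV. \<Sum>\<kappa>\<in>UNIV. \<Sum>d\<in>UNIV. ?F c d \<kappa>)" by (rule sum.swap)
    also have "\<dots> = (\<Sum>c\<in>UNIV. \<Sum>d\<in>UNIV. \<Sum>\<kappa>\<in>UNIV. ?F c d \<kappa>)" by (rule sum.cong[OF refl], rule sum.swap)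
    also have "\<dots> = pairing v (twist Y) ((x, a), p) ((y, b), q)"
      by (simp add: pairing_def twist_def sum_distrib_left)
    finally show ?thesis .
  qed
  have "opnorm (?I \<times> P \<times> UNIV) (?I \<times> P \<times> UNIV) (pairing ?V Y)
    = opnorm (?I \<times> P \<times> UNIV) (?I \<times> P \<times> UNIV) (\<lambda>x y. pairing v (twist Y) (?f x) (?f y))"
    by (rule opnorm_cong) (auto simp only: entry prod.case split: prod.split)
  also have "\<dots> = opnorm ((?I \<times> UNIV) \<times> P) ((?I \<times> UNIV) \<times> P) (pairing v (twist Y))"
    by (rule opnorm_reindex[OF f f]) (use fin in auto)
  also have "\<dots> \<le> inorm trace_class P v * matrix_norm (?I \<times> UNIV) (twist Y)"
    by (rule trace_class_apply) (use fin in auto)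
  also have "\<dots> \<le> inorm trace_class P v * matrix_norm ?I Y"
    by (intro mult_left_mono matrix_norm_twist inorm_trace_class_nonneg) auto
  finally show "opnorm (?I \<times> P \<times> UNIV) (?I \<times> P \<times> UNIV) (pairing ?V Y) \<le> inorm trace_class P v * matrix_norm ?I Y" .
qed (use fin in \<open>auto intro!: inorm_trace_class_nonneg\<close>)

end

text \<open>
  A matrix over the trace class is a completely bounded map on \<open>M_n\<close>; it therefore acts on the
  minimal tensor product with \<open>E\<close>, as is seen after applying norming maps to \<open>E\<close>.
\<close>

lemma (in ruan_seminorm) inorm_slice:
  fixes v :: "'p \<Rightarrow> 'p \<Rightarrow> complex ^ 'n ^ 'n" and Q :: "'q set"
  assumes fin: "finite P" "finite Q"
  shows "inorm E (P \<times> Q) (\<lambda>(p, s) (q, t). \<Sum>a\<in>UNIV. \<Sum>b\<in>UNIV. smult E (v p q $ a $ b) (y (s, a) (t, b)))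
    \<le> inorm trace_class P v * inorm E (Q \<times> UNIV) y"
proof (rule inorm_le_cc)
  fix r g assume g: "completely_contractive E (matrices_nat r) g"
  then interpret g: Vector_Spaces.linear "smult E" "smult (matrices_nat r)" g
    by (simp add: completely_contractive_def)
  have sum_apply: "(\<Sum>c\<in>I. F c) k l = (\<Sum>c\<in>I. F c k l)" for F :: "'n \<Rightarrow> nat \<Rightarrow> nat \<Rightarrow> complex" and I k l
    by (induction I rule: infinite_finite_induct) simp_all
  have gl: "g (\<Sum>a\<in>UNIV. \<Sum>b\<in>UNIV. smult E (c a b) (z a b)) k l = (\<Sum>a\<in>UNIV. \<Sum>b\<in>UNIV. c a b * g (z a b) k l)"
    for c and z :: "'n \<Rightarrow> 'n \<Rightarrow> 'e" and k l
    by (simp only: g.sum g.scale sum_apply) (simp add: matrices_nat_def)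
  define X :: "'q \<times> nat \<Rightarrow> 'q \<times> nat \<Rightarrow> complex ^ 'n ^ 'n" where
    "X = (\<lambda>(s, k) (t, l). \<chi> a b. g (y (s, a) (t, b)) k l)"
  let ?R = "{..<r}"
  let ?f = "\<lambda>((p :: 'p, s :: 'q), k :: nat). ((s, k), p)" and ?h = "\<lambda>((s :: 'q, k :: nat), a :: 'n). ((s, a), k)"
  have f: "bij_betw ?f ((P \<times> Q) \<times> ?R) ((Q \<times> ?R) \<times> P)"
    by (rule bij_betw_byWitness[where f' = "\<lambda>((s, k), p). ((p, s), k)"]) auto
  have h: "bij_betw ?h ((Q \<times> ?R) \<times> UNIV) ((Q \<times> UNIV) \<times> ?R)"
    by (rule bij_betw_byWitness[where f' = "\<lambda>((s, a), k). ((s, k), a)"]) auto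
  have "opnorm ((P \<times> Q) \<times> ?R) ((P \<times> Q) \<times> ?R) (\<lambda>(x, k) (x', l). g ((\<lambda>(p, s) (q, t). \<Sum>a\<in>UNIV. \<Sum>b\<in>UNIV. smult E (v p q $ a $ b) (y (s, a) (t, b))) x x') k l)
    = opnorm ((P \<times> Q) \<times> ?R) ((P \<times> Q) \<times> ?R) (\<lambda>x x'. pairing v X (?f x) (?f x'))"
    by (rule opnorm_cong) (auto simp: gl pairing_def X_def)
  also have "\<dots> = opnorm ((Q \<times> ?R) \<times> P) ((Q \<times> ?R) \<times> P) (pairing v X)"
    by (rule opnorm_reindex[OF f f]) (use fin in auto)
  also have "\<dots> \<le> inorm trace_class P v * matrix_norm (Q \<times> ?R) X" by (rule trace_class_apply) (use fin in auto)
  also have "matrix_norm (Q \<times> ?R) X = opnorm ((Q \<times> ?R) \<times> UNIV) ((Q \<times> ?R) \<times> UNIV) (\<lambda>x x'. (\<lambda>(p, k) (q, l). g (y p q) k l) (?h x) (?h x'))"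
    unfolding matrix_norm_def by (rule opnorm_cong) (auto simp: X_def)
  also have "\<dots> = opnorm ((Q \<times> UNIV) \<times> ?R) ((Q \<times> UNIV) \<times> ?R) (\<lambda>(p, k) (q, l). g (y p q) k l)"
    by (rule opnorm_reindex[OF h h]) (use fin in auto)
  also have "inorm trace_class P v * \<dots> \<le> inorm trace_class P v * inorm E (Q \<times> UNIV) y"
    by (intro mult_left_mono inorm_cc_le g inorm_trace_class_nonneg) (use fin in auto)
  finally show "opnorm ((P \<times> Q) \<times> ?R) ((P \<times> Q) \<times> ?R) (\<lambda>(x, k) (x', l). g ((\<lambda>(p, s) (q, t). \<Sum>a\<in>UNIV. \<Sum>b\<in>UNIV. smult E (v p q $ a $ b) (y (s, a) (t, b))) x x') k l)
    \<le> inorm trace_class P v * inorm E (Q \<times> UNIV) y" .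
qed (use fin in \<open>auto intro!: mult_nonneg_nonneg inorm_nonneg inorm_trace_class_nonneg\<close>)

text \<open>A factorization in which \<open>\<alpha>\<close> and \<open>\<beta>\<close> leave a further tensor factor untouched.\<close>

lemma (in ruan_seminorm) S_one_le_amplified:
  fixes u :: "'i \<times> 'k \<Rightarrow> 'i \<times> 'k \<Rightarrow> 'e ^ 'n ^ 'n" and V :: "'p \<times> 'k \<Rightarrow> 'p \<times> 'k \<Rightarrow> complex ^ 'n ^ 'n" and Q :: "'q set"
  assumes fin: "finite I" "finite K" "finite P" "finite Q"
    and u: "\<And>i a j b c d. i \<in> I \<Longrightarrow> j \<in> I \<Longrightarrow> a \<in> K \<Longrightarrow> b \<in> K \<Longrightarrow> u (i, a) (j, b) $ c $ d =
      (\<Sum>y\<in>P \<times> Q. \<Sum>z\<in>P \<times> Q. smult E (\<alpha> i y * \<beta> z j * V (fst y, a) (fst z, b) $ c $ d) (w (snd y) (snd z)))"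
  shows "inorm (S_one E) (I \<times> K) u \<le> opnorm I (P \<times> Q) \<alpha> * inorm trace_class (P \<times> K) V * inorm E Q w * opnorm (P \<times> Q) I \<beta>"
proof -
  define A where "A = (\<lambda>(i :: 'i, a :: 'k) ((p :: 'p, a'), s :: 'q). if a = a' then \<alpha> i (p, s) else 0)"
  define B where "B = (\<lambda>((p :: 'p, a' :: 'k), s :: 'q) (i :: 'i, a). if a' = a then \<beta> (p, s) i else 0)"
  let ?f = "\<lambda>((p :: 'p, a :: 'k), s :: 'q). ((p, s), a)"
  have f: "bij_betw ?f ((P \<times> K) \<times> Q) ((P \<times> Q) \<times> K)"
    by (rule bij_betw_byWitness[where f' = "\<lambda>((p, s), a). ((p, a), s)"]) auto
  have finPQ: "finite (P \<times> Q)" "finite (I \<times> K)" "finite ((P \<times> Q) \<times> K)" using fin by auto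
  have "opnorm (I \<times> K) ((P \<times> K) \<times> Q) A = opnorm (I \<times> K) ((P \<times> K) \<times> Q) (\<lambda>x y. (\<lambda>(i, a) (y, a'). if a = a' then \<alpha> i y else 0) (id x) (?f y))"
    by (rule opnorm_cong) (auto simp: A_def)
  also have "\<dots> = opnorm (I \<times> K) ((P \<times> Q) \<times> K) (\<lambda>(i, a) (y, a'). if a = a' then \<alpha> i y else 0)"
    by (rule opnorm_reindex[OF bij_betw_id f]) (use fin in auto)
  also have "\<dots> \<le> opnorm I (P \<times> Q) \<alpha>"
    by (intro opnorm_block_diagonal opnorm_nonneg order_refl fin finPQ)
  finally have A: "opnorm (I \<times> K) ((P \<times> K) \<times> Q) A \<le> opnorm I (P \<times> Q) \<alpha>" .
  have "opnorm ((P \<times> K) \<times> Q) (I \<times> K) B = opnorm ((P \<times> K) \<times> Q) (I \<times> K) (\<lambda>y x. (\<lambda>(y, a') (i, a). if a' = a then \<beta> y i else 0) (?f y) (id x))"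
    by (rule opnorm_cong) (auto simp: B_def)
  also have "\<dots> = opnorm ((P \<times> Q) \<times> K) (I \<times> K) (\<lambda>(y, a') (i, a). if a' = a then \<beta> y i else 0)"
    by (rule opnorm_reindex[OF f bij_betw_id]) (use fin in auto)
  also have "\<dots> \<le> opnorm (P \<times> Q) I \<beta>"
    by (intro opnorm_block_diagonal opnorm_nonneg order_refl fin finPQ)
  finally have B: "opnorm ((P \<times> K) \<times> Q) (I \<times> K) B \<le> opnorm (P \<times> Q) I \<beta>" .
  have "tensor_factorization E (I \<times> K) (P \<times> K) Q A V w B u"
    unfolding tensor_factorization_def
  proof (intro ballI allI)
    fix x x' c d assume "x \<in> I \<times> K" "x' \<in> I \<times> K"
    then obtain i a j b where x: "x = (i, a)" "x' = (j, b)" and mem: "i \<in> I" "a \<in> K" "j \<in> I" "b \<in> K" by auto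
    have "(\<Sum>y\<in>(P \<times> K) \<times> Q. \<Sum>z\<in>(P \<times> K) \<times> Q. smult E (A x y * B z x' * V (fst y) (fst z) $ c $ d) (w (snd y) (snd z)))
      = (\<Sum>p\<in>P. \<Sum>a'\<in>K. \<Sum>s\<in>Q. \<Sum>q\<in>P. \<Sum>b'\<in>K. \<Sum>t\<in>Q. if b' = b then if a' = a then
          smult E (\<alpha> i (p, s) * \<beta> (q, t) j * V (p, a) (q, b) $ c $ d) (w s t) else 0 else 0)"
      unfolding sum_Times x by (intro sum.cong refl) (auto simp: A_def B_def)
    also have "\<dots> = (\<Sum>p\<in>P. \<Sum>a'\<in>K. if a' = a then \<Sum>s\<in>Q. \<Sum>q\<in>P. \<Sum>t\<in>Q.
          smult E (\<alpha> i (p, s) * \<beta> (q, t) j * V (p, a) (q, b) $ c $ d) (w s t) else 0)"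
    proof (intro sum.cong refl)
      fix p a'
      have "(\<Sum>b'\<in>K. \<Sum>t\<in>Q. if b' = b then if a' = a then G t else 0 else 0) = (if a' = a then \<Sum>t\<in>Q. G t else 0)"
        for G :: "'q \<Rightarrow> 'e"
      proof -
        have "(\<Sum>b'\<in>K. \<Sum>t\<in>Q. if b' = b then if a' = a then G t else 0 else 0) = (\<Sum>b'\<in>K. if b' = b then \<Sum>t\<in>Q. if a' = a then G t else 0 else 0)"
          by (intro sum.cong refl) auto
        then show ?thesis using mem fin by simp
      qed
      then show "(\<Sum>s\<in>Q. \<Sum>q\<in>P. \<Sum>b'\<in>K. \<Sum>t\<in>Q. if b' = b then if a' = a then
          smult E (\<alpha> i (p, s) * \<beta> (q, t) j * V (p, a) (q, b) $ c $ d) (w s t) else 0 else 0)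
        = (if a' = a then \<Sum>s\<in>Q. \<Sum>q\<in>P. \<Sum>t\<in>Q. smult E (\<alpha> i (p, s) * \<beta> (q, t) j * V (p, a) (q, b) $ c $ d) (w s t) else 0)"
        by simp
    qed
    also have "\<dots> = (\<Sum>p\<in>P. \<Sum>s\<in>Q. \<Sum>q\<in>P. \<Sum>t\<in>Q. smult E (\<alpha> i (p, s) * \<beta> (q, t) j * V (p, a) (q, b) $ c $ d) (w s t))"
      using mem fin by simp
    also have "\<dots> = u x x' $ c $ d" unfolding x u[OF mem(1,3,2,4)] sum_Times fst_conv snd_conv ..
    finally show "u x x' $ c $ d = (\<Sum>y\<in>(P \<times> K) \<times> Q. \<Sum>z\<in>(P \<times> K) \<times> Q. smult E (A x y * B z x' * V (fst y) (fst z) $ c $ d) (w (snd y) (snd z)))"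
      by simp
  qed
  from S_one_le[OF _ _ _ this]
  have "inorm (S_one E) (I \<times> K) u \<le> opnorm (I \<times> K) ((P \<times> K) \<times> Q) A * inorm trace_class (P \<times> K) V * inorm E Q w * opnorm ((P \<times> K) \<times> Q) (I \<times> K) B"
    using fin by simp
  also have "\<dots> \<le> opnorm I (P \<times> Q) \<alpha> * inorm trace_class (P \<times> K) V * inorm E Q w * opnorm (P \<times> Q) I \<beta>"
    by (intro mult_mono mult_nonneg_nonneg A B order_refl opnorm_nonneg inorm_nonneg inorm_trace_class_nonneg) (use fin in auto)
  finally show ?thesis .
qed

locale bell_ruan = ruan_seminorm E + bell_basis \<psi>
  for E :: "'e::ab_group_add opspace" and \<psi> :: "'m::finite \<Rightarrow> 'n::finite \<times> 'n \<Rightarrow> complex"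
begin

text \<open>
  The three maps whose norms matter: the map sending a diagonal to \<open>\<Sum>\<kappa>. x \<kappa> |\<psi> \<kappa>\<rangle>\<langle>\<psi> \<kappa>|\<close>, with the
  first tensor factor as an additional matrix index; the diagonal \<open>\<langle>\<psi> \<kappa>|X|\<psi> \<kappa>\<rangle>\<close>, with the same
  convention; and the latter for a tensor \<open>v \<otimes> w\<close>, with \<open>v\<close> in matrices over the trace class.
\<close>

definition bell_expand :: "('i \<Rightarrow> 'i \<Rightarrow> 'e ^ 'm ^ 'm) \<Rightarrow> 'i \<times> 'n \<Rightarrow> 'i \<times> 'n \<Rightarrow> 'e ^ 'n ^ 'n" where
  "bell_expand u = (\<lambda>(i, a) (j, b). \<chi> c d. \<Sum>\<kappa>\<in>UNIV. smult E (\<psi> \<kappa> (a, c) * cnj (\<psi> \<kappa> (b, d))) (u i j $ \<kappa> $ \<kappa>))"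

definition bell_compress :: "('i \<times> 'n \<Rightarrow> 'i \<times> 'n \<Rightarrow> 'e ^ 'n ^ 'n) \<Rightarrow> 'i \<Rightarrow> 'i \<Rightarrow> 'e ^ 'm ^ 'm" where
  "bell_compress X = (\<lambda>i j. \<chi> \<kappa> \<mu>. if \<kappa> = \<mu> then
     \<Sum>s\<in>UNIV. \<Sum>t\<in>UNIV. smult E (cnj (\<psi> \<kappa> s) * \<psi> \<kappa> t) (X (i, fst s) (j, fst t) $ snd s $ snd t) else 0)"

definition bell_slice :: "('p \<Rightarrow> 'p \<Rightarrow> complex ^ 'n ^ 'n) \<Rightarrow> ('q \<Rightarrow> 'q \<Rightarrow> 'e ^ 'n ^ 'n) \<Rightarrow> 'p \<times> 'q \<Rightarrow> 'p \<times> 'q \<Rightarrow> 'e ^ 'm ^ 'm" where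
  "bell_slice v w = (\<lambda>(p, x) (q, y). \<chi> \<kappa> \<mu>. if \<kappa> = \<mu> then
     \<Sum>s\<in>UNIV. \<Sum>t\<in>UNIV. smult E (cnj (\<psi> \<kappa> s) * \<psi> \<kappa> t * v p q $ fst s $ fst t) (w x y $ snd s $ snd t) else 0)"

lemma bell_expand_S_inf:
  assumes fin: "finite I"
  shows "inorm (S_inf E) (I \<times> UNIV) (bell_expand u) \<le> inorm (S_inf E) I u"
  using inorm_bell_expand[OF bell fin, of "\<lambda>(i, \<kappa>) (j, \<mu>). u i j $ \<kappa> $ \<mu>"] fin
  by (simp add: inorm_S_inf bell_expand_def case_prod_unfold)

lemma bell_compress_S_inf:
  assumes fin: "finite I"
  shows "inorm (S_inf E) I (bell_compress X) \<le> inorm (S_inf E) (I \<times> UNIV) X"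
proof -
  let ?y = "\<lambda>(p, c) (q, d). X p q $ c $ d"
  have "inorm (S_inf E) I (bell_compress X) = inorm E (I \<times> UNIV) (\<lambda>(i, \<kappa>) (j, \<mu>). bell_compress X i j $ \<kappa> $ \<mu>)"
    by (rule inorm_S_inf[OF fin])
  also have "\<dots> = inorm E (I \<times> UNIV) (\<lambda>(i, \<kappa>) (j, \<mu>). if \<kappa> = \<mu> then
      \<Sum>s\<in>UNIV. \<Sum>t\<in>UNIV. smult E (cnj (\<psi> \<kappa> s) * \<psi> \<kappa> t) (?y ((i, fst s), snd s) ((j, fst t), snd t)) else 0)"
    by (rule inorm_cong) (use fin in \<open>auto simp: bell_compress_def\<close>)
  also have "\<dots> \<le> inorm E ((I \<times> UNIV) \<times> UNIV) ?y" by (rule inorm_bell_compress[OF bell fin])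
  also have "\<dots> = inorm (S_inf E) (I \<times> UNIV) X" by (rule inorm_S_inf[symmetric]) (use fin in simp)
  finally show ?thesis .
qed

text \<open>
  A factorization \<open>\<alpha> (v \<otimes> w) \<beta>\<close> of \<open>u\<close> becomes one of the image when \<open>v\<close> is replaced by its
  expansion, which is smaller by the factor \<open>1/n\<close>.
\<close>

lemma bell_expand_S_one:
  assumes fin: "finite I"
  shows "inorm (S_one E) (I \<times> UNIV) (bell_expand u) \<le> 1 / CARD('n) * inorm (S_one E) I u"
proof (rule le_mult_of_greater)
  fix r assume "inorm (S_one E) I u < r"
  then obtain p q :: nat and \<alpha> w \<beta> and v :: "nat \<Rightarrow> nat \<Rightarrow> complex ^ 'm ^ 'm" where
    t: "tensor_factorization E I {..<p} {..<q} \<alpha> v w \<beta> u" and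
    lt: "opnorm I ({..<p} \<times> {..<q}) \<alpha> * inorm trace_class {..<p} v * mnorm E q w * opnorm ({..<p} \<times> {..<q}) I \<beta> < r"
    by (rule S_one_less[OF fin]) blast
  let ?A = "opnorm I ({..<p} \<times> {..<q}) \<alpha>" and ?B = "opnorm ({..<p} \<times> {..<q}) I \<beta>" and ?D = "{..<p} \<times> {..<q}"
  let ?V = "\<lambda>(p, a) (q, b). \<chi> c d. \<Sum>\<kappa>\<in>UNIV. \<psi> \<kappa> (a, c) * cnj (\<psi> \<kappa> (b, d)) * v p q $ \<kappa> $ \<kappa>"
  have "inorm (S_one E) (I \<times> UNIV) (bell_expand u) \<le> ?A * inorm trace_class ({..<p} \<times> UNIV) ?V * inorm E {..<q} w * ?B"
  proof (rule S_one_le_amplified[OF fin finite finite_lessThan finite_lessThan])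
    fix i j and a b c d :: 'n assume ij: "i \<in> I" "j \<in> I"
    let ?F = "\<lambda>\<kappa> y z. smult E (\<alpha> i y * \<beta> z j * (\<psi> \<kappa> (a, c) * cnj (\<psi> \<kappa> (b, d)) * v (fst y) (fst z) $ \<kappa> $ \<kappa>)) (w (snd y) (snd z))"
    have "bell_expand u (i, a) (j, b) $ c $ d = (\<Sum>\<kappa>\<in>UNIV. \<Sum>y\<in>?D. \<Sum>z\<in>?D. ?F \<kappa> y z)"
    proof -
      have "u i j $ \<kappa> $ \<kappa> = (\<Sum>y\<in>?D. \<Sum>z\<in>?D. smult E (\<alpha> i y * \<beta> z j * v (fst y) (fst z) $ \<kappa> $ \<kappa>) (w (snd y) (snd z)))" for \<kappa>
        using t ij unfolding tensor_factorization_def by simp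
      then show ?thesis by (simp add: bell_expand_def scale_sum_right mult_ac)
    qed
    also have "\<dots> = (\<Sum>y\<in>?D. \<Sum>\<kappa>\<in>UNIV. \<Sum>z\<in>?D. ?F \<kappa> y z)" by (rule sum.swap)
    also have "\<dots> = (\<Sum>y\<in>?D. \<Sum>z\<in>?D. \<Sum>\<kappa>\<in>UNIV. ?F \<kappa> y z)" by (rule sum.cong[OF refl], rule sum.swap)
    also have "\<dots> = (\<Sum>y\<in>?D. \<Sum>z\<in>?D. smult E (\<alpha> i y * \<beta> z j * ?V (fst y, a) (fst z, b) $ c $ d) (w (snd y) (snd z)))"
      by (simp add: sum_distrib_left scale_sum_left)
    finally show "bell_expand u (i, a) (j, b) $ c $ d = \<dots>" .
  qed
  also have "\<dots> \<le> ?A * (1 / CARD('n) * inorm trace_class {..<p} v) * inorm E {..<q} w * ?B"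
    by (intro mult_mono mult_nonneg_nonneg trace_class_expand order_refl opnorm_nonneg inorm_nonneg inorm_trace_class_nonneg) (use fin in auto)
  also have "\<dots> = 1 / CARD('n) * (?A * inorm trace_class {..<p} v * mnorm E q w * ?B)" by (simp add: inorm_lessThan)
  also have "\<dots> \<le> 1 / CARD('n) * r" using lt by (intro mult_left_mono) auto
  finally show "inorm (S_one E) (I \<times> UNIV) (bell_expand u) \<le> 1 / CARD('n) * r" .
qed simp

text \<open>
  In a factorization the additional index is moved from the rows of \<open>\<alpha>\<close> and the columns of \<open>\<beta>\<close> to
  \<open>v\<close>, at the cost of \<open>\<surd>n\<close> for each; the compression of \<open>v\<close> is contractive.
\<close>

lemma bell_compress_S_one:
  assumes fin: "finite I"
  shows "inorm (S_one E) I (bell_compress X) \<le> CARD('n) * inorm (S_one E) (I \<times> UNIV) X"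
proof (rule le_mult_of_greater)
  fix r assume lt': "inorm (S_one E) (I \<times> UNIV) X < r"
  have finU: "finite (I \<times> (UNIV :: 'n set))" using fin by simp
  from lt' obtain p q :: nat and \<alpha> w \<beta> and v :: "nat \<Rightarrow> nat \<Rightarrow> complex ^ 'n ^ 'n" where
    t: "tensor_factorization E (I \<times> UNIV) {..<p} {..<q} \<alpha> v w \<beta> X" and
    lt: "opnorm (I \<times> UNIV) ({..<p} \<times> {..<q}) \<alpha> * inorm trace_class {..<p} v * mnorm E q w * opnorm ({..<p} \<times> {..<q}) (I \<times> UNIV) \<beta> < r"
    by (rule S_one_less[OF finU]) blast
  let ?D = "{..<p} \<times> {..<q}" and ?P = "{..<p} \<times> (UNIV :: 'n set)"
  let ?A = "opnorm (I \<times> UNIV) ?D \<alpha>" and ?B = "opnorm ?D (I \<times> UNIV) \<beta>"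
  let ?\<alpha> = "\<lambda>i ((p, a), s). \<alpha> (i, a) (p, s)" and ?\<beta> = "\<lambda>((p, a), s) i. \<beta> (p, s) (i, a)"
  let ?V = "\<lambda>(p, a) (q, b). \<chi> \<kappa> \<mu>. if \<kappa> = \<mu> then \<Sum>c\<in>UNIV. \<Sum>d\<in>UNIV. cnj (\<psi> \<kappa> (a, c)) * \<psi> \<kappa> (b, d) * v p q $ c $ d else 0"
  let ?f = "\<lambda>((p :: nat, a :: 'n), s :: nat). ((p, s), a)"
  have f: "bij_betw ?f (?P \<times> {..<q}) (?D \<times> UNIV)"
    by (rule bij_betw_byWitness[where f' = "\<lambda>((p, s), a). ((p, a), s)"]) auto
  have "opnorm I (?P \<times> {..<q}) ?\<alpha> = opnorm I (?P \<times> {..<q}) (\<lambda>i y. (\<lambda>i (y, a). \<alpha> (i, a) y) (id i) (?f y))"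
    by (rule opnorm_cong) auto
  also have "\<dots> = opnorm I (?D \<times> UNIV) (\<lambda>i (y, a). \<alpha> (i, a) y)"
    by (rule opnorm_reindex[OF bij_betw_id f]) (use fin in auto)
  also have "\<dots> \<le> sqrt CARD('n) * ?A" by (rule opnorm_column_to_row) (use fin in auto)
  finally have A: "opnorm I (?P \<times> {..<q}) ?\<alpha> \<le> sqrt CARD('n) * ?A" .
  have "opnorm (?P \<times> {..<q}) I ?\<beta> = opnorm (?P \<times> {..<q}) I (\<lambda>y i. cnj (cnj (?\<beta> y i)))" by simp
  also have "\<dots> \<le> opnorm I (?P \<times> {..<q}) (\<lambda>i y. cnj (?\<beta> y i))" by (rule opnorm_adjoint) (use fin in auto)
  also have "\<dots> = opnorm I (?P \<times> {..<q}) (\<lambda>i y. (\<lambda>i (y, a). cnj (\<beta> y (i, a))) (id i) (?f y))"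
    by (rule opnorm_cong) auto
  also have "\<dots> = opnorm I (?D \<times> UNIV) (\<lambda>i (y, a). cnj (\<beta> y (i, a)))"
    by (rule opnorm_reindex[OF bij_betw_id f]) (use fin in auto)
  also have "\<dots> \<le> sqrt CARD('n) * opnorm (I \<times> UNIV) ?D (\<lambda>x y. cnj (\<beta> y x))" by (rule opnorm_column_to_row) (use fin in auto)
  also have "\<dots> \<le> sqrt CARD('n) * ?B" by (intro mult_left_mono opnorm_adjoint) (use fin in auto)
  finally have B: "opnorm (?P \<times> {..<q}) I ?\<beta> \<le> sqrt CARD('n) * ?B" .
  have "tensor_factorization E I ?P {..<q} ?\<alpha> ?V w ?\<beta> (bell_compress X)"
    unfolding tensor_factorization_def
  proof (intro ballI allI)
    fix i j \<kappa> \<mu> assume ij: "i \<in> I" "j \<in> I"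
    show "bell_compress X i j $ \<kappa> $ \<mu> = (\<Sum>y\<in>?P \<times> {..<q}. \<Sum>z\<in>?P \<times> {..<q}.
      smult E (?\<alpha> i y * ?\<beta> z j * ?V (fst y) (fst z) $ \<kappa> $ \<mu>) (w (snd y) (snd z)))"
    proof (cases "\<kappa> = \<mu>")
      case True
      let ?F = "\<lambda>a c b d p s q t. smult E (\<alpha> (i, a) (p, s) * \<beta> (q, t) (j, b) * (cnj (\<psi> \<kappa> (a, c)) * \<psi> \<kappa> (b, d) * v p q $ c $ d)) (w s t)"
      have "X (i, a) (j, b) $ c $ d = (\<Sum>y\<in>?D. \<Sum>z\<in>?D. smult E (\<alpha> (i, a) y * \<beta> z (j, b) * v (fst y) (fst z) $ c $ d) (w (snd y) (snd z)))" for a b c d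
        using t ij unfolding tensor_factorization_def by simp
      then have "bell_compress X i j $ \<kappa> $ \<mu> = (\<Sum>s\<in>UNIV. \<Sum>t\<in>UNIV. \<Sum>y\<in>?D. \<Sum>z\<in>?D. ?F (fst s) (snd s) (fst t) (snd t) (fst y) (snd y) (fst z) (snd z))"
        using True by (simp add: bell_compress_def scale_sum_right mult_ac)
      also have "\<dots> = (\<Sum>y\<in>?D. \<Sum>z\<in>?D. \<Sum>s\<in>UNIV. \<Sum>t\<in>UNIV. ?F (fst s) (snd s) (fst t) (snd t) (fst y) (snd y) (fst z) (snd z))"
        by (rule sum_swap4)
      also have "\<dots> = (\<Sum>y\<in>?D. \<Sum>z\<in>?D. \<Sum>a\<in>UNIV. \<Sum>b\<in>UNIV. \<Sum>c\<in>UNIV. \<Sum>d\<in>UNIV. ?F a c b d (fst y) (snd y) (fst z) (snd z))"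
      proof (rule sum.cong[OF refl], rule sum.cong[OF refl])
        fix y z
        show "(\<Sum>s\<in>UNIV. \<Sum>t\<in>UNIV. ?F (fst s) (snd s) (fst t) (snd t) (fst y) (snd y) (fst z) (snd z))
          = (\<Sum>a\<in>UNIV. \<Sum>b\<in>UNIV. \<Sum>c\<in>UNIV. \<Sum>d\<in>UNIV. ?F a c b d (fst y) (snd y) (fst z) (snd z))"
          unfolding sum_UNIV_pair fst_conv snd_conv by (rule sum.cong[OF refl], rule sum.swap)
      qed
      also have "\<dots> = (\<Sum>a\<in>UNIV. \<Sum>b\<in>UNIV. \<Sum>y\<in>?D. \<Sum>z\<in>?D. \<Sum>c\<in>UNIV. \<Sum>d\<in>UNIV. ?F a c b d (fst y) (snd y) (fst z) (snd z))"
        by (rule sum_swap4)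
      also have "\<dots> = (\<Sum>a\<in>UNIV. \<Sum>y\<in>?D. \<Sum>b\<in>UNIV. \<Sum>z\<in>?D. \<Sum>c\<in>UNIV. \<Sum>d\<in>UNIV. ?F a c b d (fst y) (snd y) (fst z) (snd z))"
        by (rule sum.cong[OF refl], rule sum.swap)
      also have "\<dots> = (\<Sum>y\<in>?D \<times> UNIV. \<Sum>z\<in>?D \<times> UNIV. \<Sum>c\<in>UNIV. \<Sum>d\<in>UNIV. ?F (snd y) c (snd z) d (fst (fst y)) (snd (fst y)) (fst (fst z)) (snd (fst z)))"
        unfolding sum_Times[of _ ?D UNIV] fst_conv snd_conv
        by (subst sum.swap, rule sum.cong[OF refl], rule sum.cong[OF refl], rule sum.swap)
      also have "\<dots> = (\<Sum>y\<in>?P \<times> {..<q}. \<Sum>z\<in>?P \<times> {..<q}. (\<lambda>y z. \<Sum>c\<in>UNIV. \<Sum>d\<in>UNIV. ?F (snd y) c (snd z) d (fst (fst y)) (snd (fst y)) (fst (fst z)) (snd (fst z))) (?f y) (?f z))"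
        by (subst sum.reindex_bij_betw[OF f, symmetric], rule sum.cong[OF refl], rule sum.reindex_bij_betw[OF f, symmetric])
      also have "\<dots> = (\<Sum>y\<in>?P \<times> {..<q}. \<Sum>z\<in>?P \<times> {..<q}. smult E (?\<alpha> i y * ?\<beta> z j * ?V (fst y) (fst z) $ \<kappa> $ \<mu>) (w (snd y) (snd z)))"
        using True by (intro sum.cong refl) (auto simp: sum_distrib_left scale_sum_left)
      finally show ?thesis .
    next
      case False
      then show ?thesis by (simp add: bell_compress_def case_prod_unfold)
    qed
  qed
  from S_one_le[OF fin _ _ this]
  have "inorm (S_one E) I (bell_compress X) \<le> opnorm I (?P \<times> {..<q}) ?\<alpha> * inorm trace_class ?P ?V * inorm E {..<q} w * opnorm (?P \<times> {..<q}) I ?\<beta>"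
    by simp
  also have "\<dots> \<le> (sqrt CARD('n) * ?A) * inorm trace_class {..<p} v * inorm E {..<q} w * (sqrt CARD('n) * ?B)"
    by (intro mult_mono mult_nonneg_nonneg A B trace_class_compress order_refl opnorm_nonneg inorm_nonneg inorm_trace_class_nonneg) (use fin in auto)
  also have "\<dots> = (sqrt CARD('n) * sqrt CARD('n)) * (?A * inorm trace_class {..<p} v * mnorm E q w * ?B)"
    by (simp only: inorm_lessThan mult_ac)
  also have "\<dots> \<le> CARD('n) * r" using lt by simp
  finally show "inorm (S_one E) I (bell_compress X) \<le> CARD('n) * r" .
qed simp

text \<open>In the block of \<open>\<kappa>\<close>, \<open>w\<close> is conjugated by \<open>n\<^sup>-\<^sup>1\<^sup>/\<^sup>2\<close> times a unitary and \<open>v\<close> is applied to the result.\<close>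

lemma bell_slice_S_inf:
  assumes fin: "finite P" "finite Q"
  shows "inorm (S_inf E) (P \<times> Q) (bell_slice v w) \<le> inorm trace_class P v / CARD('n) * inorm (S_inf E) Q w"
proof -
  let ?N = "inorm E (Q \<times> UNIV) (\<lambda>(x, c) (y, d). w x y $ c $ d)"
  let ?x = "\<lambda>\<kappa> (p, x) (q, y). \<Sum>s\<in>UNIV. \<Sum>t\<in>UNIV. smult E (cnj (\<psi> \<kappa> s) * \<psi> \<kappa> t * v p q $ fst s $ fst t) (w x y $ snd s $ snd t)"
  let ?y = "\<lambda>\<kappa> (x, a) (y, b). \<Sum>c\<in>UNIV. \<Sum>d\<in>UNIV. smult E (cnj (\<psi> \<kappa> (a, c)) * cnj (cnj (\<psi> \<kappa> (b, d)))) (w x y $ c $ d)"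
  have nn: "0 \<le> inorm trace_class P v / CARD('n) * ?N" by (simp add: inorm_nonneg inorm_trace_class_nonneg)
  have "inorm (S_inf E) (P \<times> Q) (bell_slice v w)
    = inorm E ((P \<times> Q) \<times> UNIV) (\<lambda>(i, \<kappa>) (j, \<mu>). bell_slice v w i j $ \<kappa> $ \<mu>)"
    by (rule inorm_S_inf) (use fin in auto)
  also have "\<dots> = inorm E ((P \<times> Q) \<times> UNIV) (\<lambda>(i, \<kappa>) (j, \<mu>). if \<kappa> = \<mu> then ?x \<kappa> i j else 0)"
    by (rule inorm_cong) (use fin in \<open>auto simp: bell_slice_def\<close>)
  also have "\<dots> \<le> inorm trace_class P v / CARD('n) * ?N"
  proof (rule inorm_block_diagonal[OF _ _ nn])
    fix \<kappa>
    have "?x \<kappa> (p, x) (q, y) = (\<Sum>a\<in>UNIV. \<Sum>b\<in>UNIV. smult E (v p q $ a $ b) (?y \<kappa> (x, a) (y, b)))" for p x q y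
    proof -
      have "?x \<kappa> (p, x) (q, y) = (\<Sum>a\<in>UNIV. \<Sum>b\<in>UNIV. \<Sum>c\<in>UNIV. \<Sum>d\<in>UNIV.
          smult E (cnj (\<psi> \<kappa> (a, c)) * \<psi> \<kappa> (b, d) * v p q $ a $ b) (w x y $ c $ d))"
        unfolding prod.case sum_UNIV_pair fst_conv snd_conv by (rule sum.cong[OF refl], rule sum.swap)
      then show ?thesis by (simp add: scale_sum_right mult_ac)
    qed
    then have "inorm E (P \<times> Q) (?x \<kappa>) = inorm E (P \<times> Q) (\<lambda>(p, x) (q, y). \<Sum>a\<in>UNIV. \<Sum>b\<in>UNIV. smult E (v p q $ a $ b) (?y \<kappa> (x, a) (y, b)))"
      using fin by (intro inorm_cong) auto
    also have "\<dots> \<le> inorm trace_class P v * inorm E (Q \<times> UNIV) (?y \<kappa>)" by (rule inorm_slice[OF fin])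
    also have "\<dots> \<le> inorm trace_class P v * (1 / CARD('n) * ?N)"
      using inorm_bell_conjugate[OF bell_basis_cnj[OF bell] fin(2), of \<kappa> "\<lambda>(x, c) (y, d). w x y $ c $ d"]
      by (intro mult_left_mono inorm_trace_class_nonneg) (simp add: case_prod_unfold)
    finally show "inorm E (P \<times> Q) (?x \<kappa>) \<le> inorm trace_class P v / CARD('n) * ?N" by simp
  qed (use fin in auto)
  finally show ?thesis using fin by (simp add: inorm_S_inf)
qed

text \<open>
  After factorizing \<open>w\<close>, the map acts on the trace class factor of \<open>w\<close> only: by a compression, to
  which \<open>v\<close> is applied.
\<close>

lemma bell_slice_S_one:
  assumes fin: "finite P" "finite Q"
  shows "inorm (S_one E) (P \<times> Q) (bell_slice v w) \<le> inorm trace_class P v * inorm (S_one E) Q w"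
proof (rule le_mult_of_greater[OF _ inorm_trace_class_nonneg])
  interpret S1: ruan_seminorm "S_one E :: ('e ^ 'm ^ 'm) opspace" by (rule ruan_seminorm_S_one)
  fix r assume lt': "inorm (S_one E) Q w < r"
  then obtain p2 q2 :: nat and \<alpha> w2 \<beta> and v2 :: "nat \<Rightarrow> nat \<Rightarrow> complex ^ 'n ^ 'n" where
    t: "tensor_factorization E Q {..<p2} {..<q2} \<alpha> v2 w2 \<beta> w" and
    lt: "opnorm Q ({..<p2} \<times> {..<q2}) \<alpha> * inorm trace_class {..<p2} v2 * mnorm E q2 w2 * opnorm ({..<p2} \<times> {..<q2}) Q \<beta> < r"
    by (rule S_one_less[OF fin(2)]) blast
  let ?D = "{..<p2} \<times> {..<q2}" and ?A = "opnorm Q ({..<p2} \<times> {..<q2}) \<alpha>" and ?B = "opnorm ({..<p2} \<times> {..<q2}) Q \<beta>"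
  let ?V = "\<lambda>(p', a) (q', b). \<chi> \<kappa> \<mu>. if \<kappa> = \<mu> then \<Sum>c\<in>UNIV. \<Sum>d\<in>UNIV. cnj (\<psi> \<kappa> (a, c)) * \<psi> \<kappa> (b, d) * v2 p' q' $ c $ d else 0"
  let ?W = "\<lambda>(p', p) (q', q). \<chi> \<kappa> \<mu>. \<Sum>a\<in>UNIV. \<Sum>b\<in>UNIV. v p q $ a $ b * ?V (p', a) (q', b) $ \<kappa> $ \<mu>"
  let ?u = "\<lambda>x y. bell_slice v w (prod.swap x) (prod.swap y)"
  have sw: "bij_betw prod.swap (Q \<times> P) (P \<times> Q)" by (auto intro!: bij_betw_byWitness[where f' = prod.swap])
  have "inorm (S_one E) (P \<times> Q) (bell_slice v w) = inorm (S_one E) (Q \<times> P) ?u"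
    by (rule S1.inorm_reindex[OF sw, symmetric]) (use fin in auto)
  also have "\<dots> \<le> ?A * inorm trace_class ({..<p2} \<times> P) ?W * inorm E {..<q2} w2 * ?B"
  proof (rule S_one_le_amplified[OF fin(2,1) finite_lessThan finite_lessThan])
    fix x y p q \<kappa> \<mu> assume xy: "x \<in> Q" "y \<in> Q"
    show "?u (x, p) (y, q) $ \<kappa> $ \<mu> = (\<Sum>y'\<in>?D. \<Sum>z\<in>?D. smult E (\<alpha> x y' * \<beta> z y * ?W (fst y', p) (fst z, q) $ \<kappa> $ \<mu>) (w2 (snd y') (snd z)))"
    proof (cases "\<kappa> = \<mu>")
      case True
      let ?F = "\<lambda>a c b d y' z. smult E (\<alpha> x y' * \<beta> z y * (v p q $ a $ b * (cnj (\<psi> \<kappa> (a, c)) * \<psi> \<kappa> (b, d) * v2 (fst y') (fst z) $ c $ d))) (w2 (snd y') (snd z))"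
      have "w x y $ c $ d = (\<Sum>y'\<in>?D. \<Sum>z\<in>?D. smult E (\<alpha> x y' * \<beta> z y * v2 (fst y') (fst z) $ c $ d) (w2 (snd y') (snd z)))" for c d
        using t xy unfolding tensor_factorization_def by simp
      then have "?u (x, p) (y, q) $ \<kappa> $ \<mu> = (\<Sum>s\<in>UNIV. \<Sum>t\<in>UNIV. \<Sum>y'\<in>?D. \<Sum>z\<in>?D. ?F (fst s) (snd s) (fst t) (snd t) y' z)"
        using True by (simp add: bell_slice_def scale_sum_right mult_ac)
      also have "\<dots> = (\<Sum>y'\<in>?D. \<Sum>z\<in>?D. \<Sum>s\<in>UNIV. \<Sum>t\<in>UNIV. ?F (fst s) (snd s) (fst t) (snd t) y' z)" by (rule sum_swap4)
      also have "\<dots> = (\<Sum>y'\<in>?D. \<Sum>z\<in>?D. \<Sum>a\<in>UNIV. \<Sum>b\<in>UNIV. \<Sum>c\<in>UNIV. \<Sum>d\<in>UNIV. ?F a c b d y' z)"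
      proof (rule sum.cong[OF refl], rule sum.cong[OF refl])
        fix y' z
        show "(\<Sum>s\<in>UNIV. \<Sum>t\<in>UNIV. ?F (fst s) (snd s) (fst t) (snd t) y' z) = (\<Sum>a\<in>UNIV. \<Sum>b\<in>UNIV. \<Sum>c\<in>UNIV. \<Sum>d\<in>UNIV. ?F a c b d y' z)"
          unfolding sum_UNIV_pair fst_conv snd_conv by (rule sum.cong[OF refl], rule sum.swap)
      qed
      also have "\<dots> = (\<Sum>y'\<in>?D. \<Sum>z\<in>?D. smult E (\<alpha> x y' * \<beta> z y * ?W (fst y', p) (fst z, q) $ \<kappa> $ \<mu>) (w2 (snd y') (snd z)))"
        using True by (simp add: sum_distrib_left scale_sum_left)
      finally show ?thesis .
    next
      case False
      then show ?thesis by (simp add: bell_slice_def)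
    qed
  qed
  also have "\<dots> \<le> ?A * (inorm trace_class P v * inorm trace_class {..<p2} v2) * inorm E {..<q2} w2 * ?B"
  proof -
    have "inorm trace_class ({..<p2} \<times> P) ?W \<le> inorm trace_class P v * inorm trace_class ({..<p2} \<times> UNIV) ?V"
      by (rule trace_class_slice) (use fin in auto)
    also have "\<dots> \<le> inorm trace_class P v * inorm trace_class {..<p2} v2"
      by (intro mult_left_mono trace_class_compress inorm_trace_class_nonneg) auto
    finally show ?thesis
      by (intro mult_mono mult_nonneg_nonneg order_refl opnorm_nonneg inorm_nonneg inorm_trace_class_nonneg) (use fin in auto)
  qed
  also have "\<dots> = inorm trace_class P v * (?A * inorm trace_class {..<p2} v2 * mnorm E q2 w2 * ?B)"
    by (simp only: inorm_lessThan mult_ac)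
  also have "\<dots> \<le> inorm trace_class P v * r" using lt by (intro mult_left_mono inorm_trace_class_nonneg) auto
  finally show "inorm (S_one E) (P \<times> Q) (bell_slice v w) \<le> inorm trace_class P v * r" .
qed

end


section \<open>The spaces \<open>S\<^sub>p\<^sup>n[E]\<close>\<close>

text \<open>The reciprocal of \<open>p\<close>, which is \<open>0\<close> for \<open>p = \<infinity>\<close>.\<close>

definition exponent :: "ennreal \<Rightarrow> real" where
  "exponent p = enn2real (1 / p)"

lemma exponent_bounds:
  assumes "1 \<le> p"
  shows "0 \<le> exponent p" "exponent p \<le> 1"
proof -
  show "0 \<le> exponent p" by (simp add: exponent_def)
  have "1 / p \<le> 1" using assms by (intro divide_le_posI_ennreal) (auto intro: less_le_trans[OF zero_less_one])
  then show "exponent p \<le> 1" unfolding exponent_def by (intro enn2real_leI) simp_all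
qed

lemma exponent_top: "exponent top = 0"
  by (simp add: exponent_def)

lemma exponent_one: "exponent 1 = 1"
  by (simp add: exponent_def)

lemma smult_S_p: "smult (S_p p E) = entrywise (smult E)"
  by (simp add: S_p_def S_inf_def S_one_def interpolation_def)

lemma mnorm_S_p:
  "mnorm (S_p p E) k = (if p = \<infinity> then mnorm (S_inf E) k else if p = 1 then mnorm (S_one E) k
    else interp_norm (\<lambda>c X i j. entrywise (smult E) c (X i j)) (exponent p) (mnorm (S_inf E) k) (mnorm (S_one E) k))"
  by (simp add: S_p_def interpolation_def exponent_def S_inf_def)

context ruan_seminorm
begin

lemma couple_S_p:
  "couple (\<lambda>c X i j. entrywise (smult E) c (X i j)) (mnorm (S_inf E) k) (mnorm (S_one E :: ('e ^ 'n ^ 'n) opspace) k)"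
  using couple_same_smult[OF ruan_seminorm_S_inf ruan_seminorm_S_one, where k = k] by (simp add: S_inf_def S_one_def)

theorem ruan_seminorm_S_p:
  assumes "1 \<le> p"
  shows "ruan_seminorm (S_p p E :: ('e ^ 'n ^ 'n) opspace)"
proof -
  have "ruan_seminorm (interpolation (enn2real (1 / p)) (S_inf E) (S_one E :: ('e ^ 'n ^ 'n) opspace))"
    using exponent_bounds[OF assms] unfolding exponent_def
    by (intro ruan_seminorm_interpolation ruan_seminorm_S_inf ruan_seminorm_S_one) (auto simp: S_inf_def S_one_def)
  then show ?thesis by (simp add: S_p_def ruan_seminorm_S_inf ruan_seminorm_S_one)
qed

lemma S_p_log_convex:
  fixes u :: "nat \<Rightarrow> nat \<Rightarrow> 'e ^ 'n ^ 'n"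
  assumes p: "1 \<le> p" and AB: "0 < A" "0 < B" and u: "mnorm (S_inf E) k u \<le> A" "mnorm (S_one E) k u \<le> B"
  shows "mnorm (S_p p E) k u \<le> A powr (1 - exponent p) * B powr exponent p"
proof -
  interpret c: couple "\<lambda>c X i j. entrywise (smult E) c (X i j)" "mnorm (S_inf E) k" "mnorm (S_one E :: ('e ^ 'n ^ 'n) opspace) k"
    by (rule couple_S_p)
  show ?thesis
    using c.interp_log_convex[OF exponent_bounds[OF p] AB u] AB u
    by (auto simp: mnorm_S_p exponent_top exponent_one)
qed

text \<open>
  The target carries one seminorm, with which interpolation does nothing. This turns estimates on
  the two end points into one on the outer space \<open>S_q^n\<close>.
\<close>

lemma S_p_dominates:
  fixes T :: "(nat \<Rightarrow> nat \<Rightarrow> 'e ^ 'n ^ 'n) \<Rightarrow> 'w::ab_group_add"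
  assumes p: "1 \<le> p" and sc: "vector_space sc" and M: "seminorm sc M"
    and T: "\<And>x y. T (x + y) = T x + T y" "\<And>c x. T (\<lambda>i j. entrywise (smult E) c (x i j)) = sc c (T x)"
    and A: "0 < A" "\<And>x. M (T x) \<le> A * mnorm (S_inf E) k x" and B: "0 < B" "\<And>x. M (T x) \<le> B * mnorm (S_one E) k x"
  shows "M (T x) \<le> A powr (1 - exponent p) * B powr exponent p * mnorm (S_p p E) k x"
proof -
  interpret dom: couple "\<lambda>c X i j. entrywise (smult E) c (X i j)" "mnorm (S_inf E) k" "mnorm (S_one E :: ('e ^ 'n ^ 'n) opspace) k"
    by (rule couple_S_p)
  interpret cod: couple sc M M by (intro couple.intro sc couple_axioms.intro M)
  interpret couple_map "\<lambda>c X i j. entrywise (smult E) c (X i j)" "mnorm (S_inf E) k" "mnorm (S_one E :: ('e ^ 'n ^ 'n) opspace) k"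
    sc M M T A B by unfold_locales (fact T A B)+
  note e = exponent_bounds[OF p]
  show ?thesis
    using order_trans[OF interp_same_ge[OF sc M e, of "T x"] interp_map[OF e, of x]] A B
    by (auto simp: mnorm_S_p exponent_top exponent_one)
qed

lemma S_p_interpolate:
  fixes T :: "(nat \<Rightarrow> nat \<Rightarrow> 'e ^ 'a ^ 'a) \<Rightarrow> nat \<Rightarrow> nat \<Rightarrow> 'e ^ 'b ^ 'b"
  assumes p: "1 \<le> p"
    and T: "\<And>x y. T (x + y) = T x + T y" "\<And>c x. T (\<lambda>i j. entrywise (smult E) c (x i j)) = (\<lambda>i j. entrywise (smult E) c (T x i j))"
    and A: "0 < A" "\<And>x. mnorm (S_inf E) l (T x) \<le> A * mnorm (S_inf E) k x"
    and B: "0 < B" "\<And>x. mnorm (S_one E) l (T x) \<le> B * mnorm (S_one E) k x"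
  shows "mnorm (S_p p E) l (T x) \<le> A powr (1 - exponent p) * B powr exponent p * mnorm (S_p p E) k x"
proof -
  let ?sc = "\<lambda>c X i j. entrywise (smult E) c (X i j)"
  interpret dom: couple ?sc "mnorm (S_inf E) k" "mnorm (S_one E :: ('e ^ 'a ^ 'a) opspace) k" by (rule couple_S_p)
  interpret cod: couple ?sc "mnorm (S_inf E) l" "mnorm (S_one E :: ('e ^ 'b ^ 'b) opspace) l" by (rule couple_S_p)
  interpret couple_map ?sc "mnorm (S_inf E) k" "mnorm (S_one E :: ('e ^ 'a ^ 'a) opspace) k"
    ?sc "mnorm (S_inf E) l" "mnorm (S_one E :: ('e ^ 'b ^ 'b) opspace) l" T A B
    by unfold_locales (fact T A B)+
  show ?thesis
    using interp_map[OF exponent_bounds[OF p], of x] A B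
    by (auto simp: mnorm_S_p exponent_top exponent_one)
qed

text \<open>
  Interpolation for amplified matrices over arbitrary index sets. As the interpolation norm is
  defined for matrices indexed by numbers, \<open>T\<close> is transported along enumerations, which requires
  that its values depend on the entries with indices in \<open>I\<close> only.
\<close>

theorem S_p_map:
  fixes T :: "('i \<Rightarrow> 'i \<Rightarrow> 'e ^ 'a ^ 'a) \<Rightarrow> 'j \<Rightarrow> 'j \<Rightarrow> 'e ^ 'b ^ 'b"
  assumes p: "1 \<le> p" and fin: "finite I" "finite J"
    and T: "\<And>x y. T (x + y) = T x + T y" "\<And>c x. T (\<lambda>i j. entrywise (smult E) c (x i j)) = (\<lambda>i j. entrywise (smult E) c (T x i j))"
    and local: "\<And>x y i j. (\<And>i j. i \<in> I \<Longrightarrow> j \<in> I \<Longrightarrow> x i j = y i j) \<Longrightarrow> i \<in> J \<Longrightarrow> j \<in> J \<Longrightarrow> T x i j = T y i j"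
    and A: "0 < A" "\<And>x. inorm (S_inf E) J (T x) \<le> A * inorm (S_inf E) I x"
    and B: "0 < B" "\<And>x. inorm (S_one E) J (T x) \<le> B * inorm (S_one E) I x"
  shows "inorm (S_p p E) J (T x) \<le> A powr (1 - exponent p) * B powr exponent p * inorm (S_p p E) I x"
proof -
  let ?e = "enumeration I" and ?g = "enumeration J"
  define d where "d = the_inv_into {..<card I} ?e"
  have e: "bij_betw ?e {..<card I} I" by (rule bij_enumeration[OF fin(1)])
  have ed: "?e (d i) = i" if "i \<in> I" for i
    unfolding d_def using e that by (simp add: f_the_inv_into_f_bij_betw)
  have de: "d (?e i) = i" if "i < card I" for i
    unfolding d_def using e that by (intro the_inv_into_f_f) (auto simp: bij_betw_def)
  define lift where "lift = (\<lambda>(y :: nat \<Rightarrow> nat \<Rightarrow> 'e ^ 'a ^ 'a) i j. y (d i) (d j))"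
  define T' where "T' = (\<lambda>y i j. T (lift y) (?g i) (?g j))"
  interpret Si: ruan_seminorm "S_inf E :: ('e ^ 'a ^ 'a) opspace" by (rule ruan_seminorm_S_inf)
  interpret So: ruan_seminorm "S_one E :: ('e ^ 'a ^ 'a) opspace" by (rule ruan_seminorm_S_one)
  have lift_add: "lift (x + y) = lift x + lift y" for x y by (simp add: lift_def fun_eq_iff)
  have lift_scale: "lift (\<lambda>i j. entrywise (smult E) c (x i j)) = (\<lambda>i j. entrywise (smult E) c (lift x i j))" for c x
    by (simp add: lift_def)
  have "mnorm (S_p p E) (card J) (T' (\<lambda>i j. x (?e i) (?e j)))
    \<le> A powr (1 - exponent p) * B powr exponent p * mnorm (S_p p E) (card I) (\<lambda>i j. x (?e i) (?e j))"
  proof (rule S_p_interpolate[OF p _ _ A(1) _ B(1)])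
    show "T' (x + y) = T' x + T' y" for x y by (simp add: T'_def lift_add T fun_eq_iff)
    show "T' (\<lambda>i j. entrywise (smult E) c (x i j)) = (\<lambda>i j. entrywise (smult E) c (T' x i j))" for c x
      by (simp add: T'_def lift_scale T fun_eq_iff)
    show "mnorm (S_inf E) (card J) (T' x) \<le> A * mnorm (S_inf E) (card I) x" for x
      using A(2)[of "lift x"] Si.cong[of "card I" "\<lambda>i j. lift x (?e i) (?e j)" x] de
      by (simp add: inorm_def T'_def lift_def)
    show "mnorm (S_one E) (card J) (T' x) \<le> B * mnorm (S_one E) (card I) x" for x
      using B(2)[of "lift x"] So.cong[of "card I" "\<lambda>i j. lift x (?e i) (?e j)" x] de
      by (simp add: inorm_def T'_def lift_def)
  qed
  moreover interpret Sp: ruan_seminorm "S_p p E :: ('e ^ 'b ^ 'b) opspace" by (rule ruan_seminorm_S_p[OF p])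
  have "inorm (S_p p E) J (T x) = inorm (S_p p E) J (T (lift (\<lambda>i j. x (?e i) (?e j))))"
  proof (rule Sp.inorm_cong[OF fin(2)])
    fix i j assume "i \<in> J" "j \<in> J"
    then show "T x i j = T (lift (\<lambda>i j. x (?e i) (?e j))) i j" by (rule local[rotated]) (simp add: lift_def ed)
  qed
  ultimately show ?thesis by (simp add: inorm_def T'_def)
qed

end

section \<open>The embedding and the projection\<close>

lemma entrywise_nth: "entrywise sc c x $ a $ b = sc c (x $ a $ b)"
  by (simp add: entrywise_def)

context bell_ruan
begin

lemma bell_expand_S_p:
  assumes p: "1 \<le> p" and fin: "finite (I :: 'i set)"
  shows "inorm (S_p p E) (I \<times> UNIV) (bell_expand u) \<le> real CARD('n) powr (- exponent p) * inorm (S_p p E) I u"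
proof -
  have "inorm (S_p p E) (I \<times> UNIV) (bell_expand u) \<le> 1 powr (1 - exponent p) * (1 / real CARD('n)) powr exponent p * inorm (S_p p E) I u"
  proof (rule S_p_map[OF p fin])
    show "bell_expand (x + y) = bell_expand x + bell_expand y" for x y :: "'i \<Rightarrow> 'i \<Rightarrow> 'e ^ 'm ^ 'm"
      by (auto simp: bell_expand_def fun_eq_iff vec_eq_iff scale_right_distrib sum.distrib)
    show "bell_expand (\<lambda>i j. entrywise (smult E) c (x i j)) = (\<lambda>i j. entrywise (smult E) c (bell_expand x i j))" for c and x :: "'i \<Rightarrow> 'i \<Rightarrow> 'e ^ 'm ^ 'm"
      by (auto simp: bell_expand_def fun_eq_iff vec_eq_iff entrywise_nth scale_sum_right mult.commute)
    show "bell_expand x i j = bell_expand y i j" if "\<And>i j. i \<in> I \<Longrightarrow> j \<in> I \<Longrightarrow> x i j = y i j" "i \<in> I \<times> UNIV" "j \<in> I \<times> UNIV"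
      for i j and x y :: "'i \<Rightarrow> 'i \<Rightarrow> 'e ^ 'm ^ 'm" using that by (auto simp: bell_expand_def)
  qed (use fin bell_expand_S_inf[OF fin] bell_expand_S_one[OF fin] in auto)
  then show ?thesis by (simp add: powr_divide powr_minus_divide)
qed

lemma bell_compress_S_p:
  assumes p: "1 \<le> p" and fin: "finite (I :: 'i set)"
  shows "inorm (S_p p E) I (bell_compress X) \<le> real CARD('n) powr exponent p * inorm (S_p p E) (I \<times> UNIV) X"
proof -
  have "inorm (S_p p E) I (bell_compress X) \<le> 1 powr (1 - exponent p) * real CARD('n) powr exponent p * inorm (S_p p E) (I \<times> UNIV) X"
  proof (rule S_p_map[OF p _ fin])
    show "bell_compress (x + y) = bell_compress x + bell_compress y" for x y :: "'i \<times> 'n \<Rightarrow> 'i \<times> 'n \<Rightarrow> 'e ^ 'n ^ 'n"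
      by (auto simp: bell_compress_def fun_eq_iff vec_eq_iff scale_right_distrib sum.distrib)
    show "bell_compress (\<lambda>i j. entrywise (smult E) c (x i j)) = (\<lambda>i j. entrywise (smult E) c (bell_compress x i j))" for c and x :: "'i \<times> 'n \<Rightarrow> 'i \<times> 'n \<Rightarrow> 'e ^ 'n ^ 'n"
      by (auto simp: bell_compress_def fun_eq_iff vec_eq_iff entrywise_nth scale_sum_right mult.commute)
    show "bell_compress x i j = bell_compress y i j" if "\<And>i j. i \<in> I \<times> UNIV \<Longrightarrow> j \<in> I \<times> UNIV \<Longrightarrow> x i j = y i j" "i \<in> I" "j \<in> I"
      for i j and x y :: "'i \<times> 'n \<Rightarrow> 'i \<times> 'n \<Rightarrow> 'e ^ 'n ^ 'n" using that by (simp add: bell_compress_def cong: if_cong)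
  qed (use fin bell_compress_S_inf[OF fin] bell_compress_S_one[OF fin] in auto)
  then show ?thesis by simp
qed

lemma bell_slice_S_p:
  fixes v :: "'p \<Rightarrow> 'p \<Rightarrow> complex ^ 'n ^ 'n" and w :: "'q \<Rightarrow> 'q \<Rightarrow> 'e ^ 'n ^ 'n"
  assumes p: "1 \<le> p" and fin: "finite P" "finite Q"
  shows "inorm (S_p p E) (P \<times> Q) (bell_slice v w) \<le> real CARD('n) powr (exponent p - 1) * inorm (S_p p E) Q w * inorm trace_class P v"
proof (rule le_mult_of_greater)
  interpret Sp: ruan_seminorm "S_p p E :: ('e ^ 'n ^ 'n) opspace" by (rule ruan_seminorm_S_p[OF p])
  show "0 \<le> real CARD('n) powr (exponent p - 1) * inorm (S_p p E) Q w" by (simp add: Sp.inorm_nonneg)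
  interpret Si: ruan_seminorm "S_inf E :: ('e ^ 'n ^ 'n) opspace" by (rule ruan_seminorm_S_inf)
  interpret So: ruan_seminorm "S_one E :: ('e ^ 'n ^ 'n) opspace" by (rule ruan_seminorm_S_one)
  fix r assume r: "inorm trace_class P v < r"
  then have r0: "0 < r" using inorm_trace_class_nonneg[of P v] by linarith
  have "inorm (S_p p E) (P \<times> Q) (bell_slice v w) \<le> (r / real CARD('n)) powr (1 - exponent p) * r powr exponent p * inorm (S_p p E) Q w"
  proof (rule S_p_map[OF p fin(2)])
    show "bell_slice v (x + y) = bell_slice v x + bell_slice v y" for x y :: "'q \<Rightarrow> 'q \<Rightarrow> 'e ^ 'n ^ 'n"
      by (auto simp: bell_slice_def fun_eq_iff vec_eq_iff scale_right_distrib sum.distrib)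
    show "bell_slice v (\<lambda>i j. entrywise (smult E) c (x i j)) = (\<lambda>i j. entrywise (smult E) c (bell_slice v x i j))" for c and x :: "'q \<Rightarrow> 'q \<Rightarrow> 'e ^ 'n ^ 'n"
      by (auto simp: bell_slice_def fun_eq_iff vec_eq_iff entrywise_nth scale_sum_right mult.commute)
    show "bell_slice v x i j = bell_slice v y i j" if "\<And>i j. i \<in> Q \<Longrightarrow> j \<in> Q \<Longrightarrow> x i j = y i j" "i \<in> P \<times> Q" "j \<in> P \<times> Q"
      for i j and x y :: "'q \<Rightarrow> 'q \<Rightarrow> 'e ^ 'n ^ 'n" using that by (auto simp: bell_slice_def cong: if_cong)
    show "inorm (S_inf E) (P \<times> Q) (bell_slice v x) \<le> r / real CARD('n) * inorm (S_inf E) Q x" for x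
      by (rule order_trans[OF bell_slice_S_inf[OF fin]]) (intro mult_right_mono divide_right_mono Si.inorm_nonneg less_imp_le[OF r], simp)
    show "inorm (S_one E) (P \<times> Q) (bell_slice v x) \<le> r * inorm (S_one E) Q x" for x
      by (rule order_trans[OF bell_slice_S_one[OF fin]]) (intro mult_right_mono So.inorm_nonneg less_imp_le[OF r])
  qed (use fin r0 in auto)
  also have "(r / real CARD('n)) powr (1 - exponent p) * r powr exponent p = real CARD('n) powr (exponent p - 1) * r"
  proof -
    have "(r / real CARD('n)) powr (1 - exponent p) = r powr (1 - exponent p) * real CARD('n) powr (exponent p - 1)"
      using powr_minus_divide[of "real CARD('n)" "1 - exponent p"] r0 by (simp add: powr_divide)
    then show ?thesis using powr_same[OF r0, of "exponent p"] by (simp add: mult_ac)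
  qed
  finally show "inorm (S_p p E) (P \<times> Q) (bell_slice v w) \<le> real CARD('n) powr (exponent p - 1) * inorm (S_p p E) Q w * r" by (simp only: mult_ac)
qed

definition bell_embed :: "'e ^ 'm \<Rightarrow> ('e ^ 'n ^ 'n) ^ 'n ^ 'n" where
  "bell_embed x = (\<chi> a b c d. \<Sum>\<kappa>\<in>UNIV. smult E (\<psi> \<kappa> (a, c) * cnj (\<psi> \<kappa> (b, d))) (x $ \<kappa>))"

definition bell_project :: "('e ^ 'n ^ 'n) ^ 'n ^ 'n \<Rightarrow> 'e ^ 'm" where
  "bell_project U = (\<chi> \<kappa>. \<Sum>s\<in>UNIV. \<Sum>t\<in>UNIV. smult E (cnj (\<psi> \<kappa> s) * \<psi> \<kappa> t) (U $ fst s $ fst t $ snd s $ snd t))"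

lemma bell_project_embed: "bell_project (bell_embed x) = x"
proof (rule iffD2[OF vec_eq_iff], rule allI)
  fix \<kappa>
  let ?F = "\<lambda>\<mu> s t. smult E (cnj (\<psi> \<kappa> s) * \<psi> \<kappa> t * (\<psi> \<mu> s * cnj (\<psi> \<mu> t))) (x $ \<mu>)"
  have inner: "(\<Sum>s\<in>UNIV. \<Sum>t\<in>UNIV. ?F \<mu> s t) = (if \<kappa> = \<mu> then x $ \<mu> else 0)" for \<mu>
  proof -
    have "(\<Sum>s\<in>UNIV. \<Sum>t\<in>UNIV. ?F \<mu> s t) = smult E ((\<Sum>s\<in>UNIV. cnj (\<psi> \<kappa> s) * \<psi> \<mu> s) * (\<Sum>t\<in>UNIV. cnj (\<psi> \<mu> t) * \<psi> \<kappa> t)) (x $ \<mu>)"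
      unfolding sum_product scale_sum_left by (simp add: mult_ac)
    then show ?thesis by (simp add: orthonormal)
  qed
  have "bell_project (bell_embed x) $ \<kappa> = (\<Sum>s\<in>UNIV. \<Sum>t\<in>UNIV. \<Sum>\<mu>\<in>UNIV. ?F \<mu> s t)"
    by (simp add: bell_project_def bell_embed_def scale_sum_right)
  also have "\<dots> = (\<Sum>s\<in>UNIV. \<Sum>\<mu>\<in>UNIV. \<Sum>t\<in>UNIV. ?F \<mu> s t)" by (rule sum.cong[OF refl], rule sum.swap)
  also have "\<dots> = (\<Sum>\<mu>\<in>UNIV. \<Sum>s\<in>UNIV. \<Sum>t\<in>UNIV. ?F \<mu> s t)" by (rule sum.swap)
  also have "\<dots> = x $ \<kappa>" by (simp add: inner)
  finally show "bell_project (bell_embed x) $ \<kappa> = x $ \<kappa>" .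
qed

lemma bell_embed_S_inf:
  assumes p: "1 \<le> p"
  shows "mnorm (S_inf (S_p p E :: ('e ^ 'n ^ 'n) opspace)) k (\<lambda>i j. bell_embed (X i j)) \<le> real CARD('n) powr (- exponent p) * mnorm (l_p p E) k X"
proof -
  interpret Sp: ruan_seminorm "S_p p E :: ('e ^ 'n ^ 'n) opspace" by (rule ruan_seminorm_S_p[OF p])
  interpret Sm: ruan_seminorm "S_p p E :: ('e ^ 'm ^ 'm) opspace" by (rule ruan_seminorm_S_p[OF p])
  have "mnorm (S_inf (S_p p E :: ('e ^ 'n ^ 'n) opspace)) k (\<lambda>i j. bell_embed (X i j))
    = inorm (S_p p E) ({..<k} \<times> UNIV) (\<lambda>(i, a) (j, b). bell_embed (X i j) $ a $ b)" by (rule Sp.mnorm_S_inf)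
  also have "\<dots> = inorm (S_p p E) ({..<k} \<times> UNIV) (bell_expand (\<lambda>i j. diagonal (X i j)))"
    by (rule Sp.inorm_cong) (auto simp: bell_embed_def bell_expand_def diagonal_def vec_eq_iff)
  also have "\<dots> \<le> real CARD('n) powr (- exponent p) * inorm (S_p p E) {..<k} (\<lambda>i j. diagonal (X i j))"
    by (rule bell_expand_S_p[OF p]) simp
  finally show ?thesis by (simp add: Sm.inorm_lessThan l_p_def)
qed

text \<open>The norms of \<open>S_1^n[F]\<close> and \<open>M_n[F]\<close> differ by a factor of at most \<open>n\<close>.\<close>

lemma bell_embed_S_one:
  assumes p: "1 \<le> p"
  shows "mnorm (S_one (S_p p E :: ('e ^ 'n ^ 'n) opspace)) k (\<lambda>i j. bell_embed (X i j)) \<le> real CARD('n) * (real CARD('n) powr (- exponent p) * mnorm (l_p p E) k X)"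
proof -
  interpret Sp: ruan_seminorm "S_p p E :: ('e ^ 'n ^ 'n) opspace" by (rule ruan_seminorm_S_p[OF p])
  have "mnorm (S_one (S_p p E :: ('e ^ 'n ^ 'n) opspace)) k (\<lambda>i j. bell_embed (X i j))
    \<le> real CARD('n) * mnorm (S_inf (S_p p E :: ('e ^ 'n ^ 'n) opspace)) k (\<lambda>i j. bell_embed (X i j))"
    using Sp.S_one_le_inorm[of "{..<k}" "\<lambda>i j. bell_embed (X i j)"] by (simp add: Sp.inorm_S_one_lessThan Sp.mnorm_S_inf)
  also have "\<dots> \<le> real CARD('n) * (real CARD('n) powr (- exponent p) * mnorm (l_p p E) k X)"
    by (intro mult_left_mono bell_embed_S_inf[OF p]) simp
  finally show ?thesis .
qed

text \<open>Interpolation between \<open>n powr (- 1/p)\<close> at \<open>q = \<infinity>\<close> and \<open>n powr (1 - 1/p)\<close> at \<open>q = 1\<close>.\<close>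

lemma bell_embed_S_p:
  assumes p: "1 \<le> p" and q: "1 \<le> q"
  shows "mnorm (S_p q (S_p p E :: ('e ^ 'n ^ 'n) opspace)) k (\<lambda>i j. bell_embed (X i j))
    \<le> real CARD('n) powr (exponent q - exponent p) * mnorm (l_p p E) k X"
proof (rule le_mult_of_greater)
  interpret Sp: ruan_seminorm "S_p p E :: ('e ^ 'n ^ 'n) opspace" by (rule ruan_seminorm_S_p[OF p])
  interpret Sm: ruan_seminorm "S_p p E :: ('e ^ 'm ^ 'm) opspace" by (rule ruan_seminorm_S_p[OF p])
  fix r assume r: "mnorm (l_p p E) k X < r"
  have "0 \<le> mnorm (l_p p E) k X" unfolding l_p_def opspace.simps by (rule Sm.nonneg)
  then have r0: "0 < r" using r by linarith
  let ?A = "real CARD('n) powr (- exponent p) * r"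
  have A: "real CARD('n) powr (- exponent p) * mnorm (l_p p E) k X \<le> ?A" using r by (intro mult_left_mono) auto
  have A0: "0 < ?A" using r0 by simp
  have "mnorm (S_p q (S_p p E :: ('e ^ 'n ^ 'n) opspace)) k (\<lambda>i j. bell_embed (X i j))
    \<le> ?A powr (1 - exponent q) * (real CARD('n) * ?A) powr exponent q"
  proof (rule Sp.S_p_log_convex[OF q A0])
    show "0 < real CARD('n) * ?A" using A0 by simp
    show "mnorm (S_inf (S_p p E :: ('e ^ 'n ^ 'n) opspace)) k (\<lambda>i j. bell_embed (X i j)) \<le> ?A"
      by (rule order_trans[OF bell_embed_S_inf[OF p] A])
    show "mnorm (S_one (S_p p E :: ('e ^ 'n ^ 'n) opspace)) k (\<lambda>i j. bell_embed (X i j)) \<le> real CARD('n) * ?A"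
      by (rule order_trans[OF bell_embed_S_one[OF p]]) (intro mult_left_mono A, simp)
  qed
  also have "(real CARD('n) * ?A) powr exponent q = real CARD('n) powr exponent q * ?A powr exponent q"
    by (rule powr_mult) 
  also have "?A powr (1 - exponent q) * (real CARD('n) powr exponent q * ?A powr exponent q) = real CARD('n) powr exponent q * ?A"
    using powr_same[OF A0, of "exponent q"] by (simp only: mult_ac)
  also have "\<dots> = real CARD('n) powr (exponent q - exponent p) * r" by (simp add: powr_diff powr_minus_divide)
  finally show "mnorm (S_p q (S_p p E :: ('e ^ 'n ^ 'n) opspace)) k (\<lambda>i j. bell_embed (X i j)) \<le> real CARD('n) powr (exponent q - exponent p) * r" .
qed simp

lemma bell_project_S_inf:
  assumes p: "1 \<le> p"
  shows "mnorm (S_p p E) k (\<lambda>i j. diagonal (bell_project (U i j))) \<le> real CARD('n) powr exponent p * mnorm (S_inf (S_p p E :: ('e ^ 'n ^ 'n) opspace)) k U"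
proof -
  interpret Sp: ruan_seminorm "S_p p E :: ('e ^ 'n ^ 'n) opspace" by (rule ruan_seminorm_S_p[OF p])
  interpret Sm: ruan_seminorm "S_p p E :: ('e ^ 'm ^ 'm) opspace" by (rule ruan_seminorm_S_p[OF p])
  have "(\<lambda>i j. diagonal (bell_project (U i j))) = bell_compress (\<lambda>(i, a) (j, b). U i j $ a $ b)"
    by (simp add: fun_eq_iff vec_eq_iff bell_project_def bell_compress_def diagonal_def)
  then have "mnorm (S_p p E) k (\<lambda>i j. diagonal (bell_project (U i j))) = inorm (S_p p E) {..<k} (bell_compress (\<lambda>(i, a) (j, b). U i j $ a $ b))"
    by (simp add: Sm.inorm_lessThan)
  also have "\<dots> \<le> real CARD('n) powr exponent p * inorm (S_p p E) ({..<k} \<times> UNIV) (\<lambda>(i, a) (j, b). U i j $ a $ b)"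
    by (rule bell_compress_S_p[OF p]) simp
  finally show ?thesis by (simp only: Sp.mnorm_S_inf)
qed

text \<open>
  In a factorization \<open>\<alpha> (v \<otimes> w) \<beta>\<close> with \<open>w\<close> over \<open>S_p^n[E]\<close>, the projection acts on \<open>v \<otimes> w\<close> alone,
  where it is \<open>bell_slice\<close>.
\<close>

lemma bell_project_S_one:
  assumes p: "1 \<le> p"
  shows "mnorm (S_p p E) k (\<lambda>i j. diagonal (bell_project (U i j))) \<le> real CARD('n) powr (exponent p - 1) * mnorm (S_one (S_p p E :: ('e ^ 'n ^ 'n) opspace)) k U"
proof (rule le_mult_of_greater)
  interpret Sp: ruan_seminorm "S_p p E :: ('e ^ 'n ^ 'n) opspace" by (rule ruan_seminorm_S_p[OF p])
  interpret Sm: ruan_seminorm "S_p p E :: ('e ^ 'm ^ 'm) opspace" by (rule ruan_seminorm_S_p[OF p])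
  fix r assume "mnorm (S_one (S_p p E :: ('e ^ 'n ^ 'n) opspace)) k U < r"
  then obtain p' q' :: nat and \<alpha> w \<beta> and v :: "nat \<Rightarrow> nat \<Rightarrow> complex ^ 'n ^ 'n" where
    t: "tensor_factorization (S_p p E) {..<k} {..<p'} {..<q'} \<alpha> v w \<beta> U" and
    lt: "opnorm {..<k} ({..<p'} \<times> {..<q'}) \<alpha> * mnorm trace_class p' v * mnorm (S_p p E) q' w * opnorm ({..<p'} \<times> {..<q'}) {..<k} \<beta> < r"
    by (rule Sp.S_one_less_nat) blast
  let ?D = "{..<p'} \<times> {..<q'}"
  let ?A = "opnorm {..<k} ?D \<alpha>" and ?B = "opnorm ?D {..<k} \<beta>"
  have "mnorm (S_p p E) k (\<lambda>i j. diagonal (bell_project (U i j)))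
    = mnorm (S_p p E) k (\<lambda>i j. \<Sum>y\<in>?D. \<Sum>z\<in>?D. smult (S_p p E) (\<alpha> i y * \<beta> z j) (bell_slice v w y z))"
  proof (rule Sm.cong)
    fix i j assume ij: "i < k" "j < k"
    have U: "U i j $ a $ b $ c $ d = (\<Sum>y\<in>?D. \<Sum>z\<in>?D. smult E (\<alpha> i y * \<beta> z j * v (fst y) (fst z) $ a $ b) (w (snd y) (snd z) $ c $ d))" for a b c d
      using t ij unfolding tensor_factorization_def by (simp add: smult_S_p entrywise_nth)
    show "diagonal (bell_project (U i j)) = (\<Sum>y\<in>?D. \<Sum>z\<in>?D. smult (S_p p E) (\<alpha> i y * \<beta> z j) (bell_slice v w y z))"
    proof (rule iffD2[OF vec_eq_iff], rule allI, rule iffD2[OF vec_eq_iff], rule allI)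
      fix \<kappa> \<mu>
      let ?F = "\<lambda>s t y z. smult E (\<alpha> i y * \<beta> z j * (cnj (\<psi> \<kappa> s) * \<psi> \<kappa> t * v (fst y) (fst z) $ fst s $ fst t)) (w (snd y) (snd z) $ snd s $ snd t)"
      have "diagonal (bell_project (U i j)) $ \<kappa> $ \<mu> = (if \<kappa> = \<mu> then \<Sum>s\<in>UNIV. \<Sum>t\<in>UNIV. \<Sum>y\<in>?D. \<Sum>z\<in>?D. ?F s t y z else 0)"
        by (simp add: diagonal_def bell_project_def U scale_sum_right mult_ac)
      also have "(\<Sum>s\<in>UNIV. \<Sum>t\<in>UNIV. \<Sum>y\<in>?D. \<Sum>z\<in>?D. ?F s t y z) = (\<Sum>y\<in>?D. \<Sum>z\<in>?D. \<Sum>s\<in>UNIV. \<Sum>t\<in>UNIV. ?F s t y z)"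
        by (rule sum_swap4)
      also have "(if \<kappa> = \<mu> then \<dots> else 0) = (\<Sum>y\<in>?D. \<Sum>z\<in>?D. smult (S_p p E) (\<alpha> i y * \<beta> z j) (bell_slice v w y z)) $ \<kappa> $ \<mu>"
        by (simp add: smult_S_p entrywise_nth bell_slice_def case_prod_unfold scale_sum_right)
      finally show "diagonal (bell_project (U i j)) $ \<kappa> $ \<mu> = (\<Sum>y\<in>?D. \<Sum>z\<in>?D. smult (S_p p E) (\<alpha> i y * \<beta> z j) (bell_slice v w y z)) $ \<kappa> $ \<mu>" .
    qed
  qed
  also have "\<dots> \<le> ?A * (real CARD('n) powr (exponent p - 1) * inorm (S_p p E) {..<q'} w * inorm trace_class {..<p'} v) * ?B"
    using Sm.inorm_mult_le[where I = "{..<k}" and J = ?D and \<alpha> = \<alpha> and \<beta> = \<beta>,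
        OF finite_lessThan _ order_refl order_refl bell_slice_S_p[OF p finite_lessThan finite_lessThan]] by (simp add: Sm.inorm_lessThan)
  also have "\<dots> = real CARD('n) powr (exponent p - 1) * (?A * mnorm trace_class p' v * mnorm (S_p p E) q' w * ?B)"
    by (simp add: Sp.inorm_lessThan inorm_trace_class_lessThan)
  also have "\<dots> \<le> real CARD('n) powr (exponent p - 1) * r" using lt by (intro mult_left_mono) auto
  finally show "mnorm (S_p p E) k (\<lambda>i j. diagonal (bell_project (U i j))) \<le> real CARD('n) powr (exponent p - 1) * r" .
qed simp

lemma bell_project_add: "bell_project (x + y) = bell_project x + bell_project y"
  by (simp add: bell_project_def vec_eq_iff scale_right_distrib sum.distrib)

lemma bell_project_scale: "bell_project (entrywise (entrywise (smult E)) c x) = (\<chi> \<kappa>. smult E c (bell_project x $ \<kappa>))"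
  by (simp add: bell_project_def vec_eq_iff entrywise_nth scale_sum_right mult.commute)

lemma bell_embed_add: "bell_embed (x + y) = bell_embed x + bell_embed y"
  by (simp add: bell_embed_def vec_eq_iff scale_right_distrib sum.distrib)

lemma bell_embed_scale: "bell_embed (\<chi> \<kappa>. smult E c (x $ \<kappa>)) = entrywise (entrywise (smult E)) c (bell_embed x)"
  by (simp add: bell_embed_def vec_eq_iff entrywise_nth scale_sum_right mult.commute)

text \<open>Interpolation between \<open>n powr (1/p)\<close> at \<open>q = \<infinity>\<close> and \<open>n powr (1/p - 1)\<close> at \<open>q = 1\<close>.\<close>

lemma bell_project_S_p:
  assumes p: "1 \<le> p" and q: "1 \<le> q"
  shows "mnorm (l_p p E) k (\<lambda>i j. bell_project (U i j))
    \<le> real CARD('n) powr (exponent p - exponent q) * mnorm (S_p q (S_p p E :: ('e ^ 'n ^ 'n) opspace)) k U"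
proof -
  interpret Sp: ruan_seminorm "S_p p E :: ('e ^ 'n ^ 'n) opspace" by (rule ruan_seminorm_S_p[OF p])
  note R = ruan_seminorm_S_p[OF p, where 'n = 'm]
  interpret Sm: couple "\<lambda>c X i j. smult (S_p p E :: ('e ^ 'm ^ 'm) opspace) c (X i j)"
    "mnorm (S_p p E :: ('e ^ 'm ^ 'm) opspace) k" "mnorm (S_p p E :: ('e ^ 'm ^ 'm) opspace) k"
    by (rule couple_same_smult[OF R R refl])
  let ?T = "\<lambda>U i j. diagonal (bell_project (U i j))"
  have "mnorm (S_p p E) k (?T U)
    \<le> (real CARD('n) powr exponent p) powr (1 - exponent q) * (real CARD('n) powr (exponent p - 1)) powr exponent q * mnorm (S_p q (S_p p E :: ('e ^ 'n ^ 'n) opspace)) k U"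
  proof (rule Sp.S_p_dominates[OF q Sm.vector_space_axioms Sm.N0])
    show "?T (x + y) = ?T x + ?T y" for x y
      by (simp add: fun_eq_iff bell_project_add diagonal_def vec_eq_iff)
    show "?T (\<lambda>i j. entrywise (smult (S_p p E)) c (x i j)) = (\<lambda>i j. smult (S_p p E) c (?T x i j))" for c x
      by (simp add: fun_eq_iff smult_S_p bell_project_scale diagonal_def vec_eq_iff entrywise_nth)
  qed (use bell_project_S_inf[OF p] bell_project_S_one[OF p] in auto)
  also have "(real CARD('n) powr exponent p) powr (1 - exponent q) * (real CARD('n) powr (exponent p - 1)) powr exponent q = real CARD('n) powr (exponent p - exponent q)"
    by (simp add: powr_powr powr_add[symmetric] algebra_simps)
  finally show ?thesis by (simp add: l_p_def)
qed

lemma vector_space_l_p: "vector_space (smult (l_p p E :: ('e ^ 'm) opspace))"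
  unfolding l_p_def opspace.simps
  by unfold_locales (simp_all add: vec_eq_iff scale_right_distrib scale_left_distrib)

text \<open>
  The bounds for \<open>bell_embed\<close> and \<open>bell_project\<close> are inverse to each other, so after rescaling both
  maps are complete contractions; as the second is a left inverse of the first, the first is then
  completely isometric.
\<close>

theorem bell_embed_project:
  fixes p q :: ennreal
  defines "r \<equiv> real CARD('n) powr (exponent p - exponent q)"
  defines "J \<equiv> \<lambda>x. entrywise (entrywise (smult E)) (of_real r) (bell_embed x)"
    and "Q \<equiv> \<lambda>U. \<chi> \<kappa>. smult E (of_real (1 / r)) (bell_project U $ \<kappa>)"
  assumes p: "1 \<le> p" and q: "1 \<le> q"
  shows "completely_isometric (l_p p E) (S_p q (S_p p E)) J"
    and "completely_contractive (S_p q (S_p p E)) (l_p p E) Q" and "Q \<circ> J = id"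
proof -
  have r0: "0 < r" by (simp add: r_def)
  have inverse: "real CARD('n) powr (exponent q - exponent p) = 1 / r"
    unfolding r_def powr_minus_divide[symmetric] by simp
  interpret Sp: ruan_seminorm "S_p p E :: ('e ^ 'n ^ 'n) opspace" by (rule ruan_seminorm_S_p[OF p])
  interpret Sm: ruan_seminorm "S_p p E :: ('e ^ 'm ^ 'm) opspace" by (rule ruan_seminorm_S_p[OF p])
  interpret S: ruan_seminorm "S_p q (S_p p E) :: (('e ^ 'n ^ 'n) ^ 'n ^ 'n) opspace" by (rule Sp.ruan_seminorm_S_p[OF q])
  have sm: "smult (S_p q (S_p p E) :: (('e ^ 'n ^ 'n) ^ 'n ^ 'n) opspace) = entrywise (entrywise (smult E))"
    by (simp add: smult_S_p)
  have J_norm: "mnorm (S_p q (S_p p E)) k (\<lambda>i j. J (X i j)) \<le> mnorm (l_p p E) k X" for k X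
  proof -
    have "mnorm (S_p q (S_p p E)) k (\<lambda>i j. J (X i j)) \<le> r * mnorm (S_p q (S_p p E)) k (\<lambda>i j. bell_embed (X i j))"
      using S.mnorm_smult[of k "of_real r" "\<lambda>i j. bell_embed (X i j)"] r0 by (simp add: J_def sm)
    also have "\<dots> \<le> r * (1 / r * mnorm (l_p p E) k X)"
      using bell_embed_S_p[OF p q, of k X] r0 unfolding inverse by (intro mult_left_mono) auto
    also have "\<dots> = mnorm (l_p p E) k X" using r0 by simp
    finally show ?thesis .
  qed
  have Q_norm: "mnorm (l_p p E) k (\<lambda>i j. Q (U i j)) \<le> mnorm (S_p q (S_p p E)) k U" for k U
  proof -
    have diag: "diagonal (Q u) = smult (S_p p E) (of_real (1 / r)) (diagonal (bell_project u))" for u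
      by (simp add: Q_def diagonal_def smult_S_p vec_eq_iff entrywise_nth)
    have "mnorm (l_p p E) k (\<lambda>i j. Q (U i j)) \<le> 1 / r * mnorm (l_p p E) k (\<lambda>i j. bell_project (U i j))"
      using Sm.mnorm_smult[of k "of_real (1 / r)" "\<lambda>i j. diagonal (bell_project (U i j))"] r0
      unfolding l_p_def opspace.simps diag by (simp add: norm_divide)
    also have "\<dots> \<le> 1 / r * (r * mnorm (S_p q (S_p p E)) k U)"
      using bell_project_S_p[OF p q, of k U] r0 unfolding r_def by (intro mult_left_mono) auto
    also have "\<dots> = mnorm (S_p q (S_p p E)) k U" using r0 by simp
    finally show ?thesis .
  qed
  have QJ: "Q (J x) = x" for x
    using r0 by (simp add: Q_def J_def bell_project_scale bell_project_embed vec_eq_iff scale_scale flip: of_real_mult)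
  then show "Q \<circ> J = id" by (simp add: fun_eq_iff)
  have "Vector_Spaces.linear (smult (l_p p E)) (smult (S_p q (S_p p E))) J"
    unfolding Vector_Spaces.linear_iff
  proof (intro conjI allI vector_space_l_p S.vector_space_axioms)
    show "J (x + y) = J x + J y" for x y
      unfolding J_def bell_embed_add sm[symmetric] by (rule S.scale_right_distrib)
    show "J (smult (l_p p E) c x) = smult (S_p q (S_p p E)) c (J x)" for c x
      unfolding J_def l_p_def opspace.simps bell_embed_scale sm[symmetric] by (rule S.scale_left_commute)
  qed
  moreover have "mnorm (l_p p E) k X \<le> mnorm (S_p q (S_p p E)) k (\<lambda>i j. J (X i j))" for k X
    using Q_norm[of k "\<lambda>i j. J (X i j)"] by (simp only: QJ)
  ultimately show "completely_isometric (l_p p E) (S_p q (S_p p E)) J"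
    unfolding completely_isometric_def using J_norm by (auto intro: antisym)
  have "Vector_Spaces.linear (smult (S_p q (S_p p E))) (smult (l_p p E)) Q"
    unfolding Vector_Spaces.linear_iff
  proof (intro conjI allI vector_space_l_p S.vector_space_axioms)
    show "Q (x + y) = Q x + Q y" for x y
      by (simp add: Q_def bell_project_add vec_eq_iff scale_right_distrib)
    show "Q (smult (S_p q (S_p p E)) c x) = smult (l_p p E) c (Q x)" for c x
      by (simp add: Q_def l_p_def sm bell_project_scale vec_eq_iff mult.commute)
  qed
  then show "completely_contractive (S_p q (S_p p E)) (l_p p E) Q"
    unfolding completely_contractive_def using Q_norm by auto
qed

end

section \<open>Complete positivity\<close>

lemma positive_matrix_cong:
  assumes "\<And>i j. i \<in> I \<Longrightarrow> j \<in> I \<Longrightarrow> A i j = B i j"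
  shows "positive_matrix I A \<longleftrightarrow> positive_matrix I B"
  unfolding positive_matrix_def using assms by (simp cong: sum.cong)

text \<open>The quadratic form of \<open>V A V\<^sup>*\<close> at \<open>w\<close> is that of \<open>A\<close> at \<open>V\<^sup>* w\<close>.\<close>

lemma positive_matrix_conjugate:
  fixes V :: "'j \<Rightarrow> 'i \<Rightarrow> complex"
  assumes A: "positive_matrix I A"
  shows "positive_matrix J (\<lambda>x y. \<Sum>i\<in>I. \<Sum>j\<in>I. V x i * A i j * cnj (V y j))"
  unfolding positive_matrix_def
proof
  fix w :: "'j \<Rightarrow> complex"
  define z where "z = (\<lambda>i. \<Sum>y\<in>J. cnj (V y i) * w y)"
  let ?F = "\<lambda>x y i j. cnj (w x) * (V x i * A i j * cnj (V y j)) * w y"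
  have entry: "cnj (z i) * A i j * z j = (\<Sum>x\<in>J. \<Sum>y\<in>J. ?F x y i j)" for i j
  proof -
    have "cnj (z i) * z j = (\<Sum>x\<in>J. \<Sum>y\<in>J. (V x i * cnj (w x)) * (cnj (V y j) * w y))"
      unfolding z_def cnj_sum sum_product by simp
    then have "A i j * (cnj (z i) * z j) = (\<Sum>x\<in>J. \<Sum>y\<in>J. A i j * ((V x i * cnj (w x)) * (cnj (V y j) * w y)))"
      by (simp only: sum_distrib_left)
    then show ?thesis by (simp add: mult_ac)
  qed
  have "(\<Sum>x\<in>J. \<Sum>y\<in>J. cnj (w x) * (\<Sum>i\<in>I. \<Sum>j\<in>I. V x i * A i j * cnj (V y j)) * w y)
    = (\<Sum>x\<in>J. \<Sum>y\<in>J. \<Sum>i\<in>I. \<Sum>j\<in>I. ?F x y i j)"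
    by (simp only: sum_distrib_left sum_distrib_right)
  also have "\<dots> = (\<Sum>i\<in>I. \<Sum>j\<in>I. cnj (z i) * A i j * z j)" unfolding entry by (rule sum_swap4)
  also have "\<dots> \<in> \<real>\<^sub>\<ge>\<^sub>0" using A by (simp add: positive_matrix_def)
  finally show "(\<Sum>x\<in>J. \<Sum>y\<in>J. cnj (w x) * (\<Sum>i\<in>I. \<Sum>j\<in>I. V x i * A i j * cnj (V y j)) * w y) \<in> \<real>\<^sub>\<ge>\<^sub>0" .
qed

lemma positive_matrix_scale:
  assumes "positive_matrix I A" "0 \<le> r"
  shows "positive_matrix I (\<lambda>i j. of_real r * A i j)"
  unfolding positive_matrix_def
proof
  fix x :: "'a \<Rightarrow> complex"
  have "of_real r * (\<Sum>i\<in>I. \<Sum>j\<in>I. cnj (x i) * A i j * x j) \<in> \<real>\<^sub>\<ge>\<^sub>0"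
    using assms by (intro nonneg_Reals_mult_I) (auto simp: positive_matrix_def)
  then show "(\<Sum>i\<in>I. \<Sum>j\<in>I. cnj (x i) * (of_real r * A i j) * x j) \<in> \<real>\<^sub>\<ge>\<^sub>0"
    by (simp add: sum_distrib_left mult_ac)
qed

lemma positive_matrix_block_diagonal:
  assumes fin: "finite I" "finite K" and A: "\<And>\<kappa>. \<kappa> \<in> K \<Longrightarrow> positive_matrix I (A \<kappa>)"
  shows "positive_matrix (I \<times> K) (\<lambda>(i, \<kappa>) (j, \<mu>). if \<kappa> = \<mu> then A \<kappa> i j else 0)"
  unfolding positive_matrix_def
proof
  fix x :: "'a \<times> 'b \<Rightarrow> complex"
  have "(\<Sum>p\<in>I \<times> K. \<Sum>q\<in>I \<times> K. cnj (x p) * (\<lambda>(i, \<kappa>) (j, \<mu>). if \<kappa> = \<mu> then A \<kappa> i j else 0) p q * x q)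
    = (\<Sum>i\<in>I. \<Sum>\<kappa>\<in>K. \<Sum>j\<in>I. \<Sum>\<mu>\<in>K. if \<kappa> = \<mu> then cnj (x (i, \<kappa>)) * A \<kappa> i j * x (j, \<kappa>) else 0)"
    unfolding sum_Times prod.case fst_conv snd_conv by (intro sum.cong refl) auto
  also have "\<dots> = (\<Sum>i\<in>I. \<Sum>\<kappa>\<in>K. \<Sum>j\<in>I. cnj (x (i, \<kappa>)) * A \<kappa> i j * x (j, \<kappa>))"
    using fin by (intro sum.cong refl) (simp add: sum.delta')
  also have "\<dots> = (\<Sum>\<kappa>\<in>K. \<Sum>i\<in>I. \<Sum>j\<in>I. cnj (x (i, \<kappa>)) * A \<kappa> i j * x (j, \<kappa>))" by (rule sum.swap)
  also have "\<dots> \<in> \<real>\<^sub>\<ge>\<^sub>0"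
  proof -
    have "(\<Sum>i\<in>I. \<Sum>j\<in>I. cnj (x (i, \<kappa>)) * A \<kappa> i j * x (j, \<kappa>)) \<in> \<real>\<^sub>\<ge>\<^sub>0" if "\<kappa> \<in> K" for \<kappa>
      using A[OF that] unfolding positive_matrix_def by (rule spec[of _ "\<lambda>i. x (i, \<kappa>)"])
    with fin(2) show ?thesis by (induction K rule: finite_induct) auto
  qed
  finally show "(\<Sum>p\<in>I \<times> K. \<Sum>q\<in>I \<times> K. cnj (x p) * (\<lambda>(i, \<kappa>) (j, \<mu>). if \<kappa> = \<mu> then A \<kappa> i j else 0) p q * x q) \<in> \<real>\<^sub>\<ge>\<^sub>0" .
qed

lemma sum_matrix_delta:
  fixes f :: "'i \<Rightarrow> 'k \<Rightarrow> 'i \<Rightarrow> 'k \<Rightarrow> complex"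
  assumes "finite I" "i \<in> I" "j \<in> I"
  shows "(\<Sum>p\<in>I \<times> K. \<Sum>q\<in>I \<times> K. if fst p = i \<and> fst q = j then f (fst p) (snd p) (fst q) (snd q) else 0)
    = (\<Sum>\<kappa>\<in>K. \<Sum>\<mu>\<in>K. f i \<kappa> j \<mu>)"
proof -
  have "(\<Sum>p\<in>I \<times> K. \<Sum>q\<in>I \<times> K. if fst p = i \<and> fst q = j then f (fst p) (snd p) (fst q) (snd q) else 0)
    = (\<Sum>i'\<in>I. \<Sum>\<kappa>\<in>K. \<Sum>j'\<in>I. \<Sum>\<mu>\<in>K. if j' = j then if i' = i then f i \<kappa> j \<mu> else 0 else 0)"
    unfolding sum_Times fst_conv snd_conv by (intro sum.cong refl) auto
  also have "\<dots> = (\<Sum>i'\<in>I. \<Sum>\<kappa>\<in>K. \<Sum>j'\<in>I. if j' = j then \<Sum>\<mu>\<in>K. if i' = i then f i \<kappa> j \<mu> else 0 else 0)"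
    by (intro sum.cong refl) auto
  also have "\<dots> = (\<Sum>i'\<in>I. \<Sum>\<kappa>\<in>K. \<Sum>\<mu>\<in>K. if i' = i then f i \<kappa> j \<mu> else 0)"
    using assms by (simp add: sum.delta)
  also have "\<dots> = (\<Sum>i'\<in>I. if i' = i then \<Sum>\<kappa>\<in>K. \<Sum>\<mu>\<in>K. f i \<kappa> j \<mu> else 0)"
    by (intro sum.cong refl) auto
  also have "\<dots> = (\<Sum>\<kappa>\<in>K. \<Sum>\<mu>\<in>K. f i \<kappa> j \<mu>)" using assms by (simp add: sum.delta)
  finally show ?thesis .
qed

lemma bell_ruan_scalars:
  assumes "bell_basis \<psi>"
  shows "bell_ruan scalars \<psi>"
  using ruan_seminorm_scalars assms by (rule bell_ruan.intro)

text \<open>Up to the factor \<open>r\<close>, conjugation by the isometry that sends the standard basis to \<open>\<psi>\<close>.\<close>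

lemma bell_embed_positive:
  fixes \<psi> :: "'m::finite \<Rightarrow> 'n::finite \<times> 'n \<Rightarrow> complex"
  assumes \<psi>: "bell_basis \<psi>" and r: "0 \<le> r"
  shows "completely_positive l_inf_matrix tensor_matrix
    (\<lambda>x. entrywise (entrywise (smult scalars)) (of_real r) (bell_ruan.bell_embed scalars \<psi> x))"
  unfolding completely_positive_def
proof (intro allI impI)
  interpret bell_ruan scalars \<psi> by (rule bell_ruan_scalars[OF \<psi>])
  fix k :: nat and X :: "nat \<Rightarrow> nat \<Rightarrow> complex ^ 'm"
  let ?I = "{..<k} \<times> (UNIV :: 'm set)" and ?A = "\<lambda>(i, a) (j, b). l_inf_matrix (X i j) a b"
  let ?V = "\<lambda>(i, s) (j, \<kappa>). if j = i then \<psi> \<kappa> s else 0"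
  assume "positive_matrix ?I ?A"
  from positive_matrix_scale[OF positive_matrix_conjugate[OF this, where V = ?V] r]
  have "positive_matrix ({..<k} \<times> UNIV) (\<lambda>x y. of_real r * (\<Sum>p\<in>?I. \<Sum>q\<in>?I. ?V x p * ?A p q * cnj (?V y q)))" .
  then show "positive_matrix ({..<k} \<times> UNIV) (\<lambda>(i, a) (j, b).
      tensor_matrix (entrywise (entrywise (smult scalars)) (of_real r) (bell_embed (X i j))) a b)"
  proof (rule iffD1[OF positive_matrix_cong, rotated])
    fix x y assume xy: "x \<in> {..<k} \<times> (UNIV :: ('n \<times> 'n) set)" "y \<in> {..<k} \<times> (UNIV :: ('n \<times> 'n) set)"
    obtain i a c j b d where x: "x = (i, (a, c))" "y = (j, (b, d))" by (metis prod.exhaust)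
    have ij: "i \<in> {..<k}" "j \<in> {..<k}" using xy x by auto
    have "(\<Sum>p\<in>?I. \<Sum>q\<in>?I. ?V x p * ?A p q * cnj (?V y q))
      = (\<Sum>p\<in>?I. \<Sum>q\<in>?I. if fst p = i \<and> fst q = j then (\<lambda>i \<kappa> j \<mu>. \<psi> \<kappa> (a, c) * l_inf_matrix (X i j) \<kappa> \<mu> * cnj (\<psi> \<mu> (b, d))) (fst p) (snd p) (fst q) (snd q) else 0)"
      by (intro sum.cong refl) (auto simp: x)
    also have "\<dots> = (\<Sum>\<kappa>\<in>UNIV. \<Sum>\<mu>\<in>UNIV. \<psi> \<kappa> (a, c) * l_inf_matrix (X i j) \<kappa> \<mu> * cnj (\<psi> \<mu> (b, d)))"
      by (rule sum_matrix_delta[OF finite_lessThan ij])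
    also have "\<dots> = (\<Sum>\<kappa>\<in>UNIV. \<Sum>\<mu>\<in>UNIV. if \<kappa> = \<mu> then \<psi> \<kappa> (a, c) * cnj (\<psi> \<kappa> (b, d)) * X i j $ \<kappa> else 0)"
      by (intro sum.cong refl) (auto simp: l_inf_matrix_def diagonal_def)
    also have "\<dots> = bell_embed (X i j) $ a $ b $ c $ d" by (simp add: bell_embed_def smult_scalars)
    finally show "of_real r * (\<Sum>p\<in>?I. \<Sum>q\<in>?I. ?V x p * ?A p q * cnj (?V y q)) = (case x of (i, a) \<Rightarrow> \<lambda>(j, b).
      tensor_matrix (entrywise (entrywise (smult scalars)) (of_real r) (bell_embed (X i j))) a b) y"
      by (simp add: x tensor_matrix_def entrywise_nth smult_scalars)
  qed
qed

text \<open>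
  The compression of a positive matrix by the vector \<open>\<psi> \<kappa>\<close> is positive for each \<open>\<kappa>\<close>, and the results
  are the blocks of a diagonal.
\<close>

lemma bell_project_positive:
  fixes \<psi> :: "'m::finite \<Rightarrow> 'n::finite \<times> 'n \<Rightarrow> complex"
  assumes \<psi>: "bell_basis \<psi>" and r: "0 \<le> r"
  shows "completely_positive tensor_matrix l_inf_matrix
    (\<lambda>U. \<chi> \<kappa>. smult scalars (of_real r) (bell_ruan.bell_project scalars \<psi> U $ \<kappa>))"
  unfolding completely_positive_def
proof (intro allI impI)
  interpret bell_ruan scalars \<psi> by (rule bell_ruan_scalars[OF \<psi>])
  fix k :: nat and X :: "nat \<Rightarrow> nat \<Rightarrow> (complex ^ 'n ^ 'n) ^ 'n ^ 'n"
  let ?I = "{..<k} \<times> (UNIV :: ('n \<times> 'n) set)" and ?A = "\<lambda>(i, a) (j, b). tensor_matrix (X i j) a b"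
  let ?V = "\<lambda>\<kappa> i (j, s). if j = i then cnj (\<psi> \<kappa> s) else 0"
  let ?B = "\<lambda>\<kappa> i j. of_real r * (\<Sum>p\<in>?I. \<Sum>q\<in>?I. ?V \<kappa> i p * ?A p q * cnj (?V \<kappa> j q))"
  assume "positive_matrix ?I ?A"
  then have "positive_matrix {..<k} (?B \<kappa>)" for \<kappa> by (intro positive_matrix_scale positive_matrix_conjugate r)
  then have "positive_matrix ({..<k} \<times> UNIV) (\<lambda>(i, \<kappa>) (j, \<mu>). if \<kappa> = \<mu> then ?B \<kappa> i j else 0)"
    by (intro positive_matrix_block_diagonal) auto
  then show "positive_matrix ({..<k} \<times> UNIV) (\<lambda>(i, a) (j, b).
      l_inf_matrix (\<chi> \<kappa>. smult scalars (of_real r) (bell_project (X i j) $ \<kappa>)) a b)"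
  proof (rule iffD1[OF positive_matrix_cong, rotated])
    fix x y assume xy: "x \<in> {..<k} \<times> (UNIV :: 'm set)" "y \<in> {..<k} \<times> (UNIV :: 'm set)"
    obtain i \<kappa> j \<mu> where x: "x = (i, \<kappa>)" "y = (j, \<mu>)" by (metis prod.exhaust)
    have ij: "i \<in> {..<k}" "j \<in> {..<k}" using xy x by auto
    have "(\<Sum>p\<in>?I. \<Sum>q\<in>?I. ?V \<kappa> i p * ?A p q * cnj (?V \<kappa> j q))
      = (\<Sum>p\<in>?I. \<Sum>q\<in>?I. if fst p = i \<and> fst q = j then (\<lambda>i s j t. cnj (\<psi> \<kappa> s) * tensor_matrix (X i j) s t * \<psi> \<kappa> t) (fst p) (snd p) (fst q) (snd q) else 0)"
      by (intro sum.cong refl) auto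
    also have "\<dots> = (\<Sum>s\<in>UNIV. \<Sum>t\<in>UNIV. cnj (\<psi> \<kappa> s) * tensor_matrix (X i j) s t * \<psi> \<kappa> t)"
      by (rule sum_matrix_delta[OF finite_lessThan ij])
    also have "\<dots> = bell_project (X i j) $ \<kappa>"
      by (simp add: bell_project_def smult_scalars tensor_matrix_def case_prod_unfold mult_ac)
    finally show "(case x of (i, \<kappa>) \<Rightarrow> \<lambda>(j, \<mu>). if \<kappa> = \<mu> then ?B \<kappa> i j else 0) y = (case x of (i, a) \<Rightarrow> \<lambda>(j, b).
      l_inf_matrix (\<chi> \<kappa>. smult scalars (of_real r) (bell_project (X i j) $ \<kappa>)) a b) y"
      by (auto simp: x l_inf_matrix_def diagonal_def smult_scalars)
  qed
qed

section \<open>Block diagonals inside iterated Schatten classes\<close>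

theorem theorem1p3:
  fixes p q :: ennreal and E :: "'e::ab_group_add opspace"
  assumes "1 \<le> p" and "1 \<le> q" and "CARD('m::finite) = CARD('n::finite) ^ 2"
  shows "(\<exists>(H :: complex ^ 'm \<Rightarrow> (complex ^ 'n ^ 'n) ^ 'n ^ 'n)
           (Q :: (complex ^ 'n ^ 'n) ^ 'n ^ 'n \<Rightarrow> complex ^ 'm).
           completely_positive l_inf_matrix tensor_matrix H \<and>
           completely_isometric (l_p p scalars) (S_p q (S_p p scalars)) H \<and>
           completely_positive tensor_matrix l_inf_matrix Q \<and>
           completely_contractive (S_p q (S_p p scalars)) (l_p p scalars) Q \<and>
           Q \<circ> H = id) \<and>
         (operator_space E \<longrightarrow>
           (\<exists>(W :: (('e ^ 'n ^ 'n) ^ 'n ^ 'n) set) (J :: 'e ^ 'm \<Rightarrow> ('e ^ 'n ^ 'n) ^ 'n ^ 'n).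
             completely_complemented (S_p q (S_p p E)) W \<and>
             completely_isometric (l_p p E) (S_p q (S_p p E)) J \<and> range J = W))"
proof -
  obtain \<psi> :: "'m \<Rightarrow> 'n \<times> 'n \<Rightarrow> complex" where \<psi>: "bell_basis \<psi>" by (rule bell_basis_exists[OF assms(3)])
  show ?thesis
  proof (intro conjI impI)
    interpret bell_ruan scalars \<psi> by (rule bell_ruan_scalars[OF \<psi>])
    let ?r = "real CARD('n) powr (exponent p - exponent q)"
    show "\<exists>(H :: complex ^ 'm \<Rightarrow> (complex ^ 'n ^ 'n) ^ 'n ^ 'n) Q.
        completely_positive l_inf_matrix tensor_matrix H \<and>
        completely_isometric (l_p p scalars) (S_p q (S_p p scalars)) H \<and>
        completely_positive tensor_matrix l_inf_matrix Q \<and>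
        completely_contractive (S_p q (S_p p scalars)) (l_p p scalars) Q \<and> Q \<circ> H = id"
      using bell_embed_project[OF assms(1,2)] bell_embed_positive[OF \<psi>, of ?r] bell_project_positive[OF \<psi>, of "1 / ?r"]
      by (intro exI conjI) auto
  next
    assume "operator_space E"
    then interpret bell_ruan E \<psi> by (intro bell_ruan.intro operator_space.ruan_seminorm \<psi>)
    obtain J :: "'e ^ 'm \<Rightarrow> ('e ^ 'n ^ 'n) ^ 'n ^ 'n" and Q where
      J: "completely_isometric (l_p p E) (S_p q (S_p p E)) J" and
      Q: "completely_contractive (S_p q (S_p p E)) (l_p p E) Q" and QJ: "Q \<circ> J = id"
      using bell_embed_project[OF assms(1,2)] by blast
    have QJ': "Q (J x) = x" for x using QJ by (simp add: fun_eq_iff)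
    have "completely_complemented (S_p q (S_p p E)) (range J)"
      unfolding completely_complemented_def
    proof (intro exI conjI)
      have "Vector_Spaces.linear (smult (S_p q (S_p p E))) (smult (S_p q (S_p p E))) (J \<circ> Q)"
        using J Q by (intro Vector_Spaces.linear_compose[of _ "smult (l_p p E)"]) (auto simp: completely_isometric_def completely_contractive_def)
      then show "completely_contractive (S_p q (S_p p E)) (S_p q (S_p p E)) (J \<circ> Q)"
        using J Q by (simp add: completely_isometric_def completely_contractive_def)
      show "(J \<circ> Q) \<circ> (J \<circ> Q) = J \<circ> Q" by (simp add: fun_eq_iff QJ')
      show "range (J \<circ> Q) = range J" using QJ' by (auto simp: image_def) metis
    qed
    then show "\<exists>W (J :: 'e ^ 'm \<Rightarrow> ('e ^ 'n ^ 'n) ^ 'n ^ 'n). completely_complemented (S_p q (S_p p E)) W \<and>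
        completely_isometric (l_p p E) (S_p q (S_p p E)) J \<and> range J = W"
      using J by blast
  qed
qed

end
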